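(* Let $f\in S^k_1$ and $\alpha,\beta\in\{1,\dots,b\}$. The defining integral $$\mathcal I_{\alpha,\beta}(g)=\int_{\mathrm{SL}_2(\mathbb Z)\backslash\mathbb H}y^{k+1}f(\tau)\,\overline{\Theta_L(\tau,g,\mathcal P_{(\alpha,\beta)})}\,\frac{dx\,dy}{y^2}$$ of the Kudla--Millson lift of $f$ may be unfolded, for every $g\in G$ with $z=g^{-1}(z_0)$, as $$\mathcal I_{\alpha,\beta}(g)=\int_{\mathrm{SL}_2(\mathbb Z)\backslash\mathbb H}\frac{y^{k+1/2}f(\tau)}{\sqrt2\,|u_{z^\perp}|}\,\overline{\Theta_{L_{\mathrm{Lor}}}(\tau,\mathbf w_g,\mathcal P_{(\alpha,\beta),\mathbf w_g,0,0})}\,\frac{dx\,dy}{y^2}+2\int_{\Gamma_\infty\backslash\mathbb H}h_{\alpha,\beta}(\tau,g)\,\frac{dx\,dy}{y^2},$$ where $$h_{\alpha,\beta}(\tau,g)=\frac{y^{k+1/2}f(\tau)}{\sqrt2\,|u_{z^\perp}|}\sum_{r\ge1}\sum_{h^+=0}^2\Big(\frac r{2iy}\Big)^{h^+}\exp\Big(-\frac{\pi r^2}{2y\,u_{z^\perp}^2}\Big)\,\overline{\Theta_{L_{\mathrm{Lor}}}\big(\tau,r\mu,0,\mathbf w_g,\mathcal P_{(\alpha,\beta),\mathbf w_g,h^+,0}\big)}.$$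
   Context: Lattice setup. Let $b>2$ and let $(L,(\cdot,\cdot))$ be an even unimodular lattice of signature $(b,2)$. Put $q(v)=(v,v)/2$, $v^2=(v,v)$, $k=1+b/2$, $V=L\otimes\mathbb R$, $G=\mathrm{SO}(V)$, $e(t)=\exp(2\pi i t)$. Fix an orthogonal splitting $L=L_{\mathrm{Lor}}\oplus U$ with $L_{\mathrm{Lor}}$ unimodular of signature $(b-1,1)$ and $U=\mathbb Zu\oplus\mathbb Zu'$, $u^2=u'^2=0$, $(u,u')=1$. Fix an orthogonal basis $e_1,\dots,e_{b+2}$ of $V$ with $e_j^2=1$ for $j\le b$ and $e_{b+1}^2=e_{b+2}^2=-1$, such that $L_{\mathrm{Lor}}\otimes\mathbb R$ is spanned by $e_1,\dots,e_{b-1},e_{b+1}$ and $u=(e_b+e_{b+2})/\sqrt2$, $u'=(e_b-e_{b+2})/\sqrt2$. Let $g_0\colon V\to\mathbb R^{b,2}$, $\sum_jx_je_j\mapsto(x_1,\dots,x_{b+2})^t$, be the induced isometry. $\mathrm{Gr}(L)$ is the set of negative definite planes in $V$, with base point $z_0=\langle e_{b+1},e_{b+2}\rangle$. For a non-degenerate subspace $s\subset V$, $v_s$ is the orthogonal projection of $v$ to $s$; $|u_{z^\perp}|=\sqrt{u_{z^\perp}^2}$. $S^k_1$ is the space of weight $k$ cusp forms for $\mathrm{SL}_2(\mathbb Z)$; $\tau=x+iy\in\mathbb H$; $\Gamma_\infty=\{\left(\begin{smallmatrix}1&n\\0&1\end{smallmatrix}\right):n\in\mathbb Z\}$. Polynomials.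 $\mathcal P_{(\alpha,\beta)}(x_1,\dots,x_{b+2})=2x_\alpha x_\beta$ for $1\le\alpha,\beta\le b$. For $g\in G$ put $z=g^{-1}(z_0)$, let $w$ be the orthogonal complement of $u_z$ in $z$ and $w^\perp$ the orthogonal complement of $u_{z^\perp}$ in $z^\perp$, and let $\mathbf w_g\colon V\to V$, $\mathbf w_g(v)=g(v_{w^\perp}+v_w)$. The polynomials $\mathcal P_{(\alpha,\beta),\mathbf w_g,h^+,0}$ ($h^+=0,1,2$) on $g_0\circ\mathbf w_g(V)\cong\mathbb R^{b-1,1}$, homogeneous of degree $(2-h^+,0)$ (degree $2-h^+$ in the positive definite part and $0$ in the negative definite part), are defined by $$\mathcal P_{(\alpha,\beta)}(g_0\circ g(v))=\sum_{h^+=0}^2(v,u_{z^\perp})^{h^+}\,\mathcal P_{(\alpha,\beta),\mathbf w_g,h^+,0}\big(g_0\circ\mathbf w_g(v)\big)\quad\text{for all }v\in V.$$ $\Delta$ is the Euclidean Laplacian ($\sum_j\partial^2/\partial x_j^2$ on $\mathbb R^{b+2}$, and on $g_0\circ\mathbf w_g(V)$ the Laplacian of the restricted Euclidean inner product), and $\exp(-\Delta/8\pi y)=\sum_{m\ge0}\frac1{m!}(-\Delta/8\pi y)^m$. Theta functions. $$\Theta_L(\tau,g,\mathcal P_{(\alpha,\beta)})=\sum_{\lambda\in L}\exp(-\Delta/8\pi y)(\mathcal P_{(\alpha,\beta)})(g_0\circ g(\lambda))\,e\big(\tau q(\lambda_{z^\perp})+\bar\tau q(\lambda_z)\big).$$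 For $\delta,\nu\in L_{\mathrm{Lor}}\otimes\mathbb R$, $$\Theta_{L_{\mathrm{Lor}}}(\tau,\delta,\nu,\mathbf w_g,\mathcal P)=\sum_{\lambda\in L_{\mathrm{Lor}}}\exp(-\Delta/8\pi y)(\mathcal P)(g_0\circ\mathbf w_g(\lambda+\nu))\,e\big(\tau q((\lambda+\nu)_{w^\perp})+\bar\tau q((\lambda+\nu)_w)-(\lambda+\nu/2,\delta)\big),$$ and $\Theta_{L_{\mathrm{Lor}}}(\tau,\mathbf w_g,\mathcal P)$ is the case $\delta=\nu=0$. Finally $\mu=-u'+u_{z^\perp}/2u_{z^\perp}^2+u_z/2u_z^2\in(L_{\mathrm{Lor}}\otimes\mathbb R)\oplus\mathbb Ru$; in the arguments of $\Theta_{L_{\mathrm{Lor}}}$, $\mu$ stands for its orthogonal projection to $L_{\mathrm{Lor}}\otimes\mathbb R$. *)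

theory Defs
  imports "HOL-Complex_Analysis.Complex_Analysis"
begin

section \<open>Lattices in real quadratic spaces\<close>

definition is_zlattice :: "'v::real_vector set \<Rightarrow> bool" where
  "is_zlattice L \<longleftrightarrow> (\<exists>A. finite A \<and> independent A \<and>
     L = {v. \<exists>c :: 'v \<Rightarrow> int. v = (\<Sum>a\<in>A. of_int (c a) *\<^sub>R a)})"

definition even_lattice :: "('v::real_vector \<Rightarrow> 'v \<Rightarrow> real) \<Rightarrow> 'v set \<Rightarrow> bool" where
  "even_lattice B L \<longleftrightarrow> (\<forall>v\<in>L. \<exists>m :: int. B v v = 2 * of_int m)"

text \<open>The lattice coincides with its dual lattice, taken inside its real span.\<close>

definition unimodular :: "('v::real_vector \<Rightarrow> 'v \<Rightarrow> real) \<Rightarrow> 'v set \<Rightarrow> bool" where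
  "unimodular B L \<longleftrightarrow> L = {v \<in> span L. \<forall>w\<in>L. B v w \<in> \<int>}"

definition has_signature ::
  "('v::real_vector \<Rightarrow> 'v \<Rightarrow> real) \<Rightarrow> 'v set \<Rightarrow> nat \<Rightarrow> nat \<Rightarrow> bool" where
  "has_signature B W p n \<longleftrightarrow> (\<exists>P N. finite P \<and> finite N \<and> P \<inter> N = {} \<and>
     card P = p \<and> card N = n \<and> independent (P \<union> N) \<and> span (P \<union> N) = W \<and>
     (\<forall>x\<in>P \<union> N. \<forall>y\<in>P \<union> N. x \<noteq> y \<longrightarrow> B x y = 0) \<and>
     (\<forall>x\<in>P. B x x > 0) \<and> (\<forall>x\<in>N. B x x < 0))"

text \<open>The orthogonal complement of \<open>W'\<close> in \<open>W\<close>, and the orthogonal projection of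
  \<open>v\<close> to a non-degenerate subspace \<open>W\<close>, all with respect to the form \<open>B\<close>.\<close>

definition ortho_in :: "('v::real_vector \<Rightarrow> 'v \<Rightarrow> real) \<Rightarrow> 'v set \<Rightarrow> 'v set \<Rightarrow> 'v set" where
  "ortho_in B W W' = {v \<in> W. \<forall>x\<in>W'. B v x = 0}"

definition proj :: "('v::real_vector \<Rightarrow> 'v \<Rightarrow> real) \<Rightarrow> 'v set \<Rightarrow> 'v \<Rightarrow> 'v" where
  "proj B W v = (THE p. p \<in> W \<and> (\<forall>x\<in>W. B (v - p) x = 0))"

section \<open>The lattice setup\<close>

text \<open>
  The ambient real vector space \<open>V\<close> is the type \<open>'v\<close>, and \<open>\<real>\<^bsup>b,2\<^esup>\<close> is
  \<open>real ^ 'n\<close>. The index type \<open>'n\<close> is enumerated by \<open>ix\<close>: the \<open>j\<close>-th coordinate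
  (\<open>1 \<le> j \<le> b + 2\<close>) of \<open>x\<close> is \<open>x $ ix S j\<close>.
\<close>

record ('v, 'n) lattice_datum =
  rk :: nat
  frm :: "'v \<Rightarrow> 'v \<Rightarrow> real"
  lat :: "'v set"
  lor :: "'v set"
  uu :: 'v
  uu' :: 'v
  bas :: "nat \<Rightarrow> 'v"
  ix :: "nat \<Rightarrow> 'n"

definition lattice_setup :: "('v::real_vector, 'n::finite) lattice_datum \<Rightarrow> bool" where
  "lattice_setup S \<longleftrightarrow>
     rk S > 2 \<and>
     bij_betw (ix S) {1..rk S + 2} UNIV \<and>
     bilinear (frm S) \<and> (\<forall>v w. frm S v w = frm S w v) \<and>
     is_zlattice (lat S) \<and> span (lat S) = UNIV \<and>
     even_lattice (frm S) (lat S) \<and> unimodular (frm S) (lat S) \<and>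
     has_signature (frm S) UNIV (rk S) 2 \<and>
     is_zlattice (lor S) \<and> unimodular (frm S) (lor S) \<and>
     has_signature (frm S) (span (lor S)) (rk S - 1) 1 \<and>
     lat S = {v + of_int m *\<^sub>R uu S + of_int n *\<^sub>R uu' S | v (m::int) (n::int). v \<in> lor S} \<and>
     (\<forall>v\<in>lor S. frm S v (uu S) = 0 \<and> frm S v (uu' S) = 0) \<and>
     frm S (uu S) (uu S) = 0 \<and> frm S (uu' S) (uu' S) = 0 \<and> frm S (uu S) (uu' S) = 1 \<and>
     inj_on (bas S) {1..rk S + 2} \<and> independent (bas S ` {1..rk S + 2}) \<and>
     span (bas S ` {1..rk S + 2}) = UNIV \<and>
     (\<forall>i\<in>{1..rk S + 2}. \<forall>j\<in>{1..rk S + 2}. i \<noteq> j \<longrightarrow> frm S (bas S i) (bas S j) = 0) \<and>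
     (\<forall>j\<in>{1..rk S}. frm S (bas S j) (bas S j) = 1) \<and>
     (\<forall>j\<in>{rk S + 1, rk S + 2}. frm S (bas S j) (bas S j) = -1) \<and>
     span (lor S) = span (bas S ` ({1..rk S - 1} \<union> {rk S + 1})) \<and>
     uu S = (1 / sqrt 2) *\<^sub>R (bas S (rk S) + bas S (rk S + 2)) \<and>
     uu' S = (1 / sqrt 2) *\<^sub>R (bas S (rk S) - bas S (rk S + 2))"

definition qf :: "('v::real_vector, 'n::finite) lattice_datum \<Rightarrow> 'v \<Rightarrow> real" where
  "qf S v = frm S v v / 2"

text \<open>The isometry \<open>g\<^sub>0\<close>, sending \<open>\<Sum>\<^sub>j x\<^sub>j e\<^sub>j\<close> to \<open>x\<close>.\<close>

definition coord :: "('v::real_vector, 'n::finite) lattice_datum \<Rightarrow> 'v \<Rightarrow> real ^ 'n" where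
  "coord S v = (THE x. v = (\<Sum>j\<in>{1..rk S + 2}. (x $ ix S j) *\<^sub>R bas S j))"

definition SO_grp :: "('v::real_vector, 'n::finite) lattice_datum \<Rightarrow> ('v \<Rightarrow> 'v) set" where
  "SO_grp S = {g. linear g \<and> (\<forall>v w. frm S (g v) (g w) = frm S v w) \<and>
     det (matrix (coord S \<circ> g \<circ> inv (coord S))) = 1}"

definition base_plane :: "('v::real_vector, 'n::finite) lattice_datum \<Rightarrow> 'v set" where
  "base_plane S = span {bas S (rk S + 1), bas S (rk S + 2)}"

definition zpl :: "('v::real_vector, 'n::finite) lattice_datum \<Rightarrow> ('v \<Rightarrow> 'v) \<Rightarrow> 'v set" where
  "zpl S g = g -` base_plane S"

definition zperp :: "('v::real_vector, 'n::finite) lattice_datum \<Rightarrow> ('v \<Rightarrow> 'v) \<Rightarrow> 'v set" where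
  "zperp S g = ortho_in (frm S) UNIV (zpl S g)"

definition uz :: "('v::real_vector, 'n::finite) lattice_datum \<Rightarrow> ('v \<Rightarrow> 'v) \<Rightarrow> 'v" where
  "uz S g = proj (frm S) (zpl S g) (uu S)"

definition uzperp :: "('v::real_vector, 'n::finite) lattice_datum \<Rightarrow> ('v \<Rightarrow> 'v) \<Rightarrow> 'v" where
  "uzperp S g = proj (frm S) (zperp S g) (uu S)"

definition uzperp_sq :: "('v::real_vector, 'n::finite) lattice_datum \<Rightarrow> ('v \<Rightarrow> 'v) \<Rightarrow> real" where
  "uzperp_sq S g = frm S (uzperp S g) (uzperp S g)"

definition wsp :: "('v::real_vector, 'n::finite) lattice_datum \<Rightarrow> ('v \<Rightarrow> 'v) \<Rightarrow> 'v set" where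
  "wsp S g = ortho_in (frm S) (zpl S g) {uz S g}"

text \<open>Despite the notation, \<open>w\<^sup>\<bottom>\<close> is taken inside \<open>z\<^sup>\<bottom>\<close>; it is not the complement of \<open>w\<close> in \<open>V\<close>.\<close>

definition wperp :: "('v::real_vector, 'n::finite) lattice_datum \<Rightarrow> ('v \<Rightarrow> 'v) \<Rightarrow> 'v set" where
  "wperp S g = ortho_in (frm S) (zperp S g) {uzperp S g}"

definition wmap :: "('v::real_vector, 'n::finite) lattice_datum \<Rightarrow> ('v \<Rightarrow> 'v) \<Rightarrow> 'v \<Rightarrow> 'v" where
  "wmap S g v = g (proj (frm S) (wperp S g) v + proj (frm S) (wsp S g) v)"

definition wimg :: "('v::real_vector, 'n::finite) lattice_datum \<Rightarrow> ('v \<Rightarrow> 'v) \<Rightarrow> (real ^ 'n) set" where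
  "wimg S g = range (coord S \<circ> wmap S g)"

text \<open>The vector \<open>\<mu>\<close>, already projected to the real span of the Lorentzian lattice.\<close>

definition mu :: "('v::real_vector, 'n::finite) lattice_datum \<Rightarrow> ('v \<Rightarrow> 'v) \<Rightarrow> 'v" where
  "mu S g = proj (frm S) (span (lor S))
     (- uu' S + (1 / (2 * uzperp_sq S g)) *\<^sub>R uzperp S g
              + (1 / (2 * frm S (uz S g) (uz S g))) *\<^sub>R uz S g)"

section \<open>Polynomials and the heat operator\<close>

definition dir_laplacian ::
  "'a::euclidean_space set \<Rightarrow> ('a \<Rightarrow> real) \<Rightarrow> 'a \<Rightarrow> real" where
  "dir_laplacian A p x = (\<Sum>a\<in>A. (deriv ^^ 2) (\<lambda>t. p (x + t *\<^sub>R a)) 0)"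

text \<open>The Euclidean Laplacian of a linear subspace \<open>W\<close>; on functions that are twice differentiable
  along \<open>W\<close> it does not depend on the chosen orthonormal basis. For \<open>W = UNIV\<close> it is the sum of
  the second partial derivatives.\<close>

definition orthonormal_basis :: "'a::euclidean_space set \<Rightarrow> 'a set" where
  "orthonormal_basis W = (if W = UNIV then Basis else
     (SOME A. A \<subseteq> W \<and> pairwise orthogonal A \<and> (\<forall>a\<in>A. norm a = 1) \<and> span A = W))"

definition laplacian_on :: "'a::euclidean_space set \<Rightarrow> ('a \<Rightarrow> real) \<Rightarrow> 'a \<Rightarrow> real" where
  "laplacian_on W = dir_laplacian (orthonormal_basis W)"

text \<open>\<open>exp (- \<Delta> / 8 \<pi> y)\<close>, with \<open>\<Delta>\<close> the Laplacian of \<open>W\<close>\<close>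

definition heat :: "'a::euclidean_space set \<Rightarrow> real \<Rightarrow> ('a \<Rightarrow> real) \<Rightarrow> 'a \<Rightarrow> real" where
  "heat W y p x = (\<Sum>m. (1 / fact m) * (- 1 / (8 * pi * y)) ^ m * (laplacian_on W ^^ m) p x)"

definition poly_ab ::
  "('v::real_vector, 'n::finite) lattice_datum \<Rightarrow> nat \<Rightarrow> nat \<Rightarrow> real ^ 'n \<Rightarrow> real" where
  "poly_ab S \<alpha> \<beta> x = 2 * x $ ix S \<alpha> * x $ ix S \<beta>"

definition pos_part :: "('v::real_vector, 'n::finite) lattice_datum \<Rightarrow> real ^ 'n \<Rightarrow> real ^ 'n" where
  "pos_part S x = (\<chi> i. if i \<in> ix S ` {1..rk S} then x $ i else 0)"

definition neg_part :: "('v::real_vector, 'n::finite) lattice_datum \<Rightarrow> real ^ 'n \<Rightarrow> real ^ 'n" where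
  "neg_part S x = (\<chi> i. if i \<in> ix S ` {rk S + 1, rk S + 2} then x $ i else 0)"

text \<open>\<open>p\<close> restricts to a polynomial function on the subspace \<open>W\<close> that is homogeneous of degree
  \<open>(m, n)\<close>. It is only used for \<open>W = wimg S g\<close>, which is the direct sum of
  its intersections with the positive and the negative coordinate subspaces.\<close>

definition homogeneous_poly_on ::
  "('v::real_vector, 'n::finite) lattice_datum \<Rightarrow> (real ^ 'n) set \<Rightarrow> nat \<Rightarrow> nat \<Rightarrow> (real ^ 'n \<Rightarrow> real) \<Rightarrow> bool"
  where
  "homogeneous_poly_on S W m n p \<longleftrightarrow> real_polynomial_function p \<and>
     (\<forall>x\<in>W. \<forall>s t. p (s *\<^sub>R pos_part S x + t *\<^sub>R neg_part S x) = s ^ m * t ^ n * p x)"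

text \<open>The family \<open>h \<mapsto> P\<^bsub>(\<alpha>,\<beta>),w\<^sub>g,h,0\<^esub>\<close>. The defining identity determines its members on
  \<open>wimg S g\<close>, and only their values there enter the theta functions.\<close>

definition red_poly ::
  "('v::real_vector, 'n::finite) lattice_datum \<Rightarrow> nat \<Rightarrow> nat \<Rightarrow> ('v \<Rightarrow> 'v) \<Rightarrow> nat \<Rightarrow> real ^ 'n \<Rightarrow> real" where
  "red_poly S \<alpha> \<beta> g = (SOME p.
     (\<forall>h\<in>{0..2}. homogeneous_poly_on S (wimg S g) (2 - h) 0 (p h)) \<and>
     (\<forall>v. poly_ab S \<alpha> \<beta> (coord S (g v)) =
        (\<Sum>h\<in>{0..2}. (frm S v (uzperp S g)) ^ h * p h (coord S (wmap S g v)))))"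

section \<open>Theta functions\<close>

definition ee :: "complex \<Rightarrow> complex" where
  "ee t = exp (2 * of_real pi * \<i> * t)"

definition theta_L ::
  "('v::real_vector, 'n::finite) lattice_datum \<Rightarrow> complex \<Rightarrow> ('v \<Rightarrow> 'v) \<Rightarrow> (real ^ 'n \<Rightarrow> real) \<Rightarrow> complex" where
  "theta_L S \<tau> g p = (\<Sum>\<^sub>\<infinity>l\<in>lat S.
     of_real (heat UNIV (Im \<tau>) p (coord S (g l))) *
     ee (\<tau> * of_real (qf S (proj (frm S) (zperp S g) l))
         + cnj \<tau> * of_real (qf S (proj (frm S) (zpl S g) l))))"

definition theta_Lor ::
  "('v::real_vector, 'n::finite) lattice_datum \<Rightarrow> complex \<Rightarrow> 'v \<Rightarrow> 'v \<Rightarrow> ('v \<Rightarrow> 'v) \<Rightarrow> (real ^ 'n \<Rightarrow> real) \<Rightarrow> complex"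
  where
  "theta_Lor S \<tau> \<delta> \<nu> g p = (\<Sum>\<^sub>\<infinity>l\<in>lor S.
     of_real (heat (wimg S g) (Im \<tau>) p (coord S (wmap S g (l + \<nu>)))) *
     ee (\<tau> * of_real (qf S (proj (frm S) (wperp S g) (l + \<nu>)))
         + cnj \<tau> * of_real (qf S (proj (frm S) (wsp S g) (l + \<nu>)))
         - of_real (frm S (l + (1/2) *\<^sub>R \<nu>) \<delta>)))"

section \<open>Cusp forms and integrals over quotients of the upper half-plane\<close>

definition cusp_form :: "nat \<Rightarrow> (complex \<Rightarrow> complex) \<Rightarrow> bool" where
  "cusp_form k f \<longleftrightarrow> f holomorphic_on {\<tau>. Im \<tau> > 0} \<and>
     (\<forall>a b c d :: int. \<forall>\<tau>. a * d - b * c = 1 \<and> Im \<tau> > 0 \<longrightarrow>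
        f ((of_int a * \<tau> + of_int b) / (of_int c * \<tau> + of_int d)) = (of_int c * \<tau> + of_int d) ^ k * f \<tau>) \<and>
     (\<exists>a :: nat \<Rightarrow> complex. \<forall>\<tau>. Im \<tau> > 0 \<longrightarrow> (\<lambda>n. a (Suc n) * ee (of_nat (Suc n) * \<tau>)) sums f \<tau>)"

text \<open>The measure \<open>dx dy / y\<^sup>2\<close>; only used on subsets of the upper half-plane\<close>

definition hyp_measure :: "complex measure" where
  "hyp_measure = density lborel (\<lambda>\<tau>. ennreal (1 / (Im \<tau>)\<^sup>2))"

text \<open>Integrals over \<open>SL\<^sub>2(\<int>) \ \<H>\<close> and \<open>\<Gamma>\<^sub>\<infinity> \ \<H>\<close> of invariant functions are integrals over the
  standard fundamental domains; the boundary arcs identified by \<open>SL\<^sub>2(\<int>)\<close> are a null set.\<close>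

definition modular_domain :: "complex set" where
  "modular_domain = {\<tau>. Im \<tau> > 0 \<and> \<bar>Re \<tau>\<bar> \<le> 1 / 2 \<and> norm \<tau> \<ge> 1}"

definition strip_domain :: "complex set" where
  "strip_domain = {\<tau>. Im \<tau> > 0 \<and> 0 \<le> Re \<tau> \<and> Re \<tau> < 1}"

definition KM_integrand ::
  "('v::real_vector, 'n::finite) lattice_datum \<Rightarrow> nat \<Rightarrow> (complex \<Rightarrow> complex) \<Rightarrow> nat \<Rightarrow> nat \<Rightarrow> ('v \<Rightarrow> 'v) \<Rightarrow> complex \<Rightarrow> complex"
  where
  "KM_integrand S k f \<alpha> \<beta> g \<tau> =
     of_real (Im \<tau> ^ (k + 1)) * f \<tau> * cnj (theta_L S \<tau> g (poly_ab S \<alpha> \<beta>))"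

definition KM_lift ::
  "('v::real_vector, 'n::finite) lattice_datum \<Rightarrow> nat \<Rightarrow> (complex \<Rightarrow> complex) \<Rightarrow> nat \<Rightarrow> nat \<Rightarrow> ('v \<Rightarrow> 'v) \<Rightarrow> complex"
  where
  "KM_lift S k f \<alpha> \<beta> g = (LINT \<tau>:modular_domain|hyp_measure. KM_integrand S k f \<alpha> \<beta> g \<tau>)"

definition unf_factor ::
  "('v::real_vector, 'n::finite) lattice_datum \<Rightarrow> nat \<Rightarrow> (complex \<Rightarrow> complex) \<Rightarrow> ('v \<Rightarrow> 'v) \<Rightarrow> complex \<Rightarrow> complex"
  where
  "unf_factor S k f g \<tau> =
     of_real (Im \<tau> powr (real k + 1 / 2)) * f \<tau> / of_real (sqrt 2 * sqrt (uzperp_sq S g))"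

definition lor_integrand ::
  "('v::real_vector, 'n::finite) lattice_datum \<Rightarrow> nat \<Rightarrow> (complex \<Rightarrow> complex) \<Rightarrow> nat \<Rightarrow> nat \<Rightarrow> ('v \<Rightarrow> 'v) \<Rightarrow> complex \<Rightarrow> complex"
  where
  "lor_integrand S k f \<alpha> \<beta> g \<tau> =
     unf_factor S k f g \<tau> * cnj (theta_Lor S \<tau> 0 0 g (red_poly S \<alpha> \<beta> g 0))"

definition h_ab ::
  "('v::real_vector, 'n::finite) lattice_datum \<Rightarrow> nat \<Rightarrow> (complex \<Rightarrow> complex) \<Rightarrow> nat \<Rightarrow> nat \<Rightarrow> ('v \<Rightarrow> 'v) \<Rightarrow> complex \<Rightarrow> complex"
  where
  "h_ab S k f \<alpha> \<beta> g \<tau> = unf_factor S k f g \<tau> *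
     (\<Sum>\<^sub>\<infinity>r\<in>{1::nat..}. \<Sum>h\<in>{0..2}.
        (of_nat r / (2 * \<i> * of_real (Im \<tau>))) ^ h *
        of_real (exp (- (pi * (real r)\<^sup>2 / (2 * Im \<tau> * uzperp_sq S g)))) *
        cnj (theta_Lor S \<tau> (real r *\<^sub>R mu S g) 0 g (red_poly S \<alpha> \<beta> g h)))"

end

theory Submission
  imports Defs
begin

text \<open>
  The isometry \<open>X = coord S \<circ> g\<close> carries the lattice \<open>L\<close> to a self-dual lattice \<open>\<Lambda>\<close> in
  \<open>\<real>\<^bsup>b,2\<^esup>\<close>, the subspaces \<open>z\<^sup>\<bottom>\<close> and \<open>z\<close> to the two coordinate subspaces, and the isotropic vectors
  \<open>u\<close>, \<open>u'\<close> to \<open>U\<close>, \<open>U'\<close>. So everything happens for theta functions of \<open>\<Lambda>\<close> (locale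
  \<open>theta_data\<close>), and the Lorentzian objects are recognised only at the end.

  Every vector of \<open>\<Lambda>\<close> is \<open>v + m U\<close> with \<open>(v, U') = 0\<close> and \<open>m\<close> an integer. Poisson summation in \<open>m\<close>
  replaces the sum over \<open>m\<close> by a sum over \<open>d \<in> \<int>\<close> of the Fourier transform \<open>psi \<tau> v d\<close> along the line
  \<open>v + \<real> U\<close>. Collecting the \<open>v\<close> with \<open>(v, U) = c\<close> gives
  \<open>\<Theta>(\<tau>) = \<Sum> phi \<tau> c d\<close>, a sum over all \<open>(c, d) \<in> \<int>\<^sup>2\<close>. The point of this arrangement is that
  \<open>SL\<^sub>2(\<int>)\<close> permutes the functions \<open>phi \<tau> c d\<close>, up to the automorphy factor of \<open>\<Theta>\<close>, through its action on
  row vectors \<open>(c, d)\<close>. For the translation this is a change of variables. For the inversion, the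
  theta function is given two real parameters, a shift \<open>s U\<close> and a character
  \<open>e(- t (x, U))\<close>; then \<open>phi \<tau> c d\<close> are its Fourier coefficients in \<open>(t, s)\<close>, Poisson summation on \<open>\<Lambda>\<close>
  rotates \<open>(s, t)\<close> to \<open>(t, - s)\<close> (\<open>theta_sum_S\<close>), and comparing coefficients gives \<open>phi_S\<close>.

  Hence the products of \<open>y\<^bsup>k+1\<^esup> f\<close> with the complex conjugates of \<open>phi \<tau> c d\<close> are permuted without any factor
  (\<open>orbit_term_mob\<close>). The pair \<open>(0, 0)\<close> gives the first integral of the theorem. A pair
  \<open>(c, d) \<noteq> (0, 0)\<close> is uniquely \<open>r\<close> times the bottom row of some \<open>\<gamma> \<in> SL\<^sub>2(\<int>)\<close> with \<open>r \<ge> 1\<close>, and \<open>\<gamma>\<close> is unique once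
  it is required to move \<open>\<tau>\<close> into the strip \<open>0 \<le> x < 1\<close> (\<open>bottom_row_bij\<close>); so the remaining terms add
  up to a sum over \<open>\<gamma>\<close> of one function evaluated at \<open>\<gamma> \<tau>\<close>, and its integral over the fundamental domain unfolds
  to the strip (\<open>unfolding_integral\<close>). The factor \<open>2\<close> appears because \<open>\<gamma>\<close> and \<open>- \<gamma>\<close> act in the same way.
  All exchanges of sums and integrals are covered by the bound \<open>C r\<^bsup>-2\<^esup> y\<^sup>2 exp (- y)\<close> for the \<open>r\<close>-th term
  (\<open>orbit_term_bounds\<close>), which comes from the decay of the cusp form and the Gaussian
  \<open>exp (- \<pi> r\<^sup>2 / (2 y \<rho>))\<close>, where \<open>\<rho> = u\<^sup>2\<close> for the projection of \<open>u\<close> to \<open>z\<^sup>\<bottom>\<close>.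

  Finally \<open>phi \<tau> 0 r\<close> is a sum over the Lorentzian lattice of Gaussian integrals that can be evaluated
  (\<open>psi_0\<close>): the quadratic polynomial splits into three terms according to its degree in the direction of \<open>U\<close>, and
  these are the reduced polynomials after the heat operator (\<open>heat_red_poly\<close>,
  \<open>theta_Lor_lor_theta\<close>).
\<close>

section \<open>Sums of integrals and linear changes of variables\<close>

text \<open>Reduces sums over a countable set to sums over \<open>\<nat>\<close>, for which the exchange
  theorems for integrals are stated.\<close>

lemma has_sum_nat_enum:
  fixes \<phi> :: "'i \<Rightarrow> 'b::{topological_comm_monoid_add,t2_space}"
  assumes "countable I"
  shows "(\<phi> has_sum s) I \<longleftrightarrow>
    ((\<lambda>n. if n \<in> to_nat_on I ` I then \<phi> (from_nat_into I n) else 0) has_sum s) UNIV"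
proof -
  have inj: "inj_on (to_nat_on I) I"
    using assms by (rule inj_on_to_nat_on)
  have "((\<lambda>n. if n \<in> to_nat_on I ` I then \<phi> (from_nat_into I n) else 0) has_sum s) UNIV
     \<longleftrightarrow> ((\<lambda>n. \<phi> (from_nat_into I n)) has_sum s) (to_nat_on I ` I)"
    by (rule has_sum_cong_neutral) auto
  also have "\<dots> \<longleftrightarrow> ((\<lambda>n. \<phi> (from_nat_into I n)) \<circ> to_nat_on I has_sum s) I"
    by (rule has_sum_reindex[OF inj])
  also have "\<dots> \<longleftrightarrow> (\<phi> has_sum s) I"
    by (rule has_sum_cong) (simp add: assms)
  finally show ?thesis by simp
qed

text \<open>Fubini for a countable sum and an integral, in the form used throughout: it suffices that the
  integrals of the norms are summable.\<close>

lemma infsum_summable_integral: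
  fixes f :: "'i \<Rightarrow> 'a \<Rightarrow> complex"
  assumes cI: "countable I" and int: "\<And>i. i \<in> I \<Longrightarrow> integrable M (f i)"
    and sm: "(\<lambda>i. \<integral>x. norm (f i x) \<partial>M) summable_on I"
  shows AE_summable_of_integrals: "AE x in M. (\<lambda>i. norm (f i x)) summable_on I"
    and integrable_infsum: "integrable M (\<lambda>x. \<Sum>\<^sub>\<infinity>i\<in>I. f i x)"
    and has_sum_integral_infsum:
      "((\<lambda>i. \<integral>x. f i x \<partial>M) has_sum (\<integral>x. (\<Sum>\<^sub>\<infinity>i\<in>I. f i x) \<partial>M)) I"
proof -
  define J where "J = to_nat_on I ` I"
  define g where "g n = (if n \<in> J then f (from_nat_into I n) else (\<lambda>_. 0))" for n
  have fI: "from_nat_into I n \<in> I" if "n \<in> J" for n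
    using that cI unfolding J_def by auto
  have g_int: "integrable M (g n)" for n
    unfolding g_def using int fI by auto
  have g_app: "g n x = (if n \<in> J then f (from_nat_into I n) x else 0)" for n x
    by (simp add: g_def)
  have nrm: "norm (g n x) = (if n \<in> J then norm (f (from_nat_into I n) x) else 0)" for n x
    by (simp add: g_def)
  have sm_iff: "(\<lambda>i. norm (f i x)) summable_on I \<longleftrightarrow> summable (\<lambda>n. norm (g n x))" for x
  proof -
    have "(\<lambda>i. norm (f i x)) summable_on I \<longleftrightarrow> (\<lambda>n. norm (g n x)) summable_on UNIV"
      unfolding summable_on_def nrm J_def by (subst has_sum_nat_enum[OF cI]) simp
    also have "\<dots> \<longleftrightarrow> summable (\<lambda>n. norm (g n x))"
      by (rule summable_on_UNIV_nonneg_real_iff) simp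
    finally show ?thesis .
  qed
  have int_nrm: "(\<integral>x. norm (g n x) \<partial>M) = (if n \<in> J then \<integral>x. norm (f (from_nat_into I n) x) \<partial>M else 0)" for n
    by (simp add: g_def)
  have sm2: "summable (\<lambda>n. \<integral>x. norm (g n x) \<partial>M)"
  proof -
    have "(\<lambda>n. \<integral>x. norm (g n x) \<partial>M) summable_on UNIV"
      using sm unfolding summable_on_def int_nrm J_def by (subst (asm) has_sum_nat_enum[OF cI]) simp
    thus ?thesis
      by (subst (asm) summable_on_UNIV_nonneg_real_iff) auto
  qed
  define N where "N x = (\<Sum>n. ennreal (norm (g n x)))" for x
  have N_meas: "N \<in> borel_measurable M"
    unfolding N_def using g_int by (intro borel_measurable_suminf_order) auto
  have fin_iff: "summable (\<lambda>n. norm (g n x)) \<longleftrightarrow> N x \<noteq> top" for x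
  proof
    assume "summable (\<lambda>n. norm (g n x))"
    thus "N x \<noteq> top" unfolding N_def by (subst suminf_ennreal2) auto
  next
    assume "N x \<noteq> top"
    thus "summable (\<lambda>n. norm (g n x))" unfolding N_def
      by (intro summable_suminf_not_top) auto
  qed
  have "(\<integral>\<^sup>+x. N x \<partial>M) = (\<Sum>n. \<integral>\<^sup>+x. ennreal (norm (g n x)) \<partial>M)"
    unfolding N_def using g_int by (intro nn_integral_suminf) auto
  also have "\<dots> = (\<Sum>n. ennreal (\<integral>x. norm (g n x) \<partial>M))"
    using g_int by (intro suminf_cong nn_integral_eq_integral) auto
  also have "\<dots> \<noteq> top"
    using sm2 by (subst suminf_ennreal2) (auto)
  finally have "AE x in M. N x \<noteq> top"
    using nn_integral_noteq_infinite[OF N_meas] by simp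
  hence AE1: "AE x in M. summable (\<lambda>n. norm (g n x))"
    by (simp add: fin_iff)
  thus "AE x in M. (\<lambda>i. norm (f i x)) summable_on I"
    by (simp add: sm_iff)
  have eq: "(\<Sum>\<^sub>\<infinity>i\<in>I. f i x) = (if N x \<noteq> top then (\<Sum>n. g n x) else 0)" for x
  proof (cases "N x \<noteq> top")
    case True
    hence s: "summable (\<lambda>n. norm (g n x))" by (simp add: fin_iff)
    have "((\<lambda>n. g n x) has_sum (\<Sum>n. g n x)) UNIV"
      by (rule norm_summable_imp_has_sum[OF s summable_sums[OF summable_norm_cancel[OF s]]])
    hence "((\<lambda>i. f i x) has_sum (\<Sum>n. g n x)) I"
      by (subst has_sum_nat_enum[OF cI]) (simp add: g_app J_def)
    thus ?thesis using True by (simp add: infsumI)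
  next
    case False
    hence "\<not> (\<lambda>i. norm (f i x)) summable_on I" by (simp add: fin_iff sm_iff)
    hence "\<not> (\<lambda>i. f i x) summable_on I"
      by (simp add: summable_on_iff_abs_summable_on_complex)
    thus ?thesis using False by (simp add: infsum_not_exists)
  qed
  have int_sum: "integrable M (\<lambda>x. \<Sum>n. g n x)"
    by (rule integrable_suminf[OF g_int AE1 sm2])
  have AE2: "AE x in M. (\<Sum>n. g n x) = (\<Sum>\<^sub>\<infinity>i\<in>I. f i x)"
    using AE1 by eventually_elim (simp add: eq fin_iff)
  have meas: "(\<lambda>x. \<Sum>\<^sub>\<infinity>i\<in>I. f i x) \<in> borel_measurable M"
    unfolding eq using N_meas int_sum
    by (intro measurable_If borel_measurable_integrable) (auto simp: pred_def)
  show "integrable M (\<lambda>x. \<Sum>\<^sub>\<infinity>i\<in>I. f i x)"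
    using int_sum meas AE2 by (subst integrable_cong_AE[symmetric]) auto
  have "(\<lambda>n. \<integral>x. g n x \<partial>M) sums (\<integral>x. (\<Sum>n. g n x) \<partial>M)"
    by (rule sums_integral[OF g_int AE1 sm2])
  moreover have "summable (\<lambda>n. norm (\<integral>x. g n x \<partial>M))"
    by (rule summable_comparison_test'[OF sm2]) (simp add: integral_norm_bound)
  ultimately have "((\<lambda>n. \<integral>x. g n x \<partial>M) has_sum (\<integral>x. (\<Sum>n. g n x) \<partial>M)) UNIV"
    by (intro norm_summable_imp_has_sum) auto
  moreover have "(\<integral>x. (\<Sum>n. g n x) \<partial>M) = (\<integral>x. (\<Sum>\<^sub>\<infinity>i\<in>I. f i x) \<partial>M)"
    using AE2 meas int_sum by (intro integral_cong_AE) auto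
  moreover have "(\<lambda>n. \<integral>x. g n x \<partial>M) = (\<lambda>n. if n \<in> to_nat_on I ` I then \<integral>x. f (from_nat_into I n) x \<partial>M else 0)"
    by (auto simp: g_def J_def)
  ultimately show "((\<lambda>i. \<integral>x. f i x \<partial>M) has_sum (\<integral>x. (\<Sum>\<^sub>\<infinity>i\<in>I. f i x) \<partial>M)) I"
    by (subst has_sum_nat_enum[OF cI]) simp
qed

text \<open>Up to a constant Lebesgue measure is the only translation invariant measure. The proof convolves
  with the unit ball: integrating \<open>h (M x + y)\<close> over \<open>x\<close> and over
  \<open>y\<close> in the ball, in both orders, compares the two measures. The value of the constant
  is left open; where it matters it is recovered from a single test function.\<close>

lemma lborel_linear_distr:
  fixes M :: "'e::euclidean_space \<Rightarrow> 'e"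
  assumes lin: "linear M" and inj: "inj M"
  obtains c where "c > 0" and "distr lborel borel M = density lborel (\<lambda>_. ennreal c)"
proof -
  interpret linear M by fact
  have surj: "surj M"
    using lin inj linear_injective_imp_surjective by blast
  have M_meas [measurable]: "M \<in> borel_measurable borel"
    by (intro borel_measurable_continuous_onI linear_continuous_on linear_conv_bounded_linear[THEN iffD1] lin)
  define K where "K = (cball 0 1 :: 'e set)"
  have [measurable]: "K \<in> sets borel" by (simp add: K_def)
  have Ksym: "indicator K (- x) = (indicator K x :: ennreal)" for x
    by (simp add: K_def indicator_def)
  define \<kappa> where "\<kappa> = (\<integral>\<^sup>+x. indicator K (M x) \<partial>lborel)"
  have shift: "(\<integral>\<^sup>+x. h (x + a) \<partial>lborel) = (\<integral>\<^sup>+x. h x \<partial>lborel)"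
    if [measurable]: "h \<in> borel_measurable borel" for h :: "'e \<Rightarrow> ennreal" and a
    using nn_integral_distr[of "(+) a" lborel borel h] lborel_distr_plus[of a]
    by (simp add: add.commute)
  have shiftM: "(\<integral>\<^sup>+x. h (M x + a) \<partial>lborel) = (\<integral>\<^sup>+x. h (M x) \<partial>lborel)"
    if [measurable]: "h \<in> borel_measurable borel" for h :: "'e \<Rightarrow> ennreal" and a
  proof -
    obtain a' where a': "a = M a'" using surj by blast
    have "(\<integral>\<^sup>+x. h (M (x + a')) \<partial>lborel) = (\<integral>\<^sup>+x. h (M x) \<partial>lborel)"
      by (rule shift[of "\<lambda>x. h (M x)"]) measurable
    thus ?thesis by (simp add: a' add)
  qed
  have main: "(\<integral>\<^sup>+x. h (M x) \<partial>lborel) * emeasure lborel K = (\<integral>\<^sup>+x. h x \<partial>lborel) * \<kappa>"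
    if [measurable]: "h \<in> borel_measurable borel" for h :: "'e \<Rightarrow> ennreal"
  proof -
    have "(\<integral>\<^sup>+x. h (M x) \<partial>lborel) * emeasure lborel K
        = (\<integral>\<^sup>+y. (\<integral>\<^sup>+x. h (M x + y) \<partial>lborel) * indicator K y \<partial>lborel)"
      by (subst shiftM) (auto simp: nn_integral_cmult)
    also have "\<dots> = (\<integral>\<^sup>+y. (\<integral>\<^sup>+x. h (M x + y) * indicator K y \<partial>lborel) \<partial>lborel)"
      by (intro nn_integral_cong nn_integral_multc[symmetric]) measurable
    also have "\<dots> = (\<integral>\<^sup>+x. (\<integral>\<^sup>+y. h (M x + y) * indicator K y \<partial>lborel) \<partial>lborel)"
      by (rule lborel_pair.Fubini') measurable
    also have "\<dots> = (\<integral>\<^sup>+x. (\<integral>\<^sup>+y. h y * indicator K (y - M x) \<partial>lborel) \<partial>lborel)"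
    proof (rule nn_integral_cong)
      fix x
      have "(\<integral>\<^sup>+y. h ((y + M x)) * indicator K ((y + M x) - M x) \<partial>lborel)
         = (\<integral>\<^sup>+y. h y * indicator K (y - M x) \<partial>lborel)"
        by (rule shift[of "\<lambda>y. h y * indicator K (y - M x)"]) measurable
      thus "(\<integral>\<^sup>+y. h (M x + y) * indicator K y \<partial>lborel)
         = (\<integral>\<^sup>+y. h y * indicator K (y - M x) \<partial>lborel)"
        by (simp add: add.commute)
    qed
    also have "\<dots> = (\<integral>\<^sup>+y. (\<integral>\<^sup>+x. h y * indicator K (y - M x) \<partial>lborel) \<partial>lborel)"
      by (rule lborel_pair.Fubini') measurable
    also have "\<dots> = (\<integral>\<^sup>+y. h y * \<kappa> \<partial>lborel)"
    proof (rule nn_integral_cong)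
      fix y
      have "(\<integral>\<^sup>+x. h y * indicator K (y - M x) \<partial>lborel)
         = h y * (\<integral>\<^sup>+x. indicator K (y - M x) \<partial>lborel)"
        by (intro nn_integral_cmult) measurable
      also have "(\<integral>\<^sup>+x. indicator K (y - M x) \<partial>lborel) = (\<integral>\<^sup>+x. indicator K (M x + (- y)) \<partial>lborel)"
        using Ksym[of "M x - y" for x] by (intro nn_integral_cong) (simp add: K_def indicator_def dist_norm norm_minus_commute)
      also have "\<dots> = \<kappa>"
        unfolding \<kappa>_def by (rule shiftM) measurable
      finally show "(\<integral>\<^sup>+x. h y * indicator K (y - M x) \<partial>lborel) = h y * \<kappa>" .
    qed
    also have "\<dots> = (\<integral>\<^sup>+x. h x \<partial>lborel) * \<kappa>"
      by (rule nn_integral_multc) measurable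
    finally show ?thesis .
  qed
  have pos: "emeasure lborel A > 0" if "0 < r" "ball x r \<subseteq> A" "A \<in> sets borel" for x r and A :: "'e set"
  proof -
    have "emeasure lborel (ball x r) \<le> emeasure lborel A"
      using that by (intro emeasure_mono) auto
    moreover have "emeasure lborel (ball x r) \<noteq> 0"
      using content_ball_pos[OF that(1), of x] by (auto simp: measure_def)
    ultimately show ?thesis by (metis le_zero_eq not_gr_zero)
  qed
  have K_pos: "emeasure lborel K > 0"
    by (rule pos[of 1 0]) (auto simp: K_def)
  have K_fin: "emeasure lborel K < \<infinity>"
    unfolding K_def by (rule emeasure_lborel_cball_finite)
  have \<kappa>_eq: "\<kappa> = emeasure lborel (M -` K)"
  proof -
    have "\<kappa> = (\<integral>\<^sup>+x. indicator (M -` K) x \<partial>lborel)"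
      unfolding \<kappa>_def by (intro nn_integral_cong) (auto simp: indicator_def)
    also have "\<dots> = emeasure lborel (M -` K)"
      using measurable_sets_borel[OF M_meas] by (intro nn_integral_indicator) auto
    finally show ?thesis .
  qed
  have MK_borel: "M -` K \<in> sets borel"
    using measurable_sets_borel[OF M_meas] by auto
  obtain M' where M': "linear M'" "M' \<circ> M = id"
    using linear_injective_left_inverse[OF lin inj] by blast
  have \<kappa>_fin: "\<kappa> < \<infinity>"
  proof -
    have "bounded (M' ` K)"
      using M'(1) by (intro bounded_linear_image) (auto simp: K_def linear_conv_bounded_linear)
    moreover have "M -` K \<subseteq> M' ` K"
    proof
      fix x assume "x \<in> M -` K"
      moreover have "M' (M x) = x" using M'(2) by (simp add: pointfree_idE)
      ultimately show "x \<in> M' ` K" by (metis image_eqI vimageD)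
    qed
    ultimately have "bounded (M -` K)" by (rule bounded_subset)
    thus ?thesis unfolding \<kappa>_eq by (rule emeasure_bounded_finite)
  qed
  have \<kappa>_pos: "\<kappa> > 0"
  proof -
    obtain B where B: "B > 0" "\<And>x. norm (M x) \<le> B * norm x"
      using linear_bounded_pos[OF lin] by blast
    show ?thesis unfolding \<kappa>_eq
    proof (rule pos[of "1/B" 0])
      show "ball 0 (1/B) \<subseteq> M -` K"
      proof
        fix x :: 'e assume "x \<in> ball 0 (1/B)"
        hence "B * norm x \<le> 1" using B(1) by (simp add: field_simps)
        thus "x \<in> M -` K" using B(2)[of x] by (simp add: K_def)
      qed
    qed (use B MK_borel in auto)
  qed
  define c where "c = enn2real (\<kappa> / emeasure lborel K)"
  have c: "ennreal c = \<kappa> / emeasure lborel K"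
    unfolding c_def using K_pos \<kappa>_fin
    by (intro ennreal_enn2real) (auto simp: ennreal_divide_eq_top_iff less_top[symmetric])
  have cpos: "c > 0"
  proof -
    have "\<kappa> / emeasure lborel K > 0"
      using K_fin \<kappa>_pos by (simp add: ennreal_zero_less_divide)
    thus ?thesis using c by (metis ennreal_eq_0_iff not_le not_gr_zero)
  qed
  have eq: "(\<integral>\<^sup>+x. h (M x) \<partial>lborel) = ennreal c * (\<integral>\<^sup>+x. h x \<partial>lborel)"
    if "h \<in> borel_measurable borel" for h :: "'e \<Rightarrow> ennreal"
  proof -
    have "(\<integral>\<^sup>+x. h (M x) \<partial>lborel) * (emeasure lborel K / emeasure lborel K) = ((\<integral>\<^sup>+x. h x \<partial>lborel) * \<kappa>) / emeasure lborel K"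
      using main[OF that] by (simp add: ennreal_times_divide)
    moreover have "emeasure lborel K / emeasure lborel K = 1"
      using K_pos K_fin by (intro ennreal_divide_self) auto
    ultimately show ?thesis using c
      by (simp add: ennreal_times_divide mult.commute)
  qed
  show ?thesis
  proof (rule that[OF cpos], rule measure_eqI)
    fix A assume "A \<in> sets (distr lborel borel M)"
    hence A [measurable]: "A \<in> sets borel" by simp
    have "emeasure (distr lborel borel M) A = (\<integral>\<^sup>+x. indicator A (M x) \<partial>lborel)"
      by (subst nn_integral_distr[symmetric, of M lborel borel "indicator A"]) auto
    also have "\<dots> = ennreal c * (\<integral>\<^sup>+x. indicator A x \<partial>lborel)"
      by (rule eq) measurable
    also have "\<dots> = emeasure (density lborel (\<lambda>_. ennreal c)) A"
      by (subst emeasure_density) (auto simp: nn_integral_cmult)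
    finally show "emeasure (distr lborel borel M) A = emeasure (density lborel (\<lambda>_. ennreal c)) A" .
  qed auto
qed

lemma lborel_integral_linear_image:
  fixes M :: "'e::euclidean_space \<Rightarrow> 'e"
  assumes "linear M" and "inj M"
  obtains c where "c > 0"
    and "\<And>F :: 'e \<Rightarrow> complex. F \<in> borel_measurable borel \<Longrightarrow> (\<integral>x. F (M x) \<partial>lborel) = of_real c * (\<integral>x. F x \<partial>lborel)"
proof -
  obtain c where c: "c > 0" "distr lborel borel M = density lborel (\<lambda>_. ennreal c)"
    using lborel_linear_distr[OF assms] .
  have [measurable]: "M \<in> borel_measurable borel"
    by (intro borel_measurable_continuous_onI linear_continuous_on linear_conv_bounded_linear[THEN iffD1] assms)
  show ?thesis
  proof (rule that[OF c(1)])
    fix F :: "'e \<Rightarrow> complex" assume [measurable]: "F \<in> borel_measurable borel"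
    have "(\<integral>x. F (M x) \<partial>lborel) = (\<integral>x. F x \<partial>distr lborel borel M)"
      by (subst integral_distr) auto
    also have "\<dots> = (\<integral>x. c *\<^sub>R F x \<partial>lborel)"
      unfolding c(2) using c(1) by (subst integral_density) auto
    also have "\<dots> = of_real c * (\<integral>x. F x \<partial>lborel)"
      by (simp add: scaleR_conv_of_real)
    finally show "(\<integral>x. F (M x) \<partial>lborel) = of_real c * (\<integral>x. F x \<partial>lborel)" .
  qed
qed

lemma lborel_integral_prod:
  fixes f :: "'e::euclidean_space \<Rightarrow> real \<Rightarrow> complex"
  assumes "\<And>b. b \<in> Basis \<Longrightarrow> integrable lborel (f b)"
  shows "integrable lborel (\<lambda>x. \<Prod>b\<in>Basis. f b (x \<bullet> b))"
    and "(\<integral>x. (\<Prod>b\<in>Basis. f b (x \<bullet> b)) \<partial>lborel) = (\<Prod>b\<in>Basis. \<integral>t. f b t \<partial>lborel)"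
proof -
  interpret product_sigma_finite "\<lambda>_::'e. lborel :: real measure" ..
  have [measurable]: "f b \<in> borel_measurable borel" if "b \<in> Basis" for b
    using assms[OF that] by auto
  have eq: "(\<Prod>b\<in>Basis. f b ((\<Sum>b\<in>Basis. x b *\<^sub>R b) \<bullet> b)) = (\<Prod>b\<in>Basis. f b (x b))" for x :: "'e \<Rightarrow> real"
    by (intro prod.cong refl) simp
  have leb: "(lborel :: 'e measure) = distr (\<Pi>\<^sub>M b\<in>Basis. lborel) borel (\<lambda>f. \<Sum>b\<in>Basis. f b *\<^sub>R b)"
    by (rule lborel_eq)
  show "integrable lborel (\<lambda>x. \<Prod>b\<in>Basis. f b (x \<bullet> b))"
    by (subst leb, subst integrable_distr_eq)
       (auto simp: eq intro!: product_integrable_prod assms)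
  show "(\<integral>x. (\<Prod>b\<in>Basis. f b (x \<bullet> b)) \<partial>lborel) = (\<Prod>b\<in>Basis. \<integral>t. f b t \<partial>lborel)"
    by (subst leb, subst integral_distr)
       (auto simp: eq intro!: product_integral_prod assms)
qed

section \<open>Fourier uniqueness on the unit cube\<close>

text \<open>The additive character \<open>e(t) = exp (2 \<pi> \<i> t)\<close> of the real line.\<close>

definition ch :: "real \<Rightarrow> complex" where
  "ch t = cis (2 * pi * t)"

lemma ch_0 [simp]: "ch 0 = 1"
  by (simp add: ch_def)

lemma ch_add: "ch (s + t) = ch s * ch t"
  by (simp add: ch_def cis_mult distrib_left)

lemma cnj_ch: "cnj (ch t) = ch (- t)"
  by (simp add: ch_def cis_cnj)

lemma norm_ch [simp]: "norm (ch t) = 1"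
  by (simp add: ch_def)

lemma ch_int: "t \<in> \<int> \<Longrightarrow> ch t = 1"
  by (auto simp: ch_def complex_eq_iff elim!: Ints_cases)

lemma ch_exp: "ch t = exp (2 * of_real pi * \<i> * of_real t)"
  by (simp add: ch_def cis_conv_exp mult_ac)

lemma continuous_on_ch [continuous_intros]: "continuous_on A f \<Longrightarrow> continuous_on A (\<lambda>x. ch (f x))"
  unfolding ch_def cis_conv_exp by (intro continuous_intros)

lemma borel_measurable_ch [measurable]: "ch \<in> borel_measurable borel"
  by (intro borel_measurable_continuous_onI continuous_intros)

text \<open>The standard lattice; other lattices are its images under injective linear maps.\<close>

definition zlat :: "'e::euclidean_space set" where
  "zlat = {k. \<forall>b\<in>Basis. k \<bullet> b \<in> \<int>}"

lemma zlat_inner: "k \<in> zlat \<Longrightarrow> m \<in> zlat \<Longrightarrow> k \<bullet> m \<in> \<int>"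
  by (subst euclidean_inner) (auto simp: zlat_def intro!: Ints_sum)

lemma zlat_closed:
  "0 \<in> zlat" "k \<in> zlat \<Longrightarrow> - k \<in> zlat" "k \<in> zlat \<Longrightarrow> m \<in> zlat \<Longrightarrow> k + m \<in> zlat"
  "k \<in> zlat \<Longrightarrow> m \<in> zlat \<Longrightarrow> k - m \<in> zlat" "b \<in> Basis \<Longrightarrow> b \<in> zlat"
  by (auto simp: zlat_def inner_add_left inner_diff_left inner_not_same_Basis inner_Basis)

text \<open>A summable weight on the standard lattice that dominates every Gaussian
  (\<open>gauss_le_zwt\<close>), with a constant that is polynomial in the inverse width. The
  polynomial dependence is what later gives bounds uniform in \<open>\<tau>\<close>.\<close>

definition zwt :: "'e::euclidean_space \<Rightarrow> real" where
  "zwt k = (\<Prod>b\<in>Basis. 1 / (1 + (k \<bullet> b)\<^sup>2))"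

lemma zwt_nonneg [simp]: "0 \<le> zwt k"
  unfolding zwt_def by (intro prod_nonneg) auto

lemma summable_on_Ints_inverse_squares: "(\<lambda>x::real. 1 / (1 + x\<^sup>2)) summable_on \<int>"
proof -
  have "summable (\<lambda>n. 1 / (1 + (real n)\<^sup>2))"
    by (rule summable_comparison_test'[OF inverse_power_summable[of 2], of 1])
       (auto simp: divide_simps add_pos_nonneg)
  hence "(\<lambda>n. 1 / (1 + (real n)\<^sup>2)) summable_on UNIV"
    by (subst summable_on_UNIV_nonneg_real_iff) (simp_all add: add_nonneg_nonneg)
  hence nat: "(\<lambda>n. 1 / (1 + (real n)\<^sup>2)) summable_on A" for A
    by (rule summable_on_subset_banach) simp
  have 1: "(\<lambda>x::real. 1 / (1 + x\<^sup>2)) summable_on (real ` UNIV)"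
    by (subst summable_on_reindex) (use nat[of UNIV] in \<open>auto simp: o_def inj_on_def\<close>)
  have 2: "(\<lambda>x::real. 1 / (1 + x\<^sup>2)) summable_on ((\<lambda>n. - real n) ` {1..})"
    by (subst summable_on_reindex) (use nat[of "{1..}"] in \<open>auto simp: o_def inj_on_def\<close>)
  have "(\<int> :: real set) = real ` UNIV \<union> (\<lambda>n. - real n) ` {1..}"
  proof (intro equalityI subsetI)
    fix x :: real assume "x \<in> \<int>"
    then obtain n where n: "x = of_int n" by (auto elim: Ints_cases)
    show "x \<in> real ` UNIV \<union> (\<lambda>n. - real n) ` {1..}"
    proof (cases "n \<ge> 0")
      case True
      hence "x = real (nat n)" using n by simp
      thus ?thesis by blast
    next
      case False
      hence "x = - real (nat (- n))" "nat (- n) \<ge> 1" using n by auto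
      thus ?thesis by blast
    qed
  qed auto
  moreover have "real ` UNIV \<inter> (\<lambda>n. - real n) ` {1..} = {}"
    by auto
  ultimately show ?thesis
    using summable_on_Un_disjoint[OF 1 2] by simp
qed

lemma zwt_summable: "(zwt :: 'e::euclidean_space \<Rightarrow> real) summable_on zlat"
proof -
  let ?f = "\<lambda>x::real. 1 / (1 + x\<^sup>2)"
  let ?h = "\<lambda>k::'e. restrict (\<lambda>b. k \<bullet> b) Basis"
  have "infsum (\<lambda>g. \<Prod>b\<in>(Basis::'e set). ?f (g b)) (PiE Basis (\<lambda>_. \<int>)) = (\<Prod>b\<in>(Basis::'e set). infsum ?f \<int>)"
    using summable_on_Ints_inverse_squares
    by (intro infsum_prod_PiE_abs) (auto simp: abs_of_nonneg)
  moreover have "infsum ?f \<int> > 0"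
  proof -
    have "infsum ?f {0} \<le> infsum ?f \<int>"
      by (intro infsum_mono_neutral summable_on_Ints_inverse_squares) auto
    thus ?thesis by simp
  qed
  ultimately have "infsum (\<lambda>g. \<Prod>b\<in>(Basis::'e set). ?f (g b)) (PiE Basis (\<lambda>_. \<int>)) \<noteq> 0"
    by simp
  hence "(\<lambda>g. \<Prod>b\<in>(Basis::'e set). ?f (g b)) summable_on (PiE Basis (\<lambda>_. \<int>))"
    using infsum_not_exists by blast
  moreover have "?h ` zlat \<subseteq> PiE Basis (\<lambda>_. \<int>)"
    by (auto simp: zlat_def)
  ultimately have "(\<lambda>g. \<Prod>b\<in>(Basis::'e set). ?f (g b)) summable_on (?h ` zlat)"
    by (rule summable_on_subset_banach)
  moreover have "inj_on ?h zlat"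
  proof (rule inj_onI)
    fix k m :: 'e assume eq: "?h k = ?h m"
    show "k = m"
    proof (rule euclidean_eqI)
      fix b :: 'e assume "b \<in> Basis"
      thus "k \<bullet> b = m \<bullet> b" using fun_cong[OF eq, of b] by simp
    qed
  qed
  ultimately show ?thesis
    by (subst (asm) summable_on_reindex) (auto simp: o_def zwt_def[abs_def])
qed

lemma gauss_le_zwt:
  fixes k :: "'e::euclidean_space"
  assumes "\<epsilon> > 0"
  shows "exp (- \<epsilon> * (norm k)\<^sup>2) \<le> (1 + 1 / \<epsilon>) ^ DIM('e) * zwt k"
proof -
  have one: "exp (- (\<epsilon> * x\<^sup>2)) \<le> (1 + 1 / \<epsilon>) * (1 / (1 + x\<^sup>2))" for x :: real
  proof -
    have "1 + \<epsilon> * x\<^sup>2 \<le> exp (\<epsilon> * x\<^sup>2)" by (rule exp_ge_add_one_self)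
    hence "exp (- (\<epsilon> * x\<^sup>2)) \<le> 1 / (1 + \<epsilon> * x\<^sup>2)"
      using assms by (simp add: exp_minus inverse_eq_divide frac_le add_pos_nonneg)
    also have "\<dots> \<le> (1 + 1 / \<epsilon>) * (1 / (1 + x\<^sup>2))"
    proof -
      have "1 + x\<^sup>2 \<le> (1 + 1 / \<epsilon>) * (1 + \<epsilon> * x\<^sup>2)"
        using assms by (simp add: field_simps)
      thus ?thesis using assms by (simp add: divide_simps add_pos_nonneg) (simp add: field_simps add_pos_nonneg)
    qed
    finally show ?thesis .
  qed
  have "(norm k)\<^sup>2 = (\<Sum>b\<in>Basis. (k \<bullet> b)\<^sup>2)"
    by (subst power2_norm_eq_inner, subst euclidean_inner) (simp add: power2_eq_square)
  hence "exp (- \<epsilon> * (norm k)\<^sup>2) = (\<Prod>b\<in>Basis. exp (- (\<epsilon> * (k \<bullet> b)\<^sup>2)))"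
    by (simp add: exp_sum sum_distrib_left sum_negf flip: exp_sum)
  also have "\<dots> \<le> (\<Prod>b\<in>(Basis::'e set). (1 + 1 / \<epsilon>) * (1 / (1 + (k \<bullet> b)\<^sup>2)))"
    by (intro prod_mono conjI one) auto
  also have "\<dots> = (1 + 1 / \<epsilon>) ^ DIM('e) * zwt k"
    by (simp only: prod.distrib prod_constant zwt_def)
  finally show ?thesis .
qed

lemma countable_zlat: "countable (zlat :: 'e::euclidean_space set)"
proof -
  have "(\<lambda>k::'e. norm (zwt k)) summable_on zlat"
    using zwt_summable by simp
  hence "countable {k\<in>zlat. (zwt (k::'e)) \<noteq> 0}"
    by (rule abs_summable_countable)
  moreover have "zwt (k::'e) \<noteq> 0" for k
    unfolding zwt_def by (subst prod_zero_iff) (auto simp: add_nonneg_eq_0_iff)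
  ultimately show ?thesis by simp
qed

text \<open>The half-open cube, so that its lattice translates tile the space without overlap.\<close>

definition zcube :: "'e::euclidean_space set" where
  "zcube = {t. \<forall>b\<in>Basis. - (1/2) \<le> t \<bullet> b \<and> t \<bullet> b < 1 / 2}"

lemma zcube_borel [measurable]: "(zcube :: 'e::euclidean_space set) \<in> sets borel"
proof -
  have *: "(zcube :: 'e set) = (\<Inter>b\<in>Basis. (\<lambda>t. t \<bullet> b) -` {- (1/2)..<1 / 2 :: real})"
    by (auto simp: zcube_def)
  have "(\<lambda>t. t \<bullet> b) -` {- (1/2)..<1 / 2 :: real} \<in> sets borel" for b :: 'e
    by (rule measurable_sets_borel[of _ borel]) auto
  thus ?thesis unfolding * by (intro sets.finite_INT) auto
qed

lemma zcube_subset: "zcube \<subseteq> cbox (- (1/2) *\<^sub>R One) ((1/2) *\<^sub>R (One::'e::euclidean_space))"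
  by (auto simp: zcube_def mem_box) (metis le_less)+

lemma zcube_tile:
  fixes z :: "'b::{topological_comm_monoid_add,t2_space,semiring_1}" and t :: "'e::euclidean_space"
  shows "((\<lambda>k. indicator zcube (t - k) * z) has_sum z) zlat"
proof -
  define k0 :: 'e where "k0 = (\<Sum>b\<in>Basis. of_int \<lfloor>t \<bullet> b + 1/2\<rfloor> *\<^sub>R b)"
  have k0: "k0 \<bullet> b = of_int \<lfloor>t \<bullet> b + 1/2\<rfloor>" if "b \<in> Basis" for b
    using that by (simp add: k0_def)
  have k0z: "k0 \<in> zlat" by (simp add: zlat_def k0)
  have in0: "t - k0 \<in> zcube"
    unfolding zcube_def by (auto simp: inner_diff_left k0) linarith+
  have uniq: "k = k0" if "k \<in> zlat" "t - k \<in> zcube" for k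
  proof (rule euclidean_eqI)
    fix b :: 'e assume b: "b \<in> Basis"
    have "k \<bullet> b \<in> \<int>" using that(1) b by (simp add: zlat_def)
    then obtain n where n: "k \<bullet> b = of_int n" by (rule Ints_cases)
    have "- (1/2) \<le> t \<bullet> b - of_int n" "t \<bullet> b - of_int n < 1 / 2"
      using that(2) b by (auto simp: zcube_def inner_diff_left n)
    hence "\<lfloor>t \<bullet> b + 1/2\<rfloor> = n" by linarith
    thus "k \<bullet> b = k0 \<bullet> b" by (simp add: n k0 b)
  qed
  have "((\<lambda>k. indicator zcube (t - k) * z) has_sum z) zlat \<longleftrightarrow> ((\<lambda>k. z) has_sum z) {k0}"
  proof (rule has_sum_cong_neutral)
    fix k assume "k \<in> zlat - {k0}"
    hence "t - k \<notin> zcube" using uniq by blast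
    thus "indicator zcube (t - k) * z = 0" by simp
  qed (use k0z in0 in auto)
  thus ?thesis using has_sum_finite[of "{k0}" "\<lambda>_. z"] by simp
qed

lemma zcube_integrable:
  fixes K :: "'e::euclidean_space \<Rightarrow> complex"
  assumes "continuous_on UNIV K"
  shows "integrable lborel (\<lambda>t. indicator zcube t * K t)"
proof -
  have [measurable]: "K \<in> borel_measurable borel"
    using assms by (rule borel_measurable_continuous_onI)
  have "integrable lborel (\<lambda>t. indicator (cbox (- (1/2) *\<^sub>R One) ((1/2) *\<^sub>R One)) t *\<^sub>R K t)"
    by (intro borel_integrable_compact compact_cbox continuous_on_subset[OF assms]) auto
  thus ?thesis
    by (rule Bochner_Integration.integrable_bound) (use zcube_subset in \<open>auto simp: indicator_def\<close>)
qed

lemma integral_unit_interval_ch: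
  assumes "n \<in> \<int>"
  shows "(\<integral>x. indicator {- (1/2)..<1 / 2} x * ch (n * x) \<partial>lborel) = (if n = 0 then 1 else 0)"
    and "integrable lborel (\<lambda>x. indicator {- (1/2)..<1 / 2} x * ch (n * x))"
proof -
  define F where "F x = (if n = 0 then of_real x else ch (n * x) / (2 * pi * \<i> * n))" for x :: real
  have "has_bochner_integral lborel (\<lambda>x. indicator {- (1/2)..1 / 2} x *\<^sub>R ch (n * x)) (F (1/2) - F (- (1/2)))"
  proof (rule has_bochner_integral_FTC_Icc)
    fix x :: real
    have "((\<lambda>x. exp (2 * of_real pi * \<i> * of_real (n * x))) has_vector_derivative
        (2 * of_real pi * \<i> * n) * exp (2 * of_real pi * \<i> * of_real (n * x))) (at x within {- (1/2)..1 / 2})"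
      by (auto intro!: derivative_eq_intros has_vector_derivative_real_field simp: has_field_derivative_def)
    hence "((\<lambda>x. ch (n * x)) has_vector_derivative (2 * of_real pi * \<i> * n) * ch (n * x)) (at x within {- (1/2)..1 / 2})"
      by (simp add: ch_exp)
    hence 1: "((\<lambda>x. ch (n * x) / (2 * pi * \<i> * n)) has_vector_derivative ((2 * of_real pi * \<i> * n) * ch (n * x)) / (2 * pi * \<i> * n)) (at x within {- (1/2)..1 / 2})"
      by (rule has_vector_derivative_divide)
    show "(F has_vector_derivative ch (n * x)) (at x within {- (1/2)..1 / 2})"
    proof (cases "n = 0")
      case True
      thus ?thesis by (auto simp: F_def[abs_def] intro!: derivative_eq_intros has_vector_derivative_of_real has_vector_derivative_id)
    next
      case False
      thus ?thesis using 1 by (simp add: F_def[abs_def])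
    qed
  qed (auto intro!: continuous_intros)
  moreover have "F (1/2) - F (- (1/2)) = (if n = 0 then 1 else 0)"
  proof (cases "n = 0")
    case False
    have "ch (n * (1/2)) = ch (n * (- (1/2)) + n)" by (simp add: field_simps)
    also have "\<dots> = ch (n * (- (1/2)))" by (simp only: ch_add ch_int[OF assms] mult_1_right)
    finally show ?thesis using False by (simp add: F_def)
  qed (simp add: F_def)
  ultimately have *: "has_bochner_integral lborel (\<lambda>x. indicator {- (1/2)..1 / 2} x *\<^sub>R ch (n * x)) (if n = 0 then 1 else 0)"
    by simp
  have AE: "AE x in lborel. indicator {- (1/2)..1 / 2} x *\<^sub>R ch (n * x) = indicator {- (1/2)..<1 / 2} x * ch (n * x)"
    using AE_lborel_singleton[of "1/2 :: real"] by eventually_elim (auto simp: indicator_def)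
  have "has_bochner_integral lborel (\<lambda>x. indicator {- (1/2)..<1 / 2} x * ch (n * x)) (if n = 0 then 1 else 0)"
    using * by (subst (asm) has_bochner_integral_cong_AE[OF _ _ AE]) auto
  thus "(\<integral>x. indicator {- (1/2)..<1 / 2} x * ch (n * x) \<partial>lborel) = (if n = 0 then 1 else 0)"
    and "integrable lborel (\<lambda>x. indicator {- (1/2)..<1 / 2} x * ch (n * x))"
    by (auto simp: has_bochner_integral_iff)
qed

lemma ch_sum: "finite A \<Longrightarrow> ch (sum f A) = (\<Prod>x\<in>A. ch (f x))"
  by (induction A rule: finite_induct) (auto simp: ch_add)

lemma zcube_orthogonal:
  fixes m :: "'e::euclidean_space"
  assumes "m \<in> zlat"
  shows "(\<integral>t. indicator zcube t * ch (m \<bullet> t) \<partial>lborel) = (if m = 0 then 1 else 0)"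
proof -
  have eq: "indicator zcube t * ch (m \<bullet> t) =
     (\<Prod>b\<in>Basis. indicator {- (1/2)..<1 / 2} (t \<bullet> b) * ch ((m \<bullet> b) * (t \<bullet> b)))" for t
  proof -
    have "(indicator zcube t :: complex) = (\<Prod>b\<in>Basis. indicator {- (1/2)..<1 / 2} (t \<bullet> b))"
    proof (cases "t \<in> zcube")
      case False
      then obtain b where "b \<in> Basis" "t \<bullet> b \<notin> {- (1/2)..<1 / 2}" by (auto simp: zcube_def)
      hence "(\<Prod>b\<in>Basis. indicator {- (1/2)..<1 / 2} (t \<bullet> b) :: complex) = 0"
        by (intro prod_zero bexI[of _ b]) (auto simp: indicator_def)
      thus ?thesis using False by simp
    qed (auto simp: zcube_def)
    moreover have "ch (m \<bullet> t) = (\<Prod>b\<in>Basis. ch ((m \<bullet> b) * (t \<bullet> b)))"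
      by (subst euclidean_inner) (simp add: ch_sum)
    ultimately show ?thesis by (simp add: prod.distrib)
  qed
  have "(\<integral>t. indicator zcube t * ch (m \<bullet> t) \<partial>lborel) = (\<Prod>b\<in>(Basis::'e set). if m \<bullet> b = 0 then 1 else 0)"
    unfolding eq using assms
    by (subst lborel_integral_prod) (auto simp: integral_unit_interval_ch zlat_def)
  also have "\<dots> = (if m = 0 then 1 else 0)"
    by (cases "m = 0") (auto simp: euclidean_eq_iff[of m 0])
  finally show ?thesis .
qed

lemma zcube_bound:
  assumes "t \<in> zcube" shows "norm (t :: 'e::euclidean_space) \<le> DIM('e)"
proof -
  have "norm t \<le> (\<Sum>b\<in>Basis. \<bar>t \<bullet> b\<bar>)" by (rule norm_le_l1)
  also have "\<dots> \<le> (\<Sum>b\<in>(Basis::'e set). 1)"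
    using assms by (intro sum_mono) (auto simp: zcube_def abs_le_iff)
  finally show ?thesis by simp
qed

text \<open>Vanishing against all characters implies vanishing against all trigonometric polynomials, in
  particular against the powers of \<open>c t = \<Prod> cos\<^sup>2 (\<pi> t\<^sub>b)\<close>. On
  the cube these powers concentrate at the origin, so a nonzero value of \<open>D\<close> at
  \<open>0\<close> would make the integral nonzero.\<close>

lemma fourier_uniqueness_at_0:
  fixes D :: "'e::euclidean_space \<Rightarrow> complex"
  assumes cont: "continuous_on UNIV D"
    and zero: "\<And>m. m \<in> zlat \<Longrightarrow> (\<integral>t. indicator zcube t * (D t * ch (m \<bullet> t)) \<partial>lborel) = 0"
  shows "D 0 = 0"
proof (rule ccontr)
  assume D0: "D 0 \<noteq> 0"
  define Z where "Z K \<longleftrightarrow> continuous_on UNIV K \<and>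
    (\<forall>m\<in>zlat. (\<integral>t. indicator zcube t * (D t * K t * ch (m \<bullet> t)) \<partial>lborel) = 0)" for K :: "'e \<Rightarrow> complex"
  have Z1: "Z (\<lambda>_. 1)"
    using zero by (simp add: Z_def)
  have Zmult: "Z (\<lambda>t. K t * (of_real ((cos (pi * (t \<bullet> b)))\<^sup>2)))" if ZK: "Z K" and b: "b \<in> Basis" for K b
    unfolding Z_def
  proof safe
    have cK: "continuous_on UNIV K" using ZK by (simp add: Z_def)
    show "continuous_on UNIV (\<lambda>t. K t * (of_real ((cos (pi * (t \<bullet> b)))\<^sup>2)))"
      using cK by (intro continuous_intros)
    fix m :: 'e assume m: "m \<in> zlat"
    have c2: "of_real ((cos (pi * s))\<^sup>2) = (2 + ch s + ch (- s)) / 4" for s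
    proof -
      have "ch s + ch (- s) = of_real (2 * cos (2 * (pi * s)))"
        by (simp add: ch_def complex_eq_iff mult_ac)
      hence "ch s + ch (- s) = 4 * of_real ((cos (pi * s))\<^sup>2) - 2" by (simp add: cos_double_cos)
      thus ?thesis by (simp add: add.assoc)
    qed
    have e1: "ch ((m + b) \<bullet> t) = ch (m \<bullet> t) * ch (t \<bullet> b)" for t
      by (simp add: inner_add_left ch_add inner_commute[of t b])
    have e2: "ch ((m - b) \<bullet> t) = ch (m \<bullet> t) * ch (- (t \<bullet> b))" for t
      by (simp add: inner_diff_left inner_commute[of t b] flip: ch_add)
    have eq: "indicator zcube t * (D t * (K t * (of_real ((cos (pi * (t \<bullet> b)))\<^sup>2))) * ch (m \<bullet> t))
      = (1/2) * (indicator zcube t * (D t * K t * ch (m \<bullet> t)))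
       + (1/4) * (indicator zcube t * (D t * K t * ch ((m + b) \<bullet> t)))
       + (1/4) * (indicator zcube t * (D t * K t * ch ((m - b) \<bullet> t)))" for t
      by (simp only: c2 e1 e2) (simp add: field_simps)
    have int: "integrable lborel (\<lambda>t. indicator zcube t * (D t * K t * ch (j \<bullet> t)))" for j
      by (intro zcube_integrable continuous_intros cont cK)
    have zs: "(\<integral>t. indicator zcube t * (D t * K t * ch (j \<bullet> t)) \<partial>lborel) = 0" if "j \<in> zlat" for j
      using ZK that by (simp add: Z_def)
    show "(\<integral>t. indicator zcube t * (D t * (K t * (of_real ((cos (pi * (t \<bullet> b)))\<^sup>2))) * ch (m \<bullet> t)) \<partial>lborel) = 0"
      unfolding eq using int m b
      by (simp add: zs zlat_closed)
  qed
  define c where "c t = (\<Prod>b\<in>Basis. (cos (pi * (t \<bullet> b)))\<^sup>2)" for t :: 'e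
  have Zc: "Z (\<lambda>t. K t * of_real (c t))" if "Z K" for K
  proof -
    have "Z (\<lambda>t. K t * of_real (\<Prod>b\<in>A. (cos (pi * (t \<bullet> b)))\<^sup>2))" if "finite A" "A \<subseteq> Basis" for A
      using that
    proof (induction A rule: finite_induct)
      case empty thus ?case using \<open>Z K\<close> by simp
    next
      case (insert b A)
      have "Z (\<lambda>t. K t * of_real (\<Prod>b\<in>A. (cos (pi * (t \<bullet> b)))\<^sup>2))" using insert by simp
      from Zmult[OF this, of b] show ?case using insert by (simp add: mult_ac)
    qed
    from this[of Basis] show ?thesis by (simp add: c_def)
  qed
  have Zn: "Z (\<lambda>t. of_real (c t ^ n))" for n
  proof (induction n)
    case (Suc n)
    from Zc[OF this] show ?case by (simp add: mult_ac)
  qed (use Z1 in simp)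
  have c_cont: "continuous_on A c" for A
    unfolding c_def by (intro continuous_intros)
  have c_nonneg: "c t \<ge> 0" for t
    unfolding c_def by (intro prod_nonneg) auto
  have c_le: "c t \<le> 1" for t
    unfolding c_def by (intro prod_le_1) (auto simp: abs_square_le_1)
  have c0: "c 0 = 1" by (simp add: c_def)
  define u where "u t = Re (D t * cnj (D 0)) / (norm (D 0))\<^sup>2" for t
  have u_cont: "continuous_on A u" for A
    unfolding u_def using D0 by (intro continuous_intros continuous_on_subset[OF cont]) auto
  have u0: "u 0 = 1"
  proof -
    have "Re (D 0 * cnj (D 0)) = (norm (D 0))\<^sup>2"
      by (simp only: cmod_power2) (simp add: power2_eq_square)
    thus ?thesis using D0 unfolding u_def by (simp only:) simp
  qed
  have int_u: "integrable lborel (\<lambda>t. indicator zcube t * (u t * c t ^ n))"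
    and u_zero: "(\<integral>t. indicator zcube t * (u t * c t ^ n) \<partial>lborel) = 0" for n
  proof -
    have I: "integrable lborel (\<lambda>t. indicator zcube t * (D t * of_real (c t ^ n)))"
      by (intro zcube_integrable continuous_intros cont c_cont)
    have 0: "(\<integral>t. indicator zcube t * (D t * of_real (c t ^ n)) \<partial>lborel) = 0"
      using Zn[of n] zlat_closed(1) unfolding Z_def by force
    let ?w = "cnj (D 0) / (norm (D 0))\<^sup>2"
    have I2: "integrable lborel (\<lambda>t. indicator zcube t * (D t * of_real (c t ^ n)) * ?w)"
      using I by (intro integrable_mult_left) 
    have 02: "(\<integral>t. indicator zcube t * (D t * of_real (c t ^ n)) * ?w \<partial>lborel) = 0"
      using 0 by (subst integral_mult_left_zero) simp
    have eq: "Re (indicator zcube t * (D t * of_real (c t ^ n)) * ?w) = indicator zcube t * (u t * c t ^ n)" for t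
    proof -
      have "indicator zcube t * (D t * of_real (c t ^ n)) * ?w
         = of_real (indicator zcube t * c t ^ n / (norm (D 0))\<^sup>2) * (D t * cnj (D 0))"
        by (simp add: indicator_def)
      hence "Re (indicator zcube t * (D t * of_real (c t ^ n)) * ?w)
         = (indicator zcube t * c t ^ n / (norm (D 0))\<^sup>2) * Re (D t * cnj (D 0))"
        by (simp only: Re_complex_of_real times_complex.sel Im_complex_of_real)
      thus ?thesis unfolding u_def by (simp only: mult_ac times_divide_eq_left times_divide_eq_right)
    qed
    show "integrable lborel (\<lambda>t. indicator zcube t * (u t * c t ^ n))"
      using integrable_Re[OF I2] unfolding eq .
    show "(\<integral>t. indicator zcube t * (u t * c t ^ n) \<partial>lborel) = 0"
      using integral_Re[OF I2] unfolding eq 02 by simp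
  qed
  obtain \<delta> where \<delta>: "\<delta> > 0" "\<And>t. norm t < \<delta> \<Longrightarrow> u t > 1/2"
  proof -
    have "open {t. u t > 1/2}"
      using u_cont by (intro open_Collect_less continuous_intros) auto
    moreover have "0 \<in> {t. u t > 1/2}" by (simp add: u0)
    ultimately obtain \<delta> where "\<delta> > 0" "ball 0 \<delta> \<subseteq> {t. u t > 1/2}"
      by (meson open_contains_ball)
    thus ?thesis by (intro that[of \<delta>]) (auto simp: subset_iff)
  qed
  let ?B = "cbox (- (1/2) *\<^sub>R One) ((1/2) *\<^sub>R (One::'e))"
  obtain \<eta> where \<eta>: "0 < \<eta>" "\<eta> < 1" "\<And>t. t \<in> ?B \<Longrightarrow> norm t \<ge> \<delta> \<Longrightarrow> c t \<le> \<eta>"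
  proof (cases "?B \<inter> {t. norm t \<ge> \<delta>} = {}")
    case True thus ?thesis by (intro that[of "1/2"]) auto
  next
    case False
    have "closed {t::'e. norm t \<ge> \<delta>}" by (intro closed_Collect_le continuous_intros)
    hence "compact (?B \<inter> {t. norm t \<ge> \<delta>})" by (intro compact_Int_closed) auto
    then obtain t0 where t0: "t0 \<in> ?B \<inter> {t. norm t \<ge> \<delta>}" "\<And>t. t \<in> ?B \<inter> {t. norm t \<ge> \<delta>} \<Longrightarrow> c t \<le> c t0"
      using continuous_attains_sup[OF _ False c_cont] by blast
    have "c t0 < 1"
    proof -
      have "t0 \<noteq> 0" using t0 \<delta>(1) by auto
      then obtain b where b: "b \<in> Basis" "t0 \<bullet> b \<noteq> 0" by (auto simp: euclidean_eq_iff[of t0 0])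
      have bd: "\<bar>pi * (t0 \<bullet> b)\<bar> \<le> pi/2" using t0(1) b(1) by (auto simp: mem_box abs_mult)
      have "(cos (pi * (t0 \<bullet> b)))\<^sup>2 < 1"
      proof -
        have "sin (pi * (t0 \<bullet> b)) \<noteq> 0"
        proof
          assume "sin (pi * (t0 \<bullet> b)) = 0"
          then obtain i :: int where "pi * (t0 \<bullet> b) = of_int i * pi" by (auto simp: sin_zero_iff_int2)
          hence "t0 \<bullet> b = of_int i" by simp
          thus False using b bd by (auto simp: abs_mult)
        qed
        hence "(sin (pi * (t0 \<bullet> b)))\<^sup>2 > 0" by simp
        thus ?thesis using sin_cos_squared_add[of "pi * (t0 \<bullet> b)"] by linarith
      qed
      moreover have "c t0 = (cos (pi * (t0 \<bullet> b)))\<^sup>2 * (\<Prod>b\<in>Basis-{b}. (cos (pi * (t0 \<bullet> b)))\<^sup>2)"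
        unfolding c_def using b by (simp add: prod.remove)
      moreover have "(\<Prod>b\<in>Basis-{b}. (cos (pi * (t0 \<bullet> b)))\<^sup>2) \<le> 1"
        by (intro prod_le_1) (auto simp: abs_square_le_1)
      ultimately show ?thesis
        by (metis mult_left_le zero_le_power2 order_le_less_trans)
    qed
    show ?thesis
    proof (rule that[of "max (1/2) (c t0)"])
      fix t assume "t \<in> ?B" "norm t \<ge> \<delta>"
      hence "c t \<le> c t0" by (intro t0(2)) blast
      thus "c t \<le> max (1/2) (c t0)" by linarith
    qed (use \<open>c t0 < 1\<close> in auto)
  qed
  define \<eta>' where "\<eta>' = (1 + \<eta>) / 2"
  have \<eta>': "\<eta> < \<eta>'" "\<eta>' < 1" "0 < \<eta>'" using \<eta> by (auto simp: \<eta>'_def)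
  obtain \<delta>' where \<delta>': "\<delta>' > 0" "\<delta>' \<le> \<delta>" "\<delta>' \<le> 1/2" "\<And>t. norm t < \<delta>' \<Longrightarrow> c t > \<eta>'"
  proof -
    have "open {t. c t > \<eta>'}"
      using c_cont by (intro open_Collect_less continuous_intros) auto
    moreover have "0 \<in> {t. c t > \<eta>'}" using \<eta>' by (simp add: c0)
    ultimately obtain d where "d > 0" "ball 0 d \<subseteq> {t. c t > \<eta>'}"
      by (meson open_contains_ball)
    thus ?thesis using \<delta>(1) by (intro that[of "min (min d \<delta>) (1/2)"]) (auto simp: subset_iff)
  qed
  have in_cube: "t \<in> zcube" if "norm t < \<delta>'" for t :: 'e
    unfolding zcube_def
  proof safe
    fix b :: 'e assume "b \<in> Basis"
    hence "\<bar>t \<bullet> b\<bar> < 1/2" using Basis_le_norm[of b t] that \<delta>' by linarith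
    thus "- (1/2) \<le> t \<bullet> b" "t \<bullet> b < 1/2" by auto
  qed
  obtain M where M: "\<And>t. t \<in> ?B \<Longrightarrow> \<bar>u t\<bar> \<le> M"
  proof -
    have "compact (u ` ?B)" by (intro compact_continuous_image u_cont) auto
    hence "bounded (u ` ?B)" by (rule compact_imp_bounded)
    thus ?thesis using that by (auto simp: bounded_iff)
  qed
  have M0: "M \<ge> 0" using M[of 0] by (auto simp: mem_box)
  define v where "v = measure lborel (ball (0::'e) \<delta>')"
  have v: "v > 0" unfolding v_def using \<delta>'(1) by (rule content_ball_pos)
  have fin1: "emeasure lborel (ball (0::'e) \<delta>') < \<infinity>" by (rule emeasure_lborel_ball_finite)
  have fin2: "emeasure lborel (zcube :: 'e set) < \<infinity>"
    by (rule emeasure_bounded_finite[OF bounded_subset[OF bounded_cbox zcube_subset]])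
  define w where "w = measure lborel (zcube :: 'e set)"
  \<comment> \<open>Near the origin the integrand is at least \<open>\<eta>'\<^sup>n / 2\<close>, away from it at most \<open>M \<eta>\<^sup>n\<close> in absolute value with \<open>\<eta> < \<eta>'\<close>, and in between it is nonnegative.\<close>
  have key: "(\<eta>' ^ n / 2) * v \<le> M * \<eta> ^ n * w" for n
  proof -
    have "(\<integral>t. (\<eta>' ^ n / 2) * indicator (ball 0 \<delta>') t - (M * \<eta> ^ n) * indicator zcube t \<partial>(lborel :: 'e measure))
      \<le> (\<integral>t. indicator zcube t * (u t * c t ^ n) \<partial>(lborel :: 'e measure))"
    proof (rule integral_mono)
      fix t :: 'e
      have Mn: "M * \<eta> ^ n \<ge> 0" using M0 \<eta> by simp
      show "(\<eta>' ^ n / 2) * indicator (ball 0 \<delta>') t - (M * \<eta> ^ n) * indicator zcube t \<le> indicator zcube t * (u t * c t ^ n)"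
      proof (cases "t \<in> zcube")
        case False
        thus ?thesis using in_cube by (auto simp: indicator_def)
      next
        case True
        hence tB: "t \<in> ?B" using zcube_subset by blast
        show ?thesis
        proof (cases "norm t < \<delta>")
          case small: True
          hence ut: "u t > 1/2" using \<delta> by simp
          have "u t * c t ^ n \<ge> (1/2) * c t ^ n" using ut c_nonneg by (intro mult_right_mono) auto
          moreover have "c t ^ n \<ge> \<eta>' ^ n" if "norm t < \<delta>'"
            using \<delta>'(4)[OF that] \<eta>' by (intro power_mono) auto
          moreover have "c t ^ n \<ge> 0" using c_nonneg by simp
          ultimately show ?thesis using True Mn by (cases "norm t < \<delta>'") (auto simp: indicator_def)
        next
          case False
          have "\<bar>u t * c t ^ n\<bar> \<le> M * \<eta> ^ n"
            unfolding abs_mult using M[OF tB] \<eta>(3)[OF tB] False c_nonneg M0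
            by (intro mult_mono) (auto simp: power_mono)
          thus ?thesis using True False \<delta>' by (auto simp: indicator_def)
        qed
      qed
    qed (use fin1 fin2 int_u in \<open>auto intro!: integrable_diff integrable_mult_right integrable_real_indicator\<close>)
    also have "\<dots> = 0" by (rule u_zero)
    also have "(\<integral>t. (\<eta>' ^ n / 2) * indicator (ball 0 \<delta>') t - (M * \<eta> ^ n) * indicator zcube t \<partial>(lborel :: 'e measure))
      = (\<eta>' ^ n / 2) * v - (M * \<eta> ^ n) * w"
      using fin1 fin2 by (subst Bochner_Integration.integral_diff) (auto simp: v_def w_def)
    finally show ?thesis by simp
  qed
  have "(\<lambda>n. 2 * M * w * (\<eta> / \<eta>') ^ n) \<longlonglongrightarrow> 2 * M * w * 0"
    using \<eta> \<eta>' by (intro tendsto_mult tendsto_const LIMSEQ_realpow_zero) auto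
  hence "eventually (\<lambda>n. 2 * M * w * (\<eta> / \<eta>') ^ n < v) sequentially"
    using v by (intro order_tendstoD) auto
  then obtain n where "2 * M * w * (\<eta> / \<eta>') ^ n < v" by (auto simp: eventually_sequentially)
  moreover have "v \<le> 2 * M * w * (\<eta> / \<eta>') ^ n"
    using key[of n] \<eta>' by (simp add: field_simps)
  ultimately show False by simp
qed

section \<open>Poisson summation\<close>

lemma lborel_integral_shift:
  fixes g :: "'e::euclidean_space \<Rightarrow> complex"
  assumes [measurable]: "g \<in> borel_measurable borel"
  shows "(\<integral>t. g (t + a) \<partial>lborel) = (\<integral>t. g t \<partial>lborel)"
    and "integrable lborel (\<lambda>t. g (t + a)) \<longleftrightarrow> integrable lborel g"
proof -
  have "(\<integral>t. g t \<partial>distr lborel borel ((+) a)) = (\<integral>t. g (a + t) \<partial>lborel)"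
    by (subst integral_distr) auto
  thus "(\<integral>t. g (t + a) \<partial>lborel) = (\<integral>t. g t \<partial>lborel)"
    by (simp add: lborel_distr_plus add.commute)
  have "integrable (distr lborel borel ((+) a)) g \<longleftrightarrow> integrable lborel (\<lambda>t. g (a + t))"
    by (subst integrable_distr_eq) auto
  thus "integrable lborel (\<lambda>t. g (t + a)) \<longleftrightarrow> integrable lborel g"
    by (simp add: lborel_distr_plus add.commute)
qed

lemma gauss_shift_bound:
  fixes F :: "'e::euclidean_space \<Rightarrow> complex"
  assumes bd: "\<And>x. norm (F x) \<le> C * exp (- \<epsilon> * (norm x)\<^sup>2)" and eps: "\<epsilon> > 0" and t: "norm t \<le> R"
  shows "norm (F (t + k)) \<le> C * exp (\<epsilon> * R\<^sup>2) * exp (- (\<epsilon>/2) * (norm k)\<^sup>2)"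
proof -
  have C: "C \<ge> 0" using order_trans[OF norm_ge_zero bd[of 0]] by simp
  have "(norm k)\<^sup>2 \<le> (norm (t + k) + norm t)\<^sup>2"
    by (intro power_mono) (metis add.commute add_diff_cancel_left' norm_triangle_ineq4, simp)
  also have "\<dots> \<le> 2 * (norm (t + k))\<^sup>2 + 2 * (norm t)\<^sup>2"
    using sum_squares_bound[of "norm (t + k)" "norm t"] by (simp add: power2_sum)
  also have "\<dots> \<le> 2 * (norm (t + k))\<^sup>2 + 2 * R\<^sup>2"
    using t by (simp add: power_mono)
  finally have "- \<epsilon> * (norm (t + k))\<^sup>2 \<le> \<epsilon> * R\<^sup>2 + (- (\<epsilon>/2) * (norm k)\<^sup>2)"
    using mult_left_mono[of "(norm k)\<^sup>2" "2 * (norm (t + k))\<^sup>2 + 2 * R\<^sup>2" "\<epsilon>/2"] eps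
    by (simp add: field_simps)
  hence "exp (- \<epsilon> * (norm (t + k))\<^sup>2) \<le> exp (\<epsilon> * R\<^sup>2) * exp (- (\<epsilon>/2) * (norm k)\<^sup>2)"
    by (subst exp_add[symmetric]) (subst exp_le_cancel_iff)
  thus ?thesis using order_trans[OF bd[of "t + k"] mult_left_mono[OF _ C]] by (simp add: mult.assoc)
qed

text \<open>Makes the series of lattice translates of \<open>F\<close> converge locally uniformly.\<close>

lemma gauss_shift_zwt:
  fixes F :: "'e::euclidean_space \<Rightarrow> complex"
  assumes bd: "\<And>x. norm (F x) \<le> C * exp (- \<epsilon> * (norm x)\<^sup>2)" and eps: "\<epsilon> > 0"
  obtains W where "W \<ge> 0" "\<And>t k. norm t \<le> R \<Longrightarrow> norm (F (t + k)) \<le> W * zwt k"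
proof -
  have C: "C \<ge> 0" using order_trans[OF norm_ge_zero bd[of 0]] by simp
  show ?thesis
  proof (rule that[of "C * exp (\<epsilon> * R\<^sup>2) * (1 + 1 / (\<epsilon>/2)) ^ DIM('e)"])
    fix t k :: 'e assume t: "norm t \<le> R"
    have "norm (F (t + k)) \<le> C * exp (\<epsilon> * R\<^sup>2) * exp (- (\<epsilon>/2) * (norm k)\<^sup>2)"
      by (rule gauss_shift_bound[OF bd eps t])
    also have "\<dots> \<le> C * exp (\<epsilon> * R\<^sup>2) * ((1 + 1 / (\<epsilon>/2)) ^ DIM('e) * zwt k)"
      using C eps by (intro mult_left_mono gauss_le_zwt) auto
    finally show "norm (F (t + k)) \<le> C * exp (\<epsilon> * R\<^sup>2) * (1 + 1 / (\<epsilon>/2)) ^ DIM('e) * zwt k"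
      by (simp add: mult_ac)
  qed (use C eps in auto)
qed

text \<open>The integral over the space is the sum of the integrals over the lattice translates of the cube.\<close>

lemma
  fixes F :: "'e::euclidean_space \<Rightarrow> complex"
  assumes [measurable]: "F \<in> borel_measurable borel"
    and bd: "\<And>x. norm (F x) \<le> C * exp (- \<epsilon> * (norm x)\<^sup>2)" and eps: "\<epsilon> > 0"
  shows gauss_integrable: "integrable lborel F"
    and has_sum_integral_tiles:
      "((\<lambda>k. \<integral>t. indicator zcube t * F (t + k) \<partial>lborel) has_sum (\<integral>t. F t \<partial>lborel)) zlat"
    and summable_integral_tiles:
      "(\<lambda>k. \<integral>t. norm (indicator zcube t * F (t + k)) \<partial>lborel) summable_on zlat"
    and integrable_tile: "integrable lborel (\<lambda>t. indicator zcube t * F (t + k))"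
proof -
  obtain W where W: "W \<ge> 0" "\<And>t k. norm t \<le> real DIM('e) \<Longrightarrow> norm (F (t + k)) \<le> W * zwt k"
    using gauss_shift_zwt[OF bd eps, where R = "real DIM('e)"] by blast
  have fin: "emeasure lborel (zcube :: 'e set) < \<infinity>"
    by (rule emeasure_bounded_finite[OF bounded_subset[OF bounded_cbox zcube_subset]])
  have le: "norm (indicator zcube t * F (t + k)) \<le> W * zwt k * indicator zcube t" for t k
    using W(2)[of t k] zcube_bound[of t] by (auto simp: indicator_def)
  have I: "integrable lborel (\<lambda>t::'e. W * zwt k * indicator zcube t)" for k :: 'e
    using fin by (intro integrable_mult_right integrable_real_indicator) auto
  show int: "integrable lborel (\<lambda>t. indicator zcube t * F (t + k))" for k
    by (rule Bochner_Integration.integrable_bound[OF I[of k]])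
       (use le W in \<open>auto simp: indicator_def\<close>)
  show sm: "(\<lambda>k. \<integral>t. norm (indicator zcube t * F (t + k)) \<partial>lborel) summable_on zlat"
  proof (rule summable_on_comparison_test)
    show "(\<lambda>k::'e. W * measure lborel (zcube :: 'e set) * zwt k) summable_on zlat"
      by (intro summable_on_cmult_right zwt_summable)
    fix k :: 'e
    have "(\<integral>t. norm (indicator zcube t * F (t + k)) \<partial>lborel) \<le> (\<integral>t. W * zwt k * indicator zcube t \<partial>(lborel :: 'e measure))"
      by (intro integral_mono I integrable_norm int le)
    thus "(\<integral>t. norm (indicator zcube t * F (t + k)) \<partial>lborel) \<le> W * measure lborel (zcube :: 'e set) * zwt k"
      using fin by (simp add: mult_ac)
  qed auto
  have sh: "(\<integral>t. norm (indicator zcube (t - k) * F t) \<partial>lborel) = (\<integral>t. norm (indicator zcube t * F (t + k)) \<partial>lborel)"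
     "(\<integral>t. indicator zcube (t - k) * F t \<partial>lborel) = (\<integral>t. indicator zcube t * F (t + k) \<partial>lborel)"
     "integrable lborel (\<lambda>t. indicator zcube (t - k) * F t)" for k
  proof -
    have "(\<integral>t. of_real (norm (indicator zcube (t - k) * F t)) \<partial>lborel)
        = (\<integral>t. complex_of_real (norm (indicator zcube t * F (t + k))) \<partial>lborel)"
      using lborel_integral_shift(1)[of "\<lambda>t. of_real (norm (indicator zcube (t - k) * F t))" k] by simp
    thus "(\<integral>t. norm (indicator zcube (t - k) * F t) \<partial>lborel) = (\<integral>t. norm (indicator zcube t * F (t + k)) \<partial>lborel)"
      by (simp only: integral_complex_of_real of_real_eq_iff)
    show "(\<integral>t. indicator zcube (t - k) * F t \<partial>lborel) = (\<integral>t. indicator zcube t * F (t + k) \<partial>lborel)"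
      using lborel_integral_shift(1)[of "\<lambda>t. indicator zcube (t - k) * F t" k] by simp
    show "integrable lborel (\<lambda>t. indicator zcube (t - k) * F t)"
      using lborel_integral_shift(2)[of "\<lambda>t. indicator zcube (t - k) * F t" k] int[of k] by simp
  qed
  have sm': "(\<lambda>k. \<integral>t. norm (indicator zcube (t - k) * F t) \<partial>lborel) summable_on zlat"
    unfolding sh by (rule sm)
  have eq: "(\<Sum>\<^sub>\<infinity>k\<in>zlat. indicator zcube (t - k) * F t) = F t" for t
    by (rule infsumI[OF zcube_tile])
  show "integrable lborel F"
    using integrable_infsum[OF countable_zlat sh(3) sm'] by (simp add: eq)
  show "((\<lambda>k. \<integral>t. indicator zcube t * F (t + k) \<partial>lborel) has_sum (\<integral>t. F t \<partial>lborel)) zlat"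
    using has_sum_integral_infsum[OF countable_zlat sh(3) sm'] by (simp only: eq sh)
qed

text \<open>Weierstrass' test on balls.\<close>

lemma continuous_on_infsum_locally:
  fixes f :: "'i \<Rightarrow> 'e::euclidean_space \<Rightarrow> complex"
  assumes "\<And>i. i \<in> I \<Longrightarrow> continuous_on UNIV (f i)"
    and "\<And>R. \<exists>W. W summable_on I \<and> (\<forall>i\<in>I. \<forall>t. norm t \<le> R \<longrightarrow> norm (f i t) \<le> W i)"
  shows "continuous_on UNIV (\<lambda>t. \<Sum>\<^sub>\<infinity>i\<in>I. f i t)"
proof (rule continuous_at_imp_continuous_on, rule ballI)
  fix t0 :: 'e
  define R where "R = norm t0 + 1"
  obtain W where W: "W summable_on I" "\<And>i t. i \<in> I \<Longrightarrow> norm t \<le> R \<Longrightarrow> norm (f i t) \<le> W i"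
    using assms(2)[of R] by blast
  have "uniform_limit (ball 0 R) (\<lambda>X t. \<Sum>i\<in>X. f i t) (\<lambda>t. \<Sum>\<^sub>\<infinity>i\<in>I. f i t) (finite_subsets_at_top I)"
    by (rule Weierstrass_m_test_general[OF _ W(1)]) (use W(2) in auto)
  hence "continuous_on (ball 0 R) (\<lambda>t. \<Sum>\<^sub>\<infinity>i\<in>I. f i t)"
  proof (rule uniform_limit_theorem[rotated])
    show "\<forall>\<^sub>F X in finite_subsets_at_top I. continuous_on (ball 0 R) (\<lambda>t. \<Sum>i\<in>X. f i t)"
      by (intro eventually_finite_subsets_at_top_weakI continuous_intros
            continuous_on_subset[OF assms(1)]) auto
  qed simp
  moreover have "t0 \<in> ball 0 R" by (simp add: R_def)
  ultimately show "isCont (\<lambda>t. \<Sum>\<^sub>\<infinity>i\<in>I. f i t) t0"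
    using continuous_on_eq_continuous_at[OF open_ball] by blast
qed

lemma trig_series_coefficient:
  fixes a :: "'e::euclidean_space \<Rightarrow> complex"
  assumes sm: "(\<lambda>n. norm (a n)) summable_on zlat" and m: "m \<in> zlat"
  shows "(\<integral>t. indicator zcube t * ((\<Sum>\<^sub>\<infinity>n\<in>zlat. a n * ch (n \<bullet> t)) * ch (m \<bullet> t)) \<partial>lborel) = a (- m)"
proof -
  let ?h = "\<lambda>n t. indicator zcube t * (a n * ch (n \<bullet> t) * ch (m \<bullet> t))"
  have hint: "integrable lborel (?h n)" for n
    by (intro zcube_integrable continuous_intros)
  have hval: "(\<integral>t. ?h n t \<partial>lborel) = (if n = - m then a n else 0)" if "n \<in> zlat" for n
  proof -
    have hn: "?h n t = a n * (indicator zcube t * ch ((n + m) \<bullet> t))" for t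
      by (simp add: inner_add_left ch_add)
    have "(\<integral>t. ?h n t \<partial>lborel) = a n * (\<integral>t. indicator zcube t * ch ((n + m) \<bullet> t) \<partial>lborel)"
      unfolding hn by (rule integral_mult_right_zero)
    thus ?thesis using zcube_orthogonal[OF zlat_closed(3)[OF that m]]
      by (simp add: add_eq_0_iff2)
  qed
  have hsm: "(\<lambda>n. \<integral>t. norm (?h n t) \<partial>lborel) summable_on zlat"
  proof -
    have "(\<integral>t. norm (?h n t) \<partial>lborel) = norm (a n) * measure lborel (zcube :: 'e set)" for n
    proof -
      have "norm (?h n t) = norm (a n) * indicator zcube t" for t
        by (simp add: norm_mult indicator_def)
      thus ?thesis by simp
    qed
    thus ?thesis using sm by (simp add: summable_on_cmult_left)
  qed
  have sumH: "(\<Sum>\<^sub>\<infinity>n\<in>zlat. ?h n t) = indicator zcube t * ((\<Sum>\<^sub>\<infinity>n\<in>zlat. a n * ch (n \<bullet> t)) * ch (m \<bullet> t))" for t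
  proof -
    have s: "(\<lambda>n. a n * ch (n \<bullet> t)) summable_on zlat"
      by (rule abs_summable_summable) (use sm in \<open>simp add: norm_mult\<close>)
    have "(\<Sum>\<^sub>\<infinity>n\<in>zlat. ?h n t) = (\<Sum>\<^sub>\<infinity>n\<in>zlat. (indicator zcube t * ch (m \<bullet> t)) * (a n * ch (n \<bullet> t)))"
      by (intro infsum_cong) (simp add: mult_ac)
    also have "\<dots> = (indicator zcube t * ch (m \<bullet> t)) * (\<Sum>\<^sub>\<infinity>n\<in>zlat. a n * ch (n \<bullet> t))"
      by (intro infsum_cmult_right s)
    finally show ?thesis by (simp add: mult_ac)
  qed
  have "((\<lambda>n. \<integral>t. ?h n t \<partial>lborel) has_sum (\<integral>t. indicator zcube t * ((\<Sum>\<^sub>\<infinity>n\<in>zlat. a n * ch (n \<bullet> t)) * ch (m \<bullet> t)) \<partial>lborel)) zlat"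
    using has_sum_integral_infsum[OF countable_zlat hint hsm] by (simp only: sumH)
  moreover have "((\<lambda>n. \<integral>t. ?h n t \<partial>lborel) has_sum a (- m)) zlat"
  proof -
    have "((\<lambda>n. \<integral>t. ?h n t \<partial>lborel) has_sum a (- m)) zlat \<longleftrightarrow> ((\<lambda>n. a (- m)) has_sum a (- m)) {- m}"
    proof (rule has_sum_cong_neutral)
      fix n assume "n \<in> zlat - {- m}"
      thus "(\<integral>t. ?h n t \<partial>lborel) = 0" by (subst hval) auto
    next
      fix n assume "n \<in> zlat \<inter> {- m}"
      thus "(\<integral>t. ?h n t \<partial>lborel) = a (- m)" by (subst hval) auto
    qed (use zlat_closed(2)[OF m] in auto)
    thus ?thesis using has_sum_finite[of "{- m}" "\<lambda>_. a (- m)"] by simp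
  qed
  ultimately show "(\<integral>t. indicator zcube t * ((\<Sum>\<^sub>\<infinity>n\<in>zlat. a n * ch (n \<bullet> t)) * ch (m \<bullet> t)) \<partial>lborel) = a (- m)"
    using has_sum_unique by blast
qed

text \<open>Both sides are values at \<open>0\<close> of continuous periodic functions, the periodisation
  \<open>G\<close> of \<open>F\<close> and the Fourier series \<open>H\<close>. Tiling the space by
  cubes shows that their Fourier coefficients agree, so \<open>G 0 = H 0\<close> by
  \<open>fourier_uniqueness_at_0\<close>.\<close>

theorem poisson_summation_standard:
  fixes F :: "'e::euclidean_space \<Rightarrow> complex"
  assumes cont: "continuous_on UNIV F"
    and bd: "\<And>x. norm (F x) \<le> C * exp (- \<epsilon> * (norm x)\<^sup>2)" and eps: "\<epsilon> > 0"
    and sm: "(\<lambda>m. norm (\<integral>x. F x * ch (- (m \<bullet> x)) \<partial>lborel)) summable_on zlat"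
  shows "(\<Sum>\<^sub>\<infinity>k\<in>zlat. F k) = (\<Sum>\<^sub>\<infinity>m\<in>zlat. \<integral>x. F x * ch (- (m \<bullet> x)) \<partial>lborel)"
proof -
  have F_meas [measurable]: "F \<in> borel_measurable borel"
    using cont by (rule borel_measurable_continuous_onI)
  define Fh where "Fh m = (\<integral>x. F x * ch (- (m \<bullet> x)) \<partial>lborel)" for m
  have smh: "(\<lambda>m. norm (Fh m)) summable_on zlat" using sm by (simp add: Fh_def)
  define G where "G t = (\<Sum>\<^sub>\<infinity>k\<in>zlat. F (t + k))" for t
  define H where "H t = (\<Sum>\<^sub>\<infinity>m\<in>zlat. Fh m * ch (m \<bullet> t))" for t
  have sumF: "(\<lambda>k. F (t + k)) summable_on zlat" for t
  proof -
    obtain W where W: "W \<ge> 0" "\<And>s k. norm s \<le> norm t \<Longrightarrow> norm (F (s + k)) \<le> W * zwt k"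
      using gauss_shift_zwt[OF bd eps, where R = "norm t"] by blast
    show ?thesis
      by (rule abs_summable_summable, rule summable_on_comparison_test[of "\<lambda>k. W * zwt k"])
         (auto intro!: summable_on_cmult_right zwt_summable W)
  qed
  have G_cont: "continuous_on UNIV G"
    unfolding G_def
  proof (rule continuous_on_infsum_locally)
    fix R :: real
    obtain W where W: "W \<ge> 0" "\<And>s k. norm s \<le> R \<Longrightarrow> norm (F (s + k)) \<le> W * zwt k"
      using gauss_shift_zwt[OF bd eps, where R = "R"] by blast
    thus "\<exists>V. V summable_on zlat \<and> (\<forall>k\<in>zlat. \<forall>t. norm t \<le> R \<longrightarrow> norm (F (t + k)) \<le> V k)"
      by (intro exI[of _ "\<lambda>k. W * zwt k"]) (auto intro!: summable_on_cmult_right zwt_summable)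
  qed (auto intro!: continuous_on_compose2[OF cont] continuous_intros)
  have H_cont: "continuous_on UNIV H"
    unfolding H_def
  proof (rule continuous_on_infsum_locally)
    show "\<exists>V. V summable_on zlat \<and> (\<forall>k\<in>zlat. \<forall>t. norm t \<le> R \<longrightarrow> norm (Fh k * ch (k \<bullet> t)) \<le> V k)" for R
      using smh by (intro exI[of _ "\<lambda>m. norm (Fh m)"]) (auto simp: norm_mult)
  qed (auto intro!: continuous_intros)
  have "G 0 - H 0 = 0"
  proof (rule fourier_uniqueness_at_0[of "\<lambda>t. G t - H t"])
    show "continuous_on UNIV (\<lambda>t. G t - H t)"
      by (intro continuous_intros G_cont H_cont)
    fix m :: 'e assume m: "m \<in> zlat"
    define E where "E t = F t * ch (m \<bullet> t)" for t
    have E_meas: "E \<in> borel_measurable borel" unfolding E_def by measurable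
    have E_bd: "norm (E x) \<le> C * exp (- \<epsilon> * (norm x)\<^sup>2)" for x
      using bd[of x] by (simp add: E_def norm_mult)
    note tile = has_sum_integral_tiles[OF E_meas E_bd eps] summable_integral_tiles[OF E_meas E_bd eps]
       integrable_tile[OF E_meas E_bd eps]
    have shift: "E (t + k) = ch (m \<bullet> t) * F (t + k)" if "k \<in> zlat" for t k
      using ch_int[OF zlat_inner[OF m that]] by (simp add: E_def inner_add_right ch_add)
    have sumE: "(\<Sum>\<^sub>\<infinity>k\<in>zlat. indicator zcube t * E (t + k)) = indicator zcube t * (G t * ch (m \<bullet> t))" for t
    proof -
      have "(\<Sum>\<^sub>\<infinity>k\<in>zlat. indicator zcube t * E (t + k)) = (\<Sum>\<^sub>\<infinity>k\<in>zlat. (indicator zcube t * ch (m \<bullet> t)) * F (t + k))"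
        by (intro infsum_cong) (simp add: shift)
      also have "\<dots> = (indicator zcube t * ch (m \<bullet> t)) * G t"
        unfolding G_def by (intro infsum_cmult_right sumF)
      finally show ?thesis by (simp add: mult_ac)
    qed
    have "((\<lambda>k. \<integral>t. indicator zcube t * E (t + k) \<partial>lborel) has_sum
            (\<integral>t. indicator zcube t * (G t * ch (m \<bullet> t)) \<partial>lborel)) zlat"
      using has_sum_integral_infsum[OF countable_zlat tile(3) tile(2)] by (simp only: sumE)
    with tile(1) have 1: "(\<integral>t. indicator zcube t * (G t * ch (m \<bullet> t)) \<partial>lborel) = Fh (- m)"
      using has_sum_unique by (fastforce simp: Fh_def E_def)
    have 2: "(\<integral>t. indicator zcube t * (H t * ch (m \<bullet> t)) \<partial>lborel) = Fh (- m)"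
      unfolding H_def by (rule trig_series_coefficient[OF smh m])
    have "(\<integral>t. indicator zcube t * ((G t - H t) * ch (m \<bullet> t)) \<partial>lborel)
      = (\<integral>t. indicator zcube t * (G t * ch (m \<bullet> t)) - indicator zcube t * (H t * ch (m \<bullet> t)) \<partial>lborel)"
      by (simp add: algebra_simps)
    also have "\<dots> = 0"
      by (subst Bochner_Integration.integral_diff) 
         (auto simp: 1 2 intro!: zcube_integrable continuous_intros G_cont H_cont)
    finally show "(\<integral>t. indicator zcube t * ((G t - H t) * ch (m \<bullet> t)) \<partial>lborel) = 0" .
  qed
  thus ?thesis by (simp add: G_def H_def Fh_def)
qed

section \<open>Gaussian integrals with complex parameters\<close>

lemma power_le_fact_exp:
  fixes x :: real assumes "x \<ge> 0" shows "x ^ n \<le> fact n * exp x"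
proof -
  have "(\<Sum>k\<in>{n}. x ^ k /\<^sub>R fact k) \<le> (\<Sum>k. x ^ k /\<^sub>R fact k)"
    using assms by (intro sum_le_suminf summable_exp_generic) auto
  hence "x ^ n / fact n \<le> exp x" by (simp add: exp_def divide_inverse mult.commute)
  thus ?thesis by (simp add: field_simps)
qed

text \<open>Completing the square absorbs both the power and the exponential into an arbitrarily wide
  Gaussian.\<close>

lemma poly_exp_gauss_bound:
  fixes x s \<epsilon> :: real
  assumes "\<epsilon> > 0"
  shows "\<bar>x\<bar> ^ n * exp (s * \<bar>x\<bar>) \<le> fact n * exp ((s + 1)\<^sup>2 / (4 * \<epsilon>)) * exp (\<epsilon> * x\<^sup>2)"
proof -
  have "(s + 1) * \<bar>x\<bar> \<le> (s + 1)\<^sup>2 / (4 * \<epsilon>) + \<epsilon> * x\<^sup>2"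
  proof -
    have "0 \<le> (s + 1 - 2 * \<epsilon> * \<bar>x\<bar>)\<^sup>2 / (4 * \<epsilon>)" using assms by simp
    also have "\<dots> = (s + 1)\<^sup>2 / (4 * \<epsilon>) + \<epsilon> * x\<^sup>2 - (s + 1) * \<bar>x\<bar>"
      using assms by (simp add: power2_eq_square field_simps)
    finally show ?thesis by simp
  qed
  hence le: "exp ((s + 1) * \<bar>x\<bar>) \<le> exp ((s + 1)\<^sup>2 / (4 * \<epsilon>)) * exp (\<epsilon> * x\<^sup>2)"
    by (subst exp_add[symmetric]) simp
  have "\<bar>x\<bar> ^ n * exp (s * \<bar>x\<bar>) \<le> (fact n * exp \<bar>x\<bar>) * exp (s * \<bar>x\<bar>)"
    by (intro mult_right_mono power_le_fact_exp) auto
  also have "\<dots> = fact n * exp ((s + 1) * \<bar>x\<bar>)"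
    by (simp add: ring_distribs exp_add mult_ac)
  also have "\<dots> \<le> fact n * (exp ((s + 1)\<^sup>2 / (4 * \<epsilon>)) * exp (\<epsilon> * x\<^sup>2))"
    using le by (intro mult_left_mono) auto
  finally show ?thesis by (simp add: mult_ac)
qed

text \<open>The integrand of the Fourier transform of a Gaussian of complex inverse width \<open>a\<close> at
  a complex frequency \<open>p\<close>.\<close>

definition gker :: "complex \<Rightarrow> complex \<Rightarrow> real \<Rightarrow> complex" where
  "gker a p x = exp (- of_real pi * a * of_real (x\<^sup>2) - 2 * of_real pi * \<i> * p * of_real x)"

definition gmom :: "nat \<Rightarrow> complex \<Rightarrow> complex \<Rightarrow> complex" where
  "gmom n a p = (\<integral>x. of_real (x ^ n) * gker a p x \<partial>lborel)"

lemma continuous_on_gker [continuous_intros]: "continuous_on A (gker a p)"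
  unfolding gker_def by (intro continuous_intros)

lemma gker_measurable [measurable]: "gker a p \<in> borel_measurable borel"
  by (intro borel_measurable_continuous_onI continuous_intros)

lemma norm_gker_le: "norm (gker a p x) \<le> exp (2 * pi * norm p * \<bar>x\<bar>) * exp (- pi * Re a * x\<^sup>2)"
proof -
  have "norm (gker a p x) = exp (- pi * Re a * x\<^sup>2 + 2 * pi * Im p * x)"
    by (simp add: gker_def norm_exp_eq_Re)
  also have "Im p * x \<le> \<bar>Im p * x\<bar>" by simp
  hence "Im p * x \<le> norm p * \<bar>x\<bar>"
    using mult_right_mono[OF abs_Im_le_cmod[of p], of "\<bar>x\<bar>"] by (simp add: abs_mult)
  hence "exp (- pi * Re a * x\<^sup>2 + 2 * pi * Im p * x) \<le> exp (- pi * Re a * x\<^sup>2 + 2 * pi * norm p * \<bar>x\<bar>)"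
    by simp
  finally show ?thesis by (simp add: exp_add mult.commute flip: exp_add)
qed

lemma poly_gker_bound:
  assumes "Re a > 0"
  obtains C where "C > 0" "\<And>x. norm (of_real (x ^ n) * gker a p x) \<le> C * exp (- (pi * Re a / 2) * (norm x)\<^sup>2)"
proof -
  define \<epsilon> where "\<epsilon> = pi * Re a / 2"
  have e: "\<epsilon> > 0" using assms by (simp add: \<epsilon>_def)
  define C where "C = fact n * exp ((2 * pi * norm p + 1)\<^sup>2 / (4 * \<epsilon>))"
  show ?thesis
  proof (rule that[of C])
    fix x :: real
    have "norm (of_real (x ^ n) * gker a p x) \<le> \<bar>x\<bar> ^ n * (exp (2 * pi * norm p * \<bar>x\<bar>) * exp (- pi * Re a * x\<^sup>2))"
      using norm_gker_le[of a p x] by (simp add: norm_mult norm_power mult_left_mono)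
    also have "\<dots> = (\<bar>x\<bar> ^ n * exp (2 * pi * norm p * \<bar>x\<bar>)) * exp (- pi * Re a * x\<^sup>2)"
      by simp
    also have "\<dots> \<le> (C * exp (\<epsilon> * x\<^sup>2)) * exp (- pi * Re a * x\<^sup>2)"
      unfolding C_def by (intro mult_right_mono poly_exp_gauss_bound e) auto
    also have "\<dots> = C * exp (- \<epsilon> * x\<^sup>2)"
      by (simp add: \<epsilon>_def flip: exp_add)
    finally show "norm (of_real (x ^ n) * gker a p x) \<le> C * exp (- (pi * Re a / 2) * (norm x)\<^sup>2)"
      by (simp add: \<epsilon>_def)
  qed (simp add: C_def)
qed

lemma gmom_integrable:
  assumes "Re a > 0" shows "integrable lborel (\<lambda>x. of_real (x ^ n) * gker a p x)"
proof -
  obtain C where "\<And>x. norm (of_real (x ^ n) * gker a p x) \<le> C * exp (- (pi * Re a / 2) * (norm x)\<^sup>2)"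
    using poly_gker_bound[OF assms] by metis
  thus ?thesis by (rule gauss_integrable[rotated]) (use assms in auto)
qed

lemma integral_derivative_eq_0:
  fixes F f :: "real \<Rightarrow> complex"
  assumes der: "\<And>x. (F has_vector_derivative f x) (at x)" and cont: "\<And>x. isCont f x"
    and int: "integrable lborel f"
    and bd: "\<And>x. norm (F x) \<le> C * exp (- \<epsilon> * (norm x)\<^sup>2)" and eps: "\<epsilon> > 0"
  shows "(\<integral>x. f x \<partial>lborel) = 0"
proof -
  have lim: "(F \<longlongrightarrow> 0) at_top" "(F \<longlongrightarrow> 0) at_bot"
  proof -
    have sq: "filterlim (\<lambda>x::real. \<epsilon> * x\<^sup>2) at_top at_top" "filterlim (\<lambda>x::real. \<epsilon> * x\<^sup>2) at_top at_bot"
      using eps by real_asymp+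
    have "((\<lambda>x. C * exp (- (\<epsilon> * x\<^sup>2))) \<longlongrightarrow> C * 0) at_top" "((\<lambda>x. C * exp (- (\<epsilon> * x\<^sup>2))) \<longlongrightarrow> C * 0) at_bot"
      by (intro tendsto_mult tendsto_const filterlim_compose[OF exp_at_bot] filterlim_compose[OF filterlim_uminus_at_bot_at_top] sq)+
    thus "(F \<longlongrightarrow> 0) at_top" "(F \<longlongrightarrow> 0) at_bot"
      using bd by (auto intro!: Lim_null_comparison[of F "\<lambda>x. C * exp (- (\<epsilon> * x\<^sup>2))"] always_eventually)
  qed
  have "(LBINT x=-\<infinity>..\<infinity>. f x) = 0 - 0"
    by (rule interval_integral_FTC_integrable[where F = F])
       (use der cont int lim in \<open>auto simp: ereal_tendsto_simps set_integrable_def einterval_def\<close>)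
  thus ?thesis
    by (simp add: interval_lebesgue_integral_def set_lebesgue_integral_def)
qed

lemma gker_deriv:
  "(gker a p has_vector_derivative (- 2 * of_real pi * a * of_real x - 2 * of_real pi * \<i> * p) * gker a p x) (at x)"
proof -
  have "((\<lambda>z. exp (- of_real pi * a * z\<^sup>2 - 2 * of_real pi * \<i> * p * z)) has_field_derivative
     (- 2 * of_real pi * a * of_real x - 2 * of_real pi * \<i> * p) * gker a p x) (at (of_real x))"
    by (auto intro!: derivative_eq_intros simp: gker_def)
  from has_vector_derivative_real_field[OF this]
  show ?thesis by (simp add: gker_def[abs_def])
qed

text \<open>The integrals of the derivatives of \<open>gker\<close> and of \<open>x gker\<close> vanish; the
  two relations express the first and second moments by the zeroth.\<close>

lemma gmom_recurrences:
  fixes a p :: complex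
  assumes a: "Re a > 0"
  shows "gmom 1 a p = - (\<i> * p / a) * gmom 0 a p"
    and "gmom 2 a p = (1 / (2 * of_real pi * a) - p\<^sup>2 / a\<^sup>2) * gmom 0 a p"
proof -
  have a0: "a \<noteq> 0" using a by auto
  have I: "integrable lborel (\<lambda>x. of_real (x ^ n) * gker a p x)" for n
    by (rule gmom_integrable[OF a])
  note I0 = I[of 0, simplified] note I1 = I[of 1, simplified]
  have "(\<integral>x. (- 2 * of_real pi * a * of_real x - 2 * of_real pi * \<i> * p) * gker a p x \<partial>lborel) = 0"
  proof -
    obtain C where C: "\<And>x. norm (of_real (x ^ 0) * gker a p x) \<le> C * exp (- (pi * Re a / 2) * (norm x)\<^sup>2)"
      using poly_gker_bound[OF a] by metis
    show ?thesis
    proof (rule integral_derivative_eq_0[OF gker_deriv])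
      show "integrable lborel (\<lambda>x. (- 2 * of_real pi * a * of_real x - 2 * of_real pi * \<i> * p) * gker a p x)"
        using Bochner_Integration.integrable_diff[OF integrable_mult_right[OF I1, of "- 2 * of_real pi * a"] integrable_mult_right[OF I0, of "2 * of_real pi * \<i> * p"]]
        by (simp add: algebra_simps)
      show "isCont (\<lambda>x. (- 2 * of_real pi * a * of_real x - 2 * of_real pi * \<i> * p) * gker a p x) x" for x
        unfolding gker_def by (intro continuous_intros)
      show "norm (gker a p x) \<le> C * exp (- (pi * Re a / 2) * (norm x)\<^sup>2)" for x
        using C[of x] by simp
    qed (use a in auto)
  qed
  also have "(\<lambda>x. (- 2 * of_real pi * a * of_real x - 2 * of_real pi * \<i> * p) * gker a p x)
     = (\<lambda>x. (- 2 * of_real pi * a) * (of_real x * gker a p x) - (2 * of_real pi * \<i> * p) * gker a p x)"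
    by (simp add: algebra_simps)
  also have "(\<integral>x. (- 2 * of_real pi * a) * (of_real x * gker a p x) - (2 * of_real pi * \<i> * p) * gker a p x \<partial>lborel)
     = (- 2 * of_real pi * a) * gmom 1 a p - (2 * of_real pi * \<i> * p) * gmom 0 a p"
    using I0 I1 by (simp add: gmom_def)
  finally have 0: "(- 2 * of_real pi * a) * gmom 1 a p - (2 * of_real pi * \<i> * p) * gmom 0 a p = 0" .
  have "(2 * of_real pi) * (a * gmom 1 a p + \<i> * p * gmom 0 a p)
      = - ((- 2 * of_real pi * a) * gmom 1 a p - (2 * of_real pi * \<i> * p) * gmom 0 a p)"
    by (simp add: algebra_simps)
  hence "(2 * of_real pi) * (a * gmom 1 a p + \<i> * p * gmom 0 a p) = 0"
    unfolding 0 by simp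
  hence "a * gmom 1 a p + \<i> * p * gmom 0 a p = 0"
    by (simp only: mult_eq_0_iff) simp
  hence "a * gmom 1 a p = - (\<i> * p) * gmom 0 a p"
    unfolding add_eq_0_iff2 by simp
  thus 1: "gmom 1 a p = - (\<i> * p / a) * gmom 0 a p"
    using a0 by (simp add: field_simps)
  let ?f = "\<lambda>x. gker a p x + of_real x * ((- 2 * of_real pi * a * of_real x - 2 * of_real pi * \<i> * p) * gker a p x)"
  have eqf: "?f = (\<lambda>x. gker a p x - (2 * of_real pi * a) * (of_real (x ^ 2) * gker a p x) - (2 * of_real pi * \<i> * p) * (of_real x * gker a p x))"
    by (simp add: algebra_simps power2_eq_square)
  have "(\<integral>x. ?f x \<partial>lborel) = 0"
  proof -
    obtain C where C: "\<And>x. norm (of_real (x ^ 1) * gker a p x) \<le> C * exp (- (pi * Re a / 2) * (norm x)\<^sup>2)"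
      using poly_gker_bound[OF a] by metis
    show ?thesis
    proof (rule integral_derivative_eq_0)
      show "((\<lambda>x. of_real x * gker a p x) has_vector_derivative ?f x) (at x)" for x
        using has_vector_derivative_mult[OF has_vector_derivative_of_real[OF DERIV_ident] gker_deriv[of a p x]]
        by (simp add: add.commute)
      show "integrable lborel ?f"
        unfolding eqf by (intro Bochner_Integration.integrable_diff integrable_mult_right I0 I1 I)
      show "isCont ?f x" for x
        unfolding gker_def by (intro continuous_intros)
      show "norm (of_real x * gker a p x) \<le> C * exp (- (pi * Re a / 2) * (norm x)\<^sup>2)" for x
        using C[of x] by simp
    qed (use a in auto)
  qed
  also have "(\<integral>x. ?f x \<partial>lborel) = gmom 0 a p - (2 * of_real pi * a) * gmom 2 a p - (2 * of_real pi * \<i> * p) * gmom 1 a p"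
    unfolding eqf using I0 I1 I[of 2] by (simp add: gmom_def Bochner_Integration.integrable_diff del: of_real_power)
  finally have "(2 * of_real pi * a) * gmom 2 a p = gmom 0 a p - (2 * of_real pi * \<i> * p) * gmom 1 a p"
    by (simp add: algebra_simps)
  also have "\<dots> = (1 - 2 * of_real pi * p\<^sup>2 / a) * gmom 0 a p"
    unfolding 1 by (simp add: algebra_simps power2_eq_square)
  finally have "gmom 2 a p = (1 - 2 * of_real pi * p\<^sup>2 / a) * gmom 0 a p / (2 * of_real pi * a)"
    using a0 by (simp add: field_simps)
  also have "\<dots> = (1 / (2 * of_real pi * a) - p\<^sup>2 / a\<^sup>2) * gmom 0 a p"
    using a0 by (simp add: field_simps power2_eq_square)
  finally show "gmom 2 a p = (1 / (2 * of_real pi * a) - p\<^sup>2 / a\<^sup>2) * gmom 0 a p" .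
qed

text \<open>Differentiation under the integral sign for an exponential family, with the second order remainder
  of the exponential bounded by \<open>1 + (norm u)\<^sup>2\<close> times \<open>exp (r norm
  u)\<close>.\<close>

lemma has_field_derivative_exp_integral:
  fixes u w :: "real \<Rightarrow> complex"
  assumes [measurable]: "u \<in> borel_measurable borel" "w \<in> borel_measurable borel"
    and r: "r > 0"
    and int: "integrable lborel (\<lambda>x. norm (exp (p * u x) * w x) * (1 + (norm (u x))\<^sup>2) * exp (r * norm (u x)))"
  shows "((\<lambda>p. \<integral>x. exp (p * u x) * w x \<partial>lborel) has_field_derivative
           (\<integral>x. u x * (exp (p * u x) * w x) \<partial>lborel)) (at p)"
proof -
  let ?B = "\<lambda>x. norm (exp (p * u x) * w x) * (1 + (norm (u x))\<^sup>2) * exp (r * norm (u x))"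
  define K where "K = (\<integral>x. ?B x \<partial>lborel)"
  have exp1: "1 \<le> exp (r * norm (u x))" for x using r by simp
  have le1: "norm (u x) \<le> 1 + (norm (u x))\<^sup>2" for x
    using sum_squares_bound[of "norm (u x)" 1] by (simp add: field_simps) (smt (verit) norm_ge_zero)
  have Iu: "integrable lborel (\<lambda>x. u x * (exp (p * u x) * w x))"
  proof (rule Bochner_Integration.integrable_bound[OF int])
    have "norm (u x * (exp (p * u x) * w x)) \<le> ?B x" for x
    proof -
      have "norm (u x) * 1 \<le> (1 + (norm (u x))\<^sup>2) * exp (r * norm (u x))"
        by (intro mult_mono le1 exp1) auto
      from mult_left_mono[OF this, of "norm (exp (p * u x) * w x)"]
      show ?thesis by (simp add: norm_mult mult_ac)
    qed
    thus "AE x in lborel. norm (u x * (exp (p * u x) * w x)) \<le> norm (?B x)"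
      unfolding real_norm_def by (intro always_eventually allI order_trans[OF _ abs_ge_self])
  qed measurable
  have Ih: "integrable lborel (\<lambda>x. exp ((p + h) * u x) * w x)" if "norm h \<le> r" for h
  proof (rule Bochner_Integration.integrable_bound[OF int])
    have "norm (exp ((p + h) * u x) * w x) \<le> ?B x" for x
    proof -
      have "norm (exp (h * u x)) \<le> exp (norm (h * u x))" by (rule norm_exp)
      also have "\<dots> \<le> exp (r * norm (u x))" using that by (simp add: norm_mult mult_right_mono)
      finally have "norm (exp (h * u x)) \<le> (1 + (norm (u x))\<^sup>2) * exp (r * norm (u x))"
        by (smt (verit, best) exp_gt_zero mult_le_cancel_right1 zero_le_power2)
      from mult_left_mono[OF this, of "norm (exp (p * u x) * w x)"]
      have *: "norm (exp (p * u x) * w x) * norm (exp (h * u x)) \<le> norm (exp (p * u x) * w x) * ((1 + (norm (u x))\<^sup>2) * exp (r * norm (u x)))"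
        by simp
      have "norm (exp ((p + h) * u x) * w x) = norm (exp (p * u x) * w x) * norm (exp (h * u x))"
        by (simp add: norm_mult distrib_right exp_add del: norm_exp_eq_Re)
      with * show ?thesis by (simp only: mult.assoc)
    qed
    thus "AE x in lborel. norm (exp ((p + h) * u x) * w x) \<le> norm (?B x)"
      unfolding real_norm_def by (intro always_eventually allI order_trans[OF _ abs_ge_self])
  qed measurable
  let ?I = "\<lambda>p. \<integral>x. exp (p * u x) * w x \<partial>lborel"
  let ?D = "\<integral>x. u x * (exp (p * u x) * w x) \<partial>lborel"
  have est: "norm (?I (p + h) - ?I p - h * ?D) \<le> (norm h)\<^sup>2 * K" if h: "norm h \<le> r" for h
  proof -
    have eq: "?I (p + h) - ?I p - h * ?D = (\<integral>x. exp ((p + h) * u x) * w x - exp (p * u x) * w x - h * (u x * (exp (p * u x) * w x)) \<partial>lborel)"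
      using Ih[OF h] Ih[of 0] Iu r by simp
    have "norm (\<integral>x. exp ((p + h) * u x) * w x - exp (p * u x) * w x - h * (u x * (exp (p * u x) * w x)) \<partial>lborel)
      \<le> (\<integral>x. (norm h)\<^sup>2 * ?B x \<partial>lborel)"
    proof (rule Bochner_Integration.integral_norm_bound_integral)
      show "integrable lborel (\<lambda>x. exp ((p + h) * u x) * w x - exp (p * u x) * w x - h * (u x * (exp (p * u x) * w x)))"
        using Ih[OF h] Ih[of 0] Iu r by (intro Bochner_Integration.integrable_diff integrable_mult_right) auto
      show "integrable lborel (\<lambda>x. (norm h)\<^sup>2 * ?B x)" using int by (rule integrable_mult_right)
      fix x
      have "exp ((p + h) * u x) * w x - exp (p * u x) * w x - h * (u x * (exp (p * u x) * w x))
          = (exp (p * u x) * w x) * (exp (h * u x) - (\<Sum>k\<le>1. (h * u x) ^ k / fact k))"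
        by (simp add: distrib_right exp_add algebra_simps)
      also have "norm \<dots> \<le> norm (exp (p * u x) * w x) * (exp (norm (h * u x)) * norm (h * u x) ^ Suc 1 / fact 1)"
        by (subst norm_mult) (rule mult_left_mono[OF Taylor_exp_field norm_ge_zero])
      also have "\<dots> \<le> norm (exp (p * u x) * w x) * (exp (r * norm (u x)) * ((norm h)\<^sup>2 * (1 + (norm (u x))\<^sup>2)))"
      proof (intro mult_left_mono)
        have "norm (h * u x) \<le> r * norm (u x)" using h by (simp add: norm_mult mult_right_mono)
        hence "exp (norm (h * u x)) \<le> exp (r * norm (u x))" by simp
        moreover have "norm (h * u x) ^ Suc 1 / fact 1 \<le> (norm h)\<^sup>2 * (1 + (norm (u x))\<^sup>2)"
          by (simp add: norm_mult power_mult_distrib power2_eq_square[symmetric] distrib_left)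
        ultimately have "exp (norm (h * u x)) * (norm (h * u x) ^ Suc 1 / fact 1) \<le> exp (r * norm (u x)) * ((norm h)\<^sup>2 * (1 + (norm (u x))\<^sup>2))"
          by (intro mult_mono) auto
        thus "exp (norm (h * u x)) * norm (h * u x) ^ Suc 1 / fact 1 \<le> exp (r * norm (u x)) * ((norm h)\<^sup>2 * (1 + (norm (u x))\<^sup>2))"
          by simp
      qed auto
      also have "\<dots> = (norm h)\<^sup>2 * ?B x" by (simp add: mult_ac)
      finally show "norm (exp ((p + h) * u x) * w x - exp (p * u x) * w x - h * (u x * (exp (p * u x) * w x))) \<le> (norm h)\<^sup>2 * ?B x" .
    qed
    thus ?thesis unfolding eq K_def by (simp only: integral_mult_right_zero)
  qed
  show ?thesis unfolding DERIV_def
  proof (rule Lim_transform_bound[of _ "\<lambda>h. norm h * K", THEN LIM_zero_cancel] , goal_cases)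
    case 1
    have "eventually (\<lambda>h. h \<noteq> 0 \<and> norm h \<le> r) (at (0::complex))"
      using r by (auto simp: eventually_at intro!: exI[of _ r])
    thus ?case
    proof eventually_elim
      case (elim h)
      have "(?I (p + h) - ?I p) / h - ?D = (?I (p + h) - ?I p - h * ?D) / h"
        using elim by (simp add: field_simps)
      also have "norm \<dots> \<le> (norm h)\<^sup>2 * K / norm h"
        unfolding norm_divide using est[of h] elim by (intro divide_right_mono) auto
      also have "\<dots> = norm h * K" using elim by (simp add: power2_eq_square)
      finally show ?case by (smt (verit, best) real_norm_def)
    qed
  next
    case 2
    have "((\<lambda>h::complex. norm h * K) \<longlongrightarrow> norm (0::complex) * K) (at 0)"
      by (intro tendsto_intros)
    thus ?case by simp
  qed
qed

lemma gker_weighted_integrable: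
  assumes a: "Re a > 0" and c: "c \<ge> 0"
  shows "integrable lborel (\<lambda>x. norm (gker a p x) * (1 + c * \<bar>x\<bar> ^ n) * exp (s * \<bar>x\<bar>))"
proof -
  define \<epsilon> where "\<epsilon> = pi * Re a / 2"
  have e: "\<epsilon> > 0" using a by (simp add: \<epsilon>_def)
  define s' where "s' = 2 * pi * norm p + s"
  define C where "C m = fact m * exp ((s' + 1)\<^sup>2 / (4 * \<epsilon>))" for m :: nat
  have b: "\<bar>x\<bar> ^ m * exp (s' * \<bar>x\<bar>) \<le> C m * exp (\<epsilon> * x\<^sup>2)" for m x
    unfolding C_def by (rule poly_exp_gauss_bound[OF e])
  define F where "F x = complex_of_real (norm (gker a p x) * (1 + c * \<bar>x\<bar> ^ n) * exp (s * \<bar>x\<bar>))" for x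
  have F_meas: "F \<in> borel_measurable borel" unfolding F_def by measurable
  have nF: "norm (F x) = norm (gker a p x) * (1 + c * \<bar>x\<bar> ^ n) * exp (s * \<bar>x\<bar>)" for x
    using c unfolding F_def by (subst norm_of_real) (simp add: abs_mult)
  have "norm (F x) \<le> (C 0 + c * C n) * exp (- \<epsilon> * (norm x)\<^sup>2)" for x
  proof -
    have "norm (F x) \<le> (exp (2 * pi * norm p * \<bar>x\<bar>) * exp (- pi * Re a * x\<^sup>2)) * (1 + c * \<bar>x\<bar> ^ n) * exp (s * \<bar>x\<bar>)"
      unfolding nF using c by (intro mult_right_mono norm_gker_le) auto
    also have "\<dots> = exp (- pi * Re a * x\<^sup>2) * (\<bar>x\<bar> ^ 0 * exp (s' * \<bar>x\<bar>) + c * (\<bar>x\<bar> ^ n * exp (s' * \<bar>x\<bar>)))"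
      by (simp add: s'_def distrib_right exp_add algebra_simps)
    also have "\<dots> \<le> exp (- pi * Re a * x\<^sup>2) * (C 0 * exp (\<epsilon> * x\<^sup>2) + c * (C n * exp (\<epsilon> * x\<^sup>2)))"
      using c by (intro mult_left_mono add_mono b) auto
    also have "\<dots> = (C 0 + c * C n) * (exp (- pi * Re a * x\<^sup>2) * exp (\<epsilon> * x\<^sup>2))"
      by (simp add: algebra_simps)
    also have "\<dots> = (C 0 + c * C n) * exp (- \<epsilon> * (norm x)\<^sup>2)"
      by (simp add: \<epsilon>_def flip: exp_add)
    finally show ?thesis .
  qed
  hence "integrable lborel F" using F_meas e by (intro gauss_integrable)
  hence "integrable lborel (\<lambda>x. norm (F x))" by (rule integrable_norm)
  thus ?thesis by (simp only: nF)
qed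

text \<open>By the first recurrence the moment satisfies \<open>d/dp M = - (2 \<pi> p / a) M\<close>, whose
  solutions are multiples of \<open>exp (- \<pi> p\<^sup>2 / a)\<close>.\<close>

lemma gmom_0_char:
  assumes a: "Re a > 0"
  shows "gmom 0 a p = gmom 0 a 0 * exp (- of_real pi * p\<^sup>2 / a)"
proof -
  have a0: "a \<noteq> 0" using a by auto
  let ?u = "\<lambda>x::real. - 2 * of_real pi * \<i> * of_real x"
  let ?w = "\<lambda>x::real. exp (- of_real pi * a * of_real (x\<^sup>2))"
  have gk: "exp (p * ?u x) * ?w x = gker a p x" for p x
    by (simp add: gker_def mult_ac flip: exp_add)
  have der: "((\<lambda>p. gmom 0 a p) has_field_derivative - (2 * of_real pi * p / a) * gmom 0 a p) (at p)" for p
  proof -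
    have nu: "norm (?u x) = 2 * pi * \<bar>x\<bar>" for x by (simp add: norm_mult)
    have "((\<lambda>p. \<integral>x. exp (p * ?u x) * ?w x \<partial>lborel) has_field_derivative
           (\<integral>x. ?u x * (exp (p * ?u x) * ?w x) \<partial>lborel)) (at p)"
    proof (rule has_field_derivative_exp_integral[where r = 1])
      have "integrable lborel (\<lambda>x. norm (gker a p x) * (1 + (2*pi)\<^sup>2 * \<bar>x\<bar> ^ 2) * exp ((2 * pi) * \<bar>x\<bar>))"
        by (intro gker_weighted_integrable a) auto
      thus "integrable lborel (\<lambda>x. norm (exp (p * ?u x) * ?w x) * (1 + (norm (?u x))\<^sup>2) * exp (1 * norm (?u x)))"
        unfolding gk nu by (simp add: power_mult_distrib)
    qed auto
    also have "(\<lambda>p. \<integral>x. exp (p * ?u x) * ?w x \<partial>lborel) = (\<lambda>p. gmom 0 a p)"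
      unfolding gk by (simp add: gmom_def)
    also have "(\<integral>x. ?u x * (exp (p * ?u x) * ?w x) \<partial>lborel) = (- 2 * of_real pi * \<i>) * gmom 1 a p"
      unfolding gk gmom_def by (subst integral_mult_right_zero[symmetric]) (simp add: mult_ac)
    also have "\<dots> = - (2 * of_real pi * p / a) * gmom 0 a p"
      unfolding gmom_recurrences(1)[OF a] by (simp add: field_simps)
    finally show ?thesis .
  qed
  define h where "h p = gmom 0 a p * exp (of_real pi * p\<^sup>2 / a)" for p
  have "(h has_field_derivative 0) (at p within UNIV)" for p
    unfolding h_def using a0
    by (auto intro!: derivative_eq_intros der simp: field_simps power2_eq_square)
  then obtain c where c: "\<And>p. h p = c"
    using has_field_derivative_zero_constant[OF convex_UNIV, of h] by blast
  have "h p = h 0" by (simp add: c)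
  hence "gmom 0 a p * exp (of_real pi * p\<^sup>2 / a) = gmom 0 a 0" by (simp add: h_def)
  hence "gmom 0 a 0 * exp (- of_real pi * p\<^sup>2 / a) = gmom 0 a p * (exp (of_real pi * p\<^sup>2 / a) * exp (- (of_real pi * p\<^sup>2 / a)))"
    by simp
  thus ?thesis by (simp flip: exp_add)
qed

lemma zlat_real: "(zlat :: real set) = \<int>"
  by (simp add: zlat_def)

text \<open>Poisson summation for \<open>exp (- \<pi> x\<^sup>2)\<close>, which is its own Fourier transform
  up to this constant, shows that the theta constant equals the constant times itself.\<close>

lemma gmom_0_1: "gmom 0 1 0 = 1"
proof -
  let ?F = "\<lambda>x::real. gker 1 0 x"
  have F: "?F x = of_real (exp (- pi * x\<^sup>2))" for x
    by (simp add: gker_def flip: exp_of_real)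
  have ft: "(\<integral>x. ?F x * ch (- (m \<bullet> x)) \<partial>lborel) = gmom 0 1 0 * ?F m" for m :: real
  proof -
    have "?F x * ch (- (m \<bullet> x)) = gker 1 (of_real m) x" for x
      by (simp add: gker_def ch_exp mult_ac flip: exp_add)
    hence "(\<integral>x. ?F x * ch (- (m \<bullet> x)) \<partial>lborel) = gmom 0 1 (of_real m)"
      by (simp add: gmom_def)
    also have "\<dots> = gmom 0 1 0 * exp (- of_real pi * (of_real m)\<^sup>2 / 1)"
      by (rule gmom_0_char) simp
    finally show ?thesis by (simp add: gker_def)
  qed
  have nF: "norm (?F x) \<le> 1 * exp (- pi * (norm x)\<^sup>2)" for x
    by (simp add: F del: of_real_exp)
  obtain W where W: "W \<ge> 0" "\<And>t k. norm t \<le> (1::real) \<Longrightarrow> norm (?F (t + k)) \<le> W * zwt k"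
    using gauss_shift_zwt[OF nF pi_gt_zero, where R = 1] by blast
  have smF: "(\<lambda>k. norm (?F k)) summable_on zlat"
    by (rule summable_on_comparison_test[of "\<lambda>k. W * zwt k"])
       (use W(2)[of 0] in \<open>auto intro!: summable_on_cmult_right zwt_summable\<close>)
  have "(\<Sum>\<^sub>\<infinity>k\<in>zlat. ?F k) = (\<Sum>\<^sub>\<infinity>m\<in>zlat. \<integral>x. ?F x * ch (- (m \<bullet> x)) \<partial>lborel)"
  proof (rule poisson_summation_standard[OF _ nF pi_gt_zero])
    show "(\<lambda>m. norm (\<integral>x. ?F x * ch (- (m \<bullet> x)) \<partial>lborel)) summable_on zlat"
      unfolding ft norm_mult by (intro summable_on_cmult_right smF)
  qed (intro continuous_intros)
  also have "\<dots> = gmom 0 1 0 * (\<Sum>\<^sub>\<infinity>k\<in>zlat. ?F k)"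
    unfolding ft by (rule infsum_cmult_right, rule abs_summable_summable, rule smF)
  finally have eq: "(\<Sum>\<^sub>\<infinity>k\<in>zlat. ?F k) = gmom 0 1 0 * (\<Sum>\<^sub>\<infinity>k\<in>zlat. ?F k)" .
  have smr: "(\<lambda>k. exp (- pi * k\<^sup>2)) summable_on (zlat :: real set)"
    using smF by (simp add: F del: of_real_exp)
  have "(\<Sum>\<^sub>\<infinity>k\<in>zlat. ?F k) = of_real (\<Sum>\<^sub>\<infinity>k\<in>zlat. exp (- pi * k\<^sup>2))"
    unfolding F using has_sum_of_real[OF has_sum_infsum[OF smr]] by (rule infsumI)
  moreover have "(\<Sum>\<^sub>\<infinity>k\<in>{0::real}. exp (- pi * k\<^sup>2)) \<le> (\<Sum>\<^sub>\<infinity>k\<in>zlat. exp (- pi * k\<^sup>2))"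
    by (rule infsum_mono_neutral[OF _ smr]) (auto simp: zlat_def)
  hence "(\<Sum>\<^sub>\<infinity>k\<in>zlat. exp (- pi * k\<^sup>2)) \<noteq> 0" by simp
  ultimately have "(\<Sum>\<^sub>\<infinity>k\<in>zlat. ?F k) \<noteq> 0" by auto
  with eq show ?thesis by simp
qed

text \<open>By the second recurrence \<open>a M(a)\<^sup>2\<close> has derivative \<open>0\<close> on the
  right half-plane, and its value at \<open>1\<close> is known. Only squares of the moment occur
  below, except at real \<open>a\<close>, so no branch of the square root has to be chosen.\<close>

lemma gmom_0_squared:
  assumes a: "Re a > 0"
  shows "(gmom 0 a 0)\<^sup>2 = 1 / a"
proof -
  let ?u = "\<lambda>x::real. complex_of_real (- pi * x\<^sup>2)"
  have gk: "exp (a * ?u x) * 1 = gker a 0 x" for a x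
    by (simp add: gker_def mult_ac)
  have der: "((\<lambda>a. gmom 0 a 0) has_field_derivative - gmom 0 a 0 / (2 * a)) (at a)" if a: "Re a > 0" for a
  proof -
    define r where "r = Re a / 2"
    have r: "r > 0" using a by (simp add: r_def)
    have nu: "norm (?u x) = pi * x\<^sup>2" for x by (simp only: norm_of_real) (simp add: abs_mult)
    have "((\<lambda>p. \<integral>x. exp (p * ?u x) * 1 \<partial>lborel) has_field_derivative
           (\<integral>x. ?u x * (exp (a * ?u x) * 1) \<partial>lborel)) (at a)"
    proof (rule has_field_derivative_exp_integral[where r = r])
      have "integrable lborel (\<lambda>x. norm (gker (of_real r) 0 x) * (1 + pi\<^sup>2 * \<bar>x\<bar> ^ 4) * exp (0 * \<bar>x\<bar>))"
        using r by (intro gker_weighted_integrable) auto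
      also have "(\<lambda>x. norm (gker (of_real r) 0 x) * (1 + pi\<^sup>2 * \<bar>x\<bar> ^ 4) * exp (0 * \<bar>x\<bar>))
        = (\<lambda>x. norm (gker a 0 x) * (1 + (pi * x\<^sup>2)\<^sup>2) * exp (r * (pi * x\<^sup>2)))"
      proof
        fix x
        have "norm (gker (of_real r) 0 x) = norm (gker a 0 x) * exp (r * (pi * x\<^sup>2))"
          by (simp add: gker_def norm_exp_eq_Re r_def flip: exp_add)
        thus "norm (gker (of_real r) 0 x) * (1 + pi\<^sup>2 * \<bar>x\<bar> ^ 4) * exp (0 * \<bar>x\<bar>)
          = norm (gker a 0 x) * (1 + (pi * x\<^sup>2)\<^sup>2) * exp (r * (pi * x\<^sup>2))"
          by (simp add: power_mult_distrib)
      qed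
      finally show "integrable lborel (\<lambda>x. norm (exp (a * ?u x) * 1) * (1 + (norm (?u x))\<^sup>2) * exp (r * norm (?u x)))"
        unfolding gk nu .
    qed (use r in auto)
    also have "(\<lambda>p. \<integral>x. exp (p * ?u x) * 1 \<partial>lborel) = (\<lambda>a. gmom 0 a 0)"
      unfolding gk by (simp add: gmom_def)
    also have "(\<integral>x. ?u x * (exp (a * ?u x) * 1) \<partial>lborel) = (- of_real pi) * gmom 2 a 0"
      unfolding gk gmom_def by (subst integral_mult_right_zero[symmetric]) (simp add: mult_ac)
    also have "\<dots> = - gmom 0 a 0 / (2 * a)"
      unfolding gmom_recurrences(2)[OF a] by (simp add: field_simps)
    finally show ?thesis .
  qed
  define h where "h a = (gmom 0 a 0)\<^sup>2 * a" for a
  have cv: "convex {a. Re a > 0}" by (rule convex_halfspace_Re_gt)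
  have "(h has_field_derivative 0) (at a within {a. Re a > 0})" if "a \<in> {a. Re a > 0}" for a
  proof -
    have "a \<noteq> 0" using that by auto
    thus ?thesis unfolding h_def using that
      by (auto intro!: derivative_eq_intros has_field_derivative_at_within[OF der] simp: field_simps power2_eq_square)
  qed
  then obtain c where c: "\<And>a. Re a > 0 \<Longrightarrow> h a = c"
    using has_field_derivative_zero_constant[OF cv, of h] by blast
  have "h a = h 1" using c[OF a] c[of 1] by simp
  hence "(gmom 0 a 0)\<^sup>2 * a = 1" by (simp add: h_def gmom_0_1)
  moreover have "a \<noteq> 0" using a by auto
  ultimately show ?thesis by (simp add: field_simps)
qed

section \<open>Gaussians times Hermite polynomials\<close>

text \<open>For \<open>d \<le> 2\<close> the image of \<open>t\<^sup>d\<close> under \<open>exp (- \<Delta> /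
  8 \<pi> y)\<close>, a rescaled Hermite polynomial.\<close>

definition herm :: "real \<Rightarrow> nat \<Rightarrow> real \<Rightarrow> real" where
  "herm y d t = (if d = 0 then 1 else if d = 1 then t else t\<^sup>2 - 1 / (4 * pi * y))"

definition hg :: "complex \<Rightarrow> nat \<Rightarrow> real \<Rightarrow> complex" where
  "hg \<tau> d x = of_real (herm (Im \<tau>) d x) * exp (of_real pi * \<i> * \<tau> * of_real (x\<^sup>2))"

text \<open>The one-dimensional factor of the inversion formula; it is a square root of \<open>\<i> /
  \<tau>\<close>.\<close>

definition kap :: "complex \<Rightarrow> complex" where
  "kap \<tau> = gmom 0 (- \<i> * \<tau>) 0"

lemma kap_squared: "Im \<tau> > 0 \<Longrightarrow> (kap \<tau>)\<^sup>2 = \<i> / \<tau>"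
  unfolding kap_def by (subst gmom_0_squared) (auto simp: divide_simps)

lemma gker_tau: "gker (- (\<i> * \<tau>)) p x = exp (of_real pi * \<i> * \<tau> * of_real (x\<^sup>2)) * exp (- 2 * of_real pi * \<i> * p * of_real x)"
  by (simp add: gker_def mult_ac flip: exp_add)

lemma continuous_on_hg [continuous_intros]: "continuous_on A f \<Longrightarrow> continuous_on A (\<lambda>x. hg \<tau> d (f x))"
  unfolding hg_def herm_def by (cases "d = 0"; cases "d = 1") (auto intro!: continuous_intros)

lemma hg_measurable [measurable]: "hg \<tau> d \<in> borel_measurable borel"
  by (intro borel_measurable_continuous_onI continuous_intros)

lemma hg_bound:
  assumes "Im \<tau> > 0"
  obtains C where "C > 0" "\<And>x. norm (hg \<tau> d x) \<le> C * exp (- (pi * Im \<tau> / 2) * x\<^sup>2)"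
proof -
  have a: "Re (- \<i> * \<tau>) > 0" using assms by simp
  have "\<exists>C>0. \<forall>x. norm (of_real (x ^ n) * gker (- \<i> * \<tau>) 0 x) \<le> C * exp (- (pi * Im \<tau> / 2) * x\<^sup>2)" for n
  proof -
    obtain C where "C > 0" "\<And>x. norm (of_real (x ^ n) * gker (- \<i> * \<tau>) 0 x) \<le> C * exp (- (pi * Re (- \<i> * \<tau>) / 2) * (norm x)\<^sup>2)"
      using poly_gker_bound[OF a] by blast
    thus ?thesis by (intro exI[of _ C]) simp
  qed
  then obtain C where C: "\<And>n. C n > 0" "\<And>n x. norm (of_real (x ^ n) * gker (- \<i> * \<tau>) 0 x) \<le> C n * exp (- (pi * Im \<tau> / 2) * x\<^sup>2)"
    by metis
  define c where "c = 1 / (4 * pi * Im \<tau>)"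
  have c: "c > 0" using assms by (simp add: c_def)
  let ?g = "\<lambda>n x. of_real (x ^ n) * gker (- \<i> * \<tau>) 0 x"
  have nb: "norm (hg \<tau> d x) \<le> norm (?g 0 x) + norm (?g 1 x) + norm (?g 2 x) + c * norm (?g 0 x)" for x
  proof -
    have "hg \<tau> d x = (if d = 0 then ?g 0 x else if d = 1 then ?g 1 x else ?g 2 x - of_real c * ?g 0 x)"
      by (simp add: hg_def herm_def gker_tau c_def ring_distribs)
    then consider "norm (hg \<tau> d x) = norm (?g 0 x)" | "norm (hg \<tau> d x) = norm (?g 1 x)"
      | "norm (hg \<tau> d x) = norm (?g 2 x - of_real c * ?g 0 x)"
      by metis
    moreover have "norm (?g 2 x - of_real c * ?g 0 x) \<le> norm (?g 2 x) + c * norm (?g 0 x)"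
      by (rule order_trans[OF norm_triangle_ineq4]) (use c in \<open>simp add: norm_mult\<close>)
    moreover have "0 \<le> norm (?g 0 x)" "0 \<le> norm (?g 1 x)" "0 \<le> norm (?g 2 x)" "0 \<le> c * norm (?g 0 x)"
      using c by simp_all
    ultimately show ?thesis by cases linarith+
  qed
  show ?thesis
  proof (rule that[of "C 0 + C 1 + C 2 + c * C 0"])
    show "C 0 + C 1 + C 2 + c * C 0 > 0" using C(1)[of 0] C(1)[of 1] C(1)[of 2] c by (intro add_pos_pos mult_pos_pos)
    fix x
    have "norm (hg \<tau> d x) \<le> norm (?g 0 x) + norm (?g 1 x) + norm (?g 2 x) + c * norm (?g 0 x)" by (rule nb)
    also have "\<dots> \<le> C 0 * exp (- (pi * Im \<tau> / 2) * x\<^sup>2) + C 1 * exp (- (pi * Im \<tau> / 2) * x\<^sup>2) + C 2 * exp (- (pi * Im \<tau> / 2) * x\<^sup>2)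
        + c * (C 0 * exp (- (pi * Im \<tau> / 2) * x\<^sup>2))"
      using c by (intro add_mono mult_left_mono C(2)) auto
    finally show "norm (hg \<tau> d x) \<le> (C 0 + C 1 + C 2 + c * C 0) * exp (- (pi * Im \<tau> / 2) * x\<^sup>2)"
      by (simp add: ring_distribs mult_ac)
  qed
qed

lemma Im_S: "Im (- 1 / \<tau>) = Im \<tau> / (norm \<tau>)\<^sup>2"
  by (simp add: Im_divide cmod_power2)

lemma Im_S_pos: "Im \<tau> > 0 \<Longrightarrow> Im (- 1 / \<tau>) > 0"
  unfolding Im_S by (intro divide_pos_pos) auto

lemma hg_integrable: "Im \<tau> > 0 \<Longrightarrow> integrable lborel (\<lambda>x. hg \<tau> d x * ch (- (\<xi> * x)))"
proof -
  assume "Im \<tau> > 0"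
  then obtain C where C: "C > 0" "\<And>x. norm (hg \<tau> d x) \<le> C * exp (- (pi * Im \<tau> / 2) * x\<^sup>2)"
    using hg_bound by blast
  show ?thesis
    by (rule gauss_integrable[where C = C and \<epsilon> = "pi * Im \<tau> / 2"])
       (use C \<open>Im \<tau> > 0\<close> in \<open>auto simp: norm_mult\<close>)
qed

text \<open>The Hermite corrections are chosen such that the Fourier transform reproduces the same function at
  \<open>- 1 / \<tau>\<close>: the term \<open>1 / (2 \<pi> a)\<close> of the second moment turns
  \<open>1 / (4 \<pi> Im \<tau>)\<close> into \<open>1 / (4 \<pi> Im (- 1 / \<tau>))\<close>.\<close>

lemma hg_fourier:
  assumes \<tau>: "Im \<tau> > 0" and d: "d \<le> 2"
  shows "(\<integral>x. hg \<tau> d x * ch (- (\<xi> * x)) \<partial>lborel) = kap \<tau> * (1 / \<tau>) ^ d * hg (- 1 / \<tau>) d \<xi>"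
proof -
  let ?a = "- \<i> * \<tau>"
  have a: "Re ?a > 0" using \<tau> by simp
  have t0: "\<tau> \<noteq> 0" using \<tau> by auto
  have I: "integrable lborel (\<lambda>x. of_real (x ^ n) * gker ?a (of_real \<xi>) x)" for n
    by (rule gmom_integrable[OF a])
  have chg: "exp (of_real pi * \<i> * \<tau> * of_real (x\<^sup>2)) * ch (- (\<xi> * x)) = gker ?a (of_real \<xi>) x" for x
    by (simp add: gker_tau ch_exp mult_ac)
  have chg': "exp (of_real pi * \<i> * \<tau> * (of_real x)\<^sup>2) * ch (- (\<xi> * x)) = gker (- (\<i> * \<tau>)) (of_real \<xi>) x" for x
    using chg[of x] by simp
  have inv: "x / ?a = \<i> * x / \<tau>" for x
    using t0 by (simp add: divide_simps)
  have inv2: "?a\<^sup>2 = - (\<tau>\<^sup>2)" by (simp add: power_mult_distrib)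
  have M0: "gmom 0 ?a (of_real \<xi>) = kap \<tau> * exp (of_real pi * \<i> * (- 1 / \<tau>) * of_real (\<xi>\<^sup>2))"
    unfolding gmom_0_char[OF a, of "of_real \<xi>"] inv by (simp add: kap_def mult_ac)
  have M1: "gmom 1 ?a (of_real \<xi>) = of_real \<xi> / \<tau> * gmom 0 ?a (of_real \<xi>)"
    unfolding gmom_recurrences(1)[OF a] inv by simp
  have M2: "gmom 2 ?a (of_real \<xi>) = (\<i> / (2 * of_real pi * \<tau>) + (of_real \<xi>)\<^sup>2 / \<tau>\<^sup>2) * gmom 0 ?a (of_real \<xi>)"
    unfolding gmom_recurrences(2)[OF a] inv2 using inv[of "1 / (2 * of_real pi)"] by (simp add: mult.assoc)
  consider "d = 0" | "d = 1" | "d = 2" using d by linarith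
  thus ?thesis
  proof cases
    case 1
    have "(\<integral>x. hg \<tau> d x * ch (- (\<xi> * x)) \<partial>lborel) = gmom 0 ?a (of_real \<xi>)"
      by (simp add: 1 hg_def herm_def chg' gmom_def)
    thus ?thesis by (simp only: M0) (simp add: 1 hg_def herm_def)
  next
    case 2
    have "(\<integral>x. hg \<tau> d x * ch (- (\<xi> * x)) \<partial>lborel) = gmom 1 ?a (of_real \<xi>)"
    proof -
      have "hg \<tau> d x * ch (- (\<xi> * x)) = of_real (x ^ 1) * gker ?a (of_real \<xi>) x" for x
        unfolding chg[symmetric] by (simp add: 2 hg_def herm_def)
      thus ?thesis by (simp only: gmom_def)
    qed
    thus ?thesis by (simp only: M1 M0) (simp add: 2 hg_def herm_def)
  next
    case 3
    let ?y = "Im \<tau>"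
    have eq: "hg \<tau> d x * ch (- (\<xi> * x)) = of_real (x ^ 2) * gker ?a (of_real \<xi>) x - of_real (1 / (4 * pi * ?y)) * (of_real (x ^ 0) * gker ?a (of_real \<xi>) x)" for x
      unfolding chg[symmetric] by (simp add: 3 hg_def herm_def ring_distribs)
    have "(\<integral>x. hg \<tau> d x * ch (- (\<xi> * x)) \<partial>lborel) = gmom 2 ?a (of_real \<xi>) - of_real (1 / (4 * pi * ?y)) * gmom 0 ?a (of_real \<xi>)"
      unfolding eq gmom_def 
      by (subst Bochner_Integration.integral_diff[OF I integrable_mult_right[OF I]]) (simp only: integral_mult_right_zero)
    also have "\<dots> = (\<i> / (2 * of_real pi * \<tau>) + (of_real \<xi>)\<^sup>2 / \<tau>\<^sup>2 - of_real (1 / (4 * pi * ?y))) * gmom 0 ?a (of_real \<xi>)"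
      by (simp only: M2 left_diff_distrib)
    also have "\<i> / (2 * of_real pi * \<tau>) + (of_real \<xi>)\<^sup>2 / \<tau>\<^sup>2 - of_real (1 / (4 * pi * ?y))
      = (1 / \<tau>)\<^sup>2 * of_real (\<xi>\<^sup>2 - 1 / (4 * pi * Im (- 1 / \<tau>)))"
    proof -
      have y: "2 * \<i> * of_real ?y - \<tau> = - cnj \<tau>" by (simp add: complex_eq_iff)
      have "\<tau> * (2 * \<i> * of_real ?y - \<tau>) = - of_real ((norm \<tau>)\<^sup>2)"
        unfolding y complex_norm_square by simp
      hence e: "\<i> * \<tau> * 2 * of_real ?y - \<tau>\<^sup>2 = - of_real ((norm \<tau>)\<^sup>2)"
        by (simp add: algebra_simps power2_eq_square)
      have "\<i> / (2 * of_real pi * \<tau>) - of_real (1 / (4 * pi * ?y))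
         = (1 / \<tau>)\<^sup>2 * ((\<i> * \<tau> * 2 * of_real ?y - \<tau>\<^sup>2) / (4 * of_real pi * of_real ?y))"
        using t0 \<tau> by (simp add: field_simps power2_eq_square)
      also have "\<dots> = (1 / \<tau>)\<^sup>2 * of_real (- 1 / (4 * pi * Im (- 1 / \<tau>)))"
        unfolding e Im_S by simp
      finally have "\<i> / (2 * of_real pi * \<tau>) - of_real (1 / (4 * pi * ?y)) = (1 / \<tau>)\<^sup>2 * of_real (- 1 / (4 * pi * Im (- 1 / \<tau>)))" .
      moreover have "(of_real \<xi>)\<^sup>2 / \<tau>\<^sup>2 = (1 / \<tau>)\<^sup>2 * of_real (\<xi>\<^sup>2)" by (simp add: power_divide)
      ultimately have "\<i> / (2 * of_real pi * \<tau>) - of_real (1 / (4 * pi * ?y)) + (of_real \<xi>)\<^sup>2 / \<tau>\<^sup>2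
         = (1 / \<tau>)\<^sup>2 * (of_real (- 1 / (4 * pi * Im (- 1 / \<tau>))) + of_real (\<xi>\<^sup>2))"
        by (simp only: distrib_left)
      also have "of_real (- 1 / (4 * pi * Im (- 1 / \<tau>))) + complex_of_real (\<xi>\<^sup>2) = of_real (\<xi>\<^sup>2 - 1 / (4 * pi * Im (- 1 / \<tau>)))"
        by (subst of_real_add[symmetric], rule arg_cong[where f = of_real]) simp
      finally show ?thesis by (simp only: add_diff_eq diff_add_eq add.commute)
    qed
    finally show ?thesis unfolding M0 hg_def 3 herm_def by (simp only: mult_ac) simp
  qed
qed

text \<open>The indefinite form is \<open>(x, y) \<mapsto> x \<bullet> refl_pos P y\<close>, where
  \<open>P\<close> are the positive coordinate directions.\<close>

definition refl_pos :: "'e::euclidean_space set \<Rightarrow> 'e \<Rightarrow> 'e" where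
  "refl_pos P x = (\<Sum>b\<in>Basis. (if b \<in> P then x \<bullet> b else - (x \<bullet> b)) *\<^sub>R b)"

lemma refl_pos_component: "b \<in> Basis \<Longrightarrow> refl_pos P x \<bullet> b = (if b \<in> P then x \<bullet> b else - (x \<bullet> b))"
  by (simp add: refl_pos_def)

lemma linear_refl_pos: "linear (refl_pos P)"
  by (rule linearI; rule euclidean_eqI) (auto simp: refl_pos_component inner_add_left)

lemma refl_pos_invol: "refl_pos P (refl_pos P x) = x"
  by (rule euclidean_eqI) (auto simp: refl_pos_component)

lemma refl_pos_adjoint: "x \<bullet> refl_pos P y = refl_pos P x \<bullet> y"
  by (subst (1 2) euclidean_inner) (auto intro!: sum.cong simp: refl_pos_component)

text \<open>The product over all coordinates; conjugation in the negative directions makes it depend on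
  \<open>cnj \<tau>\<close> there, and only the positive directions carry Hermite factors.\<close>

definition hgauss :: "'e::euclidean_space set \<Rightarrow> ('e \<Rightarrow> nat) \<Rightarrow> complex \<Rightarrow> 'e \<Rightarrow> complex" where
  "hgauss P dg \<tau> x = (\<Prod>b\<in>Basis. if b \<in> P then hg \<tau> (dg b) (x \<bullet> b) else cnj (hg \<tau> 0 (x \<bullet> b)))"

lemma continuous_on_hgauss [continuous_intros]:
  assumes "continuous_on A f" shows "continuous_on A (\<lambda>x. hgauss P dg \<tau> (f x))"
proof -
  have "continuous_on A (\<lambda>x. if b \<in> P then hg \<tau> (dg b) (f x \<bullet> b) else cnj (hg \<tau> 0 (f x \<bullet> b)))" for b
    by (cases "b \<in> P") (auto intro!: continuous_intros assms)
  thus ?thesis unfolding hgauss_def by (intro continuous_intros)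
qed

lemma hgauss_bound:
  fixes P :: "'e::euclidean_space set"
  assumes \<tau>: "Im \<tau> > 0"
  obtains C where "C > 0" "\<And>x. norm (hgauss P dg \<tau> x) \<le> C * exp (- (pi * Im \<tau> / 2) * (norm x)\<^sup>2)"
proof -
  have "\<exists>C>0. \<forall>x. norm (hg \<tau> d x) \<le> C * exp (- (pi * Im \<tau> / 2) * x\<^sup>2)" for d
    using hg_bound[OF \<tau>, of d] by metis
  then obtain C where C: "\<And>d. C d > 0" "\<And>d x. norm (hg \<tau> d x) \<le> C d * exp (- (pi * Im \<tau> / 2) * x\<^sup>2)"
    by metis
  define K where "K = (\<Prod>b\<in>(Basis::'e set). C (if b \<in> P then dg b else 0))"
  show ?thesis
  proof (rule that[of K])
    show "K > 0" unfolding K_def by (intro prod_pos C)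
    fix x :: 'e
    have nx: "(norm x)\<^sup>2 = (\<Sum>b\<in>Basis. (x \<bullet> b)\<^sup>2)"
      by (subst power2_norm_eq_inner, subst euclidean_inner) (simp add: power2_eq_square)
    have "norm (hgauss P dg \<tau> x) = (\<Prod>b\<in>Basis. norm (hg \<tau> (if b \<in> P then dg b else 0) (x \<bullet> b)))"
      unfolding hgauss_def by (subst prod_norm[symmetric]) (auto intro!: prod.cong)
    also have "\<dots> \<le> (\<Prod>b\<in>Basis. C (if b \<in> P then dg b else 0) * exp (- (pi * Im \<tau> / 2) * (x \<bullet> b)\<^sup>2))"
      by (intro prod_mono conjI C norm_ge_zero)
    also have "\<dots> = K * exp (- (pi * Im \<tau> / 2) * (norm x)\<^sup>2)"
      by (simp add: K_def prod.distrib nx sum_distrib_left exp_sum sum_negf flip: exp_sum)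
    finally show "norm (hgauss P dg \<tau> x) \<le> K * exp (- (pi * Im \<tau> / 2) * (norm x)\<^sup>2)" .
  qed
qed

text \<open>The reflection in the character is what turns the Fourier transform in a negative coordinate into
  the conjugate of the positive one.\<close>

lemma hgauss_fourier:
  fixes P :: "'e::euclidean_space set"
  assumes \<tau>: "Im \<tau> > 0" and dg: "\<And>b. dg b \<le> 2" and P: "P \<subseteq> Basis"
  shows "(\<integral>x. hgauss P dg \<tau> x * ch (- (x \<bullet> refl_pos P \<xi>)) \<partial>lborel)
    = kap \<tau> ^ card P * cnj (kap \<tau>) ^ (DIM('e) - card P) * (1 / \<tau>) ^ (\<Sum>b\<in>P. dg b) * hgauss P dg (- 1 / \<tau>) \<xi>"
proof -
  let ?f = "\<lambda>b x. if b \<in> P then hg \<tau> (dg b) x * ch (- ((\<xi> \<bullet> b) * x)) else cnj (hg \<tau> 0 x * ch (- ((\<xi> \<bullet> b) * x)))"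
  have finP: "finite P" using finite_subset[OF P finite_Basis] .
  have eq: "hgauss P dg \<tau> x * ch (- (x \<bullet> refl_pos P \<xi>)) = (\<Prod>b\<in>Basis. ?f b (x \<bullet> b))" for x
  proof -
    have "ch (- (x \<bullet> refl_pos P \<xi>)) = (\<Prod>b\<in>Basis. ch (- ((x \<bullet> b) * (refl_pos P \<xi> \<bullet> b))))"
      by (subst euclidean_inner) (simp add: ch_sum flip: sum_negf)
    hence "hgauss P dg \<tau> x * ch (- (x \<bullet> refl_pos P \<xi>)) =
      (\<Prod>b\<in>Basis. (if b \<in> P then hg \<tau> (dg b) (x \<bullet> b) else cnj (hg \<tau> 0 (x \<bullet> b))) * ch (- ((x \<bullet> b) * (refl_pos P \<xi> \<bullet> b))))"
      by (simp add: hgauss_def prod.distrib)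
    also have "\<dots> = (\<Prod>b\<in>Basis. ?f b (x \<bullet> b))"
      by (intro prod.cong refl) (auto simp: refl_pos_component cnj_ch mult.commute)
    finally show ?thesis .
  qed
  have "(\<integral>x. hgauss P dg \<tau> x * ch (- (x \<bullet> refl_pos P \<xi>)) \<partial>lborel) = (\<Prod>b\<in>Basis. \<integral>x. ?f b x \<partial>lborel)"
    unfolding eq
  proof (rule lborel_integral_prod(2))
    fix b :: 'e
    show "integrable lborel (?f b)"
      using hg_integrable[OF \<tau>] by (cases "b \<in> P") (auto simp del: complex_cnj_mult intro!: integrable_cnj)
  qed
  also have "\<dots> = (\<Prod>b\<in>Basis. (if b \<in> P then kap \<tau> * (1 / \<tau>) ^ dg b else cnj (kap \<tau>)) *
      (if b \<in> P then hg (- 1 / \<tau>) (dg b) (\<xi> \<bullet> b) else cnj (hg (- 1 / \<tau>) 0 (\<xi> \<bullet> b))))"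
  proof (intro prod.cong refl)
    fix b :: 'e
    show "(\<integral>x. ?f b x \<partial>lborel) = (if b \<in> P then kap \<tau> * (1 / \<tau>) ^ dg b else cnj (kap \<tau>)) *
      (if b \<in> P then hg (- 1 / \<tau>) (dg b) (\<xi> \<bullet> b) else cnj (hg (- 1 / \<tau>) 0 (\<xi> \<bullet> b)))"
      using hg_fourier[OF \<tau> dg] hg_fourier[OF \<tau>, of 0]
      by (cases "b \<in> P") (simp_all del: complex_cnj_mult add: complex_cnj_mult[symmetric])
  qed
  also have "\<dots> = (\<Prod>b\<in>Basis. if b \<in> P then kap \<tau> * (1 / \<tau>) ^ dg b else cnj (kap \<tau>)) * hgauss P dg (- 1 / \<tau>) \<xi>"
    by (simp only: hgauss_def prod.distrib)
  also have "(\<Prod>b\<in>Basis. if b \<in> P then kap \<tau> * (1 / \<tau>) ^ dg b else cnj (kap \<tau>))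
     = (\<Prod>b\<in>P. kap \<tau> * (1 / \<tau>) ^ dg b) * (\<Prod>b\<in>Basis - P. cnj (kap \<tau>))"
    using P by (subst prod.If_cases) (auto simp: Int_absorb1 Diff_eq)
  also have "\<dots> = kap \<tau> ^ card P * (1 / \<tau>) ^ (\<Sum>b\<in>P. dg b) * cnj (kap \<tau>) ^ (DIM('e) - card P)"
    using P finP by (simp add: prod.distrib power_sum card_Diff_subset del: power_divide)
  finally show ?thesis by (simp only: mult_ac)
qed

text \<open>An injective linear map is bounded below, so the weight of the standard lattice can be
  transported.\<close>

lemma lattice_weight:
  fixes M :: "'e::euclidean_space \<Rightarrow> 'e"
  assumes "linear M" "inj M"
  obtains w :: "'e \<Rightarrow> real" and B where "B > 0" "w summable_on (M ` zlat)" "\<And>x. w x \<ge> 0"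
    "\<And>\<epsilon> x. \<epsilon> > 0 \<Longrightarrow> x \<in> M ` zlat \<Longrightarrow> exp (- \<epsilon> * (norm x)\<^sup>2) \<le> (1 + B / \<epsilon>) ^ DIM('e) * w x"
proof -
  obtain B where B: "B > 0" "\<And>x. B * norm x \<le> norm (M x)"
    using linear_inj_bounded_below_pos[OF assms] by metis
  define w where "w x = zwt (inv M x)" for x
  show ?thesis
  proof (rule that[of "1 / B\<^sup>2" w])
    have "zwt summable_on (zlat :: 'e set)" by (rule zwt_summable)
    also have "zwt = w \<circ> M" using assms(2) by (auto simp: w_def)
    finally show "w summable_on (M ` zlat)"
      using assms(2) by (subst summable_on_reindex) (auto intro: inj_on_subset simp: o_def)
    fix \<epsilon> :: real and x assume e: "\<epsilon> > 0" and "x \<in> M ` zlat"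
    then obtain k where k: "x = M k" by blast
    have "(B * norm k)\<^sup>2 \<le> (norm x)\<^sup>2" unfolding k using B by (intro power_mono) auto
    hence "exp (- \<epsilon> * (norm x)\<^sup>2) \<le> exp (- (\<epsilon> * B\<^sup>2) * (norm k)\<^sup>2)"
      using e by (simp add: power_mult_distrib mult.assoc)
    also have "\<dots> \<le> (1 + 1 / (\<epsilon> * B\<^sup>2)) ^ DIM('e) * zwt k"
      using e B by (intro gauss_le_zwt) auto
    finally show "exp (- \<epsilon> * (norm x)\<^sup>2) \<le> (1 + 1 / B\<^sup>2 / \<epsilon>) ^ DIM('e) * w x"
      using assms(2) by (simp add: w_def k mult.commute)
  qed (use B in \<open>auto simp: w_def\<close>)
qed

text \<open>Self-duality with respect to the form \<open>(x, y) \<mapsto> x \<bullet> J y\<close> means that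
  \<open>J\<close> composed with the inverse transpose of \<open>M\<close> maps the standard lattice
  onto \<open>M ` zlat\<close>; so Poisson summation for \<open>F \<circ> M\<close> is a summation
  over the same lattice on both sides.\<close>

lemma poisson_summation_lattice:
  fixes M J :: "'e::euclidean_space \<Rightarrow> 'e"
  assumes M: "linear M" "inj M"
    and J: "linear J" "\<And>x. J (J x) = x"
    and dual: "\<And>\<xi>. (\<forall>k\<in>zlat. M k \<bullet> J \<xi> \<in> \<int>) \<longleftrightarrow> \<xi> \<in> M ` zlat"
  obtains c where "c > 0"
    "\<And>F Fh C \<epsilon> C' \<epsilon>'. continuous_on UNIV F \<Longrightarrow> (\<And>x. norm (F x) \<le> C * exp (- \<epsilon> * (norm x)\<^sup>2)) \<Longrightarrow> \<epsilon> > 0 \<Longrightarrow>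
       (\<And>\<xi>. (\<integral>x. F x * ch (- (x \<bullet> J \<xi>)) \<partial>lborel) = Fh \<xi>) \<Longrightarrow>
       (\<And>x. norm (Fh x) \<le> C' * exp (- \<epsilon>' * (norm x)\<^sup>2)) \<Longrightarrow> \<epsilon>' > 0 \<Longrightarrow>
       (\<Sum>\<^sub>\<infinity>x\<in>M ` zlat. F x) = of_real c * (\<Sum>\<^sub>\<infinity>x\<in>M ` zlat. Fh x)"
proof -
  obtain c where c: "c > 0"
     "\<And>F :: 'e \<Rightarrow> complex. F \<in> borel_measurable borel \<Longrightarrow> (\<integral>x. F (M x) \<partial>lborel) = of_real c * (\<integral>x. F x \<partial>lborel)"
    using lborel_integral_linear_image[OF M] by metis
  have surjM: "surj M" using M linear_injective_imp_surjective by blast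
  define M' where "M' = inv M"
  have M'M: "M' (M x) = x" for x using M(2) by (simp add: M'_def)
  have MM': "M (M' x) = x" for x using surjM by (simp add: M'_def surj_f_inv_f)
  have linM': "linear M'" unfolding M'_def by (rule inj_linear_imp_inv_linear[OF M])
  have adj': "x \<bullet> adjoint M' y = M' x \<bullet> y" for x y by (rule adjoint_works[OF linM'])
  have adj: "x \<bullet> adjoint M y = M x \<bullet> y" for x y by (rule adjoint_works[OF M(1)])
  define T where "T m = J (adjoint M' m)" for m
  have linT: "linear T" unfolding T_def using linear_compose[OF adjoint_linear[OF linM'] J(1)] by (simp add: o_def)
  have injT: "inj T"
  proof (rule injI)
    fix m n assume "T m = T n"
    hence "adjoint M' m = adjoint M' n" unfolding T_def by (metis J(2))
    hence "M' x \<bullet> m = M' x \<bullet> n" for x by (metis adj')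
    hence "x \<bullet> m = x \<bullet> n" for x by (metis M'M)
    thus "m = n" by (metis vector_eq_ldot)
  qed
  have T_im: "T ` zlat = M ` zlat"
  proof (intro equalityI subsetI)
    fix \<xi> assume "\<xi> \<in> T ` zlat"
    then obtain m where m: "m \<in> zlat" "\<xi> = T m" by blast
    have "M k \<bullet> J \<xi> \<in> \<int>" if "k \<in> zlat" for k
      using zlat_inner[OF that m(1)] by (simp add: m(2) T_def J(2) adj' M'M)
    thus "\<xi> \<in> M ` zlat" using dual by blast
  next
    fix \<xi> assume xi: "\<xi> \<in> M ` zlat"
    define m where "m = adjoint M (J \<xi>)"
    have km: "k \<bullet> m \<in> \<int>" if "k \<in> zlat" for k
      using dual[of \<xi>] xi that by (simp add: m_def adj)
    have "m \<in> zlat" unfolding zlat_def using km[OF zlat_closed(5)] by (simp add: inner_commute)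
    moreover have "adjoint M' m = J \<xi>"
    proof -
      have "x \<bullet> adjoint M' m = x \<bullet> J \<xi>" for x by (simp add: adj' m_def adj MM')
      thus ?thesis by (metis vector_eq_ldot)
    qed
    hence "T m = \<xi>" by (simp add: T_def J(2))
    ultimately show "\<xi> \<in> T ` zlat" by blast
  qed
  obtain BM where BM: "BM > 0" "\<And>x. BM * norm x \<le> norm (M x)"
    using linear_inj_bounded_below_pos[OF M] by metis
  obtain BT where BT: "BT > 0" "\<And>x. BT * norm x \<le> norm (T x)"
    using linear_inj_bounded_below_pos[OF linT injT] by metis
  have comp: "norm (H (L x)) \<le> C * exp (- (\<epsilon> * B\<^sup>2) * (norm x)\<^sup>2)"
    if "\<And>x. norm (H x) \<le> C * exp (- \<epsilon> * (norm x)\<^sup>2)" "\<epsilon> > 0" "B > 0" "\<And>x. B * norm x \<le> norm (L x)"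
    for H :: "'e \<Rightarrow> complex" and L :: "'e \<Rightarrow> 'e" and C \<epsilon> B :: real and x
  proof -
    have C: "C \<ge> 0" using order_trans[OF norm_ge_zero that(1)[of 0]] by simp
    have "(B * norm x)\<^sup>2 \<le> (norm (L x))\<^sup>2" using that by (intro power_mono) auto
    hence "exp (- \<epsilon> * (norm (L x))\<^sup>2) \<le> exp (- (\<epsilon> * B\<^sup>2) * (norm x)\<^sup>2)"
      using that(2) by (simp add: power_mult_distrib mult.assoc)
    thus ?thesis using order_trans[OF that(1) mult_left_mono[OF _ C]] by blast
  qed
  show ?thesis
  proof (rule that[OF c(1)])
    fix F Fh :: "'e \<Rightarrow> complex" and C \<epsilon> C' \<epsilon>' :: real
    assume cont: "continuous_on UNIV F" and bd: "\<And>x. norm (F x) \<le> C * exp (- \<epsilon> * (norm x)\<^sup>2)" and e: "\<epsilon> > 0"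
      and Fh: "\<And>\<xi>. (\<integral>x. F x * ch (- (x \<bullet> J \<xi>)) \<partial>lborel) = Fh \<xi>"
      and bd': "\<And>x. norm (Fh x) \<le> C' * exp (- \<epsilon>' * (norm x)\<^sup>2)" and e': "\<epsilon>' > 0"
    have [measurable]: "F \<in> borel_measurable borel" using cont by (rule borel_measurable_continuous_onI)
    have ft: "(\<integral>x. F (M x) * ch (- (m \<bullet> x)) \<partial>lborel) = of_real c * Fh (T m)" for m
    proof -
      have "m \<bullet> x = M x \<bullet> J (T m)" for x
        by (simp add: T_def J(2) adj' M'M inner_commute)
      hence "(\<integral>x. F (M x) * ch (- (m \<bullet> x)) \<partial>lborel) = (\<integral>x. F (M x) * ch (- (M x \<bullet> J (T m))) \<partial>lborel)"
        by simp
      also have "\<dots> = of_real c * (\<integral>x. F x * ch (- (x \<bullet> J (T m))) \<partial>lborel)"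
        by (rule c(2)[of "\<lambda>x. F x * ch (- (x \<bullet> J (T m)))"]) measurable
      finally show ?thesis by (simp add: Fh)
    qed
    have smT: "(\<lambda>m. norm (Fh (T m))) summable_on zlat"
    proof -
      have b: "norm (Fh (T m)) \<le> C' * exp (- (\<epsilon>' * BT\<^sup>2) * (norm m)\<^sup>2)" for m
        by (rule comp[OF bd' e' BT])
      obtain W where W: "W \<ge> 0" "\<And>t k. norm t \<le> (1::real) \<Longrightarrow> norm (Fh (T (t + k))) \<le> W * zwt k"
        using gauss_shift_zwt[of "\<lambda>x. Fh (T x)" C' "\<epsilon>' * BT\<^sup>2" 1] b e' BT(1) by (metis mult_pos_pos zero_less_power)
      show ?thesis
        by (rule summable_on_comparison_test[of "\<lambda>k. W * zwt k"])
           (use W(2)[of 0] in \<open>auto intro!: summable_on_cmult_right zwt_summable\<close>)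
    qed
    have "(\<Sum>\<^sub>\<infinity>x\<in>M ` zlat. F x) = (\<Sum>\<^sub>\<infinity>k\<in>zlat. F (M k))"
      by (subst infsum_reindex) (use M(2) in \<open>auto simp: inj_on_def o_def\<close>)
    also have "\<dots> = (\<Sum>\<^sub>\<infinity>m\<in>zlat. \<integral>x. F (M x) * ch (- (m \<bullet> x)) \<partial>lborel)"
    proof (rule poisson_summation_standard[where C = C and \<epsilon> = "\<epsilon> * BM\<^sup>2"])
      show "continuous_on UNIV (\<lambda>x. F (M x))"
        by (rule continuous_on_compose2[OF cont linear_continuous_on]) (use M(1) in \<open>auto simp: linear_conv_bounded_linear\<close>)
      show "norm (F (M x)) \<le> C * exp (- (\<epsilon> * BM\<^sup>2) * (norm x)\<^sup>2)" for x
        by (rule comp[OF bd e BM])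
      show "(\<lambda>m. norm (\<integral>x. F (M x) * ch (- (m \<bullet> x)) \<partial>lborel)) summable_on zlat"
        unfolding ft norm_mult by (intro summable_on_cmult_right smT)
    qed (use e BM in auto)
    also have "\<dots> = of_real c * (\<Sum>\<^sub>\<infinity>m\<in>zlat. Fh (T m))"
      unfolding ft by (rule infsum_cmult_right, rule abs_summable_summable, rule smT)
    also have "(\<Sum>\<^sub>\<infinity>m\<in>zlat. Fh (T m)) = (\<Sum>\<^sub>\<infinity>x\<in>T ` zlat. Fh x)"
      by (subst infsum_reindex) (use injT in \<open>auto simp: inj_on_def o_def\<close>)
    finally show "(\<Sum>\<^sub>\<infinity>x\<in>M ` zlat. F x) = of_real c * (\<Sum>\<^sub>\<infinity>x\<in>M ` zlat. Fh x)"
      unfolding T_im .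
  qed
qed

section \<open>Inversion of the theta function of a self-dual lattice\<close>

definition ppart :: "'e::euclidean_space set \<Rightarrow> 'e \<Rightarrow> 'e" where
  "ppart P x = (1/2) *\<^sub>R (x + refl_pos P x)"

definition npart :: "'e::euclidean_space set \<Rightarrow> 'e \<Rightarrow> 'e" where
  "npart P x = (1/2) *\<^sub>R (x - refl_pos P x)"

lemma ppart_component: "b \<in> Basis \<Longrightarrow> ppart P x \<bullet> b = (if b \<in> P then x \<bullet> b else 0)"
  and npart_component: "b \<in> Basis \<Longrightarrow> npart P x \<bullet> b = (if b \<in> P then 0 else x \<bullet> b)"
  by (auto simp: ppart_def npart_def inner_add_left inner_diff_left refl_pos_component)

lemma linear_ppart: "linear (ppart P)" and linear_npart: "linear (npart P)"
  by (rule linearI; rule euclidean_eqI; simp add: ppart_component npart_component inner_add_left)+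

lemma ppart_npart_add: "ppart P x + npart P x = x"
  by (rule euclidean_eqI) (simp add: inner_add_left ppart_component npart_component)

lemma ppart_npart_inner [simp]: "ppart P x \<bullet> npart P y = 0" "npart P y \<bullet> ppart P x = 0"
  by (subst euclidean_inner, rule sum.neutral, simp add: ppart_component npart_component)+

lemma part_part [simp]: "ppart P (ppart P x) = ppart P x" "npart P (npart P x) = npart P x"
  "ppart P (npart P x) = 0" "npart P (ppart P x) = 0"
  by (rule euclidean_eqI; simp add: ppart_component npart_component)+

lemma inner_parts: "x \<bullet> y = ppart P x \<bullet> ppart P y + npart P x \<bullet> npart P y"
  by (subst (1 2) ppart_npart_add[of P, symmetric]) (simp add: inner_add_left inner_add_right)

lemma inner_ppart_right: "x \<bullet> ppart P y = ppart P x \<bullet> ppart P y"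
  by (rule trans[OF inner_parts[of x "ppart P y" P]]) (simp only: part_part inner_zero_right add_0_right)

lemma inner_npart_right: "x \<bullet> npart P y = npart P x \<bullet> npart P y"
  by (rule trans[OF inner_parts[of x "npart P y" P]]) (simp only: part_part inner_zero_right add_0_left)

lemma bj_parts: "x \<bullet> refl_pos P y = ppart P x \<bullet> ppart P y - npart P x \<bullet> npart P y"
proof -
  have "refl_pos P y = ppart P y - npart P y"
    by (rule euclidean_eqI) (simp add: inner_diff_left ppart_component npart_component refl_pos_component)
  thus ?thesis by (simp only: inner_diff_right inner_ppart_right[of x] inner_npart_right[of x])
qed

text \<open>The Gaussian \<open>e(\<tau> q(x\<^sub>+) + cnj \<tau> q(x\<^sub>-))\<close> of the indefinite
  theta functions.\<close>

definition gau :: "'e::euclidean_space set \<Rightarrow> complex \<Rightarrow> 'e \<Rightarrow> complex" where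
  "gau P \<tau> x = exp (of_real pi * \<i> * (\<tau> * of_real ((norm (ppart P x))\<^sup>2) - cnj \<tau> * of_real ((norm (npart P x))\<^sup>2)))"

lemma norm_gau: "norm (gau P \<tau> x) = exp (- pi * Im \<tau> * (norm x)\<^sup>2)"
proof -
  have "(norm x)\<^sup>2 = (norm (ppart P x))\<^sup>2 + (norm (npart P x))\<^sup>2"
    by (simp only: power2_norm_eq_inner inner_parts[of x x P])
  thus ?thesis by (simp add: gau_def norm_exp_eq_Re algebra_simps)
qed

lemma gau_add_1: "gau P (\<tau> + 1) x = gau P \<tau> x * ch (x \<bullet> refl_pos P x / 2)"
  by (simp add: gau_def ch_exp bj_parts power2_norm_eq_inner algebra_simps diff_divide_distrib flip: exp_add)

lemma hgauss_0:
  assumes "P \<subseteq> Basis"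
  shows "(\<Prod>b\<in>Basis. if b \<in> P then exp (of_real pi * \<i> * \<tau> * of_real ((x \<bullet> b)\<^sup>2)) else cnj (exp (of_real pi * \<i> * \<tau> * of_real ((x \<bullet> b)\<^sup>2))))
    = gau P \<tau> x"
proof -
  have n1: "(norm (ppart P x))\<^sup>2 = (\<Sum>b\<in>Basis. if b \<in> P then (x \<bullet> b)\<^sup>2 else 0)"
    by (simp only: power2_norm_eq_inner, subst euclidean_inner)
       (auto intro!: sum.cong simp: ppart_component power2_eq_square)
  have n2: "(norm (npart P x))\<^sup>2 = (\<Sum>b\<in>Basis. if b \<in> P then 0 else (x \<bullet> b)\<^sup>2)"
    by (simp only: power2_norm_eq_inner, subst euclidean_inner)
       (auto intro!: sum.cong simp: npart_component power2_eq_square)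
  have "gau P \<tau> x = exp (\<Sum>b\<in>Basis. of_real pi * \<i> * (\<tau> * of_real (if b \<in> P then (x \<bullet> b)\<^sup>2 else 0) - cnj \<tau> * of_real (if b \<in> P then 0 else (x \<bullet> b)\<^sup>2)))"
    unfolding gau_def n1 n2 by (simp add: sum_distrib_left sum_subtractf right_diff_distrib)
  also have "\<dots> = (\<Prod>b\<in>Basis. if b \<in> P then exp (of_real pi * \<i> * \<tau> * of_real ((x \<bullet> b)\<^sup>2)) else cnj (exp (of_real pi * \<i> * \<tau> * of_real ((x \<bullet> b)\<^sup>2))))"
    by (subst exp_sum) (auto intro!: prod.cong simp: mult.assoc exp_cnj)
  finally show ?thesis by simp
qed

lemma hgauss_gau:
  assumes P: "P \<subseteq> Basis"
  shows "hgauss P dg \<tau> x = of_real (\<Prod>b\<in>P. herm (Im \<tau>) (dg b) (x \<bullet> b)) * gau P \<tau> x"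
proof -
  have "hgauss P dg \<tau> x = (\<Prod>b\<in>Basis. (if b \<in> P then of_real (herm (Im \<tau>) (dg b) (x \<bullet> b)) else 1) *
     (if b \<in> P then exp (of_real pi * \<i> * \<tau> * of_real ((x \<bullet> b)\<^sup>2)) else cnj (exp (of_real pi * \<i> * \<tau> * of_real ((x \<bullet> b)\<^sup>2)))))"
    unfolding hgauss_def by (intro prod.cong refl) (auto simp: hg_def herm_def)
  also have "\<dots> = (\<Prod>b\<in>Basis. if b \<in> P then of_real (herm (Im \<tau>) (dg b) (x \<bullet> b)) else 1) * gau P \<tau> x"
    by (simp only: prod.distrib hgauss_0[OF P])
  also have "(\<Prod>b\<in>Basis. if b \<in> P then complex_of_real (herm (Im \<tau>) (dg b) (x \<bullet> b)) else 1) = (\<Prod>b\<in>P. of_real (herm (Im \<tau>) (dg b) (x \<bullet> b)))"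
    using P by (subst prod.If_cases) (auto simp: Int_absorb1)
  finally show ?thesis by simp
qed

text \<open>A self-dual even lattice \<open>M ` zlat\<close> of signature \<open>(2 n, 2)\<close> with two
  isotropic lattice vectors spanning a hyperbolic plane, and two positive coordinate directions that
  define the quadratic polynomial. Here \<open>2 n = b\<close>, so the weight of the cusp form is
  \<open>n + 1\<close>.\<close>

locale theta_data =
  fixes P :: "'e::euclidean_space set" and M :: "'e \<Rightarrow> 'e" and U U' :: 'e
    and n :: nat and ea eb :: 'e
  assumes P: "P \<subseteq> Basis" "card P = 2 * n" "DIM('e) = 2 * n + 2"
    and ab: "ea \<in> P" "eb \<in> P"
    and M: "linear M" "inj M"
    and dual: "\<And>\<xi>. (\<forall>k\<in>zlat. M k \<bullet> refl_pos P \<xi> \<in> \<int>) \<longleftrightarrow> \<xi> \<in> M ` zlat"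
    and even: "\<And>x. x \<in> M ` zlat \<Longrightarrow> x \<bullet> refl_pos P x / 2 \<in> \<int>"
    and U_in: "U \<in> M ` zlat" "U' \<in> M ` zlat"
    and UU: "U \<bullet> refl_pos P U = 0" "U' \<bullet> refl_pos P U' = 0" "U \<bullet> refl_pos P U' = 1"
begin

definition bj :: "'e \<Rightarrow> 'e \<Rightarrow> real" where
  "bj x y = x \<bullet> refl_pos P y"

lemma bj_sym: "bj x y = bj y x"
  unfolding bj_def by (subst refl_pos_adjoint) (rule inner_commute)

lemma bj_linear [simp]:
  "bj (x + y) z = bj x z + bj y z" "bj z (x + y) = bj z x + bj z y"
  "bj (a *\<^sub>R x) z = a * bj x z" "bj z (a *\<^sub>R x) = a * bj z x"
proof -
  interpret linear "refl_pos P" by (rule linear_refl_pos)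
  show "bj (x + y) z = bj x z + bj y z" "bj z (x + y) = bj z x + bj z y"
  "bj (a *\<^sub>R x) z = a * bj x z" "bj z (a *\<^sub>R x) = a * bj z x"
    by (simp_all add: bj_def inner_add_left inner_add_right add scale)
qed

lemma bj_UU [simp]: "bj U U = 0" "bj U' U' = 0" "bj U U' = 1" "bj U' U = 1"
  using UU bj_sym[of U' U] by (simp_all add: bj_def[symmetric])

definition Lam :: "'e set" where "Lam = M ` zlat"

text \<open>Theta functions with a Hermite degree \<open>dg b\<close> in each positive direction, shifted by
  \<open>s U\<close> and twisted by a character. The parameters \<open>s\<close> and
  \<open>t\<close> are the variables in which Fourier coefficients are taken.\<close>

definition theta_deg :: "('e \<Rightarrow> nat) \<Rightarrow> complex \<Rightarrow> real \<Rightarrow> real \<Rightarrow> complex" where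
  "theta_deg dg \<tau> s t = (\<Sum>\<^sub>\<infinity>x\<in>Lam. hgauss P dg \<tau> (x + s *\<^sub>R U) * ch (- (t * bj x U)))"

definition Kfac :: "complex \<Rightarrow> complex" where
  "Kfac \<tau> = (\<i> / \<tau>) ^ n * (- \<i> / cnj \<tau>)"

text \<open>Poisson summation, with the covolume of the lattice still hidden in the constant.\<close>

lemma theta_deg_S_const:
  obtains c0 :: real where "c0 > 0"
    "\<And>dg \<tau> s t. Im \<tau> > 0 \<Longrightarrow> (\<And>b. dg b \<le> 2) \<Longrightarrow>
      theta_deg dg \<tau> s t = of_real c0 * Kfac \<tau> * (1 / \<tau>) ^ (\<Sum>b\<in>P. dg b) * theta_deg dg (- 1 / \<tau>) t (- s)"
proof -
  obtain c where c: "c > 0"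
    "\<And>F Fh C \<epsilon> C' \<epsilon>'. continuous_on UNIV F \<Longrightarrow> (\<And>x. norm (F x) \<le> C * exp (- \<epsilon> * (norm x)\<^sup>2)) \<Longrightarrow> \<epsilon> > 0 \<Longrightarrow>
       (\<And>\<xi>. (\<integral>x. F x * ch (- (x \<bullet> refl_pos P \<xi>)) \<partial>lborel) = Fh \<xi>) \<Longrightarrow>
       (\<And>x. norm (Fh x) \<le> C' * exp (- \<epsilon>' * (norm x)\<^sup>2)) \<Longrightarrow> \<epsilon>' > 0 \<Longrightarrow>
       (\<Sum>\<^sub>\<infinity>x\<in>M ` zlat. F x) = of_real c * (\<Sum>\<^sub>\<infinity>x\<in>M ` zlat. Fh x)"
    using poisson_summation_lattice[OF M linear_refl_pos[of P] refl_pos_invol dual] by blast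
  show ?thesis
  proof (rule that[OF c(1)])
    fix dg :: "'e \<Rightarrow> nat" and \<tau> s t
    assume \<tau>: "Im \<tau> > 0" and dg: "\<And>b. dg b \<le> 2"
    let ?D = "\<Sum>b\<in>P. dg b"
    define K where "K = Kfac \<tau> * (1 / \<tau>) ^ ?D"
    define F where "F x = hgauss P dg \<tau> (x + s *\<^sub>R U) * ch (- (t * bj x U))" for x
    define Fh where "Fh x = K * (hgauss P dg (- 1 / \<tau>) (x + t *\<^sub>R U) * ch (- (- s * bj x U)))" for x
    have kK: "kap \<tau> ^ card P * cnj (kap \<tau>) ^ (DIM('e) - card P) * (1 / \<tau>) ^ ?D = K"
    proof -
      have "kap \<tau> ^ card P = (\<i> / \<tau>) ^ n" by (simp add: P power_mult kap_squared[OF \<tau>])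
      moreover have "cnj (kap \<tau>) ^ (DIM('e) - card P) = - \<i> / cnj \<tau>"
        using arg_cong[OF kap_squared[OF \<tau>], of cnj] by (simp add: P)
      ultimately show ?thesis by (simp add: K_def Kfac_def)
    qed
    have bd: "\<exists>C \<epsilon>. \<epsilon> > 0 \<and> (\<forall>x. norm (hgauss P dg \<tau> (x + a *\<^sub>R U)) \<le> C * exp (- \<epsilon> * (norm x)\<^sup>2))"
      if ti: "Im \<tau> > 0" for \<tau> a
    proof -
      obtain C where C: "\<And>x. norm (hgauss P dg \<tau> x) \<le> C * exp (- (pi * Im \<tau> / 2) * (norm x)\<^sup>2)"
        using hgauss_bound[OF ti] by blast
      have e: "pi * Im \<tau> / 2 > 0" using ti by simp
      show ?thesis using gauss_shift_bound[OF C e order_refl, of "a *\<^sub>R U"] e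
        by (intro exI[of _ "C * exp ((pi * Im \<tau> / 2) * (norm (a *\<^sub>R U))\<^sup>2)"] exI[of _ "pi * Im \<tau> / 2 / 2"])
           (auto simp: add.commute)
    qed
    obtain C \<epsilon> where C: "\<epsilon> > 0" "\<And>x. norm (hgauss P dg \<tau> (x + s *\<^sub>R U)) \<le> C * exp (- \<epsilon> * (norm x)\<^sup>2)"
      using bd[OF \<tau>] by metis
    obtain C' \<epsilon>' where C': "\<epsilon>' > 0" "\<And>x. norm (hgauss P dg (- 1 / \<tau>) (x + t *\<^sub>R U)) \<le> C' * exp (- \<epsilon>' * (norm x)\<^sup>2)"
      using bd[OF Im_S_pos[OF \<tau>]] by metis
    have contbj: "continuous_on UNIV (\<lambda>x. bj x U)" unfolding bj_def by (intro continuous_intros)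
    have "(\<Sum>\<^sub>\<infinity>x\<in>M ` zlat. F x) = of_real c * (\<Sum>\<^sub>\<infinity>x\<in>M ` zlat. Fh x)"
    proof (rule c(2))
      show "continuous_on UNIV F" unfolding F_def by (intro continuous_intros contbj)
      show "norm (F x) \<le> C * exp (- \<epsilon> * (norm x)\<^sup>2)" for x using C(2)[of x] by (simp add: F_def norm_mult)
      show "\<epsilon> > 0" by fact
      show "norm (Fh x) \<le> (norm K * C') * exp (- \<epsilon>' * (norm x)\<^sup>2)" for x
        using mult_left_mono[OF C'(2)[of x], of "norm K"] by (simp add: Fh_def norm_mult mult_ac)
      show "\<epsilon>' > 0" by fact
      fix \<xi>
      let ?g = "\<lambda>x. hgauss P dg \<tau> x * ch (- bj (x - s *\<^sub>R U) (\<xi> + t *\<^sub>R U))"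
      have g_meas: "?g \<in> borel_measurable borel"
        unfolding bj_def by (intro borel_measurable_continuous_onI continuous_intros)
      have "F x * ch (- (x \<bullet> refl_pos P \<xi>)) = ?g (x + s *\<^sub>R U)" for x
        by (simp add: F_def bj_def[symmetric] ch_add[symmetric] mult.assoc algebra_simps)
      hence "(\<integral>x. F x * ch (- (x \<bullet> refl_pos P \<xi>)) \<partial>lborel) = (\<integral>x. ?g (x + s *\<^sub>R U) \<partial>lborel)" by simp
      also have "\<dots> = (\<integral>x. ?g x \<partial>lborel)" by (rule lborel_integral_shift(1)[OF g_meas])
      also have "\<dots> = (\<integral>x. ch (s * bj \<xi> U) * (hgauss P dg \<tau> x * ch (- (x \<bullet> refl_pos P (\<xi> + t *\<^sub>R U)))) \<partial>lborel)"
      proof (rule Bochner_Integration.integral_cong[OF refl])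
        fix x
        have "bj (x - s *\<^sub>R U) (\<xi> + t *\<^sub>R U) = bj x (\<xi> + t *\<^sub>R U) - s * bj \<xi> U"
          using bj_linear(1)[of "x - s *\<^sub>R U" "s *\<^sub>R U" "\<xi> + t *\<^sub>R U"] by (simp add: bj_sym[of U \<xi>])
        hence e: "ch (- bj (x - s *\<^sub>R U) (\<xi> + t *\<^sub>R U)) = ch (s * bj \<xi> U) * ch (- bj x (\<xi> + t *\<^sub>R U))"
          by (simp only: ch_add[symmetric]) (simp only: minus_diff_eq uminus_add_conv_diff add_uminus_conv_diff)
        show "?g x = ch (s * bj \<xi> U) * (hgauss P dg \<tau> x * ch (- (x \<bullet> refl_pos P (\<xi> + t *\<^sub>R U))))"
          unfolding e by (simp only: bj_def mult_ac)
      qed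
      also have "\<dots> = ch (s * bj \<xi> U) * (K * hgauss P dg (- 1 / \<tau>) (\<xi> + t *\<^sub>R U))"
        by (subst integral_mult_right_zero) (simp only: hgauss_fourier[OF \<tau> dg P(1)] kK)
      also have "\<dots> = Fh \<xi>" by (simp add: Fh_def mult_ac)
      finally show "(\<integral>x. F x * ch (- (x \<bullet> refl_pos P \<xi>)) \<partial>lborel) = Fh \<xi>" .
    qed
    also have "(\<Sum>\<^sub>\<infinity>x\<in>M ` zlat. Fh x) = K * theta_deg dg (- 1 / \<tau>) t (- s)"
      unfolding Fh_def theta_deg_def Lam_def[symmetric] by (rule infsum_cmult_right')
    finally show "theta_deg dg \<tau> s t = of_real c * Kfac \<tau> * (1 / \<tau>) ^ ?D * theta_deg dg (- 1 / \<tau>) t (- s)"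
      by (simp add: theta_deg_def F_def Lam_def K_def)
  qed
qed

lemma gau_Lam_summable:
  assumes "Im \<tau> > 0" shows "(\<lambda>x. norm (gau P \<tau> x)) summable_on Lam"
proof -
  obtain w :: "'e \<Rightarrow> real" and B where w: "B > 0" "w summable_on (M ` zlat)" "\<And>x. w x \<ge> 0"
    "\<And>\<epsilon> x. \<epsilon> > 0 \<Longrightarrow> x \<in> M ` zlat \<Longrightarrow> exp (- \<epsilon> * (norm x)\<^sup>2) \<le> (1 + B / \<epsilon>) ^ DIM('e) * w x"
    by (rule lattice_weight[OF M], rule that)
  show ?thesis
  proof (rule summable_on_comparison_test)
    show "(\<lambda>x. (1 + B / (pi * Im \<tau>)) ^ DIM('e) * w x) summable_on Lam"
      unfolding Lam_def by (intro summable_on_cmult_right w)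
    show "norm (gau P \<tau> x) \<le> (1 + B / (pi * Im \<tau>)) ^ DIM('e) * w x" if "x \<in> Lam" for x
      using w(4)[of "pi * Im \<tau>" x] assms that by (simp add: norm_gau Lam_def)
  qed auto
qed

text \<open>Both the constant \<open>c0\<close> and the root of unity in the inversion formula are found from
  the theta constant \<open>th\<close>. It is positive at \<open>\<i>\<close>, the fixed point of
  the inversion, so \<open>c0 = 1\<close>. The relation \<open>(S T)\<^sup>3 = 1\<close>, followed
  along the orbit of \<open>\<i>\<close>, then forces \<open>\<i>\<^sup>n (- \<i>) = 1\<close>; this
  is the fact that the signature of an even unimodular lattice is divisible by eight.\<close>

lemma theta_normalisation: "\<i> ^ n * (- \<i>) = 1"
  and theta_deg_S: "Im \<tau> > 0 \<Longrightarrow> (\<And>b. dg b \<le> 2) \<Longrightarrow>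
      theta_deg dg \<tau> s t = Kfac \<tau> * (1 / \<tau>) ^ (\<Sum>b\<in>P. dg b) * theta_deg dg (- 1 / \<tau>) t (- s)"
proof -
  obtain c0 :: real where c0: "c0 > 0"
    "\<And>dg \<tau> s t. Im \<tau> > 0 \<Longrightarrow> (\<And>b. dg b \<le> 2) \<Longrightarrow>
      theta_deg dg \<tau> s t = of_real c0 * Kfac \<tau> * (1 / \<tau>) ^ (\<Sum>b\<in>P. dg b) * theta_deg dg (- 1 / \<tau>) t (- s)"
    using theta_deg_S_const by blast
  define th where "th \<tau> = (\<Sum>\<^sub>\<infinity>x\<in>Lam. gau P \<tau> x)" for \<tau>
  have th: "theta_deg (\<lambda>_. 0) \<tau> 0 0 = th \<tau>" for \<tau>
    by (simp add: theta_deg_def th_def hgauss_gau[OF P(1)] herm_def)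
  have S: "th \<tau> = of_real c0 * Kfac \<tau> * th (- 1 / \<tau>)" if "Im \<tau> > 0" for \<tau>
    using c0(2)[OF that, of "\<lambda>_. 0" 0 0] by (simp add: th)
  have T: "th (\<tau> + 1) = th \<tau>" for \<tau>
    unfolding th_def by (intro infsum_cong) (use even in \<open>simp add: gau_add_1 Lam_def ch_int\<close>)
  have th_i: "th \<i> \<noteq> 0"
  proof -
    have g: "gau P \<i> x = of_real (norm (gau P \<i> x))" for x
    proof -
      have "gau P \<i> x = exp (of_real (- pi * ((norm (ppart P x))\<^sup>2 + (norm (npart P x))\<^sup>2)))"
        by (simp add: gau_def algebra_simps)
      thus ?thesis unfolding exp_of_real by simp
    qed
    have sm: "(\<lambda>x. norm (gau P \<i> x)) summable_on Lam" by (rule gau_Lam_summable) simp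
    have "th \<i> = (\<Sum>\<^sub>\<infinity>x\<in>Lam. of_real (norm (gau P \<i> x)))"
      unfolding th_def by (intro infsum_cong) (rule g)
    also have "\<dots> = of_real (\<Sum>\<^sub>\<infinity>x\<in>Lam. norm (gau P \<i> x))"
      using has_sum_of_real[OF has_sum_infsum[OF sm]] by (rule infsumI)
    finally have e: "th \<i> = of_real (\<Sum>\<^sub>\<infinity>x\<in>Lam. norm (gau P \<i> x))" .
    have "0 \<in> Lam"
      unfolding Lam_def using M(1) by (auto simp: linear_0 zlat_closed intro!: image_eqI[of _ _ 0])
    hence "(\<Sum>\<^sub>\<infinity>x\<in>{0}. norm (gau P \<i> x)) \<le> (\<Sum>\<^sub>\<infinity>x\<in>Lam. norm (gau P \<i> x))"
      by (intro infsum_mono_neutral[OF _ sm]) auto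
    hence "(\<Sum>\<^sub>\<infinity>x\<in>Lam. norm (gau P \<i> x)) \<ge> 1" by (simp add: norm_gau)
    thus ?thesis unfolding e by simp
  qed
  have "th \<i> = of_real c0 * th \<i>"
    using S[of \<i>] by (simp add: Kfac_def)
  hence c01: "c0 = 1" using th_i by simp
  show "Im \<tau> > 0 \<Longrightarrow> (\<And>b. dg b \<le> 2) \<Longrightarrow>
      theta_deg dg \<tau> s t = Kfac \<tau> * (1 / \<tau>) ^ (\<Sum>b\<in>P. dg b) * theta_deg dg (- 1 / \<tau>) t (- s)"
    using c0(2)[of \<tau> dg s t] c01 by simp
  have S1: "th \<tau> = Kfac \<tau> * th (- 1 / \<tau>)" if "Im \<tau> > 0" for \<tau>
    using S[OF that] c01 by simp
  \<comment> \<open>\<open>\<i>\<close> is translated to \<open>1 + \<i>\<close>, inverted, translated, inverted and translated back to \<open>\<i>\<close>.\<close>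
  have "th \<i> = th (1 + \<i>)" using T[of \<i>] by (simp add: add.commute)
  also have "\<dots> = Kfac (1 + \<i>) * th (- 1 / (1 + \<i>))" by (rule S1) simp
  also have "th (- 1 / (1 + \<i>)) = th (- 1 / (1 + \<i>) + 1)" by (rule T[symmetric])
  also have "- 1 / (1 + \<i>) + 1 = (1 + \<i>) / 2" by (simp add: complex_eq_iff Re_divide Im_divide power2_eq_square)
  also have "th ((1 + \<i>) / 2) = Kfac ((1 + \<i>) / 2) * th (- 1 / ((1 + \<i>) / 2))" by (rule S1) simp
  also have "th (- 1 / ((1 + \<i>) / 2)) = th (- 1 / ((1 + \<i>) / 2) + 1)" by (rule T[symmetric])
  also have "- 1 / ((1 + \<i>) / 2) + 1 = \<i>" by (simp add: complex_eq_iff Re_divide Im_divide power2_eq_square)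
  finally have A: "Kfac (1 + \<i>) * Kfac ((1 + \<i>) / 2) = 1" using th_i by simp
  have B: "Kfac (1 + \<i>) * Kfac ((1 + \<i>) / 2) = ((\<i> / (1 + \<i>)) * (\<i> / ((1 + \<i>) / 2))) ^ n * ((- \<i> / cnj (1 + \<i>)) * (- \<i> / cnj ((1 + \<i>) / 2)))"
    by (simp only: Kfac_def power_mult_distrib mult_ac)
  have C: "(\<i> / (1 + \<i>)) * (\<i> / ((1 + \<i>) / 2)) = \<i>"
    by (simp add: complex_eq_iff Re_divide Im_divide power2_eq_square)
  have D: "(- \<i> / cnj (1 + \<i>)) * (- \<i> / cnj ((1 + \<i>) / 2)) = - \<i>"
    by (simp add: complex_eq_iff Re_divide Im_divide power2_eq_square)
  show "\<i> ^ n * (- \<i>) = 1" using A unfolding B C D .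
qed

definition dgab :: "'e \<Rightarrow> nat" where
  "dgab b = (if b = ea then 1 else 0) + (if b = eb then 1 else 0)"

text \<open>The image of \<open>2 x\<^sub>\<alpha> x\<^sub>\<beta>\<close> under the heat operator.\<close>

definition qab :: "real \<Rightarrow> 'e \<Rightarrow> real" where
  "qab y x = 2 * (x \<bullet> ea) * (x \<bullet> eb) - (if ea = eb then 1 / (2 * pi * y) else 0)"

definition FF :: "complex \<Rightarrow> 'e \<Rightarrow> complex" where
  "FF \<tau> x = of_real (qab (Im \<tau>) x) * gau P \<tau> x"

lemma finite_P: "finite P"
  using finite_subset[OF P(1) finite_Basis] .

lemma FF_hgauss: "FF \<tau> x = 2 * hgauss P dgab \<tau> x"
proof -
  let ?h = "\<lambda>b. herm (Im \<tau>) (dgab b) (x \<bullet> b)"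
  have e: "2 * (\<Prod>b\<in>P. ?h b) = qab (Im \<tau>) x"
  proof (cases "ea = eb")
    case True
    have "(\<Prod>b\<in>P. ?h b) = ?h ea * (\<Prod>b\<in>P - {ea}. ?h b)"
      using finite_P ab by (simp add: prod.remove)
    also have "(\<Prod>b\<in>P - {ea}. ?h b) = 1"
      unfolding dgab_def herm_def by (intro prod.neutral) (use True in auto)
    finally show ?thesis unfolding dgab_def herm_def qab_def using True by (simp add: power2_eq_square algebra_simps)
  next
    case False
    have "(\<Prod>b\<in>P. ?h b) = ?h ea * (\<Prod>b\<in>P - {ea}. ?h b)"
      using finite_P ab by (intro prod.remove)
    also have "(\<Prod>b\<in>P - {ea}. ?h b) = ?h eb * (\<Prod>b\<in>P - {ea} - {eb}. ?h b)"
      using finite_P ab False by (intro prod.remove finite_Diff) blast+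
    also have "(\<Prod>b\<in>P - {ea} - {eb}. ?h b) = 1"
      by (intro prod.neutral) (auto simp: dgab_def herm_def)
    finally have "(\<Prod>b\<in>P. ?h b) = (x \<bullet> ea) * (x \<bullet> eb)"
      using False by (simp add: dgab_def herm_def)
    thus ?thesis using False by (simp add: qab_def)
  qed
  show ?thesis
    unfolding FF_def hgauss_gau[OF P(1)] e[symmetric] of_real_mult of_real_numeral by (rule mult.assoc)
qed

lemma sum_dgab: "(\<Sum>b\<in>P. dgab b) = 2"
  using finite_P ab by (simp add: dgab_def sum.distrib)

definition theta_sum :: "complex \<Rightarrow> real \<Rightarrow> real \<Rightarrow> complex" where
  "theta_sum \<tau> s t = (\<Sum>\<^sub>\<infinity>x\<in>Lam. FF \<tau> (x + s *\<^sub>R U) * ch (- (t * bj x U)))"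

text \<open>The inversion formula, with the two parameters rotated by a quarter turn.\<close>

lemma theta_sum_S:
  assumes "Im \<tau> > 0"
  shows "\<tau> ^ (n + 2) * cnj \<tau> * theta_sum \<tau> s t = theta_sum (- 1 / \<tau>) t (- s)"
proof -
  have t0: "\<tau> \<noteq> 0" using assms by auto
  have theta_deg: "theta_sum \<tau> s t = 2 * theta_deg dgab \<tau> s t" for \<tau> s t
    unfolding theta_sum_def theta_deg_def FF_hgauss mult.assoc by (rule infsum_cmult_right')
  have le2: "dgab b \<le> 2" for b by (simp add: dgab_def)
  have "theta_deg dgab \<tau> s t = Kfac \<tau> * (1 / \<tau>) ^ 2 * theta_deg dgab (- 1 / \<tau>) t (- s)"
    unfolding sum_dgab[symmetric] by (rule theta_deg_S[OF assms le2])
  moreover have "Kfac \<tau> = 1 / (\<tau> ^ n * cnj \<tau>)"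
  proof -
    have "Kfac \<tau> = (\<i> ^ n * (- \<i>)) / (\<tau> ^ n * cnj \<tau>)"
      by (simp add: Kfac_def power_divide)
    thus ?thesis unfolding theta_normalisation .
  qed
  ultimately show ?thesis using t0 by (simp add: theta_deg field_simps power_add power2_eq_square)
qed

end

section \<open>Fourier transforms along an isotropic line\<close>

lemma summable_on_times_nonneg:
  fixes f :: "'a \<Rightarrow> real" and g :: "'b \<Rightarrow> real"
  assumes "f summable_on A" "g summable_on B" "\<And>x. f x \<ge> 0" "\<And>y. g y \<ge> 0"
  shows "(\<lambda>(x, y). f x * g y) summable_on A \<times> B"
proof -
  have "(\<lambda>p. norm ((\<lambda>(x, y). f x * g y) p)) summable_on A \<times> B"
    by (subst Infinite_Sum.abs_summable_on_Sigma_iff)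
       (use assms in \<open>auto simp: abs_mult infsum_cmult_right' intro!: summable_on_cmult_right summable_on_cmult_left\<close>)
  thus ?thesis by (rule abs_summable_summable)
qed

lemma gmom_0_real:
  assumes "a > 0" shows "gmom 0 (of_real a) 0 = of_real (1 / sqrt a)"
proof -
  have g: "gker (of_real a) 0 x = of_real (exp (- pi * a * x\<^sup>2))" for x
    by (simp add: gker_def flip: exp_of_real)
  define r where "r = (\<integral>x. exp (- pi * a * x\<^sup>2) \<partial>lborel)"
  have e: "gmom 0 (of_real a) 0 = of_real r"
    unfolding gmom_def g r_def by (simp del: of_real_exp)
  have "r \<ge> 0" unfolding r_def by (rule integral_nonneg_AE) simp
  have "(complex_of_real r)\<^sup>2 = 1 / of_real a"
    using gmom_0_squared[of "of_real a"] assms e by simp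
  hence "complex_of_real (r\<^sup>2) = of_real (1 / a)" by simp
  hence "r\<^sup>2 = 1 / a" by (simp only: of_real_eq_iff)
  hence "r = sqrt (1 / a)" using \<open>r \<ge> 0\<close> by (metis real_sqrt_unique)
  thus ?thesis using e by (simp add: real_sqrt_divide)
qed

context theta_data begin

text \<open>The images of \<open>u\<close> in \<open>z\<^sup>\<bottom>\<close> and in \<open>z\<close>. Both
  have squared length \<open>rho\<close>, as \<open>U\<close> is isotropic; \<open>wv\<close> is the
  projection to their complement and \<open>mm\<close> the pairing with \<open>\<mu>\<close>.\<close>

definition pU :: 'e where "pU = ppart P U"
definition mU :: 'e where "mU = npart P U"
definition rho :: real where "rho = pU \<bullet> pU"
definition wv :: "'e \<Rightarrow> 'e" where "wv v = v - (v \<bullet> pU / rho) *\<^sub>R pU - (v \<bullet> mU / rho) *\<^sub>R mU"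
definition mm :: "'e \<Rightarrow> real" where "mm v = (v \<bullet> pU + v \<bullet> mU) / (2 * rho)"

lemma mU_mU: "mU \<bullet> mU = rho"
  using UU(1) by (simp add: bj_parts rho_def pU_def mU_def)

lemma pU_mU: "pU \<bullet> mU = 0" "mU \<bullet> pU = 0" "U = pU + mU"
  by (simp_all add: pU_def mU_def ppart_npart_add)

lemma rho_pos: "rho > 0"
proof -
  have "rho \<noteq> 0"
  proof
    assume "rho = 0"
    hence "pU = 0" "mU = 0" using mU_mU by (simp_all add: rho_def)
    thus False using UU(3) pU_mU(3) by simp
  qed
  moreover have "rho \<ge> 0" by (simp add: rho_def)
  ultimately show ?thesis by simp
qed

lemma bj_U_eq: "bj v U = v \<bullet> pU - v \<bullet> mU"
  unfolding bj_def bj_parts pU_def mU_def by (simp only: inner_ppart_right[of v] inner_npart_right[of v])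

lemma parts_pU [simp]: "ppart P pU = pU" "npart P pU = 0" "ppart P mU = 0" "npart P mU = mU"
  by (simp_all add: pU_def mU_def)

lemma wv_orth: "wv v \<bullet> pU = 0" "wv v \<bullet> mU = 0"
  using rho_pos by (simp_all add: wv_def inner_diff_left pU_mU(1,2) mU_mU rho_def[symmetric])

lemma linear_wv: "linear wv"
proof (rule linearI)
  fix x y :: 'e and r :: real
  show "wv (x + y) = wv x + wv y"
    by (simp only: wv_def inner_add_left add_divide_distrib scaleR_add_left add_diff_eq diff_add_eq diff_diff_add) (simp add: algebra_simps)
  show "wv (r *\<^sub>R x) = r *\<^sub>R wv x"
    by (simp add: wv_def scaleR_diff_right)
qed

text \<open>On the line \<open>v + \<real> U\<close> the Gaussian of the lattice is an ordinary Gaussian in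
  one variable. Centering the parameter at \<open>mm v\<close> removes the linear term of its real
  part.\<close>

lemma gau_line:
  fixes v :: 'e and s :: real and \<tau> :: complex
  defines "c \<equiv> bj v U"
  assumes y: "Im \<tau> > 0"
  shows "gau P \<tau> (v + (s - mm v) *\<^sub>R U) =
    gau P \<tau> (wv v) * of_real (exp (- pi * Im \<tau> * c\<^sup>2 / (2 * rho))) * gker (of_real (2 * Im \<tau> * rho)) (of_real (- (Re \<tau> * c))) s"
proof -
  interpret p: linear "ppart P" by (rule linear_ppart)
  interpret m: linear "npart P" by (rule linear_npart)
  let ?x = "v + (s - mm v) *\<^sub>R U"
  let ?A = "v \<bullet> pU / rho + (s - mm v)" and ?B = "v \<bullet> mU / rho + (s - mm v)"
  have AB: "?A = s + c / (2 * rho)" "?B = s - c / (2 * rho)"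
    using rho_pos by (simp_all add: mm_def c_def bj_U_eq field_simps)
  have x: "?x = wv v + ?A *\<^sub>R pU + ?B *\<^sub>R mU"
  proof -
    have "?x = v + (s - mm v) *\<^sub>R (pU + mU)" by (simp only: pU_mU(3)[symmetric])
    thus ?thesis by (simp add: wv_def algebra_simps)
  qed
  have px: "ppart P ?x = ppart P (wv v) + ?A *\<^sub>R pU" and mx: "npart P ?x = npart P (wv v) + ?B *\<^sub>R mU"
    unfolding x by (simp_all add: p.add p.scale m.add m.scale)
  have o: "ppart P (wv v) \<bullet> pU = 0" "npart P (wv v) \<bullet> mU = 0"
    using wv_orth[of v] inner_ppart_right[of "wv v" P U] inner_npart_right[of "wv v" P U] by (simp_all add: pU_def mU_def)
  have np: "(norm (ppart P ?x))\<^sup>2 = (norm (ppart P (wv v)))\<^sup>2 + (s + c / (2 * rho))\<^sup>2 * rho"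
    unfolding px AB power2_norm_eq_inner using o
    by (simp add: inner_add_left inner_add_right inner_commute[of pU "ppart P (wv v)"] rho_def[symmetric] power2_eq_square)
  have nm: "(norm (npart P ?x))\<^sup>2 = (norm (npart P (wv v)))\<^sup>2 + (s - c / (2 * rho))\<^sup>2 * rho"
    unfolding mx AB power2_norm_eq_inner using o
    by (simp add: inner_add_left inner_add_right inner_commute[of mU "npart P (wv v)"] mU_mU power2_eq_square)
  have sq: "(s + c / (2 * rho))\<^sup>2 * rho = (rho * s\<^sup>2 + c\<^sup>2 / (4 * rho)) + c * s" "(s - c / (2 * rho))\<^sup>2 * rho = (rho * s\<^sup>2 + c\<^sup>2 / (4 * rho)) - c * s"
    using rho_pos by (simp_all add: field_simps power2_eq_square)
  have t: "\<tau> = of_real (Re \<tau>) + \<i> * of_real (Im \<tau>)" "cnj \<tau> = of_real (Re \<tau>) - \<i> * of_real (Im \<tau>)"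
    by (simp_all add: complex_eq_iff)
  define E where "E = rho * s\<^sup>2 + c\<^sup>2 / (4 * rho)"
  have key: "\<tau> * of_real (E + c * s) - cnj \<tau> * of_real (E - c * s) = 2 * \<i> * of_real (Im \<tau> * E) + 2 * of_real (Re \<tau> * c * s)"
    by (subst t(1), subst t(2)) (simp add: algebra_simps)
  have "gau P \<tau> ?x = gau P \<tau> (wv v) * exp (of_real pi * \<i> * (\<tau> * of_real (E + c * s) - cnj \<tau> * of_real (E - c * s)))"
    unfolding gau_def np nm sq E_def[symmetric] by (simp add: algebra_simps flip: exp_add)
  also have "of_real pi * \<i> * (\<tau> * of_real (E + c * s) - cnj \<tau> * of_real (E - c * s))
     = of_real (- pi * Im \<tau> * c\<^sup>2 / (2 * rho)) + (- of_real pi * of_real (2 * Im \<tau> * rho) * of_real (s\<^sup>2) - 2 * of_real pi * \<i> * of_real (- (Re \<tau> * c)) * of_real s)"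
    unfolding key using rho_pos by (simp add: E_def algebra_simps)
  finally show ?thesis
    by (simp only: exp_add exp_of_real gker_def mult.assoc)
qed

text \<open>The Fourier transform along the line through \<open>v\<close> in the direction of
  \<open>U\<close>.\<close>

definition psi :: "complex \<Rightarrow> 'e \<Rightarrow> real \<Rightarrow> complex" where
  "psi \<tau> v d = (\<integral>s. FF \<tau> (v + s *\<^sub>R U) * ch (d * s) \<partial>lborel)"

definition dlt :: real where "dlt = (if ea = eb then 1 else 0)"

text \<open>The constant term of the coordinate \<open>e\<close> along the centered line, see
  \<open>coord_line\<close>.\<close>

definition alp :: "'e \<Rightarrow> 'e \<Rightarrow> real" where
  "alp e v = wv v \<bullet> e + bj v U * (U \<bullet> e) / (2 * rho)"

lemma coord_line:
  assumes "e \<in> P"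
  shows "(v + (s - mm v) *\<^sub>R U) \<bullet> e = alp e v + s * (U \<bullet> e)"
proof -
  have e: "e \<in> Basis" using assms P by auto
  have U: "U \<bullet> e = pU \<bullet> e" and m: "mU \<bullet> e = 0"
    using e assms by (simp_all add: pU_def mU_def ppart_component npart_component)
  show ?thesis using rho_pos
    by (simp add: alp_def wv_def inner_add_left inner_diff_left U m mm_def bj_U_eq field_simps)
qed

lemma psi_explicit:
  fixes v :: 'e and d :: real and \<tau> :: complex
  defines "c \<equiv> bj v U" and "\<xi> \<equiv> Re \<tau> * bj v U + d" and "A \<equiv> 2 * Im \<tau> * rho"
    and "pa \<equiv> U \<bullet> ea" and "pb \<equiv> U \<bullet> eb"
  assumes y: "Im \<tau> > 0"
  shows "psi \<tau> v d = gau P \<tau> (wv v) * ch (- (d * mm v)) *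
     of_real (exp (- pi * Im \<tau> * c\<^sup>2 / (2 * rho)) * (exp (- pi * \<xi>\<^sup>2 / A) / sqrt A)) *
     (of_real (2 * alp ea v * alp eb v - dlt / (2 * pi * Im \<tau>) + 2 * pa * pb * (1 / (2 * pi * A) - \<xi>\<^sup>2 / A\<^sup>2))
       + \<i> * of_real (2 * (alp ea v * pb + alp eb v * pa) * (\<xi> / A)))"
proof -
  have A: "A > 0" using y rho_pos by (simp add: A_def)
  have ReA: "Re (complex_of_real A) > 0" using A by simp
  let ?p = "complex_of_real (- \<xi>)"
  let ?C = "gau P \<tau> (wv v) * of_real (exp (- pi * Im \<tau> * c\<^sup>2 / (2 * rho))) * ch (- (d * mm v))"
  let ?q0 = "2 * alp ea v * alp eb v - dlt / (2 * pi * Im \<tau>)"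
  let ?q1 = "2 * (alp ea v * pb + alp eb v * pa)"
  let ?q2 = "2 * pa * pb"
  have I: "integrable lborel (\<lambda>s. of_real (s ^ k) * gker (of_real A) ?p s)" for k
    by (rule gmom_integrable[OF ReA])
  let ?g = "\<lambda>s. FF \<tau> (v + s *\<^sub>R U) * ch (d * s)"
  have g_meas: "?g \<in> borel_measurable borel"
    unfolding FF_hgauss by (intro borel_measurable_continuous_onI continuous_intros)
  have g: "?g (s - mm v) = ?C * (of_real ?q0 * (of_real (s ^ 0) * gker (of_real A) ?p s)
      + of_real ?q1 * (of_real (s ^ 1) * gker (of_real A) ?p s) + of_real ?q2 * (of_real (s ^ 2) * gker (of_real A) ?p s))" for s
  proof -
    let ?x = "v + (s - mm v) *\<^sub>R U"
    have q: "qab (Im \<tau>) ?x = ?q0 + ?q1 * s + ?q2 * s\<^sup>2"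
      unfolding qab_def coord_line[OF ab(1)] coord_line[OF ab(2)]
      by (simp add: dlt_def pa_def pb_def algebra_simps power2_eq_square)
    have h: "gker (of_real A) (of_real (- (Re \<tau> * c))) s * ch (d * (s - mm v)) = ch (- (d * mm v)) * gker (of_real A) ?p s"
      by (simp add: gker_def ch_exp \<xi>_def c_def algebra_simps flip: exp_add)
    have e: "gau P \<tau> ?x * ch (d * (s - mm v)) = ?C * gker (of_real A) ?p s"
      unfolding gau_line[OF y] c_def[symmetric] A_def[symmetric] by (simp only: mult.assoc h)
    have "?g (s - mm v) = of_real (qab (Im \<tau>) ?x) * (gau P \<tau> ?x * ch (d * (s - mm v)))"
      by (simp add: FF_def mult.assoc)
    also have "\<dots> = of_real (?q0 + ?q1 * s + ?q2 * s\<^sup>2) * (?C * gker (of_real A) ?p s)"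
      unfolding e q ..
    finally show ?thesis by (simp add: algebra_simps)
  qed
  have "psi \<tau> v d = (\<integral>s. ?g (s + (- mm v)) \<partial>lborel)"
    unfolding psi_def by (rule lborel_integral_shift(1)[OF g_meas, symmetric])
  also have "\<dots> = (\<integral>s. ?C * (of_real ?q0 * (of_real (s ^ 0) * gker (of_real A) ?p s)
      + of_real ?q1 * (of_real (s ^ 1) * gker (of_real A) ?p s) + of_real ?q2 * (of_real (s ^ 2) * gker (of_real A) ?p s)) \<partial>lborel)"
    unfolding add_uminus_conv_diff g ..
  also have "\<dots> = ?C * (of_real ?q0 * gmom 0 (of_real A) ?p + of_real ?q1 * gmom 1 (of_real A) ?p + of_real ?q2 * gmom 2 (of_real A) ?p)"
    unfolding gmom_def
    by (subst integral_mult_right_zero, subst Bochner_Integration.integral_add[OF Bochner_Integration.integrable_add[OF integrable_mult_right[OF I] integrable_mult_right[OF I]] integrable_mult_right[OF I]],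
        subst Bochner_Integration.integral_add[OF integrable_mult_right[OF I] integrable_mult_right[OF I]])
       (simp only: integral_mult_right_zero)
  also have "gmom 1 (of_real A) ?p = \<i> * of_real (\<xi> / A) * gmom 0 (of_real A) ?p"
    unfolding gmom_recurrences(1)[OF ReA] by simp
  also have "gmom 2 (of_real A) ?p = of_real (1 / (2 * pi * A) - \<xi>\<^sup>2 / A\<^sup>2) * gmom 0 (of_real A) ?p"
    unfolding gmom_recurrences(2)[OF ReA] by simp
  also have "gmom 0 (of_real A) ?p = of_real (exp (- pi * \<xi>\<^sup>2 / A) / sqrt A)"
    unfolding gmom_0_char[OF ReA, of ?p] gmom_0_real[OF A] by (simp flip: exp_of_real)
  finally have "psi \<tau> v d = ?C * (of_real ?q0 * of_real (exp (- pi * \<xi>\<^sup>2 / A) / sqrt A)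
      + of_real ?q1 * (\<i> * of_real (\<xi> / A) * of_real (exp (- pi * \<xi>\<^sup>2 / A) / sqrt A))
      + of_real ?q2 * (of_real (1 / (2 * pi * A) - \<xi>\<^sup>2 / A\<^sup>2) * of_real (exp (- pi * \<xi>\<^sup>2 / A) / sqrt A)))" .
  moreover have "(g * E * w) * (a * K + b * (\<i> * X * K) + c * (Y * K)) = g * w * (E * K) * ((a + c * Y) + \<i> * (b * X))"
    for g E w a b c X Y K :: complex
    by (simp add: algebra_simps)
  ultimately show ?thesis
    by (simp only: of_real_add[of ?q0] of_real_mult[of ?q1] of_real_mult[of ?q2]
        of_real_mult[of "exp (- pi * Im \<tau> * c\<^sup>2 / (2 * rho))"])
qed

lemma FF_shift:
  fixes v :: 'e
  assumes "\<tau>' = \<tau> + 1"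
  shows "FF \<tau>' x = FF \<tau> x * ch (bj x x / 2)"
  unfolding assms FF_def gau_add_1 bj_def by simp

definition VV :: "'e set" where "VV = {v \<in> Lam. bj v U' = 0}"

definition VC :: "real \<Rightarrow> 'e set" where "VC c = {v \<in> VV. bj v U = c}"

lemma Lam_closed: "x \<in> Lam \<Longrightarrow> y \<in> Lam \<Longrightarrow> x + y \<in> Lam" "m \<in> \<int> \<Longrightarrow> x \<in> Lam \<Longrightarrow> m *\<^sub>R x \<in> Lam"
proof -
  interpret linear M by (rule M)
  show "x \<in> Lam \<Longrightarrow> y \<in> Lam \<Longrightarrow> x + y \<in> Lam"
    unfolding Lam_def by (auto simp flip: add intro!: imageI zlat_closed(3))
  show "m *\<^sub>R x \<in> Lam" if m: "m \<in> \<int>" and x: "x \<in> Lam"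
  proof -
    obtain k where k: "k \<in> zlat" "x = M k" using x by (auto simp: Lam_def)
    have "m *\<^sub>R k \<in> zlat" using k m by (auto simp: zlat_def)
    thus ?thesis unfolding Lam_def k scale[symmetric] by (rule imageI)
  qed
qed

lemma U_Lam: "U \<in> Lam" "U' \<in> Lam"
  using U_in by (auto simp: Lam_def)

lemma bj_int: "x \<in> Lam \<Longrightarrow> y \<in> Lam \<Longrightarrow> bj x y \<in> \<int>"
  using dual[of y] by (auto simp: Lam_def bj_def)

text \<open>Translation multiplies the integrand by \<open>e(q(x))\<close>, which on the line through a vector
  of an even lattice is the character \<open>e(s (v, U))\<close>.\<close>

lemma psi_T:
  assumes "v \<in> VV" and d: "d \<in> \<int>"
  shows "psi (\<tau> + 1) v d = psi \<tau> v (bj v U + d)"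
proof -
  have "FF (\<tau> + 1) (v + s *\<^sub>R U) * ch (d * s) = FF \<tau> (v + s *\<^sub>R U) * ch ((bj v U + d) * s)" for s
  proof -
    have "bj (v + s *\<^sub>R U) (v + s *\<^sub>R U) / 2 = bj v v / 2 + s * bj v U"
      by (simp add: bj_sym[of U v])
    moreover have "ch (bj v v / 2) = 1"
      using assms even[of v] by (intro ch_int) (auto simp: VV_def Lam_def bj_def)
    ultimately have "ch (bj (v + s *\<^sub>R U) (v + s *\<^sub>R U) / 2) = ch (s * bj v U)"
      by (simp only: ch_add mult_1_left)
    hence "FF (\<tau> + 1) (v + s *\<^sub>R U) * ch (d * s) = FF \<tau> (v + s *\<^sub>R U) * (ch (s * bj v U) * ch (d * s))"
      unfolding FF_shift[OF refl] by (simp only: mult.assoc)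
    moreover have "ch (s * bj v U) * ch (d * s) = ch ((bj v U + d) * s)"
      by (simp add: algebra_simps flip: ch_add)
    ultimately show ?thesis by (simp only:)
  qed
  thus ?thesis by (simp add: psi_def)
qed

end

section \<open>Fourier coefficients of the theta function\<close>

lemma one_plus_le_exp:
  fixes S \<eta> :: real assumes "\<eta> > 0" "S \<ge> 0" shows "1 + S \<le> (1 + 1 / \<eta>) * exp (\<eta> * S)"
proof -
  have "1 + S \<le> (1 + 1 / \<eta>) * (1 + \<eta> * S)" using assms by (simp add: field_simps)
  also have "\<dots> \<le> (1 + 1 / \<eta>) * exp (\<eta> * S)"
    using assms exp_ge_add_one_self[of "\<eta> * S"] by (intro mult_left_mono) auto
  finally show ?thesis .
qed

lemma one_plus_div_le: "X \<ge> 0 \<Longrightarrow> y > 0 \<Longrightarrow> 1 + X / y \<le> (1 + X) * (1 + 1 / (y::real))"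
  by (simp add: field_simps)

lemma norm_Re_Im_le: "norm (complex_of_real r + \<i> * of_real s) \<le> \<bar>r\<bar> + \<bar>s\<bar>"
  by (rule order_trans[OF norm_triangle_ineq]) (simp add: norm_mult)

lemma zlat_pair: "(c, d) \<in> (zlat :: (real \<times> real) set) \<longleftrightarrow> c \<in> \<int> \<and> d \<in> \<int>"
  by (auto simp: zlat_def Basis_prod_def)

context theta_data begin

text \<open>On the hyperplane \<open>(v, U') = 0\<close> the pair of \<open>wv v\<close> and \<open>(v,
  U)\<close> determines \<open>v\<close>, so its norm controls the norm of \<open>v\<close>.\<close>

lemma wv_lower:
  obtains e where "e > 0" "\<And>v. bj v U' = 0 \<Longrightarrow> e * (norm v)\<^sup>2 \<le> (norm (wv v))\<^sup>2 + (bj v U)\<^sup>2"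
proof -
  let ?s = "{v. bj v U' = 0}" and ?f = "\<lambda>v. (wv v, bj v U)"
  have sub: "subspace ?s"
    using bj_linear(3)[of 0] by (auto simp: subspace_def)
  have "linear ?f"
    using linear_wv by (intro linearI) (simp_all add: linear_add linear_scale)
  hence bl: "bounded_linear ?f" by (simp add: linear_conv_bounded_linear)
  have inj: "\<forall>v\<in>?s. ?f v = 0 \<longrightarrow> v = 0"
  proof (intro ballI impI)
    fix v assume v: "v \<in> ?s" and f: "?f v = 0"
    have "wv v = 0" and "v \<bullet> pU = v \<bullet> mU" using f by (auto simp: bj_U_eq zero_prod_def)
    hence "v = (v \<bullet> pU / rho) *\<^sub>R (pU + mU)" by (simp add: wv_def algebra_simps)
    hence vU: "v = (v \<bullet> pU / rho) *\<^sub>R U" by (simp only: pU_mU(3)[symmetric])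
    define r where "r = v \<bullet> pU / rho"
    have "v = r *\<^sub>R U" using vU by (simp only: r_def)
    moreover have "bj (r *\<^sub>R U) U' = r" by simp
    ultimately show "v = 0" using v by simp
  qed
  obtain e where e: "e > 0" "\<And>v. v \<in> ?s \<Longrightarrow> e * norm v \<le> norm (?f v)"
    using injective_imp_isometric[OF closed_subspace[OF sub] sub bl inj] by blast
  show ?thesis
  proof (rule that[of "e\<^sup>2"])
    fix v assume "bj v U' = 0"
    hence "e * norm v \<le> norm (?f v)" by (intro e) simp
    hence "(e * norm v)\<^sup>2 \<le> (norm (?f v))\<^sup>2" using e(1) by (intro power_mono) auto
    thus "e\<^sup>2 * (norm v)\<^sup>2 \<le> (norm (wv v))\<^sup>2 + (bj v U)\<^sup>2"
      by (simp add: norm_Pair power_mult_distrib)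
  qed (use e in simp)
qed

lemma abs_inner_P: "e \<in> P \<Longrightarrow> \<bar>x \<bullet> e\<bar> \<le> norm x"
  using P(1) by (intro Basis_le_norm) auto

text \<open>Gaussian decay in all variables of the double sum over \<open>v\<close> and \<open>d\<close>, for
  fixed \<open>\<tau>\<close>.\<close>

lemma psi_bound:
  assumes y: "Im \<tau> > 0"
  obtains K \<eta> where "\<eta> > 0" "K > 0" "\<And>v d. norm (psi \<tau> v d) \<le> K * exp (- \<eta> * ((norm (wv v))\<^sup>2 + (bj v U)\<^sup>2 + d\<^sup>2))"
proof -
  define x where "x = Re \<tau>"
  define Y where "Y = Im \<tau>"
  have Y: "Y > 0" using y by (simp add: Y_def)
  define A where "A = 2 * Y * rho"
  have A: "A > 0" using Y rho_pos by (simp add: A_def)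
  define pa pb where "pa = U \<bullet> ea" and "pb = U \<bullet> eb"
  define k where "k = 1 + \<bar>pa\<bar> / (2 * rho) + \<bar>pb\<bar> / (2 * rho) + \<bar>pa\<bar> + \<bar>pb\<bar>"
  have kpos: "k \<ge> 1" using rho_pos by (simp add: k_def)
  have pk: "\<bar>pa\<bar> \<le> k" "\<bar>pb\<bar> \<le> k" "1 + \<bar>pa\<bar> / (2 * rho) \<le> k" "1 + \<bar>pb\<bar> / (2 * rho) \<le> k"
    using rho_pos by (simp_all add: k_def)
  define Kp where "Kp = 2 * k\<^sup>2 + \<bar>dlt / (2 * pi * Y)\<bar> + 2 * k\<^sup>2 * (1 / (2 * pi * A)) + 2 * k\<^sup>2 / A\<^sup>2 + 4 * k\<^sup>2 / A"
  have Kp: "Kp > 0" using kpos A by (auto simp: Kp_def intro!: add_pos_nonneg)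
  \<comment> \<open>Half of the smallest exponent is kept; the other half absorbs the polynomial factor.\<close>
  define \<eta> where "\<eta> = Min {pi * Y, pi * Y / (2 * rho), pi / A} / 2"
  have \<eta>: "\<eta> > 0" "2 * \<eta> \<le> pi * Y" "2 * \<eta> \<le> pi * Y / (2 * rho)" "2 * \<eta> \<le> pi / A"
    using Y A rho_pos by (auto simp: \<eta>_def)
  define \<eta>' where "\<eta>' = \<eta> / (3 + 2 * x\<^sup>2)"
  have \<eta>': "\<eta>' > 0" using \<eta> by (simp add: \<eta>'_def add_pos_nonneg)
  define K where "K = Kp * (1 + 1 / \<eta>) / sqrt A"
  have Kpos: "K > 0" using Kp \<eta> A by (simp add: K_def add_pos_pos)
  show ?thesis
  proof (rule that[OF \<eta>' Kpos])
    fix v d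
    define c where "c = bj v U"
    define \<xi> where "\<xi> = x * c + d"
    define S where "S = (norm (wv v))\<^sup>2 + c\<^sup>2 + \<xi>\<^sup>2"
    define r where "r = sqrt S"
    have S: "S \<ge> 0" by (simp add: S_def)
    have rr: "r\<^sup>2 = S" "r \<ge> 0" using S by (simp_all add: r_def)
    have rle: "norm (wv v) \<le> r" "\<bar>c\<bar> \<le> r" "\<bar>\<xi>\<bar> \<le> r"
      unfolding r_def S_def by (auto intro!: real_le_rsqrt)
    have al: "\<bar>alp e v\<bar> \<le> k * r" if "e \<in> P" "1 + \<bar>U \<bullet> e\<bar> / (2 * rho) \<le> k" for e
    proof -
      have "\<bar>alp e v\<bar> \<le> \<bar>wv v \<bullet> e\<bar> + \<bar>c * (U \<bullet> e) / (2 * rho)\<bar>"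
        unfolding alp_def c_def by (rule abs_triangle_ineq)
      also have "\<bar>c * (U \<bullet> e) / (2 * rho)\<bar> = \<bar>c\<bar> * (\<bar>U \<bullet> e\<bar> / (2 * rho))"
        using rho_pos by (simp add: abs_mult)
      also have "\<bar>wv v \<bullet> e\<bar> + \<bar>c\<bar> * (\<bar>U \<bullet> e\<bar> / (2 * rho)) \<le> r + r * (\<bar>U \<bullet> e\<bar> / (2 * rho))"
        using rle rho_pos abs_inner_P[OF that(1), of "wv v"] by (intro add_mono mult_right_mono) auto
      also have "\<dots> = (1 + \<bar>U \<bullet> e\<bar> / (2 * rho)) * r" by (simp add: algebra_simps)
      also have "\<dots> \<le> k * r" using that rr by (intro mult_right_mono)
      finally show ?thesis .
    qed
    have aa: "\<bar>alp ea v\<bar> \<le> k * r" and ab': "\<bar>alp eb v\<bar> \<le> k * r"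
      using al ab pk by (auto simp: pa_def pb_def)
    let ?R = "2 * alp ea v * alp eb v - dlt / (2 * pi * Y) + 2 * pa * pb * (1 / (2 * pi * A) - \<xi>\<^sup>2 / A\<^sup>2)"
    let ?I = "2 * (alp ea v * pb + alp eb v * pa) * (\<xi> / A)"
    have m1: "\<bar>2 * alp ea v * alp eb v\<bar> \<le> 2 * k\<^sup>2 * S"
    proof -
      have "\<bar>alp ea v\<bar> * \<bar>alp eb v\<bar> \<le> (k * r) * (k * r)" using aa ab' kpos rr by (intro mult_mono) auto
      thus ?thesis by (simp add: abs_mult rr(1)[symmetric] power2_eq_square mult_ac)
    qed
    have papb: "\<bar>pa * pb\<bar> \<le> k\<^sup>2"
      unfolding abs_mult power2_eq_square using pk kpos by (intro mult_mono) auto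
    have m2: "\<bar>2 * pa * pb * (1 / (2 * pi * A))\<bar> \<le> 2 * k\<^sup>2 * (1 / (2 * pi * A))"
      using mult_right_mono[OF papb, of "2 * (1 / (2 * pi * A))"] A by (simp add: abs_mult mult_ac)
    have m3: "\<bar>2 * pa * pb * (\<xi>\<^sup>2 / A\<^sup>2)\<bar> \<le> 2 * k\<^sup>2 / A\<^sup>2 * S"
    proof -
      have "\<bar>pa * pb\<bar> * (2 * (\<xi>\<^sup>2 / A\<^sup>2)) \<le> k\<^sup>2 * (2 * (S / A\<^sup>2))"
        using papb A by (intro mult_mono mult_left_mono divide_right_mono) (auto simp: S_def)
      thus ?thesis by (simp add: abs_mult mult_ac)
    qed
    have m4: "\<bar>?I\<bar> \<le> 4 * k\<^sup>2 / A * S"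
    proof -
      have "\<bar>alp ea v * pb + alp eb v * pa\<bar> \<le> (k * r) * k + (k * r) * k"
        using aa ab' pk kpos rr
        by (intro order_trans[OF abs_triangle_ineq] add_mono) (auto simp: abs_mult intro!: mult_mono)
      hence h: "\<bar>alp ea v * pb + alp eb v * pa\<bar> * (\<bar>\<xi>\<bar> / A) \<le> ((k * r) * k + (k * r) * k) * (r / A)"
        using rle(3) A kpos rr by (intro mult_mono divide_right_mono) auto
      have e1: "\<bar>?I\<bar> = 2 * (\<bar>alp ea v * pb + alp eb v * pa\<bar> * (\<bar>\<xi>\<bar> / A))"
      proof -
        have "?I = 2 * ((alp ea v * pb + alp eb v * pa) * (\<xi> / A))" by (simp only: mult.assoc)
        moreover have "\<bar>\<xi> / A\<bar> = \<bar>\<xi>\<bar> / A" using A by simp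
        ultimately show ?thesis by (simp only: abs_mult abs_numeral)
      qed
      have e2: "4 * k\<^sup>2 / A * S = 2 * (((k * r) * k + (k * r) * k) * (r / A))"
        by (simp add: rr(1)[symmetric] power2_eq_square)
      show ?thesis unfolding e1 e2 by (rule mult_left_mono[OF h]) simp
    qed
    have "norm (of_real ?R + \<i> * of_real ?I) \<le> \<bar>?R\<bar> + \<bar>?I\<bar>"
      by (rule norm_Re_Im_le)
    also have "\<bar>?R\<bar> + \<bar>?I\<bar> \<le> 2 * k\<^sup>2 * S + \<bar>dlt / (2 * pi * Y)\<bar> + 2 * k\<^sup>2 * (1 / (2 * pi * A)) + 2 * k\<^sup>2 / A\<^sup>2 * S + 4 * k\<^sup>2 / A * S"
    proof -
      have "?R = 2 * alp ea v * alp eb v - dlt / (2 * pi * Y) + 2 * pa * pb * (1 / (2 * pi * A)) - 2 * pa * pb * (\<xi>\<^sup>2 / A\<^sup>2)"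
        by (simp only: right_diff_distrib add_diff_eq)
      thus ?thesis using m1 m2 m3 m4 by linarith
    qed
    also have "\<dots> \<le> Kp * (1 + S)"
    proof -
      have "0 \<le> \<bar>dlt / (2 * pi * Y)\<bar> * S" "0 \<le> 2 * k\<^sup>2 * (1 / (2 * pi * A)) * S" "0 \<le> 2 * k\<^sup>2" "0 \<le> 2 * k\<^sup>2 / A\<^sup>2" "0 \<le> 4 * k\<^sup>2 / A"
        using S A by simp_all
      thus ?thesis unfolding Kp_def by (simp add: distrib_left distrib_right)
    qed
    also have "\<dots> \<le> Kp * ((1 + 1 / \<eta>) * exp (\<eta> * S))"
      using Kp one_plus_le_exp[OF \<eta>(1) S] by (intro mult_left_mono) auto
    finally have poly: "norm (of_real ?R + \<i> * of_real ?I) \<le> Kp * ((1 + 1 / \<eta>) * exp (\<eta> * S))" .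
    have ex: "exp (- pi * Y * (norm (wv v))\<^sup>2) * (exp (- pi * Y * c\<^sup>2 / (2 * rho)) * exp (- pi * \<xi>\<^sup>2 / A)) \<le> exp (- (2 * \<eta>) * S)"
    proof -
      have "(2 * \<eta>) * S \<le> pi * Y * (norm (wv v))\<^sup>2 + pi * Y / (2 * rho) * c\<^sup>2 + pi / A * \<xi>\<^sup>2"
        unfolding S_def distrib_left by (intro add_mono mult_right_mono \<eta>) auto
      thus ?thesis by (simp add: mult_exp_exp)
    qed
    have dS: "(norm (wv v))\<^sup>2 + c\<^sup>2 + d\<^sup>2 \<le> (3 + 2 * x\<^sup>2) * S"
    proof -
      have "d\<^sup>2 = (\<xi> - x * c)\<^sup>2" by (simp add: \<xi>_def)
      also have "\<dots> \<le> 2 * \<xi>\<^sup>2 + 2 * (x * c)\<^sup>2"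
        using sum_squares_bound[of \<xi> "- (x * c)"] by (simp add: power2_diff)
      finally have d: "d\<^sup>2 \<le> 2 * \<xi>\<^sup>2 + 2 * x\<^sup>2 * c\<^sup>2" by (simp add: power_mult_distrib)
      have "0 \<le> x\<^sup>2 * (norm (wv v))\<^sup>2" "0 \<le> x\<^sup>2 * \<xi>\<^sup>2" "0 \<le> c\<^sup>2" "0 \<le> (norm (wv v))\<^sup>2" "0 \<le> \<xi>\<^sup>2" by simp_all
      moreover have "(3 + 2 * x\<^sup>2) * S = 3 * (norm (wv v))\<^sup>2 + 3 * c\<^sup>2 + 3 * \<xi>\<^sup>2
          + 2 * (x\<^sup>2 * (norm (wv v))\<^sup>2) + 2 * x\<^sup>2 * c\<^sup>2 + 2 * (x\<^sup>2 * \<xi>\<^sup>2)"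
        unfolding S_def by (simp add: algebra_simps)
      ultimately show ?thesis using d by linarith
    qed
    have "norm (psi \<tau> v d) = exp (- pi * Y * (norm (wv v))\<^sup>2) * (exp (- pi * Y * c\<^sup>2 / (2 * rho)) * (exp (- pi * \<xi>\<^sup>2 / A) / sqrt A)) * norm (of_real ?R + \<i> * of_real ?I)"
    proof -
      let ?r = "exp (- pi * Y * c\<^sup>2 / (2 * rho)) * (exp (- pi * \<xi>\<^sup>2 / A) / sqrt A)"
      have "psi \<tau> v d = gau P \<tau> (wv v) * ch (- (d * mm v)) * of_real ?r * (of_real ?R + \<i> * of_real ?I)"
        unfolding c_def \<xi>_def x_def Y_def A_def pa_def pb_def by (rule psi_explicit[OF y])
      moreover have "\<bar>?r\<bar> = ?r" using A by simp
      ultimately show ?thesis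
        by (simp only: norm_mult[of "_ * _ * _"] norm_mult[of "_ * _" "of_real _"] norm_mult[of "gau _ _ _"] norm_gau norm_ch norm_of_real Y_def mult_1_right)
    qed
    also have "\<dots> \<le> (exp (- (2 * \<eta>) * S) / sqrt A) * (Kp * ((1 + 1 / \<eta>) * exp (\<eta> * S)))"
    proof (rule mult_mono[OF _ poly])
      show "exp (- pi * Y * (norm (wv v))\<^sup>2) * (exp (- pi * Y * c\<^sup>2 / (2 * rho)) * (exp (- pi * \<xi>\<^sup>2 / A) / sqrt A)) \<le> exp (- (2 * \<eta>) * S) / sqrt A"
        using divide_right_mono[OF ex, of "sqrt A"] A by simp
    qed (use A in auto)
    also have "\<dots> = K * (exp (- (2 * \<eta>) * S) * exp (\<eta> * S))" by (simp add: K_def)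
    also have "\<dots> = K * exp (- \<eta> * S)" by (simp add: mult_exp_exp)
    also have "\<dots> \<le> K * exp (- \<eta>' * ((norm (wv v))\<^sup>2 + c\<^sup>2 + d\<^sup>2))"
    proof -
      have q: "3 + 2 * x\<^sup>2 > 0" by (simp add: add_pos_nonneg)
      have "\<eta>' * ((norm (wv v))\<^sup>2 + c\<^sup>2 + d\<^sup>2) \<le> \<eta>' * ((3 + 2 * x\<^sup>2) * S)"
        using dS \<eta>' by (intro mult_left_mono) auto
      also have "\<dots> = \<eta> * S" using q by (simp add: \<eta>'_def)
      finally show ?thesis using Kpos by simp
    qed
    finally show "norm (psi \<tau> v d) \<le> K * exp (- \<eta>' * ((norm (wv v))\<^sup>2 + (bj v U)\<^sup>2 + d\<^sup>2))"
      by (simp add: c_def)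
  qed
qed

lemma psi_summable:
  assumes y: "Im \<tau> > 0"
  shows "(\<lambda>(v, d). norm (psi \<tau> v d)) summable_on VV \<times> \<int>"
proof -
  obtain K \<eta> where K: "\<eta> > 0" "K > 0" "\<And>v d. norm (psi \<tau> v d) \<le> K * exp (- \<eta> * ((norm (wv v))\<^sup>2 + (bj v U)\<^sup>2 + d\<^sup>2))"
    using psi_bound[OF y] by metis
  obtain e where e: "e > 0" "\<And>v. bj v U' = 0 \<Longrightarrow> e * (norm v)\<^sup>2 \<le> (norm (wv v))\<^sup>2 + (bj v U)\<^sup>2"
    using wv_lower by metis
  obtain w :: "'e \<Rightarrow> real" and B where w: "B > 0" "w summable_on (M ` zlat)" "\<And>x. w x \<ge> 0"
    "\<And>\<epsilon> x. \<epsilon> > 0 \<Longrightarrow> x \<in> M ` zlat \<Longrightarrow> exp (- \<epsilon> * (norm x)\<^sup>2) \<le> (1 + B / \<epsilon>) ^ DIM('e) * w x"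
    by (rule lattice_weight[OF M], rule that)
  define C where "C = K * (1 + B / (\<eta> * e)) ^ DIM('e) * (1 + 1 / \<eta>)"
  have sm: "(\<lambda>(v, d::real). (C * w v) * zwt d) summable_on VV \<times> \<int>"
  proof (rule summable_on_times_nonneg)
    show "(\<lambda>v. C * w v) summable_on VV"
      by (intro summable_on_cmult_right summable_on_subset_banach[OF w(2)]) (auto simp: VV_def Lam_def)
    show "zwt summable_on (\<int> :: real set)" using zwt_summable unfolding zlat_real[symmetric] .
  qed (use w K e in \<open>auto simp: C_def\<close>)
  have le: "norm (psi \<tau> v d) \<le> (C * w v) * zwt d" if v: "v \<in> VV" for v d
  proof -
    have "exp (- \<eta> * ((norm (wv v))\<^sup>2 + (bj v U)\<^sup>2 + d\<^sup>2)) \<le> exp (- (\<eta> * e) * (norm v)\<^sup>2) * exp (- \<eta> * (norm d)\<^sup>2)"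
      using mult_left_mono[OF e(2)[of v], of \<eta>] v K(1)
      by (simp add: VV_def mult_exp_exp algebra_simps)
    also have "\<dots> \<le> ((1 + B / (\<eta> * e)) ^ DIM('e) * w v) * ((1 + 1 / \<eta>) ^ DIM(real) * zwt d)"
      using v K e w by (intro mult_mono w(4) gauss_le_zwt) (auto simp: VV_def Lam_def)
    finally have "exp (- \<eta> * ((norm (wv v))\<^sup>2 + (bj v U)\<^sup>2 + d\<^sup>2)) \<le> ((1 + B / (\<eta> * e)) ^ DIM('e) * w v) * ((1 + 1 / \<eta>) * zwt d)" by simp
    from order_trans[OF K(3) mult_left_mono[OF this, of K]] K(2)
    show ?thesis by (simp add: C_def mult_ac)
  qed
  show ?thesis
    by (rule summable_on_comparison_test[OF sm]) (use le in auto)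
qed

text \<open>By \<open>theta_sum_expansion\<close> these are the Fourier coefficients of the theta function in
  the parameters \<open>(t, s)\<close>.\<close>

definition phi :: "complex \<Rightarrow> real \<Rightarrow> real \<Rightarrow> complex" where
  "phi \<tau> c d = (\<Sum>\<^sub>\<infinity>v\<in>VC c. psi \<tau> v d)"

lemma VV_fibre_bij:
  "bij_betw (\<lambda>(v, d). ((bj v U, d), v)) (VV \<times> (\<int> :: real set)) (Sigma zlat (\<lambda>(c, d). VC c))"
proof (rule bij_betwI[of _ _ _ "\<lambda>((c, d), v). (v, d)"])
  show "(\<lambda>(v, d). ((bj v U, d), v)) \<in> VV \<times> (\<int> :: real set) \<rightarrow> Sigma zlat (\<lambda>(c, d). VC c)"
    using bj_int[OF _ U_Lam(1)] by (auto simp: VC_def VV_def zlat_pair)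
  show "(\<lambda>((c, d), v). (v, d)) \<in> Sigma zlat (\<lambda>(c, d). VC c) \<rightarrow> VV \<times> (\<int> :: real set)"
    by (auto simp: VC_def zlat_pair)
qed (auto simp: VC_def)

lemma psi_summable_Sigma:
  assumes "Im \<tau> > 0"
  shows "(\<lambda>(z, v). norm (psi \<tau> v (snd z))) summable_on Sigma zlat (\<lambda>(c, d). VC c)"
  using summable_on_reindex_bij_betw[OF VV_fibre_bij, of "\<lambda>(z, v). norm (psi \<tau> v (snd z))"] psi_summable[OF assms]
  by (simp add: case_prod_unfold)

lemma phi_summable:
  assumes "Im \<tau> > 0"
  shows "(\<lambda>z. norm (phi \<tau> (fst z) (snd z))) summable_on zlat"
proof (rule summable_on_comparison_test)
  have *: "(\<lambda>p. norm (case p of (z, v) \<Rightarrow> psi \<tau> v (snd z))) summable_on Sigma zlat (\<lambda>(c, d). VC c)"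
    using psi_summable_Sigma[OF assms] by (simp add: case_prod_unfold)
  show "(\<lambda>z. \<Sum>\<^sub>\<infinity>v\<in>VC (fst z). norm (psi \<tau> v (snd z))) summable_on zlat"
    using summable_on_Sigma_banach[OF psi_summable_Sigma[OF assms]] by (simp add: case_prod_unfold)
  show "norm (phi \<tau> (fst z) (snd z)) \<le> (\<Sum>\<^sub>\<infinity>v\<in>VC (fst z). norm (psi \<tau> v (snd z)))" if "z \<in> zlat" for z
    unfolding phi_def
    using *[unfolded Infinite_Sum.abs_summable_on_Sigma_iff] that
    by (intro norm_infsum_bound) (auto simp: case_prod_unfold)
qed auto

lemma FF_bound:
  assumes y: "Im \<tau> > 0"
  obtains C where "\<And>x. norm (FF \<tau> x) \<le> C * exp (- (pi * Im \<tau> / 2) * (norm x)\<^sup>2)"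
proof -
  obtain C where "\<And>x. norm (hgauss P dgab \<tau> x) \<le> C * exp (- (pi * Im \<tau> / 2) * (norm x)\<^sup>2)"
    using hgauss_bound[OF y] by metis
  thus ?thesis by (intro that[of "2 * C"]) (simp add: FF_hgauss norm_mult)
qed

text \<open>Poisson summation over the multiples of \<open>U\<close>.\<close>

lemma psi_poisson:
  assumes y: "Im \<tau> > 0" and v: "v \<in> VV"
  shows "(\<Sum>\<^sub>\<infinity>m\<in>\<int>. FF \<tau> (v + (m + s) *\<^sub>R U)) = (\<Sum>\<^sub>\<infinity>d\<in>\<int>. psi \<tau> v d * ch (- (d * s)))"
proof -
  have e: "pi * Im \<tau> / 2 > 0" using y by simp
  obtain C where C: "\<And>x. norm (FF \<tau> x) \<le> C * exp (- (pi * Im \<tau> / 2) * (norm x)\<^sup>2)"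
    using FF_bound[OF y] by metis
  have U0: "norm U > 0" using UU(3) by auto
  define \<epsilon> where "\<epsilon> = pi * Im \<tau> / 2 / 2 * (norm U)\<^sup>2"
  define C' where "C' = C * exp ((pi * Im \<tau> / 2) * (norm (v + s *\<^sub>R U))\<^sup>2)"
  let ?F = "\<lambda>m. FF \<tau> (v + (m + s) *\<^sub>R U)"
  have bd: "norm (?F m) \<le> C' * exp (- \<epsilon> * (norm m)\<^sup>2)" for m
    using gauss_shift_bound[OF C e order_refl, of "v + s *\<^sub>R U" "m *\<^sub>R U"]
    by (simp add: C'_def \<epsilon>_def power_mult_distrib algebra_simps)
  have ft: "(\<integral>x. ?F x * ch (- (m \<bullet> x)) \<partial>lborel) = psi \<tau> v (- m) * ch (m * s)" for m
  proof -
    let ?g = "\<lambda>x. FF \<tau> (v + x *\<^sub>R U) * ch (- m * x)"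
    have g_meas: "(\<lambda>x. ?g x * ch (m * s)) \<in> borel_measurable borel"
      unfolding FF_hgauss by (intro borel_measurable_continuous_onI continuous_intros)
    have gF: "?F x * ch (- (m \<bullet> x)) = ?g (x + s) * ch (m * s)" for x
      by (simp add: mult.assoc algebra_simps flip: ch_add)
    have "(\<integral>x. ?F x * ch (- (m \<bullet> x)) \<partial>lborel) = (\<integral>x. ?g (x + s) * ch (m * s) \<partial>lborel)"
      by (simp only: gF)
    also have "\<dots> = (\<integral>x. ?g x * ch (m * s) \<partial>lborel)" by (rule lborel_integral_shift(1)[OF g_meas])
    also have "\<dots> = psi \<tau> v (- m) * ch (m * s)" unfolding psi_def by (rule integral_mult_left_zero)
    finally show ?thesis .
  qed
  have sm: "(\<lambda>d. norm (psi \<tau> v d)) summable_on \<int>"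
  proof -
    have "(\<lambda>p. norm (case p of (v, d) \<Rightarrow> psi \<tau> v d)) summable_on VV \<times> \<int>"
      using psi_summable[OF y] by (simp add: case_prod_unfold)
    thus ?thesis unfolding Infinite_Sum.abs_summable_on_Sigma_iff using v by auto
  qed
  have neg: "bij_betw uminus \<int> (\<int> :: real set)"
    by (rule bij_betwI[of _ _ _ uminus]) auto
  have "(\<Sum>\<^sub>\<infinity>m\<in>zlat. ?F m) = (\<Sum>\<^sub>\<infinity>m\<in>zlat. \<integral>x. ?F x * ch (- (m \<bullet> x)) \<partial>lborel)"
  proof (rule poisson_summation_standard[OF _ bd])
    show "continuous_on UNIV ?F" unfolding FF_hgauss by (intro continuous_intros)
    show "\<epsilon> > 0" using e U0 by (simp add: \<epsilon>_def)
    show "(\<lambda>m. norm (\<integral>x. ?F x * ch (- (m \<bullet> x)) \<partial>lborel)) summable_on zlat"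
      unfolding ft norm_mult norm_ch zlat_real
      using sm summable_on_reindex_bij_betw[OF neg, of "\<lambda>d. norm (psi \<tau> v d)"] by simp
  qed
  also have "\<dots> = (\<Sum>\<^sub>\<infinity>m\<in>\<int>. psi \<tau> v (- m) * ch (- ((- m) * s)))"
    unfolding ft zlat_real by simp
  also have "\<dots> = (\<Sum>\<^sub>\<infinity>d\<in>\<int>. psi \<tau> v d * ch (- (d * s)))"
    by (rule infsum_reindex_bij_betw[OF neg])
  finally show ?thesis by (simp only: zlat_real)
qed

lemma Lam_fibre_bij: "bij_betw (\<lambda>(v, m). v + m *\<^sub>R U) (VV \<times> \<int>) Lam"
proof (rule bij_betwI[of _ _ _ "\<lambda>x. (x - bj x U' *\<^sub>R U, bj x U')"])
  show "(\<lambda>(v, m). v + m *\<^sub>R U) \<in> VV \<times> \<int> \<rightarrow> Lam"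
    by (auto simp: VV_def intro!: Lam_closed U_Lam)
  have sub: "bj (x - y) z = bj x z - bj y z" for x y z
    using bj_linear(1)[of "x - y" y z] by simp
  show "(\<lambda>x. (x - bj x U' *\<^sub>R U, bj x U')) \<in> Lam \<rightarrow> VV \<times> \<int>"
  proof
    fix x assume x: "x \<in> Lam"
    hence i: "bj x U' \<in> \<int>" by (rule bj_int[OF _ U_Lam(2)])
    have "x + (- bj x U') *\<^sub>R U \<in> Lam" using x i by (intro Lam_closed U_Lam) auto
    thus "(x - bj x U' *\<^sub>R U, bj x U') \<in> VV \<times> \<int>" using i by (simp add: VV_def sub)
  qed
qed (auto simp: VV_def)

text \<open>Sum over the lattice line by line: \<open>\<Lambda>\<close> is the union of the lines \<open>v +
  \<int> U\<close> with \<open>(v, U') = 0\<close>, and the vectors \<open>v\<close> are grouped by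
  the integer \<open>(v, U)\<close>.\<close>

lemma theta_sum_expansion:
  assumes y: "Im \<tau> > 0"
  shows "theta_sum \<tau> s t = (\<Sum>\<^sub>\<infinity>z\<in>zlat. phi \<tau> (fst z) (snd z) * ch (- (z \<bullet> (t, s))))"
proof -
  let ?f = "\<lambda>x. FF \<tau> (x + s *\<^sub>R U) * ch (- (t * bj x U))"
  have e: "pi * Im \<tau> / 2 > 0" using y by simp
  have sm: "?f summable_on Lam"
  proof -
    obtain C where C: "\<And>x. norm (FF \<tau> x) \<le> C * exp (- (pi * Im \<tau> / 2) * (norm x)\<^sup>2)"
      using FF_bound[OF y] by metis
    obtain w :: "'e \<Rightarrow> real" and B where w: "B > 0" "w summable_on (M ` zlat)" "\<And>x. w x \<ge> 0"
      "\<And>\<epsilon> x. \<epsilon> > 0 \<Longrightarrow> x \<in> M ` zlat \<Longrightarrow> exp (- \<epsilon> * (norm x)\<^sup>2) \<le> (1 + B / \<epsilon>) ^ DIM('e) * w x"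
      by (rule lattice_weight[OF M], rule that)
    define C' where "C' = C * exp ((pi * Im \<tau> / 2) * (norm (s *\<^sub>R U))\<^sup>2)"
    have C0: "C' \<ge> 0" using order_trans[OF norm_ge_zero C[of 0]] by (simp add: C'_def)
    have "norm (?f x) \<le> C' * ((1 + B / (pi * Im \<tau> / 2 / 2)) ^ DIM('e) * w x)" if "x \<in> Lam" for x
    proof -
      have "norm (?f x) \<le> C' * exp (- (pi * Im \<tau> / 2 / 2) * (norm x)\<^sup>2)"
        using gauss_shift_bound[OF C e order_refl, of "s *\<^sub>R U" x] by (simp add: norm_mult C'_def add.commute)
      also have "\<dots> \<le> C' * ((1 + B / (pi * Im \<tau> / 2 / 2)) ^ DIM('e) * w x)"
        using that e C0 by (intro mult_left_mono w(4)) (auto simp: Lam_def)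
      finally show ?thesis .
    qed
    note le = this
    have sm: "(\<lambda>x. C' * ((1 + B / (pi * Im \<tau> / 2 / 2)) ^ DIM('e) * w x)) summable_on Lam"
      unfolding Lam_def by (intro summable_on_cmult_right w)
    have "(\<lambda>x. norm (?f x)) summable_on Lam"
      by (rule summable_on_comparison_test[OF sm]) (use le in auto)
    thus ?thesis by (rule abs_summable_summable)
  qed
  have smP: "(\<lambda>(v, m). ?f (v + m *\<^sub>R U)) summable_on VV \<times> \<int>"
    using sm summable_on_reindex_bij_betw[OF Lam_fibre_bij, of ?f] by (simp add: case_prod_unfold)
  have "theta_sum \<tau> s t = (\<Sum>\<^sub>\<infinity>(v, m)\<in>VV \<times> \<int>. ?f (v + m *\<^sub>R U))"
    unfolding theta_sum_def using infsum_reindex_bij_betw[OF Lam_fibre_bij, of ?f] by (simp add: case_prod_unfold)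
  also have "\<dots> = (\<Sum>\<^sub>\<infinity>v\<in>VV. \<Sum>\<^sub>\<infinity>m\<in>\<int>. ?f (v + m *\<^sub>R U))"
    by (rule infsum_Sigma'_banach[OF smP, symmetric])
  also have "\<dots> = (\<Sum>\<^sub>\<infinity>v\<in>VV. \<Sum>\<^sub>\<infinity>d\<in>\<int>. psi \<tau> v d * ch (- (bj v U * t + d * s)))"
  proof (rule infsum_cong)
    fix v assume v: "v \<in> VV"
    have "(\<Sum>\<^sub>\<infinity>m\<in>\<int>. ?f (v + m *\<^sub>R U)) = (\<Sum>\<^sub>\<infinity>m\<in>\<int>. ch (- (t * bj v U)) * FF \<tau> (v + (m + s) *\<^sub>R U))"
      by (intro infsum_cong) (simp add: algebra_simps)
    also have "\<dots> = ch (- (t * bj v U)) * (\<Sum>\<^sub>\<infinity>d\<in>\<int>. psi \<tau> v d * ch (- (d * s)))"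
      unfolding infsum_cmult_right' psi_poisson[OF y v] ..
    also have "\<dots> = (\<Sum>\<^sub>\<infinity>d\<in>\<int>. psi \<tau> v d * ch (- (bj v U * t + d * s)))"
      unfolding infsum_cmult_right'[symmetric]
    proof (rule infsum_cong)
      fix d :: real
      have "ch (- (bj v U * t + d * s)) = ch (- (t * bj v U)) * ch (- (d * s))"
        by (simp only: ch_add[symmetric]) (rule arg_cong[where f = ch], simp add: algebra_simps)
      thus "ch (- (t * bj v U)) * (psi \<tau> v d * ch (- (d * s))) = psi \<tau> v d * ch (- (bj v U * t + d * s))"
        by simp
    qed
    finally show "(\<Sum>\<^sub>\<infinity>m\<in>\<int>. ?f (v + m *\<^sub>R U)) = (\<Sum>\<^sub>\<infinity>d\<in>\<int>. psi \<tau> v d * ch (- (bj v U * t + d * s)))" .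
  qed
  also have "\<dots> = (\<Sum>\<^sub>\<infinity>(v, d)\<in>VV \<times> \<int>. psi \<tau> v d * ch (- (bj v U * t + d * s)))"
  proof (rule infsum_Sigma'_banach, rule abs_summable_summable)
    show "(\<lambda>p. norm (case p of (v, d) \<Rightarrow> psi \<tau> v d * ch (- (bj v U * t + d * s)))) summable_on VV \<times> \<int>"
      using psi_summable[OF y] by (simp add: case_prod_unfold norm_mult)
  qed
  also have "\<dots> = (\<Sum>\<^sub>\<infinity>(z, v)\<in>Sigma zlat (\<lambda>(c, d). VC c). psi \<tau> v (snd z) * ch (- (z \<bullet> (t, s))))"
  proof -
    have "(\<Sum>\<^sub>\<infinity>(v, d)\<in>VV \<times> \<int>. psi \<tau> v d * ch (- (bj v U * t + d * s)))
        = (\<Sum>\<^sub>\<infinity>p\<in>VV \<times> \<int>. (\<lambda>(z, v). psi \<tau> v (snd z) * ch (- (z \<bullet> (t, s)))) ((\<lambda>(v, d). ((bj v U, d), v)) p))"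
      by (intro infsum_cong) auto
    thus ?thesis by (simp only: infsum_reindex_bij_betw[OF VV_fibre_bij])
  qed
  also have "\<dots> = (\<Sum>\<^sub>\<infinity>z\<in>zlat. \<Sum>\<^sub>\<infinity>v\<in>(case z of (c, d) \<Rightarrow> VC c). psi \<tau> v (snd z) * ch (- (z \<bullet> (t, s))))"
  proof (rule infsum_Sigma'_banach[symmetric], rule abs_summable_summable)
    show "(\<lambda>p. norm (case p of (z, v) \<Rightarrow> psi \<tau> v (snd z) * ch (- (z \<bullet> (t, s))))) summable_on Sigma zlat (\<lambda>(c, d). VC c)"
      using psi_summable_Sigma[OF y] by (simp add: case_prod_unfold norm_mult)
  qed
  also have "\<dots> = (\<Sum>\<^sub>\<infinity>z\<in>zlat. phi \<tau> (fst z) (snd z) * ch (- (z \<bullet> (t, s))))"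
    by (intro infsum_cong) (simp add: phi_def case_prod_unfold infsum_cmult_left')
  finally show ?thesis .
qed

text \<open>Two absolutely convergent trigonometric series in the parameters that agree as functions have the
  same coefficients.\<close>

lemma phi_S:
  assumes y: "Im \<tau> > 0" and cd: "c \<in> \<int>" "d \<in> \<int>"
  shows "phi (- 1 / \<tau>) c d = \<tau> ^ (n + 2) * cnj \<tau> * phi \<tau> d (- c)"
proof -
  define J where "J = \<tau> ^ (n + 2) * cnj \<tau>"
  define a where "a z = J * phi \<tau> (fst z) (snd z)" for z :: "real \<times> real"
  define b where "b z = phi (- 1 / \<tau>) (- snd z) (fst z)" for z :: "real \<times> real"
  have rot: "bij_betw (\<lambda>z. (- snd z, fst z)) (zlat :: (real \<times> real) set) zlat"
    by (rule bij_betwI[of _ _ _ "\<lambda>z. (snd z, - fst z)"]) (auto simp: zlat_pair)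
  have y': "Im (- 1 / \<tau>) > 0" by (rule Im_S_pos[OF y])
  have sma: "(\<lambda>z. norm (a z)) summable_on zlat"
    unfolding a_def norm_mult by (intro summable_on_cmult_right phi_summable y)
  have smb: "(\<lambda>z. norm (b z)) summable_on zlat"
    using summable_on_reindex_bij_betw[OF rot, of "\<lambda>z. norm (phi (- 1 / \<tau>) (fst z) (snd z))"] phi_summable[OF y']
    by (simp add: b_def)
  have eq: "(\<Sum>\<^sub>\<infinity>z\<in>zlat. a z * ch (z \<bullet> u)) = (\<Sum>\<^sub>\<infinity>z\<in>zlat. b z * ch (z \<bullet> u))" for u :: "real \<times> real"
  proof -
    obtain t s where u: "u = (t, s)" by (cases u)
    have "(\<Sum>\<^sub>\<infinity>z\<in>zlat. a z * ch (z \<bullet> u)) = J * theta_sum \<tau> (- s) (- t)"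
      unfolding theta_sum_expansion[OF y] infsum_cmult_right'[symmetric]
      by (intro infsum_cong) (simp add: a_def u inner_prod_def add.commute)
    also have "\<dots> = theta_sum (- 1 / \<tau>) (- t) s"
      using theta_sum_S[OF y, of "- s" "- t"] by (simp add: J_def)
    also have "\<dots> = (\<Sum>\<^sub>\<infinity>z\<in>zlat. phi (- 1 / \<tau>) (fst z) (snd z) * ch (- (z \<bullet> (s, - t))))"
      by (rule theta_sum_expansion[OF y'])
    also have "\<dots> = (\<Sum>\<^sub>\<infinity>z\<in>zlat. b z * ch (z \<bullet> u))"
      by (subst infsum_reindex_bij_betw[OF rot, symmetric]) (simp add: b_def u inner_prod_def algebra_simps)
    finally show ?thesis .
  qed
  have "a z = b z" if z: "z \<in> zlat" for z
    using trig_series_coefficient[OF sma zlat_closed(2)[OF z]] trig_series_coefficient[OF smb zlat_closed(2)[OF z]]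
    unfolding eq by simp
  from this[of "(d, - c)"] show ?thesis
    using cd by (simp add: a_def b_def J_def zlat_pair)
qed

lemma phi_T: "d \<in> \<int> \<Longrightarrow> phi (\<tau> + 1) c d = phi \<tau> c (c + d)"
  unfolding phi_def by (intro infsum_cong) (auto simp: psi_T VC_def)

text \<open>The values at \<open>v\<close> of the three reduced polynomials after the heat operator of the
  complement of \<open>pU\<close> and \<open>mU\<close>; only the quadratic one is changed by it.\<close>

definition q0 :: "real \<Rightarrow> 'e \<Rightarrow> real" where
  "q0 y v = 2 * (wv v \<bullet> ea) * (wv v \<bullet> eb) - (dlt - (U \<bullet> ea) * (U \<bullet> eb) / rho) / (2 * pi * y)"
definition q1 :: "'e \<Rightarrow> real" where
  "q1 v = 2 * ((wv v \<bullet> ea) * (U \<bullet> eb) + (wv v \<bullet> eb) * (U \<bullet> ea)) / rho"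
definition q2 :: real where
  "q2 = 2 * (U \<bullet> ea) * (U \<bullet> eb) / rho\<^sup>2"

text \<open>For \<open>(v, U) = 0\<close> the real part of \<open>\<tau>\<close> enters only through
  \<open>gau P \<tau> (wv v)\<close>, and the moments combine into a quadratic polynomial in
  \<open>\<i> d / 2 y\<close>.\<close>

lemma psi_0:
  assumes y: "Im \<tau> > 0" and v: "v \<in> VC 0"
  shows "psi \<tau> v d = of_real (exp (- pi * d\<^sup>2 / (2 * Im \<tau> * rho)) / sqrt (2 * Im \<tau> * rho)) *
     (gau P \<tau> (wv v) * ch (- (d * mm v)) *
      (of_real (q0 (Im \<tau>) v) + (\<i> * of_real d / (2 * of_real (Im \<tau>))) * of_real (q1 v)
        + (\<i> * of_real d / (2 * of_real (Im \<tau>)))\<^sup>2 * of_real q2))"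
proof -
  have c0: "bj v U = 0" using v by (simp add: VC_def)
  have yr: "Im \<tau> \<noteq> 0" "rho \<noteq> 0" using y rho_pos by auto
  let ?A = "2 * Im \<tau> * rho" and ?pa = "U \<bullet> ea" and ?pb = "U \<bullet> eb"
  have R: "2 * alp ea v * alp eb v - dlt / (2 * pi * Im \<tau>) + 2 * ?pa * ?pb * (1 / (2 * pi * ?A) - d\<^sup>2 / ?A\<^sup>2)
      = q0 (Im \<tau>) v - (d / (2 * Im \<tau>))\<^sup>2 * q2"
    using yr by (simp add: alp_def c0 q0_def q2_def field_simps power2_eq_square)
  have I: "2 * (alp ea v * ?pb + alp eb v * ?pa) * (d / ?A) = (d / (2 * Im \<tau>)) * q1 v"
    using yr by (simp add: alp_def c0 q1_def field_simps)
  have "of_real (q0 (Im \<tau>) v - (d / (2 * Im \<tau>))\<^sup>2 * q2) + \<i> * of_real ((d / (2 * Im \<tau>)) * q1 v)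
     = of_real (q0 (Im \<tau>) v) + (\<i> * of_real d / (2 * of_real (Im \<tau>))) * of_real (q1 v)
        + (\<i> * of_real d / (2 * of_real (Im \<tau>)))\<^sup>2 * of_real q2"
    by (simp add: power_divide power_mult_distrib)
  thus ?thesis
    unfolding psi_explicit[OF y] c0 mult_zero_right add_0_left R I
    by (simp add: mult_ac)
qed

text \<open>In contrast to \<open>psi_bound\<close>, the dependence on \<open>\<tau>\<close> is explicit and
  polynomial in \<open>1 / Im \<tau>\<close>; this is needed near the real axis, which the strip
  approaches.\<close>

lemma psi_0_uniform_bound:
  obtains K N and w :: "'e \<Rightarrow> real" where "K > 0" "w summable_on VC 0" "\<And>v. w v \<ge> 0"
    "\<And>\<tau> d v. Im \<tau> > 0 \<Longrightarrow> v \<in> VC 0 \<Longrightarrow> norm (psi \<tau> v d) \<le>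
       K * (1 + 1 / Im \<tau>) ^ N * (1 + \<bar>d\<bar> / Im \<tau>)\<^sup>2 * exp (- pi * d\<^sup>2 / (2 * Im \<tau> * rho)) * w v"
proof -
  obtain e where e: "e > 0" "\<And>v. bj v U' = 0 \<Longrightarrow> e * (norm v)\<^sup>2 \<le> (norm (wv v))\<^sup>2 + (bj v U)\<^sup>2"
    using wv_lower by metis
  obtain w :: "'e \<Rightarrow> real" and B where w: "B > 0" "w summable_on (M ` zlat)" "\<And>x. w x \<ge> 0"
    "\<And>\<epsilon> x. \<epsilon> > 0 \<Longrightarrow> x \<in> M ` zlat \<Longrightarrow> exp (- \<epsilon> * (norm x)\<^sup>2) \<le> (1 + B / \<epsilon>) ^ DIM('e) * w x"
    by (rule lattice_weight[OF M], rule that)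
  define pa pb where "pa = U \<bullet> ea" and "pb = U \<bullet> eb"
  define k where "k = 2 + \<bar>dlt - pa * pb / rho\<bar> / (2 * pi) + 2 * (\<bar>pa\<bar> + \<bar>pb\<bar>) / rho + \<bar>q2\<bar>"
  have k: "k \<ge> 2" using rho_pos by (simp add: k_def)
  define X1 where "X1 = 1 / (2 * rho)"
  define X2 where "X2 = 2 / pi"
  define X3 where "X3 = B / (pi / 2 * e)"
  have X: "X1 \<ge> 0" "X2 \<ge> 0" "X3 \<ge> 0" using rho_pos w(1) e(1) by (simp_all add: X1_def X2_def X3_def)
  let ?D = "DIM('e)"
  define K where "K = (1 + X1) * k * (1 + X2) * (1 + X3) ^ ?D"
  show ?thesis
  proof (rule that[of K w "3 + ?D"])
    show "K > 0" using X k by (simp add: K_def add_pos_nonneg)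
    show "w summable_on VC 0"
      by (rule summable_on_subset_banach[OF w(2)]) (auto simp: VC_def VV_def Lam_def)
    show "w v \<ge> 0" for v by (rule w)
    fix \<tau> d v assume \<tau>: "Im \<tau> > 0" and v: "v \<in> VC 0"
    define y where "y = Im \<tau>"
    have y: "y > 0" using \<tau> by (simp add: y_def)
    define Y where "Y = 1 + 1 / y"
    have Y1: "Y \<ge> 1" using y by (simp add: Y_def)
    define s where "s = norm (wv v)"
    define T where "T = 1 + \<bar>d\<bar> / y"
    have T1: "T \<ge> 1" using y by (simp add: T_def)
    have s0: "s \<ge> 0" by (simp add: s_def)
    have s1: "s \<le> 1 + s\<^sup>2" using sum_squares_bound[of s 1] s0 by (simp add: power2_eq_square) 
    have ins: "\<bar>wv v \<bullet> ea\<bar> \<le> s" "\<bar>wv v \<bullet> eb\<bar> \<le> s" unfolding s_def by (intro abs_inner_P ab)+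
    have b0: "\<bar>q0 y v\<bar> \<le> k * Y * (1 + s\<^sup>2)"
    proof -
      have "\<bar>q0 y v\<bar> \<le> \<bar>2 * (wv v \<bullet> ea) * (wv v \<bullet> eb)\<bar> + \<bar>(dlt - pa * pb / rho) / (2 * pi * y)\<bar>"
        unfolding q0_def pa_def pb_def by (rule abs_triangle_ineq4)
      also have "\<bar>2 * (wv v \<bullet> ea) * (wv v \<bullet> eb)\<bar> \<le> 2 * s\<^sup>2"
        using mult_mono[OF ins s0 abs_ge_zero] by (simp add: abs_mult power2_eq_square)
      also have "\<bar>(dlt - pa * pb / rho) / (2 * pi * y)\<bar> = (\<bar>dlt - pa * pb / rho\<bar> / (2 * pi)) * (1 / y)"
        using y by (simp add: abs_mult)
      also have "2 * s\<^sup>2 + (\<bar>dlt - pa * pb / rho\<bar> / (2 * pi)) * (1 / y) \<le> k * s\<^sup>2 + k * Y"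
        using k y rho_pos by (intro add_mono mult_mono) (auto simp: Y_def k_def)
      also have "\<dots> \<le> k * Y * (1 + s\<^sup>2)"
        using mult_right_mono[OF Y1, of "k * s\<^sup>2"] k by (simp add: algebra_simps)
      finally show ?thesis by simp
    qed
    have b1: "\<bar>q1 v\<bar> \<le> k * Y * (1 + s\<^sup>2)"
    proof -
      have "\<bar>(wv v \<bullet> ea) * pb + (wv v \<bullet> eb) * pa\<bar> \<le> s * \<bar>pb\<bar> + s * \<bar>pa\<bar>"
        by (intro order_trans[OF abs_triangle_ineq] add_mono) (auto simp: abs_mult intro!: mult_right_mono ins)
      hence "\<bar>q1 v\<bar> \<le> 2 * (s * \<bar>pb\<bar> + s * \<bar>pa\<bar>) / rho"
        using rho_pos by (simp add: q1_def pa_def pb_def abs_mult divide_right_mono)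
      also have "\<dots> = (2 * (\<bar>pa\<bar> + \<bar>pb\<bar>) / rho) * s" by (simp add: algebra_simps)
      also have "\<dots> \<le> k * (1 + s\<^sup>2)"
        using s1 s0 rho_pos k by (intro mult_mono) (auto simp: k_def)
      also have "\<dots> \<le> k * Y * (1 + s\<^sup>2)"
        using mult_right_mono[OF Y1, of "k * (1 + s\<^sup>2)"] k by (simp add: mult_ac)
      finally show ?thesis .
    qed
    have b2: "\<bar>q2\<bar> \<le> k * Y * (1 + s\<^sup>2)"
    proof -
      have "\<bar>q2\<bar> \<le> k * 1 * 1" using rho_pos by (simp add: k_def)
      also have "\<dots> \<le> k * Y * (1 + s\<^sup>2)" using k Y1 by (intro mult_mono) auto
      finally show ?thesis .
    qed
    define b where "b = k * Y * (1 + s\<^sup>2)"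
    have bnn: "b \<ge> 0" using k Y1 by (simp add: b_def)
    let ?z = "\<i> * of_real d / (2 * of_real y)"
    have nz: "norm ?z = \<bar>d\<bar> / (2 * y)" using y by (simp add: norm_divide norm_mult)
    have "norm (of_real (q0 y v) + ?z * of_real (q1 v) + ?z\<^sup>2 * of_real q2) \<le> \<bar>q0 y v\<bar> + (\<bar>d\<bar> / (2 * y)) * \<bar>q1 v\<bar> + (\<bar>d\<bar> / (2 * y))\<^sup>2 * \<bar>q2\<bar>"
      by (intro order_trans[OF norm_triangle_ineq] add_mono) (simp_all add: norm_mult norm_power nz del: times_divide_eq_left)
    also have "\<dots> \<le> b + (\<bar>d\<bar> / (2 * y)) * b + (\<bar>d\<bar> / (2 * y))\<^sup>2 * b"
      using b0 b1 b2 y unfolding b_def[symmetric] by (intro add_mono mult_left_mono) auto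
    also have "\<dots> = b * (1 + (\<bar>d\<bar> / (2 * y)) + (\<bar>d\<bar> / (2 * y))\<^sup>2)" by (simp add: algebra_simps)
    also have "\<dots> \<le> b * T\<^sup>2"
    proof (rule mult_left_mono[OF _ bnn])
      define q where "q = \<bar>d\<bar> / (2 * y)"
      have q: "q \<ge> 0" "T = 1 + 2 * q" using y by (simp_all add: q_def T_def)
      show "1 + \<bar>d\<bar> / (2 * y) + (\<bar>d\<bar> / (2 * y))\<^sup>2 \<le> T\<^sup>2"
        unfolding q_def[symmetric] q(2) using q(1) by (simp add: power2_eq_square algebra_simps)
    qed
    finally have poly: "norm (of_real (q0 y v) + ?z * of_real (q1 v) + ?z\<^sup>2 * of_real q2) \<le> b * T\<^sup>2" .
    have sq: "1 / sqrt (2 * y * rho) \<le> (1 + X1) * Y"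
    proof -
      define h where "h = 1 / (2 * y * rho)"
      have h: "h > 0" using y rho_pos by (simp add: h_def)
      have "1 / sqrt (2 * y * rho) = sqrt h" by (simp add: h_def real_sqrt_divide)
      also have "\<dots> \<le> 1 + h" using h sum_squares_bound[of "sqrt h" 1] by (simp add: real_sqrt_ge_zero) 
      also have "\<dots> = 1 + X1 / y" by (simp add: h_def X1_def)
      also have "\<dots> \<le> (1 + X1) * Y" unfolding Y_def by (rule one_plus_div_le[OF X(1) y])
      finally show ?thesis .
    qed
    have ga: "(1 + s\<^sup>2) * exp (- pi * y * s\<^sup>2) \<le> (1 + X2) * Y * ((1 + X3) * Y) ^ ?D * w v"
    proof -
      have "1 + s\<^sup>2 \<le> (1 + 1 / (pi * y / 2)) * exp ((pi * y / 2) * s\<^sup>2)"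
        using y by (intro one_plus_le_exp) auto
      hence "(1 + s\<^sup>2) * exp (- pi * y * s\<^sup>2) \<le> (1 + 1 / (pi * y / 2)) * exp ((pi * y / 2) * s\<^sup>2) * exp (- pi * y * s\<^sup>2)"
        by (intro mult_right_mono) auto
      also have "\<dots> = (1 + X2 / y) * exp (- (pi * y / 2) * s\<^sup>2)"
        by (simp add: X2_def mult.assoc mult_exp_exp)
      also have "\<dots> \<le> ((1 + X2) * Y) * exp (- (pi / 2 * e * y) * (norm v)\<^sup>2)"
      proof (intro mult_mono)
        show "1 + X2 / y \<le> (1 + X2) * Y" unfolding Y_def by (rule one_plus_div_le[OF X(2) y])
        have "e * (norm v)\<^sup>2 \<le> s\<^sup>2" using e(2)[of v] v by (simp add: VC_def VV_def s_def)
        from mult_left_mono[OF this, of "pi * y / 2"] y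
        show "exp (- (pi * y / 2) * s\<^sup>2) \<le> exp (- (pi / 2 * e * y) * (norm v)\<^sup>2)" by (simp add: mult_ac)
      qed (use X Y1 in auto)
      also have "exp (- (pi / 2 * e * y) * (norm v)\<^sup>2) \<le> (1 + B / (pi / 2 * e * y)) ^ ?D * w v"
        using y e v by (intro w(4)) (auto simp: VC_def VV_def Lam_def)
      also have "B / (pi / 2 * e * y) = X3 / y" by (simp add: X3_def)
      also have "(1 + X3 / y) ^ ?D * w v \<le> ((1 + X3) * Y) ^ ?D * w v"
        unfolding Y_def using X y w(3) by (intro mult_right_mono power_mono one_plus_div_le) auto
      finally show ?thesis using X Y1 by (simp add: mult_left_mono mult.assoc)
    qed
    let ?E = "exp (- pi * d\<^sup>2 / (2 * y * rho))"
    have "norm (psi \<tau> v d) = ?E * (1 / sqrt (2 * y * rho)) * (exp (- pi * y * s\<^sup>2) * norm (of_real (q0 y v) + ?z * of_real (q1 v) + ?z\<^sup>2 * of_real q2))"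
      unfolding psi_0[OF \<tau> v] y_def[symmetric] norm_mult norm_gau norm_ch norm_of_real s_def using y rho_pos
      by (simp add: abs_mult)
    also have "\<dots> \<le> ?E * ((1 + X1) * Y) * (exp (- pi * y * s\<^sup>2) * (b * T\<^sup>2))"
      using poly sq X Y1 by (intro mult_mono mult_left_mono) auto
    also have "\<dots> = ?E * ((1 + X1) * Y) * (k * Y) * T\<^sup>2 * ((1 + s\<^sup>2) * exp (- pi * y * s\<^sup>2))"
      by (simp add: b_def mult_ac)
    also have "\<dots> \<le> ?E * ((1 + X1) * Y) * (k * Y) * T\<^sup>2 * ((1 + X2) * Y * ((1 + X3) * Y) ^ ?D * w v)"
      using ga X Y1 k by (intro mult_left_mono) auto
    also have "\<dots> = K * Y ^ (3 + ?D) * T\<^sup>2 * ?E * w v"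
      by (simp add: K_def power_mult_distrib power_add power3_eq_cube mult_ac)
    finally show "norm (psi \<tau> v d) \<le> K * (1 + 1 / Im \<tau>) ^ (3 + ?D) * (1 + \<bar>d\<bar> / Im \<tau>)\<^sup>2 * exp (- pi * d\<^sup>2 / (2 * Im \<tau> * rho)) * w v"
      by (simp add: Y_def T_def y_def)
  qed
qed

lemma phi_0_bound:
  obtains K N where "K > 0" "\<And>\<tau> d. Im \<tau> > 0 \<Longrightarrow> norm (phi \<tau> 0 d) \<le>
       K * (1 + 1 / Im \<tau>) ^ N * (1 + \<bar>d\<bar> / Im \<tau>)\<^sup>2 * exp (- pi * d\<^sup>2 / (2 * Im \<tau> * rho))"
proof -
  obtain K N and w :: "'e \<Rightarrow> real" where K: "K > 0" "w summable_on VC 0" "\<And>v. w v \<ge> 0"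
    "\<And>\<tau> d v. Im \<tau> > 0 \<Longrightarrow> v \<in> VC 0 \<Longrightarrow> norm (psi \<tau> v d) \<le>
       K * (1 + 1 / Im \<tau>) ^ N * (1 + \<bar>d\<bar> / Im \<tau>)\<^sup>2 * exp (- pi * d\<^sup>2 / (2 * Im \<tau> * rho)) * w v"
    by (rule psi_0_uniform_bound, rule that)
  define W where "W = infsum w (VC 0)"
  have W: "W \<ge> 0" unfolding W_def by (intro infsum_nonneg K)
  show ?thesis
  proof (rule that[of "K * (W + 1)" N])
    show "K * (W + 1) > 0" using K W by (simp add: add_nonneg_pos)
    fix \<tau> d assume \<tau>: "Im \<tau> > 0"
    let ?C = "K * (1 + 1 / Im \<tau>) ^ N * (1 + \<bar>d\<bar> / Im \<tau>)\<^sup>2 * exp (- pi * d\<^sup>2 / (2 * Im \<tau> * rho))"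
    have C: "?C \<ge> 0" using K \<tau> by simp
    have "norm (phi \<tau> 0 d) \<le> (\<Sum>\<^sub>\<infinity>v\<in>VC 0. ?C * w v)"
      unfolding phi_def
      by (rule norm_infsum_le[OF has_sum_infsum has_sum_infsum])
         (use K \<tau> in \<open>auto intro!: summable_on_cmult_right abs_summable_summable[OF summable_on_comparison_test[of "\<lambda>v. ?C * w v"]]\<close>)
    also have "\<dots> = ?C * W" unfolding W_def by (rule infsum_cmult_right')
    also have "\<dots> \<le> ?C * (W + 1)" using C by (intro mult_left_mono) auto
    finally show "norm (phi \<tau> 0 d) \<le> K * (W + 1) * (1 + 1 / Im \<tau>) ^ N * (1 + \<bar>d\<bar> / Im \<tau>)\<^sup>2 * exp (- pi * d\<^sup>2 / (2 * Im \<tau> * rho))"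
      by (simp add: mult_ac)
  qed
qed

lemma continuous_on_phi_0: "continuous_on {\<tau>. Im \<tau> > 0} (\<lambda>\<tau>. phi \<tau> 0 d)"
proof -
  obtain K N and w :: "'e \<Rightarrow> real" where K: "K > 0" "w summable_on VC 0" "\<And>v. w v \<ge> 0"
    "\<And>\<tau> d v. Im \<tau> > 0 \<Longrightarrow> v \<in> VC 0 \<Longrightarrow> norm (psi \<tau> v d) \<le>
       K * (1 + 1 / Im \<tau>) ^ N * (1 + \<bar>d\<bar> / Im \<tau>)\<^sup>2 * exp (- pi * d\<^sup>2 / (2 * Im \<tau> * rho)) * w v"
    by (rule psi_0_uniform_bound, rule that)
  have cont_psi: "continuous_on {\<tau>. Im \<tau> > 0} (\<lambda>\<tau>. psi \<tau> v d)" if v: "v \<in> VC 0" for v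
  proof -
    have "continuous_on {\<tau>. Im \<tau> > 0} (\<lambda>\<tau>. of_real (exp (- pi * d\<^sup>2 / (2 * Im \<tau> * rho)) / sqrt (2 * Im \<tau> * rho)) *
     (gau P \<tau> (wv v) * ch (- (d * mm v)) *
      (of_real (q0 (Im \<tau>) v) + (\<i> * of_real d / (2 * of_real (Im \<tau>))) * of_real (q1 v)
        + (\<i> * of_real d / (2 * of_real (Im \<tau>)))\<^sup>2 * of_real q2)))"
      unfolding gau_def q0_def using rho_pos by (intro continuous_intros) auto
    also have "?this \<longleftrightarrow> ?thesis"
      by (intro continuous_on_cong refl) (use psi_0[OF _ v] in auto)
    finally show ?thesis .
  qed
  have "continuous_on {\<tau>. Im \<tau> > \<delta>} (\<lambda>\<tau>. phi \<tau> 0 d)" if \<delta>: "\<delta> > 0" for \<delta>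
  proof -
    let ?C = "K * (1 + 1 / \<delta>) ^ N * (1 + \<bar>d\<bar> / \<delta>)\<^sup>2"
    have "uniform_limit {\<tau>. Im \<tau> > \<delta>} (\<lambda>X \<tau>. \<Sum>v\<in>X. psi \<tau> v d) (\<lambda>\<tau>. \<Sum>\<^sub>\<infinity>v\<in>VC 0. psi \<tau> v d) (finite_subsets_at_top (VC 0))"
    proof (rule Weierstrass_m_test_general)
      show "(\<lambda>v. ?C * w v) summable_on VC 0" by (intro summable_on_cmult_right K)
      fix v \<tau> assume v: "v \<in> VC 0" and t: "\<tau> \<in> {\<tau>. Im \<tau> > \<delta>}"
      have t0: "Im \<tau> > 0" "Im \<tau> > \<delta>" using t \<delta> by auto
      have "norm (psi \<tau> v d) \<le> K * (1 + 1 / Im \<tau>) ^ N * (1 + \<bar>d\<bar> / Im \<tau>)\<^sup>2 * exp (- pi * d\<^sup>2 / (2 * Im \<tau> * rho)) * w v"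
        by (rule K(4)[OF t0(1) v])
      also have "\<dots> \<le> ?C * 1 * w v"
        using K t0 \<delta> rho_pos
        by (intro mult_right_mono mult_mono mult_left_mono power_mono add_left_mono divide_left_mono) auto
      finally show "norm (psi \<tau> v d) \<le> ?C * w v" by simp
    qed
    hence "continuous_on {\<tau>. Im \<tau> > \<delta>} (\<lambda>\<tau>. \<Sum>\<^sub>\<infinity>v\<in>VC 0. psi \<tau> v d)"
    proof (rule uniform_limit_theorem[rotated])
      show "\<forall>\<^sub>F X in finite_subsets_at_top (VC 0). continuous_on {\<tau>. Im \<tau> > \<delta>} (\<lambda>\<tau>. \<Sum>v\<in>X. psi \<tau> v d)"
        by (intro eventually_finite_subsets_at_top_weakI continuous_on_sum continuous_on_subset[OF cont_psi]) (use \<delta> in auto)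
    qed simp
    thus ?thesis by (simp add: phi_def)
  qed
  hence "continuous_on (\<Union>\<delta>\<in>{0<..}. {\<tau>. Im \<tau> > \<delta>}) (\<lambda>\<tau>. phi \<tau> 0 d)"
    by (intro continuous_on_open_UN) (auto intro: open_halfspace_Im_gt)
  moreover have "{\<tau>. Im \<tau> > 0} \<subseteq> (\<Union>\<delta>\<in>{0<..}. {\<tau>. Im \<tau> > \<delta>})"
  proof
    fix \<tau> assume "\<tau> \<in> {\<tau>. Im \<tau> > 0}"
    thus "\<tau> \<in> (\<Union>\<delta>\<in>{0<..}. {\<tau>. Im \<tau> > \<delta>})" by (intro UN_I[of "Im \<tau> / 2"]) auto
  qed
  ultimately show ?thesis by (rule continuous_on_subset)
qed

end

section \<open>The modular group and its fundamental domain\<close>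

type_synonym imat = "int \<times> int \<times> int \<times> int"

definition SL2Z :: "imat set" where
  "SL2Z = {(a, b, c, d). a * d - b * c = 1}"

definition mob :: "imat \<Rightarrow> complex \<Rightarrow> complex" where
  "mob = (\<lambda>(a, b, c, d) \<tau>. (of_int a * \<tau> + of_int b) / (of_int c * \<tau> + of_int d))"

text \<open>Matrices are quadruples \<open>(a, b, c, d)\<close> of integers, read by rows.\<close>

definition mmul :: "imat \<Rightarrow> imat \<Rightarrow> imat" where
  "mmul = (\<lambda>(a, b, c, d) (a', b', c', d'). (a * a' + b * c', a * b' + b * d', c * a' + d * c', c * b' + d * d'))"

definition minv :: "imat \<Rightarrow> imat" where
  "minv = (\<lambda>(a, b, c, d). (d, - b, - c, a))"

definition uhp :: "complex set" where
  "uhp = {\<tau>. Im \<tau> > 0}"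

lemma mmul_SL2Z: "\<gamma> \<in> SL2Z \<Longrightarrow> \<delta> \<in> SL2Z \<Longrightarrow> mmul \<gamma> \<delta> \<in> SL2Z"
proof -
  assume "\<gamma> \<in> SL2Z" "\<delta> \<in> SL2Z"
  then obtain a b c d a' b' c' d' where
    g: "\<gamma> = (a, b, c, d)" "a * d - b * c = 1" "\<delta> = (a', b', c', d')" "a' * d' - b' * c' = 1"
    by (auto simp: SL2Z_def)
  have "(a * a' + b * c') * (c * b' + d * d') - (a * b' + b * d') * (c * a' + d * c') = (a * d - b * c) * (a' * d' - b' * c')"
    by (simp add: algebra_simps)
  thus ?thesis using g by (simp add: SL2Z_def mmul_def)
qed

lemma minv_SL2Z: "\<gamma> \<in> SL2Z \<Longrightarrow> minv \<gamma> \<in> SL2Z" and minv_minv [simp]: "minv (minv \<gamma>) = \<gamma>"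
  by (auto simp: SL2Z_def minv_def mult.commute split: prod.splits)

lemma mmul_minv: "\<gamma> \<in> SL2Z \<Longrightarrow> mmul (minv \<gamma>) \<gamma> = (1, 0, 0, 1)" "\<gamma> \<in> SL2Z \<Longrightarrow> mmul \<gamma> (minv \<gamma>) = (1, 0, 0, 1)"
  by (auto simp: SL2Z_def minv_def mmul_def algebra_simps)

lemma denom_nonzero:
  assumes "c \<noteq> 0 \<or> d \<noteq> 0" "Im \<tau> > 0" shows "of_int c * \<tau> + of_int d \<noteq> 0"
proof
  assume e: "of_int c * \<tau> + of_int d = 0"
  hence "Im (of_int c * \<tau> + of_int d) = 0" by simp
  hence "c = 0" using assms(2) by simp
  thus False using e assms(1) by simp
qed

lemma SL2Z_bottom: "(a, b, c, d) \<in> SL2Z \<Longrightarrow> c \<noteq> 0 \<or> d \<noteq> 0"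
  by (auto simp: SL2Z_def)

lemma Im_mob:
  assumes "(a, b, c, d) \<in> SL2Z"
  shows "Im (mob (a, b, c, d) \<tau>) = Im \<tau> / (norm (of_int c * \<tau> + of_int d))\<^sup>2"
proof -
  have det: "real_of_int a * of_int d - of_int b * of_int c = 1"
    using assms by (simp add: SL2Z_def flip: of_int_mult of_int_diff)
  have "Im (of_int a * \<tau> + of_int b) * Re (of_int c * \<tau> + of_int d) - Re (of_int a * \<tau> + of_int b) * Im (of_int c * \<tau> + of_int d)
     = (real_of_int a * of_int d - of_int b * of_int c) * Im \<tau>"
    by (simp add: algebra_simps)
  thus ?thesis by (simp add: mob_def Im_divide cmod_power2 det)
qed

lemma mob_uhp:
  assumes "\<gamma> \<in> SL2Z" "\<tau> \<in> uhp" shows "mob \<gamma> \<tau> \<in> uhp"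
proof -
  obtain a b c d where g: "\<gamma> = (a, b, c, d)" by (cases \<gamma>)
  have "of_int c * \<tau> + of_int d \<noteq> 0"
    using assms g by (intro denom_nonzero SL2Z_bottom) (auto simp: uhp_def)
  thus ?thesis using assms unfolding g uhp_def by (simp add: Im_mob)
qed

lemma mob_mmul:
  assumes "\<gamma> \<in> SL2Z" "\<delta> \<in> SL2Z" "\<tau> \<in> uhp"
  shows "mob (mmul \<gamma> \<delta>) \<tau> = mob \<gamma> (mob \<delta> \<tau>)"
proof -
  obtain a b c d where g: "\<gamma> = (a, b, c, d)" by (cases \<gamma>)
  obtain a' b' c' d' where d: "\<delta> = (a', b', c', d')" by (cases \<delta>)
  let ?N = "of_int a' * \<tau> + of_int b'" and ?D = "of_int c' * \<tau> + of_int d'"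
  have D: "?D \<noteq> 0" using denom_nonzero SL2Z_bottom assms d by (auto simp: uhp_def)
  have "mob \<gamma> (mob \<delta> \<tau>) = ((of_int a * (?N / ?D) + of_int b) * ?D) / ((of_int c * (?N / ?D) + of_int d) * ?D)"
    using D by (simp add: mob_def g d)
  also have "(of_int a * (?N / ?D) + of_int b) * ?D = of_int a * ?N + of_int b * ?D"
    using D by (simp add: distrib_right)
  also have "(of_int c * (?N / ?D) + of_int d) * ?D = of_int c * ?N + of_int d * ?D"
    using D by (simp add: distrib_right)
  also have "(of_int a * ?N + of_int b * ?D) / (of_int c * ?N + of_int d * ?D) = mob (mmul \<gamma> \<delta>) \<tau>"
    by (simp add: mob_def mmul_def g d algebra_simps)
  finally show ?thesis by simp
qed

lemma mob_1 [simp]: "mob (1, 0, 0, 1) \<tau> = \<tau>"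
  by (simp add: mob_def)

lemma mob_minv: "\<gamma> \<in> SL2Z \<Longrightarrow> \<tau> \<in> uhp \<Longrightarrow> mob (minv \<gamma>) (mob \<gamma> \<tau>) = \<tau>" "\<gamma> \<in> SL2Z \<Longrightarrow> \<tau> \<in> uhp \<Longrightarrow> mob \<gamma> (mob (minv \<gamma>) \<tau>) = \<tau>"
  by (simp_all add: mob_mmul[symmetric] minv_SL2Z mmul_minv)

text \<open>The Euclidean algorithm on the bottom row: induction on \<open>\<bar>c\<bar>\<close>, replacing
  \<open>d\<close> by its remainder modulo \<open>c\<close>.\<close>

lemma SL2Z_induct:
  assumes g: "\<gamma> \<in> SL2Z"
    and Q1: "Q (1, 0, 0, 1)"
    and QT: "\<And>\<gamma>. \<gamma> \<in> SL2Z \<Longrightarrow> Q \<gamma> \<Longrightarrow> Q (mmul \<gamma> (1, 1, 0, 1))"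
    and QT': "\<And>\<gamma>. \<gamma> \<in> SL2Z \<Longrightarrow> Q \<gamma> \<Longrightarrow> Q (mmul \<gamma> (1, -1, 0, 1))"
    and QS: "\<And>\<gamma>. \<gamma> \<in> SL2Z \<Longrightarrow> Q \<gamma> \<Longrightarrow> Q (mmul \<gamma> (0, -1, 1, 0))"
  shows "Q \<gamma>"
proof -
  have gen: "(1, n, 0, 1) \<in> SL2Z" "(0, -1, 1, 0) \<in> SL2Z" for n by (auto simp: SL2Z_def)
  have QTn: "Q (mmul \<gamma> (1, m, 0, 1))" if "\<gamma> \<in> SL2Z" "Q \<gamma>" for \<gamma> m
  proof (induction m rule: int_induct[where k = 0])
    case base
    show ?case using that by (cases \<gamma>) (simp add: mmul_def)
  next
    case (step1 i)
    have "mmul \<gamma> (1, i + 1, 0, 1) = mmul (mmul \<gamma> (1, i, 0, 1)) (1, 1, 0, 1)"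
      by (cases \<gamma>) (simp add: mmul_def algebra_simps)
    thus ?case using QT[OF mmul_SL2Z[OF that(1) gen(1)[of i]] step1(2)] by simp
  next
    case (step2 i)
    have "mmul \<gamma> (1, i - 1, 0, 1) = mmul (mmul \<gamma> (1, i, 0, 1)) (1, -1, 0, 1)"
      by (cases \<gamma>) (simp add: mmul_def algebra_simps)
    thus ?case using QT'[OF mmul_SL2Z[OF that(1) gen(1)[of i]] step2(2)] by simp
  qed
  have "\<forall>a b c d. \<gamma> = (a, b, c, d) \<longrightarrow> nat \<bar>c\<bar> = k \<longrightarrow> \<gamma> \<in> SL2Z \<longrightarrow> Q \<gamma>" for k \<gamma>
  proof (induction k arbitrary: \<gamma> rule: less_induct)
    case (less k)
    show ?case
    proof (intro allI impI)
      fix a b c d assume g: "\<gamma> = (a, b, c, d)" "nat \<bar>c\<bar> = k" "\<gamma> \<in> SL2Z"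
      have det: "a * d - b * c = 1" using g by (simp add: SL2Z_def)
      show "Q \<gamma>"
      proof (cases "c = 0")
        case True
        hence "a * d = 1" using det by simp
        hence "(a = 1 \<and> d = 1) \<or> (a = -1 \<and> d = -1)" by (rule zmult_eq_1_iff[THEN iffD1])
        thus ?thesis
        proof
          assume "a = 1 \<and> d = 1"
          hence "\<gamma> = mmul (1, 0, 0, 1) (1, b, 0, 1)" using g True by (simp add: mmul_def)
          thus ?thesis using QTn[OF gen(1)[of 0] Q1, of b] by simp
        next
          assume ad: "a = -1 \<and> d = -1"
          have "Q (mmul (mmul (1, 0, 0, 1) (0, -1, 1, 0)) (0, -1, 1, 0))"
            by (intro QS mmul_SL2Z gen Q1)
          hence "Q (-1, 0, 0, -1)" by (simp add: mmul_def)
          moreover have "(-1, 0, 0, -1) \<in> SL2Z" by (simp add: SL2Z_def)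
          ultimately have "Q (mmul (-1, 0, 0, -1) (1, - b, 0, 1))" by (intro QTn)
          thus ?thesis using g True ad by (simp add: mmul_def)
        qed
      next
        case False
        define m where "m = d div c"
        define r where "r = d mod c"
        have d: "d = c * m + r" by (simp add: m_def r_def)
        have "\<bar>r\<bar> < \<bar>c\<bar>" unfolding r_def using False by (rule abs_mod_less)
        hence lt: "nat \<bar>- r\<bar> < k" using g(2) False by auto
        define \<gamma>' where "\<gamma>' = (- (b - m * a), a, - r, c)"
        have g': "\<gamma>' \<in> SL2Z" using det by (simp add: \<gamma>'_def SL2Z_def d algebra_simps)
        have "Q \<gamma>'" using less.IH[OF lt, of \<gamma>'] g' by (simp add: \<gamma>'_def)
        hence "Q (mmul (mmul \<gamma>' (0, -1, 1, 0)) (1, m, 0, 1))"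
          by (intro QTn QS mmul_SL2Z g' gen)
        thus ?thesis by (simp add: mmul_def \<gamma>'_def g(1) d algebra_simps)
      qed
    qed
  qed
  thus ?thesis using g by (cases \<gamma>) auto
qed

definition modular_interior :: "complex set" where
  "modular_interior = {\<tau>. Im \<tau> > 0 \<and> \<bar>Re \<tau>\<bar> < 1/2 \<and> norm \<tau> > 1}"

lemma finite_small_denominators:
  assumes y: "Im \<tau> > 0"
  shows "finite {(c, d). norm (of_int (c::int) * \<tau> + of_int (d::int)) \<le> 1}"
proof -
  define N where "N = \<lceil>1 / Im \<tau>\<rceil>"
  define R where "R = \<lceil>1 + (1 / Im \<tau>) * norm \<tau>\<rceil>"
  have "{(c, d). norm (of_int (c::int) * \<tau> + of_int (d::int)) \<le> 1} \<subseteq> {- N..N} \<times> {- R..R}"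
  proof safe
    fix c d :: int assume le: "norm (of_int c * \<tau> + of_int d) \<le> 1"
    have "\<bar>of_int c * Im \<tau>\<bar> \<le> 1"
      using order_trans[OF abs_Im_le_cmod le] by simp
    hence c1: "\<bar>real_of_int c\<bar> \<le> 1 / Im \<tau>" using y by (simp add: abs_mult field_simps)
    hence cN: "real_of_int \<bar>c\<bar> \<le> of_int N" unfolding N_def by linarith
    have "norm (complex_of_int d) \<le> norm (of_int c * \<tau> + of_int d) + norm (of_int c * \<tau>)"
      by (metis add.commute add_diff_cancel_left' norm_triangle_ineq4)
    also have "\<dots> \<le> 1 + (1 / Im \<tau>) * norm \<tau>"
      using le mult_right_mono[OF c1 norm_ge_zero[of \<tau>]] by (intro add_mono) (simp_all add: norm_mult)
    finally have "real_of_int \<bar>d\<bar> \<le> of_int R" unfolding R_def by (simp, linarith)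
    with cN show "c \<in> {- N..N}" "d \<in> {- R..R}" by (simp_all only: of_int_le_iff) auto
  qed
  thus ?thesis by (rule finite_subset) simp
qed

text \<open>Only finitely many bottom rows make \<open>c \<tau> + d\<close> small; a bottom row with the
  smallest value gives an image of maximal height, which after a translation lies in the fundamental
  domain.\<close>

lemma reduction_to_modular_domain:
  assumes t: "\<tau> \<in> uhp"
  obtains \<gamma> where "\<gamma> \<in> SL2Z" "mob \<gamma> \<tau> \<in> modular_domain"
proof -
  have y: "Im \<tau> > 0" using t by (simp add: uhp_def)
  let ?den = "\<lambda>(c, d). norm (of_int (c::int) * \<tau> + of_int (d::int))"
  define A where "A = {(c, d). ?den (c, d) \<le> 1 \<and> (\<exists>a b. (a, b, c, d) \<in> SL2Z)}"
  have fin: "finite A"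
    by (rule finite_subset[OF _ finite_small_denominators[OF y]]) (auto simp: A_def)
  have "(0, 1) \<in> A" by (auto simp: A_def SL2Z_def)
  hence ne: "A \<noteq> {}" by blast
  obtain p where p: "p \<in> A" "\<And>q. q \<in> A \<Longrightarrow> ?den p \<le> ?den q"
  proof -
    have "Min (?den ` A) \<in> ?den ` A" using fin ne by (intro Min_in) auto
    then obtain p where "p \<in> A" "?den p = Min (?den ` A)" by (metis (no_types, lifting) imageE)
    thus ?thesis using fin by (intro that[of p]) auto
  qed
  obtain c d where cd: "p = (c, d)" by (cases p)
  obtain a0 b0 where ab0: "(a0, b0, c, d) \<in> SL2Z" using p(1) by (auto simp: A_def cd)
  define m where "m = \<lfloor>Re (mob (a0, b0, c, d) \<tau>) + 1/2\<rfloor>"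
  define \<gamma> where "\<gamma> = (a0 - m * c, b0 - m * d, c, d)"
  have g: "\<gamma> \<in> SL2Z" using ab0 by (auto simp: SL2Z_def \<gamma>_def algebra_simps)
  have D: "of_int c * \<tau> + of_int d \<noteq> 0" using denom_nonzero[OF SL2Z_bottom[OF ab0] y] .
  have mg: "mob \<gamma> \<tau> = mob (a0, b0, c, d) \<tau> - of_int m"
  proof -
    have e: "of_int (a0 - m * c) * \<tau> + of_int (b0 - m * d) = (of_int a0 * \<tau> + of_int b0) - of_int m * (of_int c * \<tau> + of_int d)"
      by (simp add: algebra_simps)
    show ?thesis unfolding mob_def \<gamma>_def prod.case e using D by (simp add: diff_divide_distrib)
  qed
  have "Re (mob \<gamma> \<tau>) = Re (mob (a0, b0, c, d) \<tau>) - of_int m" by (simp add: mg)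
  hence re: "\<bar>Re (mob \<gamma> \<tau>)\<bar> \<le> 1/2" unfolding m_def by linarith
  have up: "mob \<gamma> \<tau> \<in> uhp" by (rule mob_uhp[OF g t])
  have "norm (mob \<gamma> \<tau>) \<ge> 1"
  proof (rule ccontr)
    assume "\<not> norm (mob \<gamma> \<tau>) \<ge> 1"
    hence lt: "norm (mob \<gamma> \<tau>) < 1" by simp
    let ?a = "a0 - m * c" and ?b = "b0 - m * d"
    have "norm (mob \<gamma> \<tau>) = norm (of_int ?a * \<tau> + of_int ?b) / norm (of_int c * \<tau> + of_int d)"
      by (simp add: mob_def \<gamma>_def norm_divide)
    hence less: "norm (of_int ?a * \<tau> + of_int ?b) < norm (of_int c * \<tau> + of_int d)"
      using lt D by (simp add: field_simps)
    have "norm (of_int c * \<tau> + of_int d) \<le> 1" using p(1) by (simp add: A_def cd)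
    moreover have "(- c, - d, ?a, ?b) \<in> SL2Z" using g by (simp add: SL2Z_def \<gamma>_def algebra_simps)
    ultimately have "(?a, ?b) \<in> A" using less by (auto simp: A_def)
    from p(2)[OF this] less show False by (simp add: cd)
  qed
  thus ?thesis using re up g by (intro that[of \<gamma>]) (auto simp: modular_domain_def uhp_def)
qed

lemma denominator_gt_1:
  assumes t: "\<tau> \<in> modular_interior" and c: "c \<noteq> 0"
  shows "norm (of_int c * \<tau> + of_int d) > 1"
proof -
  define x where "x = Re \<tau>"
  have x: "\<bar>x\<bar> < 1/2" and n: "(norm \<tau>)\<^sup>2 > 1"
    using t by (auto simp: modular_interior_def x_def power2_eq_square intro!: less_1_mult)
  have "(norm (of_int c * \<tau> + of_int d))\<^sup>2 = (of_int c)\<^sup>2 * (norm \<tau>)\<^sup>2 + 2 * of_int c * of_int d * x + (of_int d)\<^sup>2"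
    unfolding cmod_power2 x_def by (simp add: power2_eq_square algebra_simps)
  moreover have "(of_int c)\<^sup>2 * (norm \<tau>)\<^sup>2 > (real_of_int c)\<^sup>2" using n c by simp
  moreover have "2 * of_int c * of_int d * x \<ge> - \<bar>real_of_int c * of_int d\<bar>"
  proof -
    have "\<bar>2 * (real_of_int c * of_int d) * x\<bar> \<le> \<bar>real_of_int c * of_int d\<bar> * 1"
      using x mult_left_mono[of "2 * \<bar>x\<bar>" 1 "\<bar>real_of_int c * of_int d\<bar>"] by (simp add: abs_mult)
    thus ?thesis by (simp add: mult.assoc)
  qed
  ultimately have "(norm (of_int c * \<tau> + of_int d))\<^sup>2 > (real_of_int c)\<^sup>2 - \<bar>real_of_int c * of_int d\<bar> + (of_int d)\<^sup>2"
    by linarith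
  moreover have "c\<^sup>2 - \<bar>c * d\<bar> + d\<^sup>2 \<ge> 1"
  proof -
    have "2 * (c\<^sup>2 - \<bar>c * d\<bar> + d\<^sup>2) = c\<^sup>2 + d\<^sup>2 + (\<bar>c\<bar> - \<bar>d\<bar>)\<^sup>2"
      by (simp add: power2_diff abs_mult)
    moreover have "c\<^sup>2 > 0" "d\<^sup>2 \<ge> 0" "(\<bar>c\<bar> - \<bar>d\<bar>)\<^sup>2 \<ge> 0" using c by simp_all
    ultimately have "0 < 2 * (c\<^sup>2 - \<bar>c * d\<bar> + d\<^sup>2)" by linarith
    thus ?thesis by simp
  qed
  hence "(real_of_int c)\<^sup>2 - \<bar>real_of_int c * of_int d\<bar> + (of_int d)\<^sup>2 \<ge> 1"
    by (metis (mono_tags, lifting) of_int_1_le_iff of_int_abs of_int_add of_int_diff of_int_mult of_int_power)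
  ultimately have "(norm (of_int c * \<tau> + of_int d))\<^sup>2 > 1" by linarith
  thus ?thesis by (metis norm_ge_zero not_le one_power2 power_mono)
qed

text \<open>If \<open>c \<noteq> 0\<close>, then both \<open>\<gamma>\<close> and its inverse would strictly
  lower the imaginary part.\<close>

lemma interior_injective:
  assumes t: "\<tau> \<in> modular_interior" and g: "\<gamma> \<in> SL2Z" and gt: "mob \<gamma> \<tau> \<in> modular_interior"
  shows "\<gamma> = (1, 0, 0, 1) \<or> \<gamma> = (-1, 0, 0, -1)"
proof -
  obtain a b c d where abcd: "\<gamma> = (a, b, c, d)" by (cases \<gamma>)
  have tu: "\<tau> \<in> uhp" using t by (auto simp: modular_interior_def uhp_def)
  have c0: "c = 0"
  proof (rule ccontr)
    assume c: "c \<noteq> 0"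
    have "Im (mob \<gamma> \<tau>) < Im \<tau>"
    proof -
      have "(norm (of_int c * \<tau> + of_int d))\<^sup>2 > 1"
        using denominator_gt_1[OF t c, of d] by (simp add: power2_eq_square less_1_mult)
      thus ?thesis using g tu unfolding abcd by (subst Im_mob) (auto simp: uhp_def divide_less_eq)
    qed
    moreover have "Im (mob (minv \<gamma>) (mob \<gamma> \<tau>)) < Im (mob \<gamma> \<tau>)"
    proof -
      have "(norm (of_int (- c) * mob \<gamma> \<tau> + of_int a))\<^sup>2 > 1"
        using denominator_gt_1[OF gt, of "- c" a] c by (simp add: power2_eq_square less_1_mult)
      moreover have "minv \<gamma> = (d, - b, - c, a)" by (simp add: minv_def abcd)
      ultimately show ?thesis using minv_SL2Z[OF g] mob_uhp[OF g tu]
        by (simp only:) (subst Im_mob, auto simp: uhp_def divide_less_eq)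
    qed
    ultimately show False by (simp add: mob_minv[OF g tu])
  qed
  hence "a * d = 1" using g by (simp add: SL2Z_def abcd)
  hence ad: "(a = 1 \<and> d = 1) \<or> (a = -1 \<and> d = -1)" by (rule zmult_eq_1_iff[THEN iffD1])
  have "\<bar>Re (mob \<gamma> \<tau>)\<bar> < 1/2" "\<bar>Re \<tau>\<bar> < 1/2" using t gt by (auto simp: modular_interior_def)
  hence "\<bar>Re \<tau>\<bar> < 1/2 \<and> (\<bar>Re \<tau> + of_int b\<bar> < 1/2 \<or> \<bar>of_int b - Re \<tau>\<bar> < 1/2)"
    using ad c0 by (auto simp: mob_def abcd)
  hence "\<bar>real_of_int b\<bar> < 1" by linarith
  hence "b = 0" by linarith
  thus ?thesis using ad c0 abcd by auto
qed

section \<open>Unfolding integrals over the fundamental domain\<close>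

lemma nn_integral_lborel_scale:
  fixes h :: "complex \<Rightarrow> ennreal"
  assumes w: "w \<noteq> 0" and [measurable]: "h \<in> borel_measurable borel"
  shows "(\<integral>\<^sup>+z. h (w * z) \<partial>lborel) = ennreal (1 / (norm w)\<^sup>2) * (\<integral>\<^sup>+z. h z \<partial>lborel)"
proof -
  have lin: "linear ((*) w)" by (rule linearI) (simp_all add: distrib_left)
  have inj: "inj ((*) w)" using w by (auto intro: injI)
  obtain c where c: "c > 0" "distr lborel borel ((*) w) = density lborel (\<lambda>_. ennreal c)"
    using lborel_linear_distr[OF lin inj] by metis
  have eq: "(\<integral>\<^sup>+z. g (w * z) \<partial>lborel) = ennreal c * (\<integral>\<^sup>+z. g z \<partial>lborel)"
    if [measurable]: "g \<in> borel_measurable borel" for g :: "complex \<Rightarrow> ennreal"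
  proof -
    have "(\<integral>\<^sup>+z. g (w * z) \<partial>lborel) = (\<integral>\<^sup>+z. g z \<partial>distr lborel borel ((*) w))"
      by (subst nn_integral_distr) auto
    also have "\<dots> = ennreal c * (\<integral>\<^sup>+z. g z \<partial>lborel)"
      unfolding c(2) by (subst nn_integral_density) (auto simp: nn_integral_cmult)
    finally show ?thesis .
  qed
  have em: "emeasure lborel (ball (0::complex) r) = ennreal (r\<^sup>2 * measure lborel (ball (0::complex) 1))" if "r > 0" for r
  proof -
    have "emeasure lborel (ball (0::complex) r) = ennreal (measure lborel (ball (0::complex) r))"
      using emeasure_lborel_ball_finite[of "0::complex" r] by (intro emeasure_eq_ennreal_measure) auto
    thus ?thesis using content_ball_conv_unit_ball[of r "0::complex"] that by simp
  qed
  have "(\<integral>\<^sup>+z. indicator (ball 0 1) (w * z) \<partial>lborel) = (\<integral>\<^sup>+z. indicator (ball (0::complex) (1 / norm w)) z \<partial>lborel)"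
    using w by (intro nn_integral_cong) (auto simp: indicator_def norm_mult field_simps)
  moreover have "indicator (ball (0::complex) 1) \<in> borel_measurable borel"
    by (intro borel_measurable_indicator borel_open) auto
  ultimately have "ennreal ((1 / norm w)\<^sup>2 * measure lborel (ball (0::complex) 1)) = ennreal c * ennreal (measure lborel (ball (0::complex) 1))"
    using eq[of "indicator (ball 0 1)"] em[of "1 / norm w"] em[of 1] w by simp
  hence A: "(1 / norm w)\<^sup>2 * measure lborel (ball (0::complex) 1) = c * measure lborel (ball (0::complex) 1)"
    using c(1) by (simp flip: ennreal_mult)
  have "measure lborel (ball (0::complex) 1) > 0" by (rule content_ball_pos) simp
  hence "(1 / norm w)\<^sup>2 = c" using A by (simp only: mult_cancel_right) auto
  hence "c = 1 / (norm w)\<^sup>2" by (simp add: power_divide)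
  thus ?thesis using eq[of h] by simp
qed

text \<open>The integral for \<open>dz / (norm z)\<^sup>2\<close>, the Haar measure of the multiplicative
  group of complex numbers.\<close>

definition mult_haar :: "(complex \<Rightarrow> ennreal) \<Rightarrow> ennreal" where
  "mult_haar f = (\<integral>\<^sup>+z. f z * ennreal (1 / (norm z)\<^sup>2) \<partial>lborel)"

lemma mult_haar_scale:
  assumes w: "w \<noteq> 0" and [measurable]: "f \<in> borel_measurable borel"
  shows "mult_haar (\<lambda>z. f (w * z)) = mult_haar f"
proof -
  have n: "ennreal (1 / (norm z)\<^sup>2) = ennreal ((norm w)\<^sup>2) * ennreal (1 / (norm (w * z))\<^sup>2)" for z
    using w by (subst ennreal_mult[symmetric]) (auto simp: norm_mult power_mult_distrib)
  have "mult_haar (\<lambda>z. f (w * z)) = (\<integral>\<^sup>+z. ennreal ((norm w)\<^sup>2) * (f (w * z) * ennreal (1 / (norm (w * z))\<^sup>2)) \<partial>lborel)"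
    unfolding mult_haar_def by (intro nn_integral_cong) (subst n, simp only: mult_ac)
  also have "\<dots> = ennreal ((norm w)\<^sup>2) * (\<integral>\<^sup>+z. f (w * z) * ennreal (1 / (norm (w * z))\<^sup>2) \<partial>lborel)"
    by (intro nn_integral_cmult) measurable
  also have "(\<integral>\<^sup>+z. f (w * z) * ennreal (1 / (norm (w * z))\<^sup>2) \<partial>lborel) = ennreal (1 / (norm w)\<^sup>2) * mult_haar f"
    unfolding mult_haar_def by (rule nn_integral_lborel_scale[OF w]) measurable
  also have "ennreal ((norm w)\<^sup>2) * (ennreal (1 / (norm w)\<^sup>2) * mult_haar f) = mult_haar f"
    using w by (simp add: mult.assoc[symmetric] ennreal_mult[symmetric])
  finally show ?thesis .
qed

text \<open>A Haar measure of a commutative group is invariant under inversion: integrate \<open>f (1 / z) g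
  (z w)\<close> over both variables and use the invariance under multiplication in each, with a test
  function \<open>g\<close> of finite positive integral.\<close>

lemma mult_haar_inverse:
  assumes [measurable]: "f \<in> borel_measurable borel"
  shows "mult_haar (\<lambda>z. f (1 / z)) = mult_haar f"
proof -
  define g :: "complex \<Rightarrow> ennreal" where "g = indicator (cball 0 2 - ball 0 1)"
  have [measurable]: "g \<in> borel_measurable borel" unfolding g_def by (intro borel_measurable_indicator sets.Diff borel_closed borel_open) auto
  let ?k = "\<lambda>z::complex. ennreal (1 / (norm z)\<^sup>2)"
  have AE0: "AE z in lborel. z \<noteq> (0::complex)" by (rule AE_lborel_singleton)
  have "mult_haar (\<lambda>z. f (1 / z)) * mult_haar g = (\<integral>\<^sup>+z. f (1 / z) * ?k z * mult_haar g \<partial>lborel)"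
    unfolding mult_haar_def[of "\<lambda>z. f (1 / z)"] by (rule nn_integral_multc[symmetric]) measurable
  also have "\<dots> = (\<integral>\<^sup>+z. (\<integral>\<^sup>+w. f (1 / z) * ?k z * (g (z * w) * ?k w) \<partial>lborel) \<partial>lborel)"
  proof (rule nn_integral_cong_AE, use AE0 in eventually_elim)
    fix z :: complex assume z: "z \<noteq> 0"
    have "mult_haar g = mult_haar (\<lambda>w. g (z * w))" by (rule mult_haar_scale[OF z, symmetric]) measurable
    thus "f (1 / z) * ?k z * mult_haar g = (\<integral>\<^sup>+w. f (1 / z) * ?k z * (g (z * w) * ?k w) \<partial>lborel)"
      unfolding mult_haar_def by (simp only:) (rule nn_integral_cmult[symmetric], measurable)
  qed
  also have "\<dots> = (\<integral>\<^sup>+w. (\<integral>\<^sup>+z. f (1 / z) * ?k z * (g (z * w) * ?k w) \<partial>lborel) \<partial>lborel)"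
    by (rule lborel_pair.Fubini') measurable
  also have "\<dots> = (\<integral>\<^sup>+w. (\<integral>\<^sup>+u. f (w / u) * ?k u * (g u * ?k w) \<partial>lborel) \<partial>lborel)"
  proof (rule nn_integral_cong_AE, use AE0 in eventually_elim)
    fix w :: complex assume w: "w \<noteq> 0"
    have "mult_haar (\<lambda>z. (\<lambda>u. f (w / u) * (g u * ?k w)) (w * z)) = mult_haar (\<lambda>u. f (w / u) * (g u * ?k w))"
      by (rule mult_haar_scale[OF w]) measurable
    thus "(\<integral>\<^sup>+z. f (1 / z) * ?k z * (g (z * w) * ?k w) \<partial>lborel) = (\<integral>\<^sup>+u. f (w / u) * ?k u * (g u * ?k w) \<partial>lborel)"
      unfolding mult_haar_def using w by (simp add: mult_ac)
  qed
  also have "\<dots> = (\<integral>\<^sup>+u. (\<integral>\<^sup>+w. f (w / u) * ?k u * (g u * ?k w) \<partial>lborel) \<partial>lborel)"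
    by (rule lborel_pair.Fubini') measurable
  also have "\<dots> = (\<integral>\<^sup>+u. (g u * ?k u) * mult_haar f \<partial>lborel)"
  proof (rule nn_integral_cong_AE, use AE0 in eventually_elim)
    fix u :: complex assume u: "u \<noteq> 0"
    have "mult_haar (\<lambda>w. f ((1 / u) * w)) = mult_haar f" by (rule mult_haar_scale) (use u in auto)
    hence "(g u * ?k u) * mult_haar f = (g u * ?k u) * (\<integral>\<^sup>+w. f (w / u) * ?k w \<partial>lborel)"
      by (simp add: mult_haar_def)
    also have "\<dots> = (\<integral>\<^sup>+w. (g u * ?k u) * (f (w / u) * ?k w) \<partial>lborel)"
      by (rule nn_integral_cmult[symmetric]) measurable
    finally show "(\<integral>\<^sup>+w. f (w / u) * ?k u * (g u * ?k w) \<partial>lborel) = (g u * ?k u) * mult_haar f"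
      by (simp add: mult_ac)
  qed
  also have "\<dots> = mult_haar g * mult_haar f"
    unfolding mult_haar_def[of g] by (rule nn_integral_multc) measurable
  finally have eq: "mult_haar (\<lambda>z. f (1 / z)) * mult_haar g = mult_haar f * mult_haar g" by (simp add: mult.commute)
  have g_fin: "mult_haar g < \<infinity>"
  proof -
    have "mult_haar g \<le> (\<integral>\<^sup>+z. indicator (cball (0::complex) 2) z \<partial>lborel)"
      unfolding mult_haar_def
    proof (rule nn_integral_mono)
      fix z :: complex
      have "ennreal (1 / (norm z)\<^sup>2) \<le> 1" if "norm z \<ge> 1"
        using that by (simp add: divide_le_eq power2_eq_square) (metis mult_mono mult_1 norm_ge_zero zero_le_one)
      thus "g z * ennreal (1 / (norm z)\<^sup>2) \<le> indicator (cball 0 2) z"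
        by (auto simp: g_def indicator_def)
    qed
    also have "\<dots> < \<infinity>" using emeasure_lborel_cball_finite[of "0::complex" 2] by simp
    finally show ?thesis .
  qed
  have g_pos: "mult_haar g > 0"
  proof -
    have "(\<integral>\<^sup>+z. ennreal (1/4) * indicator (ball (3/2 :: complex) (1/2)) z \<partial>lborel) \<le> mult_haar g"
      unfolding mult_haar_def
    proof (rule nn_integral_mono)
      fix z :: complex
      show "ennreal (1/4) * indicator (ball (3/2) (1/2)) z \<le> g z * ennreal (1 / (norm z)\<^sup>2)"
      proof (cases "z \<in> ball (3/2) (1/2)")
        case True
        hence d: "norm (3/2 - z) < 1/2" by (simp add: dist_norm)
        have "norm (3/2 :: complex) \<le> norm (3/2 - z) + norm z" by (metis diff_add_cancel norm_triangle_ineq)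
        hence 1: "norm z \<ge> 1" using d by simp
        have "norm z \<le> norm (3/2 :: complex) + norm (3/2 - z)" by (metis norm_minus_commute norm_triangle_sub)
        hence 2: "norm z \<le> 2" using d by simp
        have "(norm z)\<^sup>2 \<le> 2\<^sup>2" using 2 by (intro power_mono) auto
        hence "1 / 4 \<le> 1 / (norm z)\<^sup>2" using 1 by (intro divide_left_mono) auto
        thus ?thesis using True 1 2 by (simp add: g_def indicator_def)
      qed simp
    qed
    moreover have "(\<integral>\<^sup>+z. ennreal (1/4) * indicator (ball (3/2 :: complex) (1/2)) z \<partial>lborel) = ennreal (1/4) * emeasure lborel (ball (3/2 :: complex) (1/2))"
      by (subst nn_integral_cmult) (auto intro!: borel_measurable_indicator borel_open)
    moreover have "emeasure lborel (ball (3/2 :: complex) (1/2)) \<noteq> 0"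
      using content_ball_pos[of "1/2" "3/2 :: complex"] by (auto simp: measure_def)
    ultimately show ?thesis by (metis ennreal_eq_0_iff le_zero_eq mult_eq_0_iff not_gr_zero not_le zero_less_divide_1_iff zero_less_numeral)
  qed
  show ?thesis
    using eq g_fin g_pos by (auto simp: ennreal_mult_cancel_left mult.commute[of _ "mult_haar g"])
qed

text \<open>The hyperbolic measure \<open>dx dy / y\<^sup>2\<close>, supported on the upper half-plane so that
  it is invariant under \<open>SL\<^sub>2(\<int>)\<close> as a measure on the complex numbers.\<close>

definition hypH :: "complex measure" where
  "hypH = density lborel (\<lambda>\<tau>. indicator uhp \<tau> * ennreal (1 / (Im \<tau>)\<^sup>2))"

lemma uhp_borel [measurable]: "uhp \<in> sets borel"
  unfolding uhp_def by (intro borel_open open_halfspace_Im_gt)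

lemma Im_borel [measurable]: "Im \<in> borel_measurable borel" and Re_borel [measurable]: "Re \<in> borel_measurable borel"
  by (intro borel_measurable_continuous_onI continuous_intros)+

lemma sets_hypH [simp, measurable_cong]: "sets hypH = sets borel" and space_hypH [simp]: "space hypH = UNIV"
  by (simp_all add: hypH_def)

lemma nn_integral_hypH:
  assumes [measurable]: "h \<in> borel_measurable borel"
  shows "(\<integral>\<^sup>+\<tau>. h \<tau> \<partial>hypH) = (\<integral>\<^sup>+\<tau>. indicator uhp \<tau> * ennreal (1 / (Im \<tau>)\<^sup>2) * h \<tau> \<partial>lborel)"
  unfolding hypH_def by (rule nn_integral_density) measurable

lemma AE_hypH_uhp: "AE \<tau> in hypH. \<tau> \<in> uhp"
  unfolding hypH_def by (subst AE_density) (auto simp: indicator_def)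

lemma mob_measurable [measurable]: "mob \<gamma> \<in> borel_measurable borel"
  by (cases \<gamma>) (simp add: mob_def)

text \<open>It suffices to treat the generators. The inversion \<open>- 1 / \<tau>\<close> is reduced to
  \<open>mult_haar_inverse\<close> by writing \<open>dx dy / y\<^sup>2\<close> as a density for the
  multiplicative Haar measure.\<close>

lemma nn_integral_hypH_mob:
  assumes "\<gamma> \<in> SL2Z" and "h \<in> borel_measurable borel"
  shows "(\<integral>\<^sup>+\<tau>. h (mob \<gamma> \<tau>) \<partial>hypH) = (\<integral>\<^sup>+\<tau>. h \<tau> \<partial>hypH)"
proof -
  have shift: "(\<integral>\<^sup>+\<tau>. h (\<tau> + of_int n) \<partial>hypH) = (\<integral>\<^sup>+\<tau>. h \<tau> \<partial>hypH)"
    if [measurable]: "h \<in> borel_measurable borel" for h :: "complex \<Rightarrow> ennreal" and n :: int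
  proof -
    let ?g = "\<lambda>\<tau>. indicator uhp \<tau> * ennreal (1 / (Im \<tau>)\<^sup>2) * h \<tau>"
    have "(\<integral>\<^sup>+\<tau>. ?g \<tau> \<partial>lborel) = (\<integral>\<^sup>+\<tau>. ?g \<tau> \<partial>distr lborel borel ((+) (of_int n)))"
      by (simp add: lborel_distr_plus)
    also have "\<dots> = (\<integral>\<^sup>+\<tau>. ?g (of_int n + \<tau>) \<partial>lborel)" by (subst nn_integral_distr) auto
    also have "\<dots> = (\<integral>\<^sup>+\<tau>. h (\<tau> + of_int n) \<partial>hypH)"
      by (subst nn_integral_hypH) (auto intro!: nn_integral_cong simp: indicator_def uhp_def add.commute)
    finally show ?thesis by (simp add: nn_integral_hypH)
  qed
  have inv: "(\<integral>\<^sup>+\<tau>. h (- 1 / \<tau>) \<partial>hypH) = (\<integral>\<^sup>+\<tau>. h \<tau> \<partial>hypH)"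
    if [measurable]: "h \<in> borel_measurable borel" for h :: "complex \<Rightarrow> ennreal"
  proof -
    define f where "f z = indicator {z. Im z < 0} z * h (- z) * ennreal ((norm z)\<^sup>2 / (Im z)\<^sup>2)" for z
    have [measurable]: "{z. Im z < 0} \<in> sets borel" by (intro borel_open open_halfspace_Im_lt)
    have f_meas [measurable]: "f \<in> borel_measurable borel" unfolding f_def by measurable
    have "(\<integral>\<^sup>+\<tau>. h (- 1 / \<tau>) \<partial>hypH) = mult_haar (\<lambda>z. f (1 / z))"
      unfolding mult_haar_def
    proof (subst nn_integral_hypH, measurable, intro nn_integral_cong)
      fix \<tau> :: complex
      show "indicator uhp \<tau> * ennreal (1 / (Im \<tau>)\<^sup>2) * h (- 1 / \<tau>) = f (1 / \<tau>) * ennreal (1 / (norm \<tau>)\<^sup>2)"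
      proof (cases "\<tau> \<in> uhp")
        case True
        hence y: "Im \<tau> > 0" and n: "norm \<tau> > 0" by (auto simp: uhp_def)
        have im: "Im (1 / \<tau>) = - Im \<tau> / (norm \<tau>)\<^sup>2" by (simp add: Im_divide cmod_power2)
        have "(norm (1 / \<tau>))\<^sup>2 / (Im (1 / \<tau>))\<^sup>2 * (1 / (norm \<tau>)\<^sup>2) = 1 / (Im \<tau>)\<^sup>2"
          unfolding im using y n by (simp add: norm_divide power_divide field_simps power2_eq_square)
        hence "ennreal ((norm (1 / \<tau>))\<^sup>2 / (Im (1 / \<tau>))\<^sup>2) * ennreal (1 / (norm \<tau>)\<^sup>2) = ennreal (1 / (Im \<tau>)\<^sup>2)"
          by (subst ennreal_mult[symmetric]) auto
        moreover have "Im (1 / \<tau>) < 0" unfolding im using y n by (simp add: divide_neg_pos)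
        ultimately show ?thesis using True by (simp add: f_def mult.assoc mult.commute[of _ "h _"])
      next
        case False
        have "Im (1 / \<tau>) \<ge> 0" using False by (auto simp: Im_divide uhp_def not_less intro!: divide_nonpos_nonneg)
        thus ?thesis using False by (simp add: f_def)
      qed
    qed
    also have "\<dots> = mult_haar f" by (rule mult_haar_inverse) measurable
    also have "\<dots> = (\<integral>\<^sup>+z. (\<lambda>u. indicator uhp u * ennreal (1 / (Im u)\<^sup>2) * h u) ((-1) * z) \<partial>lborel)"
      unfolding mult_haar_def
    proof (intro nn_integral_cong)
      fix z :: complex
      show "f z * ennreal (1 / (norm z)\<^sup>2) = (\<lambda>u. indicator uhp u * ennreal (1 / (Im u)\<^sup>2) * h u) ((-1) * z)"
      proof (cases "Im z < 0")
        case True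
        hence n: "norm z > 0" by auto
        have "ennreal ((norm z)\<^sup>2 / (Im z)\<^sup>2) * ennreal (1 / (norm z)\<^sup>2) = ennreal (1 / (Im z)\<^sup>2)"
          using n by (subst ennreal_mult[symmetric]) auto
        thus ?thesis using True by (simp add: f_def uhp_def mult.assoc mult.commute[of _ "h _"])
      qed (auto simp: f_def uhp_def)
    qed
    also have "\<dots> = (\<integral>\<^sup>+\<tau>. h \<tau> \<partial>hypH)"
      by (subst nn_integral_lborel_scale) (auto simp: nn_integral_hypH)
    finally show ?thesis .
  qed
  define Q where "Q \<gamma> \<longleftrightarrow> (\<forall>h. h \<in> borel_measurable borel \<longrightarrow>
    (\<integral>\<^sup>+\<tau>. h (mob \<gamma> \<tau>) \<partial>hypH) = (\<integral>\<^sup>+\<tau>. (h \<tau> :: ennreal) \<partial>hypH))" for \<gamma>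
  have step: "Q (mmul \<gamma> \<delta>)" if "\<gamma> \<in> SL2Z" "\<delta> \<in> SL2Z" "Q \<gamma>" "Q \<delta>" for \<gamma> \<delta>
    unfolding Q_def
  proof (intro allI impI)
    fix h :: "complex \<Rightarrow> ennreal" assume h [measurable]: "h \<in> borel_measurable borel"
    have hm: "(\<lambda>u. h (mob \<gamma> u)) \<in> borel_measurable borel" by measurable
    have "(\<integral>\<^sup>+\<tau>. h (mob (mmul \<gamma> \<delta>) \<tau>) \<partial>hypH) = (\<integral>\<^sup>+\<tau>. h (mob \<gamma> (mob \<delta> \<tau>)) \<partial>hypH)"
      by (intro nn_integral_cong_AE, use AE_hypH_uhp in eventually_elim) (simp add: mob_mmul that)
    also have "\<dots> = (\<integral>\<^sup>+\<tau>. h (mob \<gamma> \<tau>) \<partial>hypH)" using that(4) hm unfolding Q_def by blast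
    also have "\<dots> = (\<integral>\<^sup>+\<tau>. h \<tau> \<partial>hypH)" using that(3) h unfolding Q_def by blast
    finally show "(\<integral>\<^sup>+\<tau>. h (mob (mmul \<gamma> \<delta>) \<tau>) \<partial>hypH) = (\<integral>\<^sup>+\<tau>. h \<tau> \<partial>hypH)" .
  qed
  have gens: "(1, 1, 0, 1) \<in> SL2Z" "(1, -1, 0, 1) \<in> SL2Z" "(0, -1, 1, 0) \<in> SL2Z"
    by (simp_all add: SL2Z_def)
  have Qg: "Q (1, 1, 0, 1)" "Q (1, -1, 0, 1)" "Q (0, -1, 1, 0)"
    unfolding Q_def using shift[of _ 1] shift[of _ "-1"] inv by (auto simp: mob_def)
  have "Q \<gamma>"
    using assms(1)
  proof (rule SL2Z_induct)
    show "Q (1, 0, 0, 1)" by (simp add: Q_def)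
  qed (use step gens Qg in blast)+
  thus ?thesis using assms(2) unfolding Q_def by blast
qed

lemma distr_hypH_mob: "\<gamma> \<in> SL2Z \<Longrightarrow> distr hypH borel (mob \<gamma>) = hypH"
proof (rule measure_eqI)
  fix A assume g: "\<gamma> \<in> SL2Z" and "A \<in> sets (distr hypH borel (mob \<gamma>))"
  hence A [measurable]: "A \<in> sets borel" by simp
  have "emeasure (distr hypH borel (mob \<gamma>)) A = (\<integral>\<^sup>+\<tau>. indicator A (mob \<gamma> \<tau>) \<partial>hypH)"
    by (subst nn_integral_distr[symmetric, of "mob \<gamma>" hypH borel "indicator A"]) auto
  also have "\<dots> = (\<integral>\<^sup>+\<tau>. indicator A \<tau> \<partial>hypH)" by (rule nn_integral_hypH_mob[OF g]) measurable
  finally show "emeasure (distr hypH borel (mob \<gamma>)) A = emeasure hypH A" by simp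
qed simp

lemma integral_hypH_mob:
  fixes F :: "complex \<Rightarrow> complex"
  assumes "\<gamma> \<in> SL2Z" and [measurable]: "F \<in> borel_measurable borel"
  shows "(\<integral>\<tau>. F (mob \<gamma> \<tau>) \<partial>hypH) = (\<integral>\<tau>. F \<tau> \<partial>hypH)"
    and "integrable hypH (\<lambda>\<tau>. F (mob \<gamma> \<tau>)) \<longleftrightarrow> integrable hypH F"
proof -
  have [measurable]: "mob \<gamma> \<in> measurable hypH borel" by simp
  show "(\<integral>\<tau>. F (mob \<gamma> \<tau>) \<partial>hypH) = (\<integral>\<tau>. F \<tau> \<partial>hypH)"
    using integral_distr[of "mob \<gamma>" hypH borel F] distr_hypH_mob[OF assms(1)] by simp
  show "integrable hypH (\<lambda>\<tau>. F (mob \<gamma> \<tau>)) \<longleftrightarrow> integrable hypH F"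
    using integrable_distr_eq[of "mob \<gamma>" hypH borel F] distr_hypH_mob[OF assms(1)] by simp
qed

lemma modular_domain_borel [measurable]: "modular_domain \<in> sets borel"
proof -
  have d: "modular_domain = uhp \<inter> {\<tau>. \<bar>Re \<tau>\<bar> \<le> 1/2} \<inter> {\<tau>. norm \<tau> \<ge> 1}"
    by (auto simp: modular_domain_def uhp_def)
  have c: "closed {\<tau>. \<bar>Re \<tau>\<bar> \<le> 1/2}" "closed {\<tau>::complex. norm \<tau> \<ge> 1}"
    by (intro closed_Collect_le continuous_intros)+
  show ?thesis unfolding d by (intro sets.Int uhp_borel borel_closed[OF c(1)] borel_closed[OF c(2)])
qed

lemma strip_domain_borel [measurable]: "strip_domain \<in> sets borel"
proof -
  have d: "strip_domain = uhp \<inter> {\<tau>. 0 \<le> Re \<tau>} \<inter> {\<tau>. Re \<tau> < 1}"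
    by (auto simp: strip_domain_def uhp_def)
  have c: "closed {\<tau>. 0 \<le> Re \<tau>}" "open {\<tau>. Re \<tau> < 1}"
    by (intro closed_Collect_le open_Collect_less continuous_intros)+
  show ?thesis unfolding d by (intro sets.Int uhp_borel borel_closed[OF c(1)] borel_open[OF c(2)])
qed

lemma countable_SL2Z: "countable SL2Z"
  by (rule countable_subset[OF subset_UNIV]) simp

text \<open>Outside the translates of the boundary, a null set, \<open>\<tau>\<close> lies in exactly one
  image of the fundamental domain, which is counted twice because of \<open>\<gamma>\<close> and
  \<open>- \<gamma>\<close>.\<close>

lemma AE_two_tiles: "AE \<tau> in hypH. \<exists>\<gamma>0\<in>SL2Z. {\<gamma>\<in>SL2Z. mob \<gamma> \<tau> \<in> modular_domain} = {\<gamma>0, mmul (-1, 0, 0, -1) \<gamma>0} \<and> \<gamma>0 \<noteq> mmul (-1, 0, 0, -1) \<gamma>0"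
proof -
  define N where "N = modular_domain - modular_interior"
  have d: "modular_interior = modular_domain \<inter> {\<tau>. \<bar>Re \<tau>\<bar> < 1/2} \<inter> {\<tau>. norm \<tau> > 1}"
    by (auto simp: modular_domain_def modular_interior_def)
  have c: "open {\<tau>. \<bar>Re \<tau>\<bar> < 1/2}" "open {\<tau>::complex. norm \<tau> > 1}"
    by (intro open_Collect_less continuous_intros)+
  have [measurable]: "modular_interior \<in> sets borel"
    unfolding d by (intro sets.Int modular_domain_borel borel_open[OF c(1)] borel_open[OF c(2)])
  have N_meas [measurable]: "N \<in> sets borel" unfolding N_def by measurable
  have "negligible N"
  proof (rule negligible_subset)
    have "negligible {x :: complex. 1 \<bullet> x = 1/2}" "negligible {x :: complex. 1 \<bullet> x = - (1/2)}"
      by (intro negligible_hyperplane; simp)+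
    thus "negligible ({x :: complex. 1 \<bullet> x = 1/2} \<union> {x. 1 \<bullet> x = - (1/2)} \<union> sphere 0 1)"
      by (intro negligible_Un negligible_sphere)
    show "N \<subseteq> {x :: complex. 1 \<bullet> x = 1/2} \<union> {x. 1 \<bullet> x = - (1/2)} \<union> sphere 0 1"
      by (auto simp: N_def modular_domain_def modular_interior_def inner_complex_def)
  qed
  hence "N \<in> null_sets lborel"
    by (simp add: negligible_iff_null_sets null_sets_completion_iff)
  hence "AE \<tau> in lborel. \<tau> \<notin> N" by (rule AE_not_in)
  hence AEN: "AE \<tau> in hypH. \<tau> \<notin> N"
    unfolding hypH_def by (subst AE_density) (auto elim: eventually_mono)
  have "AE \<tau> in hypH. mob \<gamma> \<tau> \<notin> N" if g: "\<gamma> \<in> SL2Z" for \<gamma>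
  proof -
    have "AE \<tau> in distr hypH borel (mob \<gamma>). \<tau> \<notin> N" unfolding distr_hypH_mob[OF g] by (rule AEN)
    thus ?thesis by (subst (asm) AE_distr_iff) auto
  qed
  hence "AE \<tau> in hypH. \<forall>\<gamma>\<in>SL2Z. mob \<gamma> \<tau> \<notin> N"
    by (subst AE_ball_countable[OF countable_SL2Z]) blast
  with AE_hypH_uhp show ?thesis
  proof eventually_elim
    fix \<tau> assume t: "\<tau> \<in> uhp" and nN: "\<forall>\<gamma>\<in>SL2Z. mob \<gamma> \<tau> \<notin> N"
    let ?m = "(-1, 0, 0, -1) :: imat"
    have m: "?m \<in> SL2Z" by (simp add: SL2Z_def)
    obtain \<gamma>0 where g0: "\<gamma>0 \<in> SL2Z" "mob \<gamma>0 \<tau> \<in> modular_domain" using reduction_to_modular_domain[OF t] .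
    have i0: "mob \<gamma>0 \<tau> \<in> modular_interior" using g0 nN by (auto simp: N_def)
    have mm: "mob (mmul ?m \<gamma>0) \<tau> = mob \<gamma>0 \<tau>"
      by (subst mob_mmul[OF m g0(1) t]) (simp add: mob_def)
    have "\<gamma> \<in> {\<gamma>0, mmul ?m \<gamma>0}" if g: "\<gamma> \<in> SL2Z" "mob \<gamma> \<tau> \<in> modular_domain" for \<gamma>
    proof -
      have i: "mob \<gamma> \<tau> \<in> modular_interior" using g nN by (auto simp: N_def)
      let ?\<delta> = "mmul \<gamma> (minv \<gamma>0)"
      have d: "?\<delta> \<in> SL2Z" by (intro mmul_SL2Z minv_SL2Z g g0)
      have "mob ?\<delta> (mob \<gamma>0 \<tau>) = mob \<gamma> \<tau>"
        using mob_minv(1)[OF g0(1) t] by (subst mob_mmul[OF g(1) minv_SL2Z[OF g0(1)] mob_uhp[OF g0(1) t]]) simp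
      hence "?\<delta> = (1, 0, 0, 1) \<or> ?\<delta> = ?m" using interior_injective[OF i0 d] i by simp
      moreover have "\<gamma> = mmul ?\<delta> \<gamma>0"
      proof -
        obtain a b c e where ge: "\<gamma> = (a, b, c, e)" by (cases \<gamma>)
        obtain a' b' c' e' where g0e: "\<gamma>0 = (a', b', c', e')" by (cases \<gamma>0)
        have det: "a' * e' - b' * c' = 1" using g0 by (simp add: SL2Z_def g0e)
        have "x = x * (a' * e' - b' * c')" for x :: int by (simp add: det)
        from this[of a] this[of b] this[of c] this[of e] show ?thesis
          by (simp add: ge g0e mmul_def minv_def algebra_simps)
      qed
      moreover have "mmul (1, 0, 0, 1) \<gamma>0 = \<gamma>0" by (cases \<gamma>0) (simp add: mmul_def)
      ultimately show ?thesis by auto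
    qed
    moreover have "\<gamma>0 \<noteq> mmul ?m \<gamma>0" using g0(1) by (cases \<gamma>0) (auto simp: mmul_def SL2Z_def)
    ultimately show "\<exists>\<gamma>0\<in>SL2Z. {\<gamma>\<in>SL2Z. mob \<gamma> \<tau> \<in> modular_domain} = {\<gamma>0, mmul ?m \<gamma>0} \<and> \<gamma>0 \<noteq> mmul ?m \<gamma>0"
      using g0 mm mmul_SL2Z[OF m g0(1)] by (intro bexI[of _ \<gamma>0] conjI) auto
  qed
qed

text \<open>The strip is cut into its intersections with the images of the fundamental domain; each piece is
  moved back by the invariance of the measure. Every point of the strip is counted twice by
  \<open>AE_two_tiles\<close>.\<close>

theorem unfolding_integral:
  fixes h :: "complex \<Rightarrow> complex"
  assumes h_meas [measurable]: "h \<in> borel_measurable borel"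
    and int: "integrable hypH (\<lambda>\<tau>. indicator strip_domain \<tau> * h \<tau>)"
  shows "integrable hypH (\<lambda>\<tau>. \<Sum>\<^sub>\<infinity>\<gamma>\<in>SL2Z. indicator modular_domain \<tau> * (indicator strip_domain (mob \<gamma> \<tau>) * h (mob \<gamma> \<tau>)))"
    and "(\<integral>\<tau>. (\<Sum>\<^sub>\<infinity>\<gamma>\<in>SL2Z. indicator modular_domain \<tau> * (indicator strip_domain (mob \<gamma> \<tau>) * h (mob \<gamma> \<tau>))) \<partial>hypH)
      = 2 * (\<integral>\<tau>. indicator strip_domain \<tau> * h \<tau> \<partial>hypH)"
proof -
  let ?h = "\<lambda>\<tau>. indicator strip_domain \<tau> * h \<tau>"
  define g where "g \<gamma> \<tau> = indicator modular_domain (mob \<gamma> \<tau>) * ?h \<tau>" for \<gamma> \<tau>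
  define f where "f \<gamma> \<tau> = indicator modular_domain \<tau> * ?h (mob \<gamma> \<tau>)" for \<gamma> \<tau>
  have g_meas [measurable]: "g \<gamma> \<in> borel_measurable borel" for \<gamma> unfolding g_def by measurable
  have g_int: "integrable hypH (g \<gamma>)" for \<gamma>
  proof (rule Bochner_Integration.integrable_bound[OF int])
    show "g \<gamma> \<in> borel_measurable hypH" by measurable
    show "AE x in hypH. norm (g \<gamma> x) \<le> norm (?h x)"
      by (intro always_eventually allI) (simp add: g_def norm_mult indicator_def)
  qed
  have AEsum: "AE \<tau> in hypH. ((\<lambda>\<gamma>. g \<gamma> \<tau>) has_sum 2 * ?h \<tau>) SL2Z \<and> (\<forall>X. finite X \<longrightarrow> X \<subseteq> SL2Z \<longrightarrow> (\<Sum>\<gamma>\<in>X. norm (g \<gamma> \<tau>)) \<le> 2 * norm (?h \<tau>))"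
    using AE_two_tiles
  proof eventually_elim
    fix \<tau> assume "\<exists>\<gamma>0\<in>SL2Z. {\<gamma>\<in>SL2Z. mob \<gamma> \<tau> \<in> modular_domain} = {\<gamma>0, mmul (-1, 0, 0, -1) \<gamma>0} \<and> \<gamma>0 \<noteq> mmul (-1, 0, 0, -1) \<gamma>0"
    then obtain \<gamma>0 where g0: "\<gamma>0 \<in> SL2Z" "{\<gamma>\<in>SL2Z. mob \<gamma> \<tau> \<in> modular_domain} = {\<gamma>0, mmul (-1, 0, 0, -1) \<gamma>0}" "\<gamma>0 \<noteq> mmul (-1, 0, 0, -1) \<gamma>0"
      by blast
    let ?S = "{\<gamma>0, mmul (-1, 0, 0, -1) \<gamma>0}"
    have S: "?S \<subseteq> SL2Z" using g0(2) by blast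
    have in_iff: "\<gamma> \<in> SL2Z \<Longrightarrow> mob \<gamma> \<tau> \<in> modular_domain \<longleftrightarrow> \<gamma> \<in> ?S" for \<gamma> using g0(2) by blast
    have "((\<lambda>\<gamma>. g \<gamma> \<tau>) has_sum 2 * ?h \<tau>) SL2Z \<longleftrightarrow> ((\<lambda>\<gamma>. ?h \<tau>) has_sum 2 * ?h \<tau>) ?S"
    proof (rule has_sum_cong_neutral)
      fix \<gamma> assume "\<gamma> \<in> SL2Z - ?S"
      hence "mob \<gamma> \<tau> \<notin> modular_domain" using in_iff by blast
      thus "g \<gamma> \<tau> = 0" by (simp add: g_def)
    next
      fix \<gamma> assume "\<gamma> \<in> SL2Z \<inter> ?S"
      hence "mob \<gamma> \<tau> \<in> modular_domain" using in_iff by blast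
      thus "g \<gamma> \<tau> = ?h \<tau>" by (simp add: g_def)
    qed (use S in blast)
    moreover have "((\<lambda>\<gamma>. ?h \<tau>) has_sum 2 * ?h \<tau>) ?S"
      using has_sum_finite[of ?S "\<lambda>_. ?h \<tau>"] g0(3) by simp
    moreover have "(\<Sum>\<gamma>\<in>X. norm (g \<gamma> \<tau>)) \<le> 2 * norm (?h \<tau>)" if X: "finite X" "X \<subseteq> SL2Z" for X
    proof -
      have "(\<Sum>\<gamma>\<in>X. norm (g \<gamma> \<tau>)) = (\<Sum>\<gamma>\<in>X \<inter> ?S. norm (g \<gamma> \<tau>))"
      proof (rule sum.mono_neutral_right)
        show "\<forall>\<gamma>\<in>X - X \<inter> ?S. norm (g \<gamma> \<tau>) = 0"
        proof
          fix \<gamma> assume "\<gamma> \<in> X - X \<inter> ?S"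
          hence "mob \<gamma> \<tau> \<notin> modular_domain" using in_iff X by blast
          thus "norm (g \<gamma> \<tau>) = 0" by (simp add: g_def)
        qed
      qed (use X in auto)
      also have "\<dots> \<le> (\<Sum>\<gamma>\<in>X \<inter> ?S. norm (?h \<tau>))"
        by (intro sum_mono) (simp add: g_def norm_mult indicator_def)
      also have "\<dots> \<le> (\<Sum>\<gamma>\<in>?S. norm (?h \<tau>))" by (intro sum_mono2) auto
      also have "\<dots> = 2 * norm (?h \<tau>)" using g0(3) by simp
      finally show ?thesis .
    qed
    ultimately show "((\<lambda>\<gamma>. g \<gamma> \<tau>) has_sum 2 * ?h \<tau>) SL2Z \<and> (\<forall>X. finite X \<longrightarrow> X \<subseteq> SL2Z \<longrightarrow> (\<Sum>\<gamma>\<in>X. norm (g \<gamma> \<tau>)) \<le> 2 * norm (?h \<tau>))"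
      by blast
  qed
  have g_sm: "(\<lambda>\<gamma>. \<integral>\<tau>. norm (g \<gamma> \<tau>) \<partial>hypH) summable_on SL2Z"
  proof (rule nonneg_bdd_above_summable_on)
    show "bdd_above (sum (\<lambda>\<gamma>. \<integral>\<tau>. norm (g \<gamma> \<tau>) \<partial>hypH) ` {F. F \<subseteq> SL2Z \<and> finite F})"
    proof (rule bdd_aboveI2)
      fix X assume X: "X \<in> {F. F \<subseteq> SL2Z \<and> finite F}"
      have "(\<Sum>\<gamma>\<in>X. \<integral>\<tau>. norm (g \<gamma> \<tau>) \<partial>hypH) = (\<integral>\<tau>. (\<Sum>\<gamma>\<in>X. norm (g \<gamma> \<tau>)) \<partial>hypH)"
        using g_int by (intro Bochner_Integration.integral_sum[symmetric]) auto
      also have "\<dots> \<le> (\<integral>\<tau>. 2 * norm (?h \<tau>) \<partial>hypH)"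
      proof (rule integral_mono_AE)
        show "AE \<tau> in hypH. (\<Sum>\<gamma>\<in>X. norm (g \<gamma> \<tau>)) \<le> 2 * norm (?h \<tau>)"
          using AEsum by eventually_elim (use X in auto)
      qed (use g_int int in \<open>auto intro!: Bochner_Integration.integrable_sum integrable_mult_right\<close>)
      finally show "(\<Sum>\<gamma>\<in>X. \<integral>\<tau>. norm (g \<gamma> \<tau>) \<partial>hypH) \<le> (\<integral>\<tau>. 2 * norm (?h \<tau>) \<partial>hypH)" .
    qed
  qed simp
  have g_has: "((\<lambda>\<gamma>. \<integral>\<tau>. g \<gamma> \<tau> \<partial>hypH) has_sum 2 * (\<integral>\<tau>. ?h \<tau> \<partial>hypH)) SL2Z"
  proof -
    have "(\<integral>\<tau>. (\<Sum>\<^sub>\<infinity>\<gamma>\<in>SL2Z. g \<gamma> \<tau>) \<partial>hypH) = (\<integral>\<tau>. 2 * ?h \<tau> \<partial>hypH)"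
    proof (rule integral_cong_AE)
      show "AE \<tau> in hypH. (\<Sum>\<^sub>\<infinity>\<gamma>\<in>SL2Z. g \<gamma> \<tau>) = 2 * ?h \<tau>"
        using AEsum by eventually_elim (auto dest: infsumI)
      show "(\<lambda>\<tau>. \<Sum>\<^sub>\<infinity>\<gamma>\<in>SL2Z. g \<gamma> \<tau>) \<in> borel_measurable hypH"
        using integrable_infsum[OF countable_SL2Z g_int g_sm] by auto
    qed measurable
    thus ?thesis using has_sum_integral_infsum[OF countable_SL2Z g_int g_sm] by simp
  qed
  have gf: "(\<integral>\<tau>. f \<gamma> \<tau> \<partial>hypH) = (\<integral>\<tau>. g (minv \<gamma>) \<tau> \<partial>hypH)"
     "(\<integral>\<tau>. norm (f \<gamma> \<tau>) \<partial>hypH) = (\<integral>\<tau>. norm (g (minv \<gamma>) \<tau>) \<partial>hypH)"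
     "integrable hypH (f \<gamma>)" if gm: "\<gamma> \<in> SL2Z" for \<gamma>
  proof -
    have f_meas [measurable]: "f \<gamma> \<in> borel_measurable borel" unfolding f_def by measurable
    have AE: "AE \<tau> in hypH. g (minv \<gamma>) (mob \<gamma> \<tau>) = f \<gamma> \<tau>"
      using AE_hypH_uhp by eventually_elim (simp add: g_def f_def mob_minv[OF gm])
    have "(\<integral>\<tau>. f \<gamma> \<tau> \<partial>hypH) = (\<integral>\<tau>. g (minv \<gamma>) (mob \<gamma> \<tau>) \<partial>hypH)"
      by (rule integral_cong_AE) (use AE in \<open>auto elim: eventually_mono\<close>)
    also have "\<dots> = (\<integral>\<tau>. g (minv \<gamma>) \<tau> \<partial>hypH)" by (rule integral_hypH_mob(1)[OF gm]) measurable
    finally show "(\<integral>\<tau>. f \<gamma> \<tau> \<partial>hypH) = (\<integral>\<tau>. g (minv \<gamma>) \<tau> \<partial>hypH)" .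
    have "(\<integral>\<tau>. complex_of_real (norm (f \<gamma> \<tau>)) \<partial>hypH) = (\<integral>\<tau>. complex_of_real (norm (g (minv \<gamma>) (mob \<gamma> \<tau>))) \<partial>hypH)"
      by (rule integral_cong_AE) (use AE in \<open>auto elim: eventually_mono\<close>)
    also have "\<dots> = (\<integral>\<tau>. complex_of_real (norm (g (minv \<gamma>) \<tau>)) \<partial>hypH)"
      by (rule integral_hypH_mob(1)[OF gm]) measurable
    finally show "(\<integral>\<tau>. norm (f \<gamma> \<tau>) \<partial>hypH) = (\<integral>\<tau>. norm (g (minv \<gamma>) \<tau>) \<partial>hypH)"
      by (simp only: integral_complex_of_real of_real_eq_iff)
    have "integrable hypH (\<lambda>\<tau>. g (minv \<gamma>) (mob \<gamma> \<tau>))"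
      using integral_hypH_mob(2)[OF gm, of "g (minv \<gamma>)"] g_int by simp
    thus "integrable hypH (f \<gamma>)"
      by (rule integrable_cong_AE_imp) (use AE in auto)
  qed
  have bij: "bij_betw minv SL2Z SL2Z"
    by (rule bij_betwI[of _ _ _ minv]) (auto intro: minv_SL2Z)
  have f_sm: "(\<lambda>\<gamma>. \<integral>\<tau>. norm (f \<gamma> \<tau>) \<partial>hypH) summable_on SL2Z"
  proof -
    have "(\<lambda>\<gamma>. \<integral>\<tau>. norm (g (minv \<gamma>) \<tau>) \<partial>hypH) summable_on SL2Z"
      using summable_on_reindex_bij_betw[OF bij, of "\<lambda>\<gamma>. \<integral>\<tau>. norm (g \<gamma> \<tau>) \<partial>hypH"] g_sm by simp
    thus ?thesis by (subst summable_on_cong[OF gf(2)])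
  qed
  have f_has: "((\<lambda>\<gamma>. \<integral>\<tau>. f \<gamma> \<tau> \<partial>hypH) has_sum 2 * (\<integral>\<tau>. ?h \<tau> \<partial>hypH)) SL2Z"
  proof -
    have "((\<lambda>\<gamma>. \<integral>\<tau>. g (minv \<gamma>) \<tau> \<partial>hypH) has_sum 2 * (\<integral>\<tau>. ?h \<tau> \<partial>hypH)) SL2Z"
      using has_sum_reindex_bij_betw[OF bij, of "\<lambda>\<gamma>. \<integral>\<tau>. g \<gamma> \<tau> \<partial>hypH"] g_has by simp
    thus ?thesis by (subst has_sum_cong[OF gf(1)])
  qed
  show "integrable hypH (\<lambda>\<tau>. \<Sum>\<^sub>\<infinity>\<gamma>\<in>SL2Z. indicator modular_domain \<tau> * ?h (mob \<gamma> \<tau>))"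
    using integrable_infsum[OF countable_SL2Z gf(3) f_sm] by (simp add: f_def)
  show "(\<integral>\<tau>. (\<Sum>\<^sub>\<infinity>\<gamma>\<in>SL2Z. indicator modular_domain \<tau> * ?h (mob \<gamma> \<tau>)) \<partial>hypH) = 2 * (\<integral>\<tau>. ?h \<tau> \<partial>hypH)"
    using has_sum_unique[OF has_sum_integral_infsum[OF countable_SL2Z gf(3) f_sm] f_has] by (simp add: f_def)
qed

section \<open>Unfolding against a cusp form\<close>

lemma norm_ee: "norm (ee t) = exp (- 2 * pi * Im t)"
  by (simp add: ee_def norm_exp_eq_Re)

lemma cusp_form_mob:
  assumes "cusp_form k f" "(a, b, c, d) \<in> SL2Z" "Im \<tau> > 0"
  shows "f (mob (a, b, c, d) \<tau>) = (of_int c * \<tau> + of_int d) ^ k * f \<tau>"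
  using assms by (simp add: cusp_form_def SL2Z_def mob_def)

text \<open>The terms of the expansion are bounded at \<open>\<tau> = \<i> / 4\<close>; comparing with this
  point gives a geometric series for \<open>Im \<tau> \<ge> 1/2\<close>.\<close>

lemma cusp_form_decay:
  assumes "cusp_form k f"
  obtains C where "C > 0" "\<And>\<tau>. Im \<tau> \<ge> 1/2 \<Longrightarrow> norm (f \<tau>) \<le> C * exp (- 2 * pi * Im \<tau>)"
proof -
  obtain a :: "nat \<Rightarrow> complex" where a: "\<And>\<tau>. Im \<tau> > 0 \<Longrightarrow> (\<lambda>n. a (Suc n) * ee (of_nat (Suc n) * \<tau>)) sums f \<tau>"
    using assms by (auto simp: cusp_form_def)
  have "(\<lambda>n. a (Suc n) * ee (of_nat (Suc n) * (\<i> / 4))) sums f (\<i> / 4)" by (rule a) simp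
  hence "Bseq (\<lambda>n. a (Suc n) * ee (of_nat (Suc n) * (\<i> / 4)))"
    by (intro convergent_imp_Bseq summable_LIMSEQ_zero[THEN convergentI]) (rule sums_summable)
  then obtain B where B: "B > 0" "\<And>n. norm (a (Suc n) * ee (of_nat (Suc n) * (\<i> / 4))) \<le> B"
    by (auto simp: Bseq_def)
  define q where "q = exp (- (pi / 2))"
  have q: "0 < q" "q < 1" by (simp_all add: q_def)
  show ?thesis
  proof (rule that[of "B * exp (pi / 2) / (1 - q)"])
    show "B * exp (pi / 2) / (1 - q) > 0" using B q by simp
    fix \<tau> assume y: "Im \<tau> \<ge> 1/2"
    define x where "x = exp (pi / 2 - 2 * pi * Im \<tau>)"
    have "pi / 2 - 2 * pi * Im \<tau> \<le> - (pi / 2)" using mult_left_mono[OF y, of "2 * pi"] by simp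
    hence x: "0 < x" "x \<le> q" by (simp_all add: x_def q_def)
    have tm: "norm (a (Suc n) * ee (of_nat (Suc n) * \<tau>)) \<le> B * x * q ^ n" for n
    proof -
      have "norm (a (Suc n) * ee (of_nat (Suc n) * \<tau>)) = norm (a (Suc n)) * exp (- 2 * pi * (real (Suc n) * Im \<tau>))"
        by (simp add: norm_mult norm_ee)
      also have "exp (- 2 * pi * (real (Suc n) * Im \<tau>)) = exp (- 2 * pi * (real (Suc n) * (1/4))) * x ^ Suc n"
        unfolding x_def exp_of_nat_mult[symmetric] mult_exp_exp by (simp add: field_simps)
      also have "norm (a (Suc n)) * (exp (- 2 * pi * (real (Suc n) * (1/4))) * x ^ Suc n)
         = norm (a (Suc n) * ee (of_nat (Suc n) * (\<i> / 4))) * x ^ Suc n"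
        by (simp add: norm_mult norm_ee)
      also have "\<dots> \<le> B * x ^ Suc n" using B(2)[of n] x by (intro mult_right_mono) auto
      also have "\<dots> = B * x * x ^ n" by simp
      also have "\<dots> \<le> B * x * q ^ n" using B x by (intro mult_left_mono power_mono) auto
      finally show ?thesis .
    qed
    have gs: "(\<lambda>n. B * x * q ^ n) sums (B * x * (1 / (1 - q)))"
      using q by (intro sums_mult geometric_sums) auto
    have "norm (f \<tau>) \<le> B * x * (1 / (1 - q))"
    proof -
      have s: "(\<lambda>n. a (Suc n) * ee (of_nat (Suc n) * \<tau>)) sums f \<tau>" using y by (intro a) auto
      have sn: "summable (\<lambda>n. norm (a (Suc n) * ee (of_nat (Suc n) * \<tau>)))"
        by (rule summable_comparison_test'[OF sums_summable[OF gs]]) (use tm in auto)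
      have "norm (f \<tau>) \<le> (\<Sum>n. norm (a (Suc n) * ee (of_nat (Suc n) * \<tau>)))"
        unfolding sums_unique[OF s] by (rule summable_norm[OF sn])
      also have "\<dots> \<le> (\<Sum>n. B * x * q ^ n)"
        by (rule suminf_le[OF tm sn sums_summable[OF gs]])
      also have "\<dots> = B * x * (1 / (1 - q))" using sums_unique[OF gs] by simp
      finally show ?thesis .
    qed
    also have "x = exp (pi / 2) * exp (- 2 * pi * Im \<tau>)"
      by (simp add: x_def mult_exp_exp)
    also have "B * (exp (pi / 2) * exp (- 2 * pi * Im \<tau>)) * (1 / (1 - q)) = B * exp (pi / 2) / (1 - q) * exp (- 2 * pi * Im \<tau>)"
      by simp
    finally show "norm (f \<tau>) \<le> B * exp (pi / 2) / (1 - q) * exp (- 2 * pi * Im \<tau>)" .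
  qed
qed

lemma modular_domain_Im: "\<tau> \<in> modular_domain \<Longrightarrow> Im \<tau> \<ge> 1/2"
proof -
  assume t: "\<tau> \<in> modular_domain"
  hence y: "Im \<tau> > 0" and x: "\<bar>Re \<tau>\<bar> \<le> 1/2" and n: "1 \<le> norm \<tau>" by (auto simp: modular_domain_def)
  have "(Re \<tau>)\<^sup>2 \<le> (1/2)\<^sup>2" using x by (simp add: abs_le_square_iff[symmetric])
  moreover have "1\<^sup>2 \<le> (norm \<tau>)\<^sup>2" using n by (intro power_mono) auto
  ultimately have "(1/2)\<^sup>2 \<le> (Im \<tau>)\<^sup>2" unfolding cmod_power2 power_divide by simp
  thus ?thesis using y by (simp add: abs_le_square_iff[symmetric])
qed

text \<open>The function \<open>(norm f)\<^sup>2 y\<^sup>k\<close> is invariant, hence bounded by its supremum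
  over the fundamental domain. This covers small \<open>y\<close>; for large \<open>y\<close> the
  expansion gives exponential decay.\<close>

lemma cusp_form_bound:
  assumes f: "cusp_form k f"
  obtains C where "C > 0" "\<And>\<tau>. \<tau> \<in> uhp \<Longrightarrow> norm (f \<tau>) \<le> C * (1 + 1 / Im \<tau>) ^ k * exp (- 2 * pi * Im \<tau>)"
proof -
  obtain C where C: "C > 0" "\<And>\<tau>. Im \<tau> \<ge> 1/2 \<Longrightarrow> norm (f \<tau>) \<le> C * exp (- 2 * pi * Im \<tau>)"
    using cusp_form_decay[OF f] by metis
  define D where "D = C\<^sup>2 * fact k"
  have D: "D > 0" using C by (simp add: D_def)
  have inv: "(norm (f \<tau>))\<^sup>2 * Im \<tau> ^ k \<le> D" if t: "\<tau> \<in> uhp" for \<tau>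
  proof -
    obtain \<gamma> where g: "\<gamma> \<in> SL2Z" "mob \<gamma> \<tau> \<in> modular_domain" using reduction_to_modular_domain[OF t] .
    obtain a b c d where abcd: "\<gamma> = (a, b, c, d)" by (cases \<gamma>)
    have y: "Im \<tau> > 0" using t by (simp add: uhp_def)
    define j where "j = norm (of_int c * \<tau> + of_int d)"
    have j: "j > 0" using denom_nonzero[OF SL2Z_bottom y] g(1) by (simp add: j_def abcd)
    let ?u = "mob \<gamma> \<tau>"
    have "norm (f ?u) = j ^ k * norm (f \<tau>)"
      using cusp_form_mob[OF f _ y] g(1) by (simp add: abcd norm_mult norm_power j_def)
    moreover have "Im ?u = Im \<tau> / j\<^sup>2" using Im_mob g(1) by (simp add: abcd j_def)
    ultimately have "(norm (f ?u))\<^sup>2 * Im ?u ^ k = (norm (f \<tau>))\<^sup>2 * Im \<tau> ^ k"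
      using j by (simp add: power_mult_distrib power_divide power_mult[symmetric] mult.commute)
    moreover have "(norm (f ?u))\<^sup>2 * Im ?u ^ k \<le> D"
    proof -
      have yu: "Im ?u \<ge> 1/2" by (rule modular_domain_Im[OF g(2)])
      have "(norm (f ?u))\<^sup>2 * Im ?u ^ k \<le> (C * exp (- 2 * pi * Im ?u))\<^sup>2 * (fact k * exp (Im ?u))"
        using C(2)[OF yu] yu by (intro mult_mono power_mono power_le_fact_exp) auto
      also have "\<dots> = D * (exp (- 2 * pi * Im ?u) * exp (- 2 * pi * Im ?u) * exp (Im ?u))"
        by (simp add: D_def power_mult_distrib power2_eq_square mult_ac)
      also have "\<dots> \<le> D * 1"
      proof (intro mult_left_mono)
        have "pi \<ge> 3" using pi_gt3 by simp
        hence "Im ?u * 1 \<le> Im ?u * (4 * pi)" using yu by (intro mult_left_mono) auto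
        thus "exp (- 2 * pi * Im ?u) * exp (- 2 * pi * Im ?u) * exp (Im ?u) \<le> 1"
          by (simp add: mult_exp_exp mult_ac)
      qed (use D in auto)
      finally show ?thesis by simp
    qed
    ultimately show ?thesis by simp
  qed
  define E where "E = C + (1 + D) * exp pi"
  show ?thesis
  proof (rule that[of E])
    show "E > 0" using C D by (simp add: E_def add_pos_pos)
    fix \<tau> assume t: "\<tau> \<in> uhp"
    hence y: "Im \<tau> > 0" by (simp add: uhp_def)
    have Y: "1 + 1 / Im \<tau> \<ge> 1" using y by simp
    hence Yk: "(1 + 1 / Im \<tau>) ^ k \<ge> 1" by (rule one_le_power)
    show "norm (f \<tau>) \<le> E * (1 + 1 / Im \<tau>) ^ k * exp (- 2 * pi * Im \<tau>)"
    proof (cases "Im \<tau> \<ge> 1/2")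
      case True
      have "norm (f \<tau>) \<le> C * 1 * exp (- 2 * pi * Im \<tau>)" using C(2)[OF True] by simp
      also have "\<dots> \<le> E * (1 + 1 / Im \<tau>) ^ k * exp (- 2 * pi * Im \<tau>)"
        using Yk C D by (intro mult_right_mono mult_mono) (auto simp: E_def)
      finally show ?thesis .
    next
      case False
      define X where "X = norm (f \<tau>)"
      have "X \<le> 1 + X\<^sup>2" using sum_squares_bound[of X 1] by (simp add: X_def power2_eq_square)
         (smt (verit) norm_ge_zero)
      also have "X\<^sup>2 \<le> D / Im \<tau> ^ k" using inv[OF t] y by (simp add: X_def field_simps)
      also have "D / Im \<tau> ^ k = D * (1 / Im \<tau>) ^ k" by (simp add: power_divide)
      also have "1 + D * (1 / Im \<tau>) ^ k \<le> (1 + 1 / Im \<tau>) ^ k + D * (1 + 1 / Im \<tau>) ^ k"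
        using Yk D y by (intro add_mono mult_left_mono power_mono) auto
      also have "\<dots> = (1 + D) * (1 + 1 / Im \<tau>) ^ k * 1" by (simp add: algebra_simps)
      also have "\<dots> \<le> (1 + D) * (1 + 1 / Im \<tau>) ^ k * (exp pi * exp (- 2 * pi * Im \<tau>))"
      proof (rule mult_left_mono)
        have "2 * pi * Im \<tau> \<le> pi" using mult_left_mono[of "Im \<tau>" "1/2" "2 * pi"] False by simp
        thus "1 \<le> exp pi * exp (- 2 * pi * Im \<tau>)" by (simp add: mult_exp_exp)
      qed (use D Yk in auto)
      also have "\<dots> = ((1 + D) * exp pi) * (1 + 1 / Im \<tau>) ^ k * exp (- 2 * pi * Im \<tau>)" by (simp add: mult_ac)
      also have "\<dots> \<le> E * (1 + 1 / Im \<tau>) ^ k * exp (- 2 * pi * Im \<tau>)"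
        using Yk C D by (intro mult_right_mono) (auto simp: E_def)
      finally show ?thesis by (simp add: X_def)
    qed
  qed
qed

lemma exp_decay_integrable:
  fixes g :: "complex \<Rightarrow> complex"
  assumes A [measurable]: "A \<in> sets borel" and sub: "A \<subseteq> uhp \<inter> {\<tau>. \<bar>Re \<tau>\<bar> \<le> 1}"
    and meas: "(\<lambda>\<tau>. indicator A \<tau> * g \<tau>) \<in> borel_measurable borel"
    and C: "C \<ge> 0" and bd: "\<And>\<tau>. \<tau> \<in> A \<Longrightarrow> norm (g \<tau>) \<le> C * ((Im \<tau>)\<^sup>2 * exp (- Im \<tau>))"
  shows "integrable hypH (\<lambda>\<tau>. indicator A \<tau> * g \<tau>)"
    and "(\<integral>\<tau>. norm (indicator A \<tau> * g \<tau>) \<partial>hypH) \<le> C * (\<integral>\<tau>. norm (indicator (uhp \<inter> {\<tau>. \<bar>Re \<tau>\<bar> \<le> 1}) \<tau> * (complex_of_real ((Im \<tau>)\<^sup>2 * exp (- Im \<tau>)))) \<partial>hypH)"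
proof -
  let ?S = "uhp \<inter> {\<tau>. \<bar>Re \<tau>\<bar> \<le> 1}"
  let ?G = "\<lambda>\<tau>. indicator ?S \<tau> * complex_of_real ((Im \<tau>)\<^sup>2 * exp (- Im \<tau>))"
  have S [measurable]: "?S \<in> sets borel"
    by (intro sets.Int uhp_borel borel_closed closed_Collect_le continuous_intros)
  let ?f = "\<lambda>b x. if b = 1 then complex_of_real (indicator {-1..1} x) else complex_of_real (indicator {0..} x * exp (- x))"
  have ei: "integrable lborel (\<lambda>x::real. indicator {0..} x * exp (- x))"
  proof (rule integrableI_nonneg)
    have "(\<integral>\<^sup>+x. ennreal (exp (- x)) * indicator {0..} x \<partial>lborel) = ennreal (0 - (- exp (- 0)))"
    proof (rule nn_integral_FTC_atLeast)
      show "((\<lambda>x::real. - exp (- x)) \<longlongrightarrow> 0) at_top" by real_asymp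
    qed (auto intro!: derivative_eq_intros)
    moreover have "(\<integral>\<^sup>+x. ennreal (indicator {0..} x * exp (- x)) \<partial>lborel) = (\<integral>\<^sup>+x. ennreal (exp (- x)) * indicator {0..} x \<partial>lborel)"
      by (intro nn_integral_cong) (auto simp: indicator_def)
    ultimately show "(\<integral>\<^sup>+x. ennreal (indicator {0..} x * exp (- x)) \<partial>lborel) < \<infinity>" by simp
  qed auto
  have "integrable lborel (\<lambda>z::complex. \<Prod>b\<in>Basis. ?f b (z \<bullet> b))"
  proof (rule lborel_integral_prod(1)[where f = "?f"])
    fix b :: complex assume "b \<in> Basis"
    have "integrable lborel (indicator {-1..1} :: real \<Rightarrow> real)"
      by (rule integrable_real_indicator) auto
    thus "integrable lborel (?f b)"
      using ei by (cases "b = 1") (simp_all only: if_True if_False complex_of_real_integrable_eq refl simp_thms)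
  qed
  also have "(\<lambda>z. \<Prod>b\<in>Basis. ?f b (z \<bullet> b)) = (\<lambda>z. complex_of_real (indicator {-1..1} (Re z) * (indicator {0..} (Im z) * exp (- Im z))))"
    by (auto simp: fun_eq_iff Basis_complex_def inner_complex_def)
  finally have IL: "integrable lborel (\<lambda>z. complex_of_real (indicator {-1..1} (Re z) * (indicator {0..} (Im z) * exp (- Im z))))" .
  have GI: "integrable hypH ?G"
  proof (rule integrableI_bounded)
    show "?G \<in> borel_measurable hypH" by measurable
    have "(\<integral>\<^sup>+\<tau>. ennreal (norm (?G \<tau>)) \<partial>hypH) = (\<integral>\<^sup>+\<tau>. indicator uhp \<tau> * ennreal (1 / (Im \<tau>)\<^sup>2) * ennreal (norm (?G \<tau>)) \<partial>lborel)"
      by (rule nn_integral_hypH) measurable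
    also have "\<dots> \<le> (\<integral>\<^sup>+\<tau>. ennreal (norm (complex_of_real (indicator {-1..1} (Re \<tau>) * (indicator {0..} (Im \<tau>) * exp (- Im \<tau>))))) \<partial>lborel)"
    proof (rule nn_integral_mono)
      fix \<tau> :: complex
      show "indicator uhp \<tau> * ennreal (1 / (Im \<tau>)\<^sup>2) * ennreal (norm (?G \<tau>)) \<le> ennreal (norm (complex_of_real (indicator {-1..1} (Re \<tau>) * (indicator {0..} (Im \<tau>) * exp (- Im \<tau>)))))"
      proof (cases "\<tau> \<in> ?S")
        case True
        hence "Im \<tau> > 0" "\<bar>Re \<tau>\<bar> \<le> 1" by (auto simp: uhp_def)
        thus ?thesis using True
          by (simp add: norm_mult norm_power abs_le_iff indicator_def flip: ennreal_mult)
      qed simp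
    qed
    also have "\<dots> < \<infinity>" using IL unfolding integrable_iff_bounded by blast
    finally show "(\<integral>\<^sup>+\<tau>. ennreal (norm (?G \<tau>)) \<partial>hypH) < \<infinity>" .
  qed
  have pw: "norm (indicator A \<tau> * g \<tau>) \<le> C * norm (?G \<tau>)" for \<tau>
    using bd[of \<tau>] C sub by (auto simp: indicator_def norm_mult norm_power)
  show int: "integrable hypH (\<lambda>\<tau>. indicator A \<tau> * g \<tau>)"
  proof (rule Bochner_Integration.integrable_bound)
    show "integrable hypH (\<lambda>\<tau>. C * norm (?G \<tau>))" using GI by (intro integrable_mult_right integrable_norm)
    show "(\<lambda>\<tau>. indicator A \<tau> * g \<tau>) \<in> borel_measurable hypH" using meas by simp
    show "AE \<tau> in hypH. norm (indicator A \<tau> * g \<tau>) \<le> norm (C * norm (?G \<tau>))"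
      using pw C by (intro always_eventually allI) (simp add: abs_mult)
  qed
  have "(\<integral>\<tau>. norm (indicator A \<tau> * g \<tau>) \<partial>hypH) \<le> (\<integral>\<tau>. C * norm (?G \<tau>) \<partial>hypH)"
    by (intro integral_mono integrable_norm int integrable_mult_right GI pw)
  thus "(\<integral>\<tau>. norm (indicator A \<tau> * g \<tau>) \<partial>hypH) \<le> C * (\<integral>\<tau>. norm (?G \<tau>) \<partial>hypH)"
    by simp
qed

context theta_data begin

text \<open>The contribution of the coefficient \<open>(c, d)\<close> to the integrand of the lift, of weight
  zero.\<close>

definition orbit_term :: "(complex \<Rightarrow> complex) \<Rightarrow> real \<Rightarrow> real \<Rightarrow> complex \<Rightarrow> complex" where
  "orbit_term f c d \<tau> = of_real (Im \<tau> ^ (n + 2)) * f \<tau> * cnj (phi \<tau> c d)"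

lemma orbit_term_S:
  assumes f: "cusp_form (n + 1) f" and t: "\<tau> \<in> uhp" and cd: "c \<in> \<int>" "d \<in> \<int>"
  shows "orbit_term f c d (- 1 / \<tau>) = orbit_term f d (- c) \<tau>"
proof -
  have y: "Im \<tau> > 0" using t by (simp add: uhp_def)
  hence t0: "\<tau> \<noteq> 0" by auto
  have "f (mob (0, -1, 1, 0) \<tau>) = (of_int 1 * \<tau> + of_int 0) ^ (n + 1) * f \<tau>"
    by (rule cusp_form_mob[OF f _ y]) (simp add: SL2Z_def)
  hence fS: "f (- 1 / \<tau>) = \<tau> ^ (n + 1) * f \<tau>" by (simp add: mob_def)
  have nt: "complex_of_real ((norm \<tau>)\<^sup>2) = \<tau> * cnj \<tau>" by (rule complex_norm_square)
  have "orbit_term f c d (- 1 / \<tau>) = of_real ((Im \<tau> / (norm \<tau>)\<^sup>2) ^ (n + 2)) * (\<tau> ^ (n + 1) * f \<tau>) * cnj (\<tau> ^ (n + 2) * cnj \<tau> * phi \<tau> d (- c))"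
    unfolding orbit_term_def Im_S fS phi_S[OF y cd] ..
  also have "of_real ((Im \<tau> / (norm \<tau>)\<^sup>2) ^ (n + 2)) = complex_of_real (Im \<tau> ^ (n + 2)) / (\<tau> * cnj \<tau>) ^ (n + 2)"
    unfolding power_divide of_real_divide of_real_power[symmetric] nt[symmetric] by simp
  also have "complex_of_real (Im \<tau> ^ (n + 2)) / (\<tau> * cnj \<tau>) ^ (n + 2) * (\<tau> ^ (n + 1) * f \<tau>) * cnj (\<tau> ^ (n + 2) * cnj \<tau> * phi \<tau> d (- c))
     = orbit_term f d (- c) \<tau>"
    using t0 by (simp add: orbit_term_def power_mult_distrib power_add power2_eq_square field_simps)
  finally show ?thesis .
qed

lemma cusp_form_T:
  assumes f: "cusp_form k f" and y: "Im \<tau> > 0" shows "f (\<tau> + 1) = f \<tau>"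
proof -
  have "f (mob (1, 1, 0, 1) \<tau>) = (of_int 0 * \<tau> + of_int 1) ^ k * f \<tau>"
    by (rule cusp_form_mob[OF f _ y]) (simp add: SL2Z_def)
  thus ?thesis by (simp add: mob_def)
qed

lemma orbit_term_T:
  assumes f: "cusp_form k f" and t: "\<tau> \<in> uhp" and cd: "d \<in> \<int>"
  shows "orbit_term f c d (\<tau> + 1) = orbit_term f c (c + d) \<tau>"
  using cusp_form_T[OF f, of \<tau>] t by (simp add: orbit_term_def phi_T[OF cd] uhp_def)

text \<open>The weights of \<open>f\<close>, of \<open>phi\<close> and of the power of \<open>y\<close>
  cancel; by multiplicativity it suffices to check the generators.\<close>

lemma orbit_term_mob:
  assumes f: "cusp_form (n + 1) f" and g: "\<gamma> \<in> SL2Z"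
  shows "\<tau> \<in> uhp \<Longrightarrow> orbit_term f (of_int r) (of_int s) (mob \<gamma> \<tau>)
    = (case \<gamma> of (a, b, c, d) \<Rightarrow> orbit_term f (of_int (r * a + s * c)) (of_int (r * b + s * d)) \<tau>)"
proof -
  define Q where "Q \<gamma> \<longleftrightarrow> (\<forall>\<tau>\<in>uhp. \<forall>r s. orbit_term f (of_int r) (of_int s) (mob \<gamma> \<tau>)
    = (case \<gamma> of (a, b, c, d) \<Rightarrow> orbit_term f (of_int (r * a + s * c)) (of_int (r * b + s * d)) \<tau>))" for \<gamma>
  have step: "Q (mmul \<gamma> \<delta>)" if g: "\<gamma> \<in> SL2Z" "\<delta> \<in> SL2Z" and Qg: "Q \<gamma>" "Q \<delta>" for \<gamma> \<delta>
    unfolding Q_def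
  proof (intro ballI allI)
    fix \<tau> r s assume t: "\<tau> \<in> uhp"
    obtain a b c d where 1: "\<gamma> = (a, b, c, d)" by (cases \<gamma>)
    obtain a' b' c' d' where 2: "\<delta> = (a', b', c', d')" by (cases \<delta>)
    have "orbit_term f (of_int r) (of_int s) (mob (mmul \<gamma> \<delta>) \<tau>) = orbit_term f (of_int (r * a + s * c)) (of_int (r * b + s * d)) (mob \<delta> \<tau>)"
      using Qg(1) mob_uhp[OF g(2) t] unfolding mob_mmul[OF g t] unfolding Q_def 1 prod.case by blast
    also have "\<dots> = orbit_term f (of_int ((r * a + s * c) * a' + (r * b + s * d) * c')) (of_int ((r * a + s * c) * b' + (r * b + s * d) * d')) \<tau>"
      using Qg(2) t unfolding Q_def 2 prod.case by blast
    also have "\<dots> = (case mmul \<gamma> \<delta> of (a, b, c, d) \<Rightarrow> orbit_term f (of_int (r * a + s * c)) (of_int (r * b + s * d)) \<tau>)"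
      by (simp add: mmul_def 1 2 algebra_simps)
    finally show "orbit_term f (of_int r) (of_int s) (mob (mmul \<gamma> \<delta>) \<tau>) = (case mmul \<gamma> \<delta> of (a, b, c, d) \<Rightarrow> orbit_term f (of_int (r * a + s * c)) (of_int (r * b + s * d)) \<tau>)" .
  qed
  have gens: "(1, 1, 0, 1) \<in> SL2Z" "(1, -1, 0, 1) \<in> SL2Z" "(0, -1, 1, 0) \<in> SL2Z"
    by (simp_all add: SL2Z_def)
  have QT: "Q (1, 1, 0, 1)"
    unfolding Q_def using orbit_term_T[OF f] by (simp add: mob_def)
  have QT': "Q (1, -1, 0, 1)"
    unfolding Q_def
  proof (intro ballI allI)
    fix \<tau> r s assume t: "\<tau> \<in> uhp"
    hence t': "\<tau> - 1 \<in> uhp" by (simp add: uhp_def)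
    show "orbit_term f (of_int r) (of_int s) (mob (1, -1, 0, 1) \<tau>) = (case (1, -1, 0, 1) of (a, b, c, d) \<Rightarrow> orbit_term f (of_int (r * a + s * c)) (of_int (r * b + s * d)) \<tau>)"
      using orbit_term_T[OF f t', of "of_int (s - r)" "of_int r"] by (simp add: mob_def)
  qed
  have QS: "Q (0, -1, 1, 0)"
    unfolding Q_def using orbit_term_S[OF f] by (simp add: mob_def)
  have "Q \<gamma>"
    using g
  proof (rule SL2Z_induct)
    show "Q (1, 0, 0, 1)" by (simp add: Q_def)
  qed (use step gens QT QT' QS in blast)+
  thus "\<tau> \<in> uhp \<Longrightarrow> orbit_term f (of_int r) (of_int s) (mob \<gamma> \<tau>)
    = (case \<gamma> of (a, b, c, d) \<Rightarrow> orbit_term f (of_int (r * a + s * c)) (of_int (r * b + s * d)) \<tau>)"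
    unfolding Q_def by blast
qed

lemma orbit_term_summable:
  assumes "\<tau> \<in> uhp"
  shows "(\<lambda>z. norm (orbit_term f (fst z) (snd z) \<tau>)) summable_on zlat"
  unfolding orbit_term_def norm_mult complex_mod_cnj
  using assms by (intro summable_on_cmult_right phi_summable) (simp add: uhp_def)

lemma orbit_term_total:
  assumes "\<tau> \<in> uhp"
  shows "(\<Sum>\<^sub>\<infinity>z\<in>zlat. orbit_term f (fst z) (snd z) \<tau>) = of_real (Im \<tau> ^ (n + 2)) * f \<tau> * cnj (theta_sum \<tau> 0 0)"
proof -
  have y: "Im \<tau> > 0" using assms by (simp add: uhp_def)
  have "theta_sum \<tau> 0 0 = (\<Sum>\<^sub>\<infinity>z\<in>zlat. phi \<tau> (fst z) (snd z))"
    unfolding theta_sum_expansion[OF y] by (simp add: zero_prod_def[symmetric])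
  hence "cnj (theta_sum \<tau> 0 0) = (\<Sum>\<^sub>\<infinity>z\<in>zlat. cnj (phi \<tau> (fst z) (snd z)))"
    by (simp add: infsum_cnj)
  thus ?thesis unfolding orbit_term_def by (simp add: infsum_cmult_right')
qed

lemma orbit_term_measurable:
  assumes f: "cusp_form k f"
  shows "(\<lambda>\<tau>. indicator uhp \<tau> * orbit_term f 0 d \<tau>) \<in> borel_measurable borel"
proof -
  have "continuous_on uhp f" using f unfolding cusp_form_def uhp_def
    by (intro holomorphic_on_imp_continuous_on) blast
  hence "continuous_on uhp (orbit_term f 0 d)"
    unfolding orbit_term_def[abs_def] using continuous_on_phi_0[of d] by (intro continuous_intros) (simp_all add: uhp_def)
  hence "(\<lambda>\<tau>. indicator uhp \<tau> *\<^sub>R orbit_term f 0 d \<tau>) \<in> borel_measurable borel"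
    by (intro borel_measurable_continuous_on_indicator) auto
  moreover have "(\<lambda>\<tau>. indicator uhp \<tau> *\<^sub>R orbit_term f 0 d \<tau>) = (\<lambda>\<tau>. indicator uhp \<tau> * orbit_term f 0 d \<tau>)"
    by (auto simp: indicator_def fun_eq_iff)
  ultimately show ?thesis by simp
qed

text \<open>With \<open>x = d\<^sup>2 / y\<close> all factors \<open>1 / y\<close> and \<open>\<bar>d\<bar> /
  y\<close> are at most \<open>x\<close> and are absorbed by the Gaussian \<open>exp (- e
  x)\<close>. The gain \<open>1 / d\<^sup>2\<close> comes from \<open>d\<^sup>2 = x y\<close>, where
  the exponential decay of the cusp form pays for \<open>y\<close>.\<close>

lemma orbit_term_bounds:
  assumes f: "cusp_form (n + 1) f"
  obtains C where "C > 0"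
    "\<And>\<tau> d. \<tau> \<in> uhp \<Longrightarrow> \<bar>d\<bar> \<ge> 1 \<Longrightarrow> norm (orbit_term f 0 d \<tau>) \<le> C / d\<^sup>2 * ((Im \<tau>)\<^sup>2 * exp (- Im \<tau>))"
    "\<And>\<tau>. Im \<tau> \<ge> 1/2 \<Longrightarrow> norm (orbit_term f 0 0 \<tau>) \<le> C * ((Im \<tau>)\<^sup>2 * exp (- Im \<tau>))"
proof -
  obtain A where A: "A > 0" "\<And>\<tau>. \<tau> \<in> uhp \<Longrightarrow> norm (f \<tau>) \<le> A * (1 + 1 / Im \<tau>) ^ (n + 1) * exp (- 2 * pi * Im \<tau>)"
    by (rule cusp_form_bound[OF f], rule that)
  obtain K N where K: "K > 0" "\<And>\<tau> d. Im \<tau> > 0 \<Longrightarrow> norm (phi \<tau> 0 d) \<le>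
       K * (1 + 1 / Im \<tau>) ^ N * (1 + \<bar>d\<bar> / Im \<tau>)\<^sup>2 * exp (- pi * d\<^sup>2 / (2 * Im \<tau> * rho))"
    by (rule phi_0_bound, rule that)
  define m where "m = n + 1 + N + 3"
  define e where "e = pi / (2 * rho)"
  have e: "e > 0" using rho_pos by (simp add: e_def)
  define B where "B = fact m * exp e / e ^ m"
  have B: "B > 0" using e by (simp add: B_def)
  have poly: "(1 + t) ^ m * exp (- (e * t)) \<le> B" if "t \<ge> 0" for t :: real
  proof -
    have "(e * (1 + t)) ^ m \<le> fact m * exp (e * (1 + t))" using e that by (intro power_le_fact_exp) auto
    hence "(e * (1 + t)) ^ m * exp (- (e * t)) \<le> fact m * exp (e * (1 + t)) * exp (- (e * t))"
      by (intro mult_right_mono) auto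
    also have "\<dots> = fact m * exp e" unfolding mult.assoc mult_exp_exp by (simp add: algebra_simps)
    finally have "e ^ m * ((1 + t) ^ m * exp (- (e * t))) \<le> fact m * exp e"
      unfolding power_mult_distrib mult.assoc .
    thus ?thesis using e unfolding B_def by (simp add: pos_le_divide_eq mult.commute)
  qed
  have ypow: "y ^ (n + 3) * exp (- 2 * pi * y) \<le> fact (n + 1) * (y\<^sup>2 * exp (- y))"
    "y ^ (n + 2) * exp (- 2 * pi * y) \<le> fact n * (y\<^sup>2 * exp (- y))" if y: "y > 0" for y :: real
  proof -
    have "3 * y \<le> pi * y" using y pi_gt3 by (intro mult_right_mono) auto
    hence ee: "exp y * exp (- 2 * pi * y) \<le> exp (- y)" using y unfolding mult_exp_exp exp_le_cancel_iff by simp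
    have g: "y ^ (j + 2) * exp (- 2 * pi * y) \<le> fact j * (y\<^sup>2 * exp (- y))" for j
    proof -
      have "y ^ (j + 2) * exp (- 2 * pi * y) = y ^ j * (y\<^sup>2 * exp (- 2 * pi * y))" by (simp only: power_add mult.assoc)
      also have "\<dots> \<le> (fact j * exp y) * (y\<^sup>2 * exp (- 2 * pi * y))"
        using y by (intro mult_right_mono power_le_fact_exp) auto
      also have "\<dots> = fact j * (y\<^sup>2 * (exp y * exp (- 2 * pi * y)))" by simp
      also have "\<dots> \<le> fact j * (y\<^sup>2 * exp (- y))" using ee by (intro mult_left_mono) auto
      finally show ?thesis .
    qed
    show "y ^ (n + 3) * exp (- 2 * pi * y) \<le> fact (n + 1) * (y\<^sup>2 * exp (- y))" using g[of "n + 1"] by (simp add: eval_nat_numeral)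
    show "y ^ (n + 2) * exp (- 2 * pi * y) \<le> fact n * (y\<^sup>2 * exp (- y))" by (rule g)
  qed
  have raw: "norm (orbit_term f 0 d \<tau>) \<le> A * K * (Im \<tau> ^ (n + 2) * exp (- 2 * pi * Im \<tau>))
      * ((1 + 1 / Im \<tau>) ^ (n + 1 + N) * (1 + \<bar>d\<bar> / Im \<tau>)\<^sup>2 * exp (- (e * (d\<^sup>2 / Im \<tau>))))" if t: "\<tau> \<in> uhp" for d \<tau>
  proof -
    have y: "Im \<tau> > 0" using t by (simp add: uhp_def)
    have "norm (orbit_term f 0 d \<tau>) = Im \<tau> ^ (n + 2) * norm (f \<tau>) * norm (phi \<tau> 0 d)"
      using y by (simp add: orbit_term_def norm_mult norm_power)
    also have "\<dots> \<le> Im \<tau> ^ (n + 2) * (A * (1 + 1 / Im \<tau>) ^ (n + 1) * exp (- 2 * pi * Im \<tau>)) *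
        (K * (1 + 1 / Im \<tau>) ^ N * (1 + \<bar>d\<bar> / Im \<tau>)\<^sup>2 * exp (- pi * d\<^sup>2 / (2 * Im \<tau> * rho)))"
      using y A by (intro mult_mono A(2)[OF t] K(2)[OF y]) auto
    also have "- pi * d\<^sup>2 / (2 * Im \<tau> * rho) = - (e * (d\<^sup>2 / Im \<tau>))"
      by (simp add: e_def field_simps)
    finally show ?thesis by (simp only: power_add mult_ac)
  qed
  define C where "C = A * K * (fact (n + 1) * B + fact n * 3 ^ (n + 1 + N))"
  show ?thesis
  proof (rule that[of C])
    show "C > 0" using A K B by (simp add: C_def add_pos_pos)
    fix \<tau> :: complex
    {
      fix d :: real assume t: "\<tau> \<in> uhp" and d: "\<bar>d\<bar> \<ge> 1"
      have y: "Im \<tau> > 0" using t by (simp add: uhp_def)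
      define x where "x = d\<^sup>2 / Im \<tau>"
      have d2: "1 \<le> d\<^sup>2" "\<bar>d\<bar> \<le> d\<^sup>2" using d mult_mono[of 1 "\<bar>d\<bar>" 1 "\<bar>d\<bar>"] mult_mono[of 1 "\<bar>d\<bar>" "\<bar>d\<bar>" "\<bar>d\<bar>"]
        by (auto simp: power2_eq_square simp flip: abs_mult)
      have x: "x \<ge> 0" "1 / Im \<tau> \<le> x" "\<bar>d\<bar> / Im \<tau> \<le> x"
        using d2 y by (auto simp: x_def intro!: divide_right_mono)
      have "(1 + 1 / Im \<tau>) ^ (n + 1 + N) * (1 + \<bar>d\<bar> / Im \<tau>)\<^sup>2 \<le> (1 + x) ^ (n + 1 + N) * (1 + x)\<^sup>2"
        using x y by (intro mult_mono power_mono) auto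
      also have "\<dots> = (1 + x) ^ (n + 1 + N + 2)" by (simp only: power_add mult.assoc)
      finally have p: "(1 + 1 / Im \<tau>) ^ (n + 1 + N) * (1 + \<bar>d\<bar> / Im \<tau>)\<^sup>2 \<le> (1 + x) ^ (n + 1 + N + 2)" .
      have "d\<^sup>2 * norm (orbit_term f 0 d \<tau>) \<le> d\<^sup>2 * (A * K * (Im \<tau> ^ (n + 2) * exp (- 2 * pi * Im \<tau>))
          * ((1 + x) ^ (n + 1 + N + 2) * exp (- (e * x))))"
      proof (rule mult_left_mono)
        have "norm (orbit_term f 0 d \<tau>) \<le> A * K * (Im \<tau> ^ (n + 2) * exp (- 2 * pi * Im \<tau>))
          * ((1 + 1 / Im \<tau>) ^ (n + 1 + N) * (1 + \<bar>d\<bar> / Im \<tau>)\<^sup>2 * exp (- (e * x)))"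
          using raw[OF t, of d] unfolding x_def .
        also have "\<dots> \<le> A * K * (Im \<tau> ^ (n + 2) * exp (- 2 * pi * Im \<tau>)) * ((1 + x) ^ (n + 1 + N + 2) * exp (- (e * x)))"
          using y A(1) K(1) by (intro mult_left_mono mult_right_mono p) auto
        finally show "norm (orbit_term f 0 d \<tau>) \<le> A * K * (Im \<tau> ^ (n + 2) * exp (- 2 * pi * Im \<tau>)) * ((1 + x) ^ (n + 1 + N + 2) * exp (- (e * x)))" .
      qed simp
      also have "d\<^sup>2 = x * Im \<tau>" using y by (simp add: x_def)
      also have "x * Im \<tau> * (A * K * (Im \<tau> ^ (n + 2) * exp (- 2 * pi * Im \<tau>)) * ((1 + x) ^ (n + 1 + N + 2) * exp (- (e * x))))
        = A * K * (Im \<tau> ^ (n + 3) * exp (- 2 * pi * Im \<tau>)) * (x * (1 + x) ^ (n + 1 + N + 2) * exp (- (e * x)))"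
        by (simp add: eval_nat_numeral)
      also have "\<dots> \<le> A * K * (fact (n + 1) * ((Im \<tau>)\<^sup>2 * exp (- Im \<tau>))) * B"
      proof (rule mult_mono[OF mult_left_mono[OF ypow(1)[OF y]]])
        have "x * (1 + x) ^ (n + 1 + N + 2) * exp (- (e * x)) \<le> (1 + x) * (1 + x) ^ (n + 1 + N + 2) * exp (- (e * x))"
          using x by (intro mult_right_mono) auto
        also have "\<dots> = (1 + x) ^ m * exp (- (e * x))" by (simp add: m_def eval_nat_numeral)
        also have "\<dots> \<le> B" by (rule poly[OF x(1)])
        finally show "x * (1 + x) ^ (n + 1 + N + 2) * exp (- (e * x)) \<le> B" .
      qed (use A(1) K(1) x y in auto)
      also have "\<dots> = (A * K * (fact (n + 1) * B)) * ((Im \<tau>)\<^sup>2 * exp (- Im \<tau>))" by simp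
      also have "\<dots> \<le> C * ((Im \<tau>)\<^sup>2 * exp (- Im \<tau>))"
        using A K B unfolding C_def by (intro mult_right_mono mult_left_mono) auto
      finally have "x * Im \<tau> * norm (orbit_term f 0 d \<tau>) \<le> C * ((Im \<tau>)\<^sup>2 * exp (- Im \<tau>))" .
      moreover have "x * Im \<tau> = d\<^sup>2" "d\<^sup>2 > 0" using y d2 by (auto simp: x_def)
      ultimately show "norm (orbit_term f 0 d \<tau>) \<le> C / d\<^sup>2 * ((Im \<tau>)\<^sup>2 * exp (- Im \<tau>))"
        by (simp add: pos_le_divide_eq mult.commute)
    next
      assume y: "Im \<tau> \<ge> 1/2"
      hence t: "\<tau> \<in> uhp" and y0: "Im \<tau> > 0" by (auto simp: uhp_def)
      have "1 + 1 / Im \<tau> \<le> 3" using y y0 by (simp add: field_simps)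
      hence p: "(1 + 1 / Im \<tau>) ^ (n + 1 + N) \<le> 3 ^ (n + 1 + N)" using y0 by (intro power_mono) auto
      have "norm (orbit_term f 0 0 \<tau>) \<le> A * K * (Im \<tau> ^ (n + 2) * exp (- 2 * pi * Im \<tau>)) * (1 + 1 / Im \<tau>) ^ (n + 1 + N)"
        using raw[OF t, of 0] by simp
      also have "\<dots> \<le> A * K * (fact n * ((Im \<tau>)\<^sup>2 * exp (- Im \<tau>))) * 3 ^ (n + 1 + N)"
        using A(1) K(1) y0 by (intro mult_mono[OF mult_left_mono[OF ypow(2)[OF y0]] p]) auto
      also have "\<dots> = (A * K * (fact n * 3 ^ (n + 1 + N))) * ((Im \<tau>)\<^sup>2 * exp (- Im \<tau>))" by simp
      also have "\<dots> \<le> C * ((Im \<tau>)\<^sup>2 * exp (- Im \<tau>))"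
        using A K B unfolding C_def by (intro mult_right_mono mult_left_mono) auto
      finally show "norm (orbit_term f 0 0 \<tau>) \<le> C * ((Im \<tau>)\<^sup>2 * exp (- Im \<tau>))" .
    }
  qed
qed

end

text \<open>A nonzero integer pair is its greatest common divisor \<open>r\<close> times a primitive pair,
  which extends to a matrix by Bezout. The extension is unique up to translation from the left, and
  the strip is a fundamental domain for translations.\<close>

lemma bottom_row_bij:
  assumes t: "\<tau> \<in> uhp"
  shows "bij_betw (\<lambda>((a, b, c, d), r). (of_int (int r * c), of_int (int r * d)))
    ({\<gamma> \<in> SL2Z. mob \<gamma> \<tau> \<in> strip_domain} \<times> {1::nat..}) (zlat - {0 :: real \<times> real})"
    (is "bij_betw ?F (?G \<times> _) _")
proof (rule bij_betw_imageI)
  have trans: "mob (a + j * c, b + j * d, c, d) \<tau> = mob (a, b, c, d) \<tau> + of_int j"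
    if "(a, b, c, d) \<in> SL2Z" for a b c d j
  proof -
    have "of_int c * \<tau> + of_int d \<noteq> 0" using denom_nonzero[OF SL2Z_bottom[OF that]] t by (simp add: uhp_def)
    thus ?thesis by (simp add: mob_def field_simps)
  qed
  show "inj_on ?F (?G \<times> {1..})"
  proof (rule inj_onI)
    fix p p' assume p: "p \<in> ?G \<times> {1..}" "p' \<in> ?G \<times> {1..}" and eq: "?F p = ?F p'"
    obtain a b c d r where P: "p = ((a, b, c, d), r)" by (metis prod.exhaust)
    obtain a' b' c' d' r' where P': "p' = ((a', b', c', d'), r')" by (metis prod.exhaust)
    have e1: "int r * c = int r' * c'" and e2: "int r * d = int r' * d'" using eq unfolding P P' prod.case prod.inject of_int_eq_iff by blast+
    have g: "a * d - b * c = 1" "a' * d' - b' * c' = 1" using p by (auto simp: P P' SL2Z_def)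
    have "coprime c d" "coprime c' d'"
      using g by (auto intro!: coprimeI simp: dvd_def) (metis dvd_def dvd_diff dvd_mult zdvd1_eq)+
    hence "int r = gcd (int r * c) (int r * d)" "int r' = gcd (int r' * c') (int r' * d')"
      by (simp_all add: gcd_mult_left coprime_iff_gcd_eq_1)
    hence r: "r = r'" using e1 e2 by simp
    have r0: "int r \<noteq> 0" using p by (simp add: P)
    have c: "c = c'" and d: "d = d'" using e1 e2 r r0 by simp_all
    \<comment> \<open>The upper right entry of the quotient of the two matrices, which is a translation.\<close>
    define j where "j = b' * a - a' * b"
    have "a + j * c = a + b' * c * a - a' * (b * c)" by (simp add: j_def algebra_simps)
    also have "b * c = a * d - 1" using g by simp
    also have "a + b' * c * a - a' * (a * d - 1) = a + a' - a * (a' * d' - b' * c')" by (simp add: c d algebra_simps)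
    finally have a': "a' = a + j * c" using g by simp
    have "b + j * d = b - b * (a' * d') + b' * (a * d)" by (simp add: j_def d algebra_simps)
    also have "a * d = 1 + b * c" using g by simp
    also have "b - b * (a' * d') + b' * (1 + b * c) = b + b' - b * (a' * d' - b' * c')" by (simp add: c algebra_simps)
    finally have b': "b' = b + j * d" using g by simp
    have "Re (mob (a', b', c', d') \<tau>) = Re (mob (a, b, c, d) \<tau>) + of_int j"
      using trans[of a b c d j] p unfolding a' b' c[symmetric] d[symmetric] P by simp
    moreover have "0 \<le> Re (mob (a', b', c', d') \<tau>)" "Re (mob (a', b', c', d') \<tau>) < 1" "0 \<le> Re (mob (a, b, c, d) \<tau>)" "Re (mob (a, b, c, d) \<tau>) < 1"
      using p by (auto simp: P P' strip_domain_def)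
    ultimately have "j = 0" by linarith
    thus "p = p'" using a' b' c d r by (simp add: P P')
  qed
  show "?F ` (?G \<times> {1..}) = zlat - {0}"
  proof (intro equalityI subsetI)
    fix z assume "z \<in> ?F ` (?G \<times> {1..})"
    then obtain a b c d r where z: "z = (of_int (int r * c), of_int (int r * d))" "(a, b, c, d) \<in> SL2Z" "r \<ge> 1" by auto
    have "int r * c \<noteq> 0 \<or> int r * d \<noteq> 0" using SL2Z_bottom[OF z(2)] z(3) by simp
    thus "z \<in> zlat - {0}" unfolding z by (simp add: zlat_pair zero_prod_def del: of_int_mult)
  next
    fix z :: "real \<times> real" assume z: "z \<in> zlat - {0}"
    then obtain C D where CD: "z = (of_int C, of_int D)" by (cases z) (auto simp: zlat_pair elim!: Ints_cases)
    have nz: "C \<noteq> 0 \<or> D \<noteq> 0" using z by (auto simp: CD zero_prod_def)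
    define r where "r = gcd C D"
    have r: "r > 0" using nz by (simp add: r_def)
    obtain c d where cd: "C = r * c" "D = r * d" unfolding r_def by (metis dvdE gcd_dvd1 gcd_dvd2)
    obtain u v where uv: "u * C + v * D = r" using bezout_int[of C D] by (auto simp: r_def)
    hence "r * (u * c + v * d) = r * 1" by (simp add: cd algebra_simps)
    hence "u * c + v * d = 1" using r by simp
    hence g: "(v, - u, c, d) \<in> SL2Z" by (simp add: SL2Z_def)
    define j where "j = - \<lfloor>Re (mob (v, - u, c, d) \<tau>)\<rfloor>"
    define \<gamma> where "\<gamma> = (v + j * c, - u + j * d, c, d)"
    have g': "\<gamma> \<in> SL2Z" using g by (simp add: \<gamma>_def SL2Z_def algebra_simps)
    have "mob \<gamma> \<tau> \<in> strip_domain"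
      using mob_uhp[OF g' t] trans[OF g, of j] unfolding \<gamma>_def[symmetric]
      by (simp add: strip_domain_def uhp_def j_def) linarith
    hence "(\<gamma>, nat r) \<in> ?G \<times> {1..}" using g' r by simp
    moreover have "?F (\<gamma>, nat r) = z" using r by (simp add: \<gamma>_def CD cd)
    ultimately show "z \<in> ?F ` (?G \<times> {1..})" by (metis (no_types, lifting) image_eqI)
  qed
qed

context theta_data begin

lemma orbit_term_sum:
  assumes f: "cusp_form (n + 1) f" and t: "\<tau> \<in> uhp"
  shows "(\<Sum>\<^sub>\<infinity>\<gamma>\<in>SL2Z. \<Sum>\<^sub>\<infinity>r\<in>{1::nat..}. indicator strip_domain (mob \<gamma> \<tau>) * orbit_term f 0 (real r) (mob \<gamma> \<tau>))
    = (\<Sum>\<^sub>\<infinity>z\<in>zlat - {0}. orbit_term f (fst z) (snd z) \<tau>)"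
proof -
  let ?G = "{\<gamma> \<in> SL2Z. mob \<gamma> \<tau> \<in> strip_domain}"
  let ?F = "\<lambda>((a, b, c, d), r). (real_of_int (int r * c), real_of_int (int r * d))"
  let ?E = "\<lambda>z. orbit_term f (fst z) (snd z) \<tau>"
  note bij = bottom_row_bij[OF t]
  have eq: "?E (?F (\<gamma>, r)) = orbit_term f 0 (real r) (mob \<gamma> \<tau>)" if "\<gamma> \<in> SL2Z" for \<gamma> r
    using orbit_term_mob[OF f that t, of 0 "int r"] by (cases \<gamma>) simp
  have "?E summable_on (zlat - {0})"
    by (rule abs_summable_summable, rule summable_on_subset_banach[OF orbit_term_summable[OF t]]) auto
  hence "(\<lambda>p. ?E (?F p)) summable_on ?G \<times> {1..}"
    using summable_on_reindex_bij_betw[OF bij, of ?E] by blast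
  hence sm: "(\<lambda>(\<gamma>, r). orbit_term f 0 (real r) (mob \<gamma> \<tau>)) summable_on ?G \<times> {1..}"
    by (rule summable_on_cong[THEN iffD1, rotated]) (use eq in auto)
  have "(\<Sum>\<^sub>\<infinity>z\<in>zlat - {0}. ?E z) = (\<Sum>\<^sub>\<infinity>p\<in>?G \<times> {1..}. ?E (?F p))"
    using infsum_reindex_bij_betw[OF bij, of ?E] by (rule sym)
  also have "\<dots> = (\<Sum>\<^sub>\<infinity>(\<gamma>, r)\<in>?G \<times> {1..}. orbit_term f 0 (real r) (mob \<gamma> \<tau>))"
    by (rule infsum_cong) (use eq in auto)
  also have "\<dots> = (\<Sum>\<^sub>\<infinity>\<gamma>\<in>?G. \<Sum>\<^sub>\<infinity>r\<in>{1..}. orbit_term f 0 (real r) (mob \<gamma> \<tau>))"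
    using infsum_Sigma'_banach[OF sm] by simp
  also have "\<dots> = (\<Sum>\<^sub>\<infinity>\<gamma>\<in>SL2Z. \<Sum>\<^sub>\<infinity>r\<in>{1::nat..}. indicator strip_domain (mob \<gamma> \<tau>) * orbit_term f 0 (real r) (mob \<gamma> \<tau>))"
    by (rule infsum_cong_neutral) auto
  finally show ?thesis ..
qed

text \<open>The unfolding identity in coordinates: the sum over nonzero pairs becomes a sum over
  \<open>SL\<^sub>2(\<int>)\<close> by \<open>orbit_term_sum\<close> and unfolds to the strip.\<close>

theorem theta_unfolding:
  assumes f: "cusp_form (n + 1) f"
  defines "KM \<equiv> \<lambda>\<tau>. of_real (Im \<tau> ^ (n + 2)) * f \<tau> * cnj (theta_sum \<tau> 0 0)"
    and "hh \<equiv> \<lambda>\<tau>. \<Sum>\<^sub>\<infinity>r\<in>{1::nat..}. orbit_term f 0 (real r) \<tau>"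
  shows "integrable hypH (\<lambda>\<tau>. indicator modular_domain \<tau> * KM \<tau>)"
    and "integrable hypH (\<lambda>\<tau>. indicator modular_domain \<tau> * orbit_term f 0 0 \<tau>)"
    and "integrable hypH (\<lambda>\<tau>. indicator strip_domain \<tau> * hh \<tau>)"
    and "(\<integral>\<tau>. indicator modular_domain \<tau> * KM \<tau> \<partial>hypH)
      = (\<integral>\<tau>. indicator modular_domain \<tau> * orbit_term f 0 0 \<tau> \<partial>hypH) + 2 * (\<integral>\<tau>. indicator strip_domain \<tau> * hh \<tau> \<partial>hypH)"
proof -
  obtain C where C: "C > 0"
    "\<And>\<tau> d. \<tau> \<in> uhp \<Longrightarrow> \<bar>d\<bar> \<ge> 1 \<Longrightarrow> norm (orbit_term f 0 d \<tau>) \<le> C / d\<^sup>2 * ((Im \<tau>)\<^sup>2 * exp (- Im \<tau>))"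
    "\<And>\<tau>. Im \<tau> \<ge> 1/2 \<Longrightarrow> norm (orbit_term f 0 0 \<tau>) \<le> C * ((Im \<tau>)\<^sup>2 * exp (- Im \<tau>))"
    by (rule orbit_term_bounds[OF f], rule that)
  have md: "modular_domain \<subseteq> uhp \<inter> {\<tau>. \<bar>Re \<tau>\<bar> \<le> 1}" by (auto simp: modular_domain_def uhp_def)
  have sd: "strip_domain \<subseteq> uhp \<inter> {\<tau>. \<bar>Re \<tau>\<bar> \<le> 1}" by (auto simp: strip_domain_def uhp_def)
  have meas: "(\<lambda>\<tau>. indicator A \<tau> * orbit_term f 0 d \<tau>) \<in> borel_measurable borel" if A: "A \<subseteq> uhp" "A \<in> sets borel" for A d
  proof -
    have "(\<lambda>\<tau>. indicator A \<tau> * (indicator uhp \<tau> * orbit_term f 0 d \<tau>)) \<in> borel_measurable borel"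
      by (intro borel_measurable_times borel_measurable_indicator A orbit_term_measurable[OF f])
    also have "(\<lambda>\<tau>. indicator A \<tau> * (indicator uhp \<tau> * orbit_term f 0 d \<tau>)) = (\<lambda>\<tau>. indicator A \<tau> * orbit_term f 0 d \<tau>)"
      using A by (auto simp: fun_eq_iff indicator_def)
    finally show ?thesis .
  qed
  show i0: "integrable hypH (\<lambda>\<tau>. indicator modular_domain \<tau> * orbit_term f 0 0 \<tau>)"
    using md C by (intro exp_decay_integrable(1)[OF _ md _ _ C(3)] meas modular_domain_Im) auto
  define H where "H = (\<lambda>\<tau>. \<Sum>\<^sub>\<infinity>r\<in>{1::nat..}. indicator strip_domain \<tau> * orbit_term f 0 (real r) \<tau>)"
  define W where "W = (\<integral>\<tau>. norm (indicator (uhp \<inter> {\<tau>. \<bar>Re \<tau>\<bar> \<le> 1}) \<tau> * (complex_of_real ((Im \<tau>)\<^sup>2 * exp (- Im \<tau>)))) \<partial>hypH)"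
  have bd: "integrable hypH (\<lambda>\<tau>. indicator strip_domain \<tau> * orbit_term f 0 (real r) \<tau>)"
    "(\<integral>\<tau>. norm (indicator strip_domain \<tau> * orbit_term f 0 (real r) \<tau>) \<partial>hypH) \<le> C / (real r)\<^sup>2 * W" if r: "r \<in> {1..}" for r :: nat
    unfolding W_def
    using sd C r by (intro exp_decay_integrable[OF _ sd meas _ C(2)]; auto)+
  have sm: "(\<lambda>r. \<integral>\<tau>. norm (indicator strip_domain \<tau> * orbit_term f 0 (real r) \<tau>) \<partial>hypH) summable_on {1::nat..}"
  proof (rule summable_on_comparison_test)
    have "summable (\<lambda>r. norm (C * W * (1 / real r ^ 2)))"
      using summable_mult[OF inverse_power_summable[of 2, where 'a = real], of "\<bar>C * W\<bar>"]
      by (simp add: abs_mult divide_inverse power_inverse)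
    hence "(\<lambda>r. C * W * (1 / real r ^ 2)) summable_on UNIV" by (rule norm_summable_imp_summable_on)
    hence "(\<lambda>r. C * W * (1 / real r ^ 2)) summable_on {1..}" by (rule summable_on_subset_banach) auto
    thus "(\<lambda>r. C / (real r)\<^sup>2 * W) summable_on {1..}" by (simp add: mult_ac)
  qed (use bd in auto)
  have Hint: "integrable hypH H"
    unfolding H_def by (rule integrable_infsum[OF _ bd(1) sm]) auto
  have Hmeas: "H \<in> borel_measurable borel" using borel_measurable_integrable[OF Hint] by simp
  have SH: "indicator strip_domain \<tau> * H \<tau> = H \<tau>" for \<tau> by (simp add: H_def indicator_def)
  have Hhh: "H = (\<lambda>\<tau>. indicator strip_domain \<tau> * hh \<tau>)" by (auto simp: H_def hh_def indicator_def)
  show "integrable hypH (\<lambda>\<tau>. indicator strip_domain \<tau> * hh \<tau>)" using Hint unfolding Hhh .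
  have ih: "integrable hypH (\<lambda>\<tau>. indicator strip_domain \<tau> * H \<tau>)" unfolding SH by (rule Hint)
  let ?O = "\<lambda>\<tau>. \<Sum>\<^sub>\<infinity>\<gamma>\<in>SL2Z. indicator modular_domain \<tau> * (indicator strip_domain (mob \<gamma> \<tau>) * H (mob \<gamma> \<tau>))"
  note unf = unfolding_integral[OF Hmeas ih]
  have split: "indicator modular_domain \<tau> * KM \<tau> = indicator modular_domain \<tau> * orbit_term f 0 0 \<tau> + ?O \<tau>" for \<tau>
  proof (cases "\<tau> \<in> modular_domain")
    case True
    hence t: "\<tau> \<in> uhp" using md by blast
    have "?O \<tau> = (\<Sum>\<^sub>\<infinity>z\<in>zlat - {0}. orbit_term f (fst z) (snd z) \<tau>)"
      unfolding SH using True orbit_term_sum[OF f t] by (simp add: H_def)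
    moreover have "KM \<tau> = (\<Sum>\<^sub>\<infinity>z\<in>zlat. orbit_term f (fst z) (snd z) \<tau>)" unfolding KM_def orbit_term_total[OF t] ..
    moreover have "(\<Sum>\<^sub>\<infinity>z\<in>zlat. orbit_term f (fst z) (snd z) \<tau>) = (\<Sum>\<^sub>\<infinity>z\<in>{0} \<union> (zlat - {0}). orbit_term f (fst z) (snd z) \<tau>)"
      by (rule arg_cong[where f = "infsum _"]) (auto simp: zlat_def)
    moreover have "\<dots> = (\<Sum>\<^sub>\<infinity>z\<in>{0}. orbit_term f (fst z) (snd z) \<tau>) + (\<Sum>\<^sub>\<infinity>z\<in>zlat - {0}. orbit_term f (fst z) (snd z) \<tau>)"
      by (rule infsum_Un_disjoint; (rule abs_summable_summable, rule summable_on_subset_banach[OF orbit_term_summable[OF t]])?) (auto simp: zlat_def)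
    ultimately show ?thesis using True by simp
  qed simp
  show "integrable hypH (\<lambda>\<tau>. indicator modular_domain \<tau> * KM \<tau>)"
    unfolding split by (intro Bochner_Integration.integrable_add i0 unf(1))
  show "(\<integral>\<tau>. indicator modular_domain \<tau> * KM \<tau> \<partial>hypH)
      = (\<integral>\<tau>. indicator modular_domain \<tau> * orbit_term f 0 0 \<tau> \<partial>hypH) + 2 * (\<integral>\<tau>. indicator strip_domain \<tau> * hh \<tau> \<partial>hypH)"
  proof -
    have "(\<integral>\<tau>. indicator modular_domain \<tau> * KM \<tau> \<partial>hypH) = (\<integral>\<tau>. indicator modular_domain \<tau> * orbit_term f 0 0 \<tau> \<partial>hypH) + (\<integral>\<tau>. ?O \<tau> \<partial>hypH)"
      unfolding split by (rule Bochner_Integration.integral_add[OF i0 unf(1)])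
    moreover have "(\<lambda>\<tau>. indicator strip_domain \<tau> * H \<tau>) = (\<lambda>\<tau>. indicator strip_domain \<tau> * hh \<tau>)"
      unfolding SH by (rule Hhh)
    ultimately show ?thesis unfolding unf(2) by simp
  qed
qed

end

section \<open>The heat operator and orthogonal projections\<close>

lemma orthonormal_basis_properties:
  fixes W :: "'a::euclidean_space set"
  assumes "subspace W"
  shows "orthonormal_basis W \<subseteq> W" "pairwise orthogonal (orthonormal_basis W)"
    "\<And>a. a \<in> orthonormal_basis W \<Longrightarrow> norm a = 1" "span (orthonormal_basis W) = W" "finite (orthonormal_basis W)"
proof -
  have "orthonormal_basis W \<subseteq> W \<and> pairwise orthogonal (orthonormal_basis W)
    \<and> (\<forall>a\<in>orthonormal_basis W. norm a = 1) \<and> span (orthonormal_basis W) = W"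
  proof (cases "W = UNIV")
    case True
    thus ?thesis by (auto simp: orthonormal_basis_def pairwise_def orthogonal_def inner_Basis)
  next
    case False
    obtain B where "B \<subseteq> W" "pairwise orthogonal B" "\<And>x. x \<in> B \<Longrightarrow> norm x = 1" "span B = W"
      using orthonormal_basis_subspace[OF assms] by metis
    hence ex: "B \<subseteq> W \<and> pairwise orthogonal B \<and> (\<forall>a\<in>B. norm a = 1) \<and> span B = W" by blast
    have "(\<lambda>A. A \<subseteq> W \<and> pairwise orthogonal A \<and> (\<forall>a\<in>A. norm a = 1) \<and> span A = W) (orthonormal_basis W)"
      using someI[of "\<lambda>A. A \<subseteq> W \<and> pairwise orthogonal A \<and> (\<forall>a\<in>A. norm a = 1) \<and> span A = W", OF ex] False
      by (simp add: orthonormal_basis_def)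
    thus ?thesis .
  qed
  thus p: "orthonormal_basis W \<subseteq> W" "pairwise orthogonal (orthonormal_basis W)"
    "\<And>a. a \<in> orthonormal_basis W \<Longrightarrow> norm a = 1" "span (orthonormal_basis W) = W" by blast+
  have "0 \<notin> orthonormal_basis W" using p(3)[of 0] by auto
  thus "finite (orthonormal_basis W)"
    using pairwise_orthogonal_independent[OF p(2)] by (simp add: independent_imp_finite)
qed

text \<open>Parseval's identity. It removes the unspecified choice in \<open>orthonormal_basis\<close>.\<close>

lemma orthonormal_basis_inner:
  fixes W :: "'a::euclidean_space set"
  assumes "subspace W" "x \<in> W"
  shows "(\<Sum>a\<in>orthonormal_basis W. (a \<bullet> x) * (a \<bullet> y)) = x \<bullet> y"
proof -
  note p = orthonormal_basis_properties[OF assms(1)]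
  have "x \<bullet> y = (\<Sum>a\<in>orthonormal_basis W. (x \<bullet> a) *\<^sub>R a) \<bullet> y"
    using orthonormal_basis_expand[OF p(2,3) _ p(5), of x] assms(2) p(4) by simp
  thus ?thesis by (simp add: inner_sum_left inner_commute[of _ x])
qed

lemma second_deriv_quadratic: "(deriv ^^ 2) (\<lambda>t::real. A + B * t + C * t\<^sup>2) 0 = 2 * C"
proof -
  have 1: "deriv (\<lambda>t. A + B * t + C * t\<^sup>2) = (\<lambda>t. B + 2 * C * t)"
    by (rule ext, rule DERIV_imp_deriv) (auto intro!: derivative_eq_intros)
  have 2: "deriv (\<lambda>t. B + 2 * C * t) 0 = 2 * C"
    by (rule DERIV_imp_deriv) (auto intro!: derivative_eq_intros)
  have "(deriv ^^ 2) h = deriv (deriv h)" for h :: "real \<Rightarrow> real" by (simp add: numeral_2_eq_2)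
  thus ?thesis unfolding 1 by (simp only: 1 2)
qed

text \<open>On a polynomial of degree at most two the series of the heat operator stops after the first order
  term. All hypotheses concern the values on \<open>W\<close> only, because second derivatives along
  \<open>W\<close> do not leave it.\<close>

lemma heat_quadratic:
  fixes W :: "'a::euclidean_space set" and p :: "'a \<Rightarrow> real"
  assumes W: "subspace W" and x: "x \<in> W"
    and p: "\<And>x. x \<in> W \<Longrightarrow> p x = 2 * s * (x \<bullet> e) * (x \<bullet> e') + x \<bullet> w + c"
  shows "heat W y p x = p x - s / (2 * pi * y) * (\<Sum>a\<in>orthonormal_basis W. (a \<bullet> e) * (a \<bullet> e'))"
proof -
  let ?S = "\<Sum>a\<in>orthonormal_basis W. (a \<bullet> e) * (a \<bullet> e')"
  have lap: "laplacian_on W q x = 4 * s' * ?S"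
    if q: "\<And>x. x \<in> W \<Longrightarrow> q x = 2 * s' * (x \<bullet> e) * (x \<bullet> e') + x \<bullet> w' + c'" and x: "x \<in> W" for q s' w' c' x
  proof -
    have "(deriv ^^ 2) (\<lambda>t. q (x + t *\<^sub>R a)) 0 = 2 * (2 * s' * (a \<bullet> e) * (a \<bullet> e'))" if a: "a \<in> orthonormal_basis W" for a
    proof -
      have "x + t *\<^sub>R a \<in> W" for t
        using a orthonormal_basis_properties(1)[OF W] x W by (auto intro!: subspace_add subspace_scale)
      hence "(\<lambda>t. q (x + t *\<^sub>R a)) = (\<lambda>t. q x + (2 * s' * ((x \<bullet> e) * (a \<bullet> e') + (a \<bullet> e) * (x \<bullet> e')) + a \<bullet> w') * t + (2 * s' * (a \<bullet> e) * (a \<bullet> e')) * t\<^sup>2)"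
        using q x by (auto simp: fun_eq_iff inner_add_left algebra_simps power2_eq_square)
      thus ?thesis by (simp only: second_deriv_quadratic)
    qed
    thus ?thesis by (simp add: laplacian_on_def dir_laplacian_def sum_distrib_left mult.assoc)
  qed
  have lap2: "(laplacian_on W ^^ Suc (Suc m)) p x = 0" if "x \<in> W" for m x
    using that
  proof (induction m arbitrary: x)
    case 0
    have "laplacian_on W (laplacian_on W p) x = 4 * 0 * ?S"
      by (rule lap[where w' = 0 and c' = "4 * s * ?S"]) (use lap[OF p] 0 in auto)
    thus ?case by simp
  next
    case (Suc m)
    have "laplacian_on W ((laplacian_on W ^^ Suc (Suc m)) p) x = 4 * 0 * ?S"
      by (rule lap[where w' = 0 and c' = 0]) (use Suc in auto)
    thus ?case by simp
  qed
  have "heat W y p x = (\<Sum>m<2. (1 / fact m) * (- 1 / (8 * pi * y)) ^ m * (laplacian_on W ^^ m) p x)"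
    unfolding heat_def
  proof (rule suminf_finite)
    fix m :: nat assume "m \<notin> {..<2}"
    then obtain j where "m = Suc (Suc j)" by (metis add_2_eq_Suc le_Suc_ex lessThan_iff not_less)
    thus "(1 / fact m) * (- 1 / (8 * pi * y)) ^ m * (laplacian_on W ^^ m) p x = 0" using lap2[OF x] by simp
  qed simp
  also have "\<dots> = p x - 1 / (8 * pi * y) * laplacian_on W p x" by (simp add: numeral_2_eq_2)
  also have "laplacian_on W p x = 4 * s * ?S" by (rule lap[OF p x])
  finally show ?thesis by simp
qed

lemma proj_eqI:
  assumes B: "bilinear B" and W: "subspace W"
    and nd: "\<And>p. p \<in> W \<Longrightarrow> (\<And>x. x \<in> W \<Longrightarrow> B p x = 0) \<Longrightarrow> p = 0"
    and p: "p \<in> W" "\<And>x. x \<in> W \<Longrightarrow> B (v - p) x = 0"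
  shows "proj B W v = p"
  unfolding proj_def
proof (rule the_equality)
  show "p \<in> W \<and> (\<forall>x\<in>W. B (v - p) x = 0)" using p by blast
  fix p' assume p': "p' \<in> W \<and> (\<forall>x\<in>W. B (v - p') x = 0)"
  have "p' - p = 0"
  proof (rule nd)
    show "p' - p \<in> W" using p p' W by (intro subspace_diff) auto
    fix x assume x: "x \<in> W"
    have "B ((v - p) - (v - p')) x = B (v - p) x - B (v - p') x" by (rule bilinear_lsub[OF B])
    thus "B (p' - p) x = 0" using p p' x by simp
  qed
  thus "p' = p" by simp
qed

context theta_data begin

text \<open>The Lorentzian theta functions of the three reduced polynomials at \<open>\<delta> = r
  \<mu>\<close>, in coordinates.\<close>

definition lor_theta :: "nat \<Rightarrow> complex \<Rightarrow> real \<Rightarrow> complex" where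
  "lor_theta h \<tau> r = (\<Sum>\<^sub>\<infinity>v\<in>VC 0. of_real (if h = 0 then q0 (Im \<tau>) v else if h = 1 then q1 v else q2) *
     (gau P \<tau> (wv v) * ch (- (r * mm v))))"

text \<open>Splitting the sum needs the three series to converge separately. Their absolute convergence
  follows from that of the combined series at the two frequencies \<open>d = 0\<close> and \<open>d
  = 2 y\<close>: there the factor \<open>\<i> d / 2 y\<close> is \<open>0\<close> and
  \<open>\<i>\<close>, and real and imaginary parts separate the terms.\<close>

lemma phi_0_lor_theta:
  assumes y: "Im \<tau> > 0"
  shows "phi \<tau> 0 r = of_real (exp (- pi * r\<^sup>2 / (2 * Im \<tau> * rho)) / sqrt (2 * Im \<tau> * rho)) *
     (\<Sum>h\<in>{0..2}. (\<i> * of_real r / (2 * of_real (Im \<tau>))) ^ h * lor_theta h \<tau> r)"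
proof -
  let ?y = "Im \<tau>"
  let ?fac = "\<lambda>r. exp (- pi * r\<^sup>2 / (2 * ?y * rho)) / sqrt (2 * ?y * rho)"
  let ?c = "\<lambda>r. \<i> * complex_of_real r / (2 * of_real ?y)"
  let ?g = "\<lambda>v. norm (gau P \<tau> (wv v))"
  obtain K N and w :: "'e \<Rightarrow> real" where K: "K > 0" "w summable_on VC 0" "\<And>v. w v \<ge> 0"
    "\<And>\<tau> d v. Im \<tau> > 0 \<Longrightarrow> v \<in> VC 0 \<Longrightarrow> norm (psi \<tau> v d) \<le>
       K * (1 + 1 / Im \<tau>) ^ N * (1 + \<bar>d\<bar> / Im \<tau>)\<^sup>2 * exp (- pi * d\<^sup>2 / (2 * Im \<tau> * rho)) * w v"
    by (rule psi_0_uniform_bound, rule that)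
  have fac: "?fac d > 0" for d using y rho_pos by simp
  have gen: "(1 / F) * N = Z" if "N = F * Z" "F > 0" for F N Z :: real using that by simp
  have base: "(\<lambda>v. norm (of_real (q0 ?y v) + ?c d * of_real (q1 v) + (?c d)\<^sup>2 * of_real q2) * ?g v) summable_on VC 0" for d
  proof -
    have "(\<lambda>v. norm (psi \<tau> v d)) summable_on VC 0"
      by (rule summable_on_comparison_test[OF summable_on_cmult_right[OF K(2), of "K * (1 + 1 / Im \<tau>) ^ N * (1 + \<bar>d\<bar> / Im \<tau>)\<^sup>2 * exp (- pi * d\<^sup>2 / (2 * Im \<tau> * rho))"]])
         (use K(4)[OF y] in auto)
    hence "(\<lambda>v. (1 / ?fac d) * norm (psi \<tau> v d)) summable_on VC 0" by (rule summable_on_cmult_right)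
    thus ?thesis
    proof (rule summable_on_cong[THEN iffD1, rotated])
      fix v assume v: "v \<in> VC 0"
      have "norm (psi \<tau> v d) = ?fac d * (norm (of_real (q0 ?y v) + ?c d * of_real (q1 v) + (?c d)\<^sup>2 * of_real q2) * ?g v)"
        unfolding psi_0[OF y v] norm_mult norm_of_real norm_ch abs_of_pos[OF fac] by (simp only: mult_ac mult_1_left mult_1_right)
      thus "(1 / ?fac d) * norm (psi \<tau> v d) = norm (of_real (q0 ?y v) + ?c d * of_real (q1 v) + (?c d)\<^sup>2 * of_real q2) * ?g v"
        by (rule gen[OF _ fac])
    qed
  qed
  have s0: "(\<lambda>v. \<bar>q0 ?y v\<bar> * ?g v) summable_on VC 0" using base[of 0] by simp
  \<comment> \<open>At \<open>d = 2 y\<close> the factor \<open>\<i> d / 2 y\<close> is \<open>\<i>\<close>.\<close>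
  have parts: "complex_of_real (q0 ?y v) + ?c (2 * ?y) * of_real (q1 v) + (?c (2 * ?y))\<^sup>2 * of_real q2 = Complex (q0 ?y v - q2) (q1 v)" for v
    using y by (simp add: complex_eq_iff power_mult_distrib power_divide)
  have s1: "(\<lambda>v. \<bar>q1 v\<bar> * ?g v) summable_on VC 0"
    by (rule summable_on_comparison_test[OF base[of "2 * ?y"]])
       (use abs_Im_le_cmod[of "Complex (q0 ?y _ - q2) (q1 _)"] in \<open>auto simp only: parts complex.sel intro!: mult_right_mono\<close>, simp_all)
  have s2: "(\<lambda>v. \<bar>q2\<bar> * ?g v) summable_on VC 0"
  proof (rule summable_on_comparison_test[OF summable_on_add[OF s0 base[of "2 * ?y"]]])
    fix v assume "v \<in> VC 0"
    have "\<bar>q0 ?y v - q2\<bar> \<le> norm (Complex (q0 ?y v - q2) (q1 v))"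
      using abs_Re_le_cmod[of "Complex (q0 ?y v - q2) (q1 v)"] by simp
    hence "\<bar>q2\<bar> * ?g v \<le> (\<bar>q0 ?y v\<bar> + norm (Complex (q0 ?y v - q2) (q1 v))) * ?g v"
      by (intro mult_right_mono) auto
    thus "\<bar>q2\<bar> * ?g v \<le> \<bar>q0 ?y v\<bar> * ?g v + norm (of_real (q0 ?y v) + ?c (2 * ?y) * of_real (q1 v) + (?c (2 * ?y))\<^sup>2 * of_real q2) * ?g v"
      unfolding parts by (simp only: distrib_right)
  qed simp
  let ?q = "\<lambda>h v. if h = 0 then q0 ?y v else if h = 1 then q1 v else q2"
  let ?t = "\<lambda>(h::nat) v. complex_of_real (?q h v) * (gau P \<tau> (wv v) * ch (- (r * mm v)))"
  have st: "(\<lambda>v. ?t h v) summable_on VC 0" for h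
  proof (rule abs_summable_summable)
    have "norm (?t h v) = \<bar>?q h v\<bar> * ?g v" for v by (simp add: norm_mult norm_ch)
    moreover have "(\<lambda>v. \<bar>?q h v\<bar> * ?g v) summable_on VC 0"
      using s0 s1 s2 by (cases "h = 0"; cases "h = 1") simp_all
    ultimately show "(\<lambda>v. norm (?t h v)) summable_on VC 0" by simp
  qed
  have "phi \<tau> 0 r = (\<Sum>\<^sub>\<infinity>v\<in>VC 0. of_real (?fac r) * (\<Sum>h\<in>{0..2}. ?c r ^ h * ?t h v))"
    unfolding phi_def
  proof (rule infsum_cong)
    fix v assume v: "v \<in> VC 0"
    have "(\<Sum>h\<in>{0..2}. ?c r ^ h * ?t h v) = ?t 0 v + ?c r * ?t 1 v + (?c r)\<^sup>2 * ?t 2 v"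
      by (simp add: atLeast0AtMost numeral_2_eq_2)
    also have "\<dots> = gau P \<tau> (wv v) * ch (- (r * mm v)) * (of_real (q0 ?y v) + ?c r * of_real (q1 v) + (?c r)\<^sup>2 * of_real q2)"
      by (simp add: algebra_simps)
    finally show "psi \<tau> v r = of_real (?fac r) * (\<Sum>h\<in>{0..2}. ?c r ^ h * ?t h v)"
      unfolding psi_0[OF y v] by (rule arg_cong[symmetric])
  qed
  also have "\<dots> = of_real (?fac r) * (\<Sum>\<^sub>\<infinity>v\<in>VC 0. \<Sum>h\<in>{0..2}. ?c r ^ h * ?t h v)" by (rule infsum_cmult_right')
  also have "(\<Sum>\<^sub>\<infinity>v\<in>VC 0. \<Sum>h\<in>{0..2}. ?c r ^ h * ?t h v) = (\<Sum>h\<in>{0..2}. \<Sum>\<^sub>\<infinity>v\<in>VC 0. ?c r ^ h * ?t h v)"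
  proof -
    have e: "(\<Sum>h\<in>{0..2}. F h) = F 0 + F 1 + F 2" for F :: "nat \<Rightarrow> complex"
      by (simp add: atLeast0AtMost numeral_2_eq_2)
    have s: "(\<lambda>v. ?c r ^ h * ?t h v) summable_on VC 0" for h by (rule summable_on_cmult_right[OF st])
    show ?thesis unfolding e by (simp only: infsum_add[OF summable_on_add[OF s s] s] infsum_add[OF s s])
  qed
  also have "\<dots> = (\<Sum>h\<in>{0..2}. ?c r ^ h * lor_theta h \<tau> r)"
    unfolding lor_theta_def by (intro sum.cong refl infsum_cmult_right')
  finally show ?thesis .
qed

end

text \<open>On subsets of the upper half-plane the two measures agree.\<close>

lemma hypH_hyp_measure:
  fixes F :: "complex \<Rightarrow> complex"
  assumes A: "A \<subseteq> uhp" and int: "integrable hypH (\<lambda>\<tau>. indicator A \<tau> * F \<tau>)"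
    and eq: "\<And>\<tau>. \<tau> \<in> A \<Longrightarrow> G \<tau> = F \<tau>"
  shows "set_integrable hyp_measure A G"
    and "(LINT \<tau>:A|hyp_measure. G \<tau>) = (\<integral>\<tau>. indicator A \<tau> * F \<tau> \<partial>hypH)"
proof -
  have G: "(\<lambda>\<tau>. indicator A \<tau> *\<^sub>R G \<tau>) = (\<lambda>\<tau>. indicator A \<tau> * F \<tau>)"
    using eq by (auto simp: fun_eq_iff indicator_def)
  have h: "hypH = density hyp_measure (\<lambda>\<tau>. ennreal (indicator uhp \<tau>))"
    unfolding hypH_def hyp_measure_def
    by (subst density_density_eq) (auto simp: indicator_def fun_eq_iff intro!: density_cong)
  have m: "(\<lambda>\<tau>. indicator A \<tau> * F \<tau>) \<in> borel_measurable hyp_measure"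
    using borel_measurable_integrable[OF int] unfolding hyp_measure_def by simp
  have u: "(\<lambda>\<tau>. indicator uhp \<tau>) \<in> borel_measurable hyp_measure" unfolding hyp_measure_def by simp
  have AA: "(\<lambda>\<tau>. indicator uhp \<tau> *\<^sub>R (indicator A \<tau> * F \<tau>)) = (\<lambda>\<tau>. indicator A \<tau> * F \<tau>)"
    using A by (auto simp: fun_eq_iff indicator_def)
  show "set_integrable hyp_measure A G"
    using int unfolding h set_integrable_def G by (subst (asm) integrable_density[OF m u]) (auto simp: AA)
  show "(LINT \<tau>:A|hyp_measure. G \<tau>) = (\<integral>\<tau>. indicator A \<tau> * F \<tau> \<partial>hypH)"
    unfolding h set_lebesgue_integral_def G by (subst integral_density[OF m u]) (auto simp: AA)
qed

section \<open>Coordinates of the quadratic space\<close>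

locale lattice_frame =
  fixes S :: "('v::real_vector, 'n::finite) lattice_datum" and g :: "'v \<Rightarrow> 'v"
  assumes lset: "lattice_setup S" and g: "g \<in> SO_grp S"
begin

definition Pos :: "(real ^ 'n) set" where "Pos = (\<lambda>j. axis (ix S j) 1) ` {1..rk S}"
definition X :: "'v \<Rightarrow> real ^ 'n" where "X v = coord S (g v)"
definition comb :: "real ^ 'n \<Rightarrow> 'v" where "comb x = (\<Sum>j\<in>{1..rk S + 2}. (x $ ix S j) *\<^sub>R bas S j)"

lemma ix_bij: "bij_betw (ix S) {1..rk S + 2} UNIV"
  and frm_bilinear: "bilinear (frm S)" and frm_sym: "frm S v w = frm S w v"
  and bas_inj: "inj_on (bas S) {1..rk S + 2}" and bas_ind: "independent (bas S ` {1..rk S + 2})"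
  and bas_span: "span (bas S ` {1..rk S + 2}) = UNIV"
  and bas_orth: "i \<in> {1..rk S + 2} \<Longrightarrow> j \<in> {1..rk S + 2} \<Longrightarrow> i \<noteq> j \<Longrightarrow> frm S (bas S i) (bas S j) = 0"
  and bas_pos: "j \<in> {1..rk S} \<Longrightarrow> frm S (bas S j) (bas S j) = 1"
  and bas_neg: "j \<in> {rk S + 1, rk S + 2} \<Longrightarrow> frm S (bas S j) (bas S j) = -1"
  using lset unfolding lattice_setup_def by blast+

lemma frm_simps [simp]:
  "frm S (v + v') w = frm S v w + frm S v' w" "frm S w (v + v') = frm S w v + frm S w v'"
  "frm S (v - v') w = frm S v w - frm S v' w" "frm S w (v - v') = frm S w v - frm S w v'"
  "frm S (a *\<^sub>R v) w = a * frm S v w" "frm S w (a *\<^sub>R v) = a * frm S w v"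
  "frm S (- v) w = - frm S v w" "frm S w (- v) = - frm S w v" "frm S 0 w = 0" "frm S w 0 = 0"
  using bilinear_ladd[OF frm_bilinear] bilinear_radd[OF frm_bilinear] bilinear_lsub[OF frm_bilinear]
    bilinear_rsub[OF frm_bilinear] bilinear_lmul[OF frm_bilinear] bilinear_rmul[OF frm_bilinear]
    bilinear_lneg[OF frm_bilinear] bilinear_rneg[OF frm_bilinear] bilinear_lzero[OF frm_bilinear] bilinear_rzero[OF frm_bilinear]
  by simp_all

lemma linear_comb: "linear comb"
  by (rule linearI) (simp_all only: comb_def vector_add_component vector_scaleR_component scaleR_add_left sum.distrib scaleR_sum_right scaleR_scaleR real_scaleR_def)

lemma bij_comb: "bij comb"
proof -
  interpret linear comb by (rule linear_comb)
  have surj: "\<exists>x. v = comb x" for v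
  proof -
    have "v \<in> span (bas S ` {1..rk S + 2})" using bas_span by simp
    then obtain c where "v = (\<Sum>b\<in>bas S ` {1..rk S + 2}. c b *\<^sub>R b)" by (auto simp: span_finite)
    also have "\<dots> = (\<Sum>j\<in>{1..rk S + 2}. c (bas S j) *\<^sub>R bas S j)" unfolding sum.reindex[OF bas_inj] o_def ..
    also have "\<dots> = comb (\<chi> i. c (bas S (inv_into {1..rk S + 2} (ix S) i)))"
      unfolding comb_def using ix_bij by (intro sum.cong refl) (simp add: bij_betw_def)
    finally show ?thesis by blast
  qed
  have "x = 0" if x: "comb x = 0" for x
  proof -
    have "(\<Sum>b\<in>bas S ` {1..rk S + 2}. (x $ ix S (inv_into {1..rk S + 2} (bas S) b)) *\<^sub>R b) = comb x"
      unfolding comb_def sum.reindex[OF bas_inj] o_def using bas_inj by (intro sum.cong refl) simp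
    hence z: "(\<Sum>b\<in>bas S ` {1..rk S + 2}. (x $ ix S (inv_into {1..rk S + 2} (bas S) b)) *\<^sub>R b) = 0"
      using x by (rule trans)
    have "x $ ix S (inv_into {1..rk S + 2} (bas S) b) = 0" if "b \<in> bas S ` {1..rk S + 2}" for b
      by (rule independentD[OF bas_ind _ _ z that]) auto
    hence "x $ ix S j = 0" if "j \<in> {1..rk S + 2}" for j
      using that by (metis bas_inj imageI inv_into_f_f)
    hence "x $ i = 0" for i using ix_bij by (metis UNIV_I bij_betw_def imageE)
    thus ?thesis by (simp add: vec_eq_iff)
  qed
  hence "inj comb" using linear_inj_iff_eq_0[OF linear_comb] by blast
  thus ?thesis using surj by (auto simp: bij_def)
qed

lemma coord_comb: "coord S v = x \<longleftrightarrow> v = comb x"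
proof -
  obtain x0 where v: "v = comb x0" using bij_comb by (metis bij_pointE)
  have "coord S v = x0"
    unfolding coord_def comb_def[symmetric] v using bij_comb by (auto simp: bij_def inj_eq)
  thus ?thesis using bij_comb by (auto simp: v bij_def inj_eq)
qed

lemma linear_coord: "linear (coord S)"
proof -
  interpret linear comb by (rule linear_comb)
  have c: "comb (coord S v) = v" for v using coord_comb by metis
  show ?thesis by (rule linearI) (simp_all add: coord_comb add scale c)
qed

lemma Pos_mem: "axis (ix S j) 1 \<in> Pos \<longleftrightarrow> j \<in> {1..rk S}" if "j \<in> {1..rk S + 2}"
proof -
  have "ix S j = ix S i \<longleftrightarrow> j = i" if "i \<in> {1..rk S}" for i
    using ix_bij that \<open>j \<in> {1..rk S + 2}\<close> unfolding bij_betw_def by (intro inj_on_eq_iff[of "ix S"]) auto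
  thus ?thesis by (auto simp: Pos_def axis_eq_axis image_iff simp del: atLeastAtMost_iff)
qed

lemma frm_coord: "frm S v w = coord S v \<bullet> refl_pos Pos (coord S w)"
proof -
  define x z where "x = coord S v" and "z = coord S w"
  have v: "v = comb x" "w = comb z" using coord_comb[of v x] coord_comb[of w z] x_def z_def by blast+
  let ?I = "{1..rk S + 2}"
  have "frm S v w = (\<Sum>(i, j)\<in>?I \<times> ?I. frm S ((x $ ix S i) *\<^sub>R bas S i) ((z $ ix S j) *\<^sub>R bas S j))"
    unfolding v comb_def by (rule bilinear_sum[OF frm_bilinear])
  also have "\<dots> = (\<Sum>i\<in>?I. \<Sum>j\<in>?I. (x $ ix S i) * (z $ ix S j) * frm S (bas S i) (bas S j))"
    by (simp only: frm_simps sum.cartesian_product mult_ac)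
  also have "\<dots> = (\<Sum>i\<in>?I. \<Sum>j\<in>?I. if j = i then (x $ ix S i) * (z $ ix S i) * frm S (bas S i) (bas S i) else 0)"
    using bas_orth by (intro sum.cong refl) auto
  also have "\<dots> = (\<Sum>i\<in>?I. (x $ ix S i) * (z $ ix S i) * frm S (bas S i) (bas S i))"
    by (intro sum.cong refl) simp
  also have "\<dots> = (\<Sum>i\<in>?I. (x $ ix S i) * (refl_pos Pos z $ ix S i))"
  proof (intro sum.cong refl)
    fix i assume i: "i \<in> ?I"
    have "refl_pos Pos z $ ix S i = (if i \<in> {1..rk S} then z $ ix S i else - (z $ ix S i))"
      using refl_pos_component[of "axis (ix S i) 1" Pos z] Pos_mem[OF i] by (simp add: inner_axis axis_in_Basis_iff)
    moreover have "i \<in> {rk S + 1, rk S + 2}" if "i \<notin> {1..rk S}" using i that by auto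
    ultimately show "(x $ ix S i) * (z $ ix S i) * frm S (bas S i) (bas S i) = (x $ ix S i) * (refl_pos Pos z $ ix S i)"
      using bas_pos[of i] bas_neg[of i] by auto
  qed
  also have "\<dots> = (\<Sum>i\<in>UNIV. (x $ i) * (refl_pos Pos z $ i))"
    by (rule sum.reindex_bij_betw[OF ix_bij])
  finally show ?thesis by (simp add: x_def z_def inner_vec_def)
qed

lemma linear_g: "linear g" and g_frm: "frm S (g v) (g w) = frm S v w"
  using g by (auto simp: SO_grp_def)

lemma linear_X: "linear X"
  unfolding X_def[abs_def] using linear_compose[OF linear_g linear_coord] by (simp add: o_def)

lemma frm_X: "frm S v w = X v \<bullet> refl_pos Pos (X w)"
  unfolding X_def frm_coord[symmetric] by (simp add: g_frm)

text \<open>The reflected vector is a test vector with \<open>(v, w)\<close> equal to the squared Euclidean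
  length.\<close>

lemma frm_nondegenerate: "v = 0" if "\<And>w. frm S v w = 0"
proof -
  obtain w where w: "coord S w = refl_pos Pos (coord S v)" using coord_comb by metis
  have "coord S v \<bullet> coord S v = 0" using that[of w] unfolding frm_coord w refl_pos_invol .
  hence "coord S v = 0" by simp
  thus ?thesis using linear_0[OF linear_comb] unfolding coord_comb by simp
qed

lemma bij_X: "bij X"
proof -
  interpret X: linear X by (rule linear_X)
  interpret c: linear comb by (rule linear_comb)
  have "v = 0" if "X v = 0" for v
    by (rule frm_nondegenerate) (simp add: frm_X that)
  hence i: "inj X" using linear_inj_iff_eq_0[OF linear_X] by blast
  have "inj (X \<circ> comb)" using i bij_comb by (intro inj_compose) (simp_all add: bij_def)
  hence "surj (X \<circ> comb)"
    using linear_injective_imp_surjective[OF linear_compose[OF linear_comb linear_X]] by simp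
  moreover have "range (X \<circ> comb) \<subseteq> range X" by auto
  ultimately have "surj X" by blast
  thus ?thesis using i by (simp add: bij_def)
qed

lemma X_simps [simp]: "X (v + w) = X v + X w" "X (v - w) = X v - X w" "X (a *\<^sub>R v) = a *\<^sub>R X v" "X (- v) = - X v" "X 0 = 0"
  "X v = X w \<longleftrightarrow> v = w"
  using bij_X by (simp_all add: linear_add[OF linear_X] linear_diff[OF linear_X] linear_scale[OF linear_X] linear_neg[OF linear_X] linear_0[OF linear_X] bij_def inj_eq)

lemma X_surjE: obtains v where "X v = x"
  using bij_X by (metis bij_pointE)

lemma Pos_Basis: "Pos \<subseteq> Basis" by (auto simp: Pos_def axis_in_Basis_iff)

lemma card_Pos: "card Pos = rk S" and DIM_rk: "CARD('n) = rk S + 2"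
proof -
  have "inj_on (\<lambda>j. axis (ix S j) (1::real)) {1..rk S}"
    using ix_bij by (auto simp: inj_on_def bij_betw_def axis_eq_axis)
  thus "card Pos = rk S" unfolding Pos_def by (simp add: card_image)
  show "CARD('n) = rk S + 2" using bij_betw_same_card[OF ix_bij] by simp
qed

text \<open>A basis of the lattice is a basis of the space, so it is indexed by the standard basis vectors.\<close>

lemma lattice_matrix:
  obtains M :: "real ^ 'n \<Rightarrow> real ^ 'n" where "linear M" "inj M" "M ` zlat = X ` lat S"
proof -
  interpret X: linear X by (rule linear_X)
  obtain A where A: "finite A" "independent A" "lat S = {v. \<exists>c :: 'v \<Rightarrow> int. v = (\<Sum>a\<in>A. of_int (c a) *\<^sub>R a)}"
    using lset unfolding lattice_setup_def is_zlattice_def by blast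
  have "lat S \<subseteq> span A" unfolding A(3) by (clarify, intro span_sum span_scale span_base)
  moreover have "span (lat S) = UNIV" using lset unfolding lattice_setup_def by blast
  ultimately have sp: "span A = UNIV" by (metis span_mono span_span top.extremum_uniqueI)
  have iX: "inj_on X A" using bij_X by (auto simp: bij_def intro: inj_on_subset)
  have "independent (X ` A)" 
    by (rule linear_independent_injective_image[OF linear_X A(2)])
       (use bij_X in \<open>auto simp: bij_def intro: inj_on_subset\<close>)
  moreover have "span (X ` A) = UNIV" using bij_X sp by (simp add: linear_span_image[OF linear_X] bij_def)
  ultimately have "card (X ` A) = DIM(real ^ 'n)" by (metis dim_UNIV dim_eq_card_independent dim_span)
  hence "card (Basis :: (real ^ 'n) set) = card A" by (simp add: card_image[OF iX])
  then obtain h where h: "bij_betw h (Basis :: (real ^ 'n) set) A"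
    using A(1) by (metis finite_Basis finite_same_card_bij)
  define m where "m x = (\<Sum>b\<in>Basis. (x \<bullet> b) *\<^sub>R h b)" for x :: "real ^ 'n"
  have lm: "linear m" by (rule linearI) (simp_all add: m_def inner_add_left scaleR_add_left sum.distrib scaleR_sum_right)
  have inv: "inv_into Basis h (h b) = b" if "b \<in> Basis" for b using h that by (simp add: bij_betw_def)
  have m: "m x = (\<Sum>a\<in>A. (x \<bullet> inv_into Basis h a) *\<^sub>R a)" for x
    unfolding m_def sum.reindex_bij_betw[OF h, symmetric] by (intro sum.cong refl) (simp add: inv)
  have "x = 0" if "m x = 0" for x
  proof -
    have "x \<bullet> inv_into Basis h a = 0" if "a \<in> A" for a
      by (rule independentD[OF A(2,1) subset_refl \<open>m x = 0\<close>[unfolded m] that])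
    hence "x \<bullet> b = 0" if "b \<in> Basis" for b using that inv h by (metis bij_betwE)
    thus ?thesis using euclidean_all_zero_iff by blast
  qed
  hence im: "inj m" using linear_inj_iff_eq_0[OF lm] by blast
  have img: "m ` zlat = lat S"
  proof (intro equalityI subsetI)
    fix v assume "v \<in> m ` zlat"
    then obtain x where x: "x \<in> zlat" "v = m x" by blast
    have fl: "of_int \<lfloor>x \<bullet> inv_into Basis h a\<rfloor> = x \<bullet> inv_into Basis h a" if "a \<in> A" for a
    proof -
      have "inv_into Basis h a \<in> Basis" using h that by (metis bij_betw_def inv_into_into)
      thus ?thesis using x(1) by (auto simp: zlat_def elim!: Ints_cases)
    qed
    hence "v = (\<Sum>a\<in>A. of_int \<lfloor>x \<bullet> inv_into Basis h a\<rfloor> *\<^sub>R a)" unfolding x(2) m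
      by (intro sum.cong refl arg_cong2[where f = scaleR] fl[symmetric])
    thus "v \<in> lat S" unfolding A(3) by (intro CollectI exI[of _ "\<lambda>a. \<lfloor>x \<bullet> inv_into Basis h a\<rfloor>"])
  next
    fix v assume "v \<in> lat S"
    then obtain c :: "'v \<Rightarrow> int" where c: "v = (\<Sum>a\<in>A. of_int (c a) *\<^sub>R a)" unfolding A(3) by blast
    define x where "x = (\<Sum>b\<in>Basis. real_of_int (c (h b)) *\<^sub>R (b :: real ^ 'n))"
    have "m x = (\<Sum>b\<in>Basis. of_int (c (h b)) *\<^sub>R h b)" unfolding m_def x_def by (intro sum.cong refl) (simp add: inner_sum_left_Basis)
    also have "\<dots> = v" unfolding c by (rule sum.reindex_bij_betw[OF h])
    finally show "v \<in> m ` zlat" by (intro rev_image_eqI[of x]) (auto simp: zlat_def x_def inner_sum_left_Basis)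
  qed
  show ?thesis
  proof (rule that[of "X \<circ> m"])
    show "linear (X \<circ> m)" by (rule linear_compose[OF lm linear_X])
    show "inj (X \<circ> m)" using im bij_X by (intro inj_compose) (auto simp: bij_def)
    show "(X \<circ> m) ` zlat = X ` lat S" by (simp only: image_comp[symmetric] img)
  qed
qed

lemma lor_zero: "0 \<in> lor S"
proof -
  obtain A where A: "lor S = {v. \<exists>c :: 'v \<Rightarrow> int. v = (\<Sum>a\<in>A. of_int (c a) *\<^sub>R a)}"
    using lset unfolding lattice_setup_def is_zlattice_def by blast
  have "\<exists>c :: 'v \<Rightarrow> int. 0 = (\<Sum>a\<in>A. of_int (c a) *\<^sub>R a)" by (rule exI[of _ "\<lambda>_. 0"]) simp
  thus ?thesis unfolding A by (simp only: mem_Collect_eq)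
qed

lemma lat_decomp: "lat S = {v + of_int m *\<^sub>R uu S + of_int n *\<^sub>R uu' S | v (m::int) (n::int). v \<in> lor S}"
  and lor_orth: "v \<in> lor S \<Longrightarrow> frm S v (uu S) = 0" "v \<in> lor S \<Longrightarrow> frm S v (uu' S) = 0"
  and uu_frm [simp]: "frm S (uu S) (uu S) = 0" "frm S (uu' S) (uu' S) = 0" "frm S (uu S) (uu' S) = 1" "frm S (uu' S) (uu S) = 1"
proof -
  show "lat S = {v + of_int m *\<^sub>R uu S + of_int n *\<^sub>R uu' S | v (m::int) (n::int). v \<in> lor S}"
    by (insert lset[unfolded lattice_setup_def], elim conjE, assumption)
  have "\<forall>v\<in>lor S. frm S v (uu S) = 0 \<and> frm S v (uu' S) = 0"
    by (insert lset[unfolded lattice_setup_def], elim conjE, assumption)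
  thus "v \<in> lor S \<Longrightarrow> frm S v (uu S) = 0" "v \<in> lor S \<Longrightarrow> frm S v (uu' S) = 0" by blast+
  show "frm S (uu S) (uu S) = 0" "frm S (uu' S) (uu' S) = 0" "frm S (uu S) (uu' S) = 1"
    by (insert lset[unfolded lattice_setup_def], (elim conjE, assumption)+)
  thus "frm S (uu' S) (uu S) = 1" using frm_sym by metis
qed

lemma uu_lat: "uu S \<in> lat S" "uu' S \<in> lat S" and lor_lat: "lor S \<subseteq> lat S"
proof -
  have "v + of_int m *\<^sub>R uu S + of_int n *\<^sub>R uu' S \<in> lat S" if "v \<in> lor S" for v m n
    unfolding lat_decomp using that by blast
  from this[OF lor_zero, of 1 0] this[OF lor_zero, of 0 1] this[of _ 0 0]
  show "uu S \<in> lat S" "uu' S \<in> lat S" "lor S \<subseteq> lat S" by auto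
qed

lemma lor_eq: "lor S = {v \<in> lat S. frm S v (uu S) = 0 \<and> frm S v (uu' S) = 0}"
proof (intro equalityI subsetI)
  fix v assume "v \<in> lor S"
  thus "v \<in> {v \<in> lat S. frm S v (uu S) = 0 \<and> frm S v (uu' S) = 0}" using lor_lat lor_orth by blast
next
  fix v assume v: "v \<in> {v \<in> lat S. frm S v (uu S) = 0 \<and> frm S v (uu' S) = 0}"
  then obtain l m n where l: "v = l + of_int m *\<^sub>R uu S + of_int n *\<^sub>R uu' S" "l \<in> lor S" unfolding lat_decomp by blast
  have "m = 0" "n = 0" using v lor_orth[OF l(2)] unfolding l(1) by simp_all
  thus "v \<in> lor S" using l by simp
qed

text \<open>The real span of \<open>L = L\<^sub>L\<^sub>o\<^sub>r \<oplus> U\<close> is everything.\<close>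

lemma span_lor_decomp:
  obtains s a b where "v = s + a *\<^sub>R uu S + b *\<^sub>R uu' S" "s \<in> span (lor S)"
proof -
  let ?T = "{s + a *\<^sub>R uu S + b *\<^sub>R uu' S | s a b. s \<in> span (lor S)}"
  have "subspace ?T"
  proof (rule subspaceI)
    show "0 \<in> ?T" unfolding mem_Collect_eq
      by (rule exI[of _ 0], rule exI[of _ 0], rule exI[of _ 0]) (simp add: span_zero)
    fix x y c assume "x \<in> ?T" 
    then obtain s a b where x: "x = s + a *\<^sub>R uu S + b *\<^sub>R uu' S" "s \<in> span (lor S)" by blast
    have "c *\<^sub>R x = c *\<^sub>R s + (c * a) *\<^sub>R uu S + (c * b) *\<^sub>R uu' S" by (simp add: x scaleR_add_right)
    thus "c *\<^sub>R x \<in> ?T" using span_scale[OF x(2)] by blast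
    assume "y \<in> ?T"
    then obtain s' a' b' where y: "y = s' + a' *\<^sub>R uu S + b' *\<^sub>R uu' S" "s' \<in> span (lor S)" by blast
    have "x + y = (s + s') + (a + a') *\<^sub>R uu S + (b + b') *\<^sub>R uu' S" by (simp add: x y scaleR_add_left)
    thus "x + y \<in> ?T" using span_add[OF x(2) y(2)] by blast
  qed
  moreover have "lat S \<subseteq> ?T" unfolding lat_decomp using span_base[of _ "lor S"] by blast
  ultimately have "span (lat S) \<subseteq> ?T" by (intro span_minimal)
  moreover have "span (lat S) = UNIV" using lset unfolding lattice_setup_def by blast
  ultimately show ?thesis using that by blast
qed

lemma span_lor_orth: "s \<in> span (lor S) \<Longrightarrow> frm S s (uu S) = 0 \<and> frm S s (uu' S) = 0"
  by (induction rule: span_induct) (auto intro!: subspaceI simp: lor_orth)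

end

section \<open>Comparison with the Lorentzian theta functions\<close>

text \<open>The two locales are joined along \<open>X\<close>; the matrix \<open>M\<close> belongs to an
  integral basis of the lattice.\<close>

locale lattice_lift = lattice_frame S g + theta_data Pos M "X (uu S)" "X (uu' S)" n "axis (ix S \<alpha>) 1" "axis (ix S \<beta>) 1"
  for S :: "('v::real_vector, 'n::finite) lattice_datum" and g M n \<alpha> \<beta> +
  assumes M_lat: "M ` zlat = X ` lat S"
begin

abbreviation ea :: "real ^ 'n" where "ea \<equiv> axis (ix S \<alpha>) 1"
abbreviation eb :: "real ^ 'n" where "eb \<equiv> axis (ix S \<beta>) 1"

lemma frm_bj: "frm S v w = bj (X v) (X w)"
  by (simp add: bj_def frm_X)

lemma Lam_X: "Lam = X ` lat S"
  by (simp add: Lam_def M_lat)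

lemma VC_0: "VC 0 = X ` lor S"
  unfolding VC_def VV_def Lam_X lor_eq by (auto simp: frm_bj)

lemma bj_parts': "bj x z = ppart Pos x \<bullet> ppart Pos z - npart Pos x \<bullet> npart Pos z"
  unfolding bj_def by (rule bj_parts)

lemma parts_simps [simp]:
  "ppart Pos (x + z) = ppart Pos x + ppart Pos z" "npart Pos (x + z) = npart Pos x + npart Pos z"
  "ppart Pos (x - z) = ppart Pos x - ppart Pos z" "npart Pos (x - z) = npart Pos x - npart Pos z"
  "ppart Pos (c *\<^sub>R x) = c *\<^sub>R ppart Pos x" "npart Pos (c *\<^sub>R x) = c *\<^sub>R npart Pos x"
  "ppart Pos 0 = 0" "npart Pos 0 = 0"
  by (simp_all add: linear_add[OF linear_ppart] linear_add[OF linear_npart] linear_diff[OF linear_ppart] linear_diff[OF linear_npart]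
    linear_scale[OF linear_ppart] linear_scale[OF linear_npart] linear_0[OF linear_ppart] linear_0[OF linear_npart])

lemma ppart_zero_iff: "ppart Pos x = 0 \<longleftrightarrow> (\<forall>j\<in>{1..rk S}. x $ ix S j = 0)"
proof
  assume *: "ppart Pos x = 0"
  show "\<forall>j\<in>{1..rk S}. x $ ix S j = 0"
  proof
    fix j assume "j \<in> {1..rk S}"
    hence "axis (ix S j) 1 \<in> Pos" by (simp add: Pos_def)
    thus "x $ ix S j = 0" using ppart_component[of "axis (ix S j) 1" Pos x] * by (simp add: inner_axis)
  qed
next
  assume *: "\<forall>j\<in>{1..rk S}. x $ ix S j = 0"
  show "ppart Pos x = 0"
  proof (rule euclidean_eqI)
    fix b :: "real ^ 'n" assume "b \<in> Basis"
    thus "ppart Pos x \<bullet> b = 0 \<bullet> b" using * by (auto simp: ppart_component Pos_def inner_axis)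
  qed
qed

lemma base_plane_iff: "v \<in> base_plane S \<longleftrightarrow> ppart Pos (coord S v) = 0"
proof
  interpret c: linear "coord S" by (rule linear_coord)
  have ax: "coord S (bas S j) = axis (ix S j) 1" if j: "j \<in> {1..rk S + 2}" for j
  proof -
    have "comb (axis (ix S j) 1) = (\<Sum>i\<in>{1..rk S + 2}. if i = j then bas S j else 0)"
      unfolding comb_def
    proof (intro sum.cong refl)
      fix i assume i: "i \<in> {1..rk S + 2}"
      have "ix S i = ix S j \<longleftrightarrow> i = j" using ix_bij i j unfolding bij_betw_def by (meson inj_on_eq_iff)
      thus "axis (ix S j) 1 $ ix S i *\<^sub>R bas S i = (if i = j then bas S j else 0)" by (auto simp: axis_def)
    qed
    also have "\<dots> = bas S j" using j by (simp only: sum.delta finite_atLeastAtMost if_True)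
    finally show ?thesis unfolding coord_comb by simp
  qed
  have zero: "ppart Pos (coord S (bas S j)) = 0" if "j \<in> {rk S + 1, rk S + 2}" for j
  proof -
    have "ix S i \<noteq> ix S j" if "i \<in> {1..rk S}" for i
    proof -
      have "ix S i = ix S j \<longleftrightarrow> i = j"
        using ix_bij that \<open>j \<in> {rk S + 1, rk S + 2}\<close> unfolding bij_betw_def
        by (intro inj_on_eq_iff[of "ix S" "{1..rk S + 2}"]) auto
      thus ?thesis using that \<open>j \<in> {rk S + 1, rk S + 2}\<close> by auto
    qed
    thus ?thesis using that by (auto simp: ax ppart_zero_iff axis_def)
  qed
  have "base_plane S \<subseteq> {w. ppart Pos (coord S w) = 0}"
    unfolding base_plane_def
    by (rule span_minimal) (use zero in \<open>auto intro!: subspaceI simp: c.add c.scale c.zero\<close>)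
  thus "ppart Pos (coord S v) = 0" if "v \<in> base_plane S" using that by blast
  assume v: "ppart Pos (coord S v) = 0"
  have "v = comb (coord S v)" using coord_comb by metis
  also have "\<dots> = (\<Sum>j\<in>{rk S + 1, rk S + 2}. (coord S v $ ix S j) *\<^sub>R bas S j)"
    unfolding comb_def using v unfolding ppart_zero_iff by (intro sum.mono_neutral_right) auto
  also have "\<dots> \<in> base_plane S" unfolding base_plane_def by (intro span_sum span_scale span_base) auto
  finally show "v \<in> base_plane S" .
qed

lemma zpl_iff: "v \<in> zpl S g \<longleftrightarrow> ppart Pos (X v) = 0"
  by (simp add: zpl_def base_plane_iff X_def)

lemma zperp_iff: "v \<in> zperp S g \<longleftrightarrow> npart Pos (X v) = 0"
proof
  assume v: "v \<in> zperp S g"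
  obtain w where w: "X w = npart Pos (X v)" by (rule X_surjE)
  have "w \<in> zpl S g" by (simp add: zpl_iff w)
  hence "frm S v w = 0" using v by (simp add: zperp_def ortho_in_def)
  thus "npart Pos (X v) = 0" by (simp add: frm_bj bj_parts' w)
next
  assume "npart Pos (X v) = 0"
  thus "v \<in> zperp S g" by (auto simp: zperp_def ortho_in_def frm_bj bj_parts' zpl_iff)
qed

text \<open>In a subspace whose vectors are purely positive or purely negative an isotropic vector vanishes,
  so the form is non-degenerate there and the projection is determined by orthogonality.\<close>

lemma proj_X:
  assumes W: "subspace W" and split: "\<And>x. x \<in> W \<Longrightarrow> ppart Pos (X x) = 0 \<or> npart Pos (X x) = 0"
    and p: "p \<in> W" and o: "\<And>x. x \<in> W \<Longrightarrow> bj (X v - X p) (X x) = 0"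
  shows "proj (frm S) W v = p"
proof (rule proj_eqI[OF frm_bilinear W _ p])
  fix q assume q: "q \<in> W" "\<And>x. x \<in> W \<Longrightarrow> frm S q x = 0"
  have "ppart Pos (X q) = 0 \<and> npart Pos (X q) = 0"
    using q(2)[OF q(1)] split[OF q(1)] by (auto simp: frm_bj bj_parts')
  hence "X q = 0" using ppart_npart_add[of Pos "X q"] by simp
  thus "q = 0" using X_simps(6)[of q 0] by simp
qed (use o in \<open>simp add: frm_bj\<close>)

lemma subspace_z: "subspace (zpl S g)" "subspace (zperp S g)"
  by (auto intro!: subspaceI simp: zpl_iff zperp_iff)

lemma X_proj_z: "X (proj (frm S) (zpl S g) v) = npart Pos (X v)" "X (proj (frm S) (zperp S g) v) = ppart Pos (X v)"
proof -
  obtain p where p: "X p = npart Pos (X v)" by (rule X_surjE)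
  have "proj (frm S) (zpl S g) v = p"
    by (rule proj_X[OF subspace_z(1)]) (auto simp: zpl_iff p bj_parts')
  thus "X (proj (frm S) (zpl S g) v) = npart Pos (X v)" by (simp add: p)
  obtain p where p: "X p = ppart Pos (X v)" by (rule X_surjE)
  have "proj (frm S) (zperp S g) v = p"
    by (rule proj_X[OF subspace_z(2)]) (auto simp: zperp_iff p bj_parts')
  thus "X (proj (frm S) (zperp S g) v) = ppart Pos (X v)" by (simp add: p)
qed

lemma X_uz: "X (uz S g) = mU" "X (uzperp S g) = pU"
  by (simp_all add: uz_def uzperp_def X_proj_z pU_def mU_def)

lemma frm_uz: "frm S v (uz S g) = - (X v \<bullet> mU)" "frm S v (uzperp S g) = X v \<bullet> pU"
  using inner_npart_right[of "X v" Pos "X (uu S)"] inner_ppart_right[of "X v" Pos "X (uu S)"]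
  by (simp_all add: frm_bj X_uz bj_parts' flip: pU_def mU_def)

lemma uzperp_sq_rho: "uzperp_sq S g = rho" and uz_sq: "frm S (uz S g) (uz S g) = - rho"
  by (simp_all add: uzperp_sq_def frm_uz X_uz mU_mU rho_def[symmetric])

lemma wsp_iff: "v \<in> wsp S g \<longleftrightarrow> ppart Pos (X v) = 0 \<and> X v \<bullet> mU = 0"
  and wperp_iff: "v \<in> wperp S g \<longleftrightarrow> npart Pos (X v) = 0 \<and> X v \<bullet> pU = 0"
  by (simp_all add: wsp_def wperp_def ortho_in_def zpl_iff zperp_iff frm_uz)

lemma wv_parts: "ppart Pos (wv x) = ppart Pos x - (x \<bullet> pU / rho) *\<^sub>R pU" "npart Pos (wv x) = npart Pos x - (x \<bullet> mU / rho) *\<^sub>R mU"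
  by (simp_all add: wv_def)

lemma wv_parts_orth: "ppart Pos (wv x) \<bullet> pU = 0" "npart Pos (wv x) \<bullet> mU = 0"
  using wv_orth[of x] inner_ppart_right[of "wv x" Pos "X (uu S)"] inner_npart_right[of "wv x" Pos "X (uu S)"]
  by (simp_all add: pU_def[symmetric] mU_def[symmetric])

lemma X_proj_w: "X (proj (frm S) (wsp S g) v) = npart Pos (wv (X v))" "X (proj (frm S) (wperp S g) v) = ppart Pos (wv (X v))"
proof -
  have s: "subspace (wsp S g)" "subspace (wperp S g)"
    by (auto intro!: subspaceI simp: wsp_iff wperp_iff inner_add_left)
  obtain p where p: "X p = npart Pos (wv (X v))" by (rule X_surjE)
  have "proj (frm S) (wsp S g) v = p"
  proof (rule proj_X[OF s(1)])
    show "p \<in> wsp S g" by (simp add: wsp_iff p wv_parts_orth)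
    fix x assume x: "x \<in> wsp S g"
    hence "npart Pos (X x) \<bullet> mU = 0" "ppart Pos (X x) = 0"
      using inner_npart_right[of "X x" Pos "X (uu S)"] by (simp_all add: wsp_iff mU_def)
    thus "bj (X v - X p) (X x) = 0" by (simp add: p bj_parts' wv_parts inner_commute)
  qed (auto simp: wsp_iff)
  thus "X (proj (frm S) (wsp S g) v) = npart Pos (wv (X v))" by (simp add: p)
  obtain p where p: "X p = ppart Pos (wv (X v))" by (rule X_surjE)
  have "proj (frm S) (wperp S g) v = p"
  proof (rule proj_X[OF s(2)])
    show "p \<in> wperp S g" by (simp add: wperp_iff p wv_parts_orth)
    fix x assume x: "x \<in> wperp S g"
    hence "ppart Pos (X x) \<bullet> pU = 0" "npart Pos (X x) = 0"
      using inner_ppart_right[of "X x" Pos "X (uu S)"] by (simp_all add: wperp_iff pU_def)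
    thus "bj (X v - X p) (X x) = 0" by (simp add: p bj_parts' wv_parts inner_commute)
  qed (auto simp: wperp_iff)
  thus "X (proj (frm S) (wperp S g) v) = ppart Pos (wv (X v))" by (simp add: p)
qed

lemma coord_wmap: "coord S (wmap S g v) = wv (X v)"
proof -
  have "coord S (wmap S g v) = X (proj (frm S) (wperp S g) v + proj (frm S) (wsp S g) v)"
    by (simp add: wmap_def X_def)
  thus ?thesis by (simp add: X_proj_w ppart_npart_add del: parts_simps)
qed

lemma wv_fix: "x \<bullet> pU = 0 \<Longrightarrow> x \<bullet> mU = 0 \<Longrightarrow> wv x = x"
  by (simp add: wv_def)

lemma wimg_eq: "wimg S g = {x. x \<bullet> pU = 0 \<and> x \<bullet> mU = 0}"
proof (intro equalityI subsetI)
  fix x assume "x \<in> wimg S g"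
  thus "x \<in> {x. x \<bullet> pU = 0 \<and> x \<bullet> mU = 0}" by (auto simp: wimg_def coord_wmap wv_orth)
next
  fix x assume x: "x \<in> {x. x \<bullet> pU = 0 \<and> x \<bullet> mU = 0}"
  obtain v where "X v = x" by (rule X_surjE)
  hence "x = (coord S \<circ> wmap S g) v" using x by (simp add: coord_wmap wv_fix)
  thus "x \<in> wimg S g" unfolding wimg_def by blast
qed

lemma subspace_wimg: "subspace (wimg S g)"
  by (auto intro!: subspaceI simp: wimg_eq inner_add_left)

lemma wv_wimg: "wv x \<in> wimg S g"
  by (simp add: wimg_eq wv_orth)

text \<open>Pairing with a vector of the Lorentzian lattice sees neither the projection to its span nor the
  summand \<open>- u'\<close>.\<close>

lemma frm_mu:
  assumes "l \<in> lor S" shows "frm S l (mu S g) = mm (X l)"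
proof -
  let ?m = "- uu' S + (1 / (2 * uzperp_sq S g)) *\<^sub>R uzperp S g + (1 / (2 * frm S (uz S g) (uz S g))) *\<^sub>R uz S g"
  obtain s a b where s: "?m = s + a *\<^sub>R uu S + b *\<^sub>R uu' S" "s \<in> span (lor S)" by (rule span_lor_decomp)
  have "mu S g = s"
    unfolding mu_def
  proof (rule proj_eqI[OF frm_bilinear subspace_span _ s(2)])
    fix p assume p: "p \<in> span (lor S)" "\<And>x. x \<in> span (lor S) \<Longrightarrow> frm S p x = 0"
    show "p = 0"
    proof (rule frm_nondegenerate)
      fix w
      obtain s' a' b' where w: "w = s' + a' *\<^sub>R uu S + b' *\<^sub>R uu' S" "s' \<in> span (lor S)" by (rule span_lor_decomp)
      thus "frm S p w = 0" using p(2)[OF w(2)] span_lor_orth[OF p(1)] by simp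
    qed
  next
    fix x assume "x \<in> span (lor S)"
    thus "frm S (?m - s) x = 0" unfolding s(1) using span_lor_orth[of x] frm_sym[of x] by simp
  qed
  hence "frm S l (mu S g) = frm S l ?m"
    unfolding s(1) using lor_orth[OF assms] by simp
  also have "\<dots> = (X l \<bullet> pU) / (2 * rho) + (X l \<bullet> mU) / (2 * rho)"
    unfolding frm_simps frm_uz(1)[of l] frm_uz(2)[of l] uzperp_sq_rho uz_sq using lor_orth[OF assms] by simp
  finally show ?thesis by (simp add: mm_def add_divide_distrib)
qed

lemma gau_ee: "ee (\<tau> * of_real ((norm (ppart Pos x))\<^sup>2 / 2) + cnj \<tau> * of_real (- (norm (npart Pos x))\<^sup>2 / 2)) = gau Pos \<tau> x"
  unfolding ee_def gau_def by (rule arg_cong[where f = exp]) (simp add: algebra_simps)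

lemma qf_parts: "npart Pos (X v) = 0 \<Longrightarrow> qf S v = (norm (ppart Pos (X v)))\<^sup>2 / 2"
  "ppart Pos (X v) = 0 \<Longrightarrow> qf S v = - (norm (npart Pos (X v)))\<^sup>2 / 2"
  by (simp_all add: qf_def frm_bj bj_parts' power2_norm_eq_inner)

lemma theta_L_theta_sum:
  shows "theta_L S \<tau> g (poly_ab S \<alpha> \<beta>) = theta_sum \<tau> 0 0"
proof -
  have h: "heat UNIV y (poly_ab S \<alpha> \<beta>) x = qab y x" for y x
  proof -
    have "heat UNIV y (poly_ab S \<alpha> \<beta>) x = poly_ab S \<alpha> \<beta> x - 1 / (2 * pi * y) * (\<Sum>a\<in>orthonormal_basis UNIV. (a \<bullet> ea) * (a \<bullet> eb))"
      by (rule heat_quadratic[where w = 0 and c = 0]) (simp_all add: poly_ab_def inner_axis)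
    also have "(\<Sum>a\<in>orthonormal_basis UNIV. (a \<bullet> ea) * (a \<bullet> eb)) = ea \<bullet> eb" by (rule orthonormal_basis_inner) auto
    also have "ea \<bullet> eb = (if ea = eb then 1 else 0)"
      by (rule inner_Basis) (use ab Pos_Basis in blast)+
    also have "poly_ab S \<alpha> \<beta> x = 2 * (x \<bullet> ea) * (x \<bullet> eb)" by (simp add: poly_ab_def inner_axis)
    finally show ?thesis unfolding qab_def by simp
  qed
  have "theta_sum \<tau> 0 0 = (\<Sum>\<^sub>\<infinity>x\<in>X ` lat S. FF \<tau> x)" unfolding theta_sum_def Lam_X by (simp add: ch_0)
  also have "\<dots> = (\<Sum>\<^sub>\<infinity>l\<in>lat S. FF \<tau> (X l))"
    using bij_X by (subst infsum_reindex) (auto simp: bij_def o_def intro: inj_on_subset)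
  also have "\<dots> = theta_L S \<tau> g (poly_ab S \<alpha> \<beta>)"
    unfolding theta_L_def h FF_def gau_ee[symmetric]
    by (intro infsum_cong) (simp add: qf_parts X_proj_z flip: X_def)
  finally show ?thesis ..
qed

text \<open>An explicit family with the defining property of the reduced polynomials.\<close>

definition Q :: "nat \<Rightarrow> real ^ 'n \<Rightarrow> real" where
  "Q h x = (if h = 0 then 2 * (x \<bullet> ea) * (x \<bullet> eb)
     else if h = 1 then 2 * ((x \<bullet> ea) * (X (uu S) \<bullet> eb) + (x \<bullet> eb) * (X (uu S) \<bullet> ea)) / rho else q2)"

lemma uu_components: "pU \<bullet> ea = X (uu S) \<bullet> ea" "pU \<bullet> eb = X (uu S) \<bullet> eb" "mU \<bullet> ea = 0" "mU \<bullet> eb = 0"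
  using ab Pos_Basis by (simp_all add: pU_def mU_def ppart_component npart_component axis_in_Basis_iff)

lemma sum_0_2: "(\<Sum>h\<in>{0..2::nat}. F h) = F 0 + F 1 + (F 2 :: 'b :: comm_monoid_add)"
  by (simp add: atLeast0AtMost numeral_2_eq_2)

lemma Q_expand: "2 * (x \<bullet> ea) * (x \<bullet> eb) = (\<Sum>h\<in>{0..2}. (x \<bullet> pU) ^ h * Q h (wv x))"
proof -
  have "x = wv x + (x \<bullet> pU / rho) *\<^sub>R pU + (x \<bullet> mU / rho) *\<^sub>R mU" by (simp add: wv_def)
  hence c: "x \<bullet> e = wv x \<bullet> e + (x \<bullet> pU / rho) * (pU \<bullet> e) + (x \<bullet> mU / rho) * (mU \<bullet> e)" for e
    by (metis inner_add_left inner_scaleR_left)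
  have "(\<Sum>h\<in>{0..2}. (x \<bullet> pU) ^ h * Q h (wv x)) = Q 0 (wv x) + (x \<bullet> pU) * Q 1 (wv x) + (x \<bullet> pU)\<^sup>2 * Q 2 (wv x)"
    unfolding sum_0_2 by simp
  also have "\<dots> = 2 * (x \<bullet> ea) * (x \<bullet> eb)"
    unfolding c[of ea] c[of eb] uu_components using rho_pos
    by (simp add: Q_def q2_def field_simps power2_eq_square)
  finally show ?thesis ..
qed

lemma pos_neg_parts: "pos_part S x = ppart Pos x" "neg_part S x = npart Pos x"
proof -
  have m: "axis i 1 \<in> Pos \<longleftrightarrow> i \<in> ix S ` {1..rk S}" for i
    by (auto simp: Pos_def axis_eq_axis)
  have "i \<in> ix S ` {1..rk S} \<or> i \<in> ix S ` {rk S + 1, rk S + 2}" for i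
  proof -
    have "{1..rk S + 2} = {1..rk S} \<union> {rk S + 1, rk S + 2}" by auto
    thus ?thesis using ix_bij by (metis UNIV_I Un_iff bij_betw_def image_Un)
  qed
  moreover have "ix S ` {1..rk S} \<inter> ix S ` {rk S + 1, rk S + 2} = {}"
    using ix_bij unfolding bij_betw_def by (subst inj_on_image_Int[symmetric, of "ix S" "{1..rk S + 2}"]) auto
  ultimately have m': "i \<in> ix S ` {rk S + 1, rk S + 2} \<longleftrightarrow> i \<notin> ix S ` {1..rk S}" for i by blast
  have p: "ppart Pos x $ i = (if i \<in> ix S ` {1..rk S} then x $ i else 0)"
    "npart Pos x $ i = (if i \<in> ix S ` {1..rk S} then 0 else x $ i)" for i
    using ppart_component[of "axis i 1" Pos x] npart_component[of "axis i 1" Pos x] unfolding m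
    by (simp_all only: inner_axis axis_in_Basis_iff Basis_real_def insertI1 simp_thms inner_real_def mult_1_right)
  show "pos_part S x = ppart Pos x" "neg_part S x = npart Pos x"
    unfolding vec_eq_iff pos_part_def neg_part_def vec_lambda_beta p m' by auto
qed

text \<open>The chosen family and the explicit one satisfy the same identity, in which \<open>(v, u)\<close>
  projected to \<open>z\<^sup>\<bottom>\<close> can be any real number \<open>t\<close> while the
  point of \<open>wimg\<close> is fixed; comparing at \<open>t = 0, 1, - 1\<close> separates the
  three members.\<close>

lemma red_poly_Q:
  assumes h: "h \<in> {0..2}" and x: "x \<in> wimg S g"
  shows "red_poly S \<alpha> \<beta> g h x = Q h x"
proof -
  let ?R = "\<lambda>p. (\<forall>h\<in>{0..2}. homogeneous_poly_on S (wimg S g) (2 - h) 0 (p h)) \<and>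
     (\<forall>v. poly_ab S \<alpha> \<beta> (coord S (g v)) =
        (\<Sum>h\<in>{0..2}. (frm S v (uzperp S g)) ^ h * p h (coord S (wmap S g v))))"
  have poly: "poly_ab S \<alpha> \<beta> (coord S (g v)) = 2 * (X v \<bullet> ea) * (X v \<bullet> eb)" for v
    by (simp add: poly_ab_def X_def inner_axis)
  have "?R Q"
  proof (intro conjI ballI allI)
    fix v show "poly_ab S \<alpha> \<beta> (coord S (g v)) = (\<Sum>h\<in>{0..2}. (frm S v (uzperp S g)) ^ h * Q h (coord S (wmap S g v)))"
      unfolding poly frm_uz coord_wmap by (rule Q_expand)
  next
    fix h :: nat assume h: "h \<in> {0..2}"
    hence "h = 0 \<or> h = 1 \<or> h = 2" by auto
    moreover have "real_polynomial_function (Q h)"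
    proof -
      have lin: "real_polynomial_function (\<lambda>x. x \<bullet> e)" for e :: "real ^ 'n"
        by (rule real_polynomial_function.intros(1), rule bounded_linear_inner_left)
      note rules = real_polynomial_function.intros(4,3) real_polynomial_function_divide real_polynomial_function.intros(2) lin
      consider "h = 0" | "h = 1" | "h \<noteq> 0" "h \<noteq> 1" by blast
      thus ?thesis
        by cases (simp_all only: Q_def[abs_def] if_True if_False one_neq_zero simp_thms, (intro rules)+)
    qed
    moreover have "(s *\<^sub>R ppart Pos x + t *\<^sub>R npart Pos x) \<bullet> e = s * (x \<bullet> e)" if "e \<in> {ea, eb}" for s t x e
      using that ab Pos_Basis by (auto simp: inner_add_left ppart_component npart_component axis_in_Basis_iff)
    ultimately show "homogeneous_poly_on S (wimg S g) (2 - h) 0 (Q h)"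
      by (auto simp: homogeneous_poly_on_def pos_neg_parts Q_def power2_eq_square field_simps)
  qed
  hence R: "?R (red_poly S \<alpha> \<beta> g)" 
    using someI[where P = "?R" and x = Q] unfolding red_poly_def by blast
  have eq: "(\<Sum>h\<in>{0..2}. t ^ h * red_poly S \<alpha> \<beta> g h x) = (\<Sum>h\<in>{0..2}. t ^ h * Q h x)" for t
  proof -
    obtain v where v: "X v = x + (t / rho) *\<^sub>R pU" by (rule X_surjE)
    have o: "X v \<bullet> pU = t" "X v \<bullet> mU = 0" using x rho_pos by (simp_all add: v wimg_eq inner_add_left pU_mU(1,2) flip: rho_def)
    hence "wv (X v) = x" by (simp add: wv_def v)
    thus ?thesis using R[THEN conjunct2, THEN spec, of v] Q_expand[of "X v"] unfolding poly frm_uz coord_wmap o by simp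
  qed
  have "h = 0 \<or> h = 1 \<or> h = 2" using h by auto
  thus ?thesis using eq[of 0] eq[of 1] eq[of "-1"] unfolding sum_0_2 by auto
qed

text \<open>Only \<open>h = 0\<close> has a Laplacian. Its trace over \<open>wimg\<close> is the inner product
  of the projected coordinate vectors, which accounts for the correction by \<open>pU\<close> in
  \<open>q0\<close>.\<close>

lemma heat_red_poly:
  assumes h: "h \<in> {0..2}"
  shows "heat (wimg S g) y (red_poly S \<alpha> \<beta> g h) (wv x) = (if h = 0 then q0 y x else if h = 1 then q1 x else q2)"
proof -
  define s w where "s = (if h = 0 then 1 else 0 :: real)"
    and "w = (if h = 1 then (2 / rho) *\<^sub>R ((X (uu S) \<bullet> eb) *\<^sub>R ea + (X (uu S) \<bullet> ea) *\<^sub>R eb) else 0)"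
  have p: "red_poly S \<alpha> \<beta> g h x = 2 * s * (x \<bullet> ea) * (x \<bullet> eb) + x \<bullet> w + (if h = 2 then q2 else 0)" if "x \<in> wimg S g" for x
    using h unfolding red_poly_Q[OF h that] Q_def s_def w_def
    by (auto simp: inner_add_right algebra_simps add_divide_distrib)
  have heat: "heat (wimg S g) y (red_poly S \<alpha> \<beta> g h) (wv x)
      = red_poly S \<alpha> \<beta> g h (wv x) - s / (2 * pi * y) * (\<Sum>a\<in>orthonormal_basis (wimg S g). (a \<bullet> ea) * (a \<bullet> eb))"
    by (rule heat_quadratic[OF subspace_wimg wv_wimg p])
  have "(\<Sum>a\<in>orthonormal_basis (wimg S g). (a \<bullet> ea) * (a \<bullet> eb)) = (\<Sum>a\<in>orthonormal_basis (wimg S g). (a \<bullet> wv ea) * (a \<bullet> eb))"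
  proof (intro sum.cong refl arg_cong2[where f = "(*)"])
    fix a assume "a \<in> orthonormal_basis (wimg S g)"
    hence "a \<in> wimg S g" using orthonormal_basis_properties(1)[OF subspace_wimg] by blast
    thus "a \<bullet> ea = a \<bullet> wv ea" by (simp add: wv_def wimg_eq inner_diff_right)
  qed
  also have "\<dots> = wv ea \<bullet> eb" by (rule orthonormal_basis_inner[OF subspace_wimg wv_wimg])
  also have "\<dots> = dlt - (X (uu S) \<bullet> ea) * (X (uu S) \<bullet> eb) / rho"
  proof -
    have "ea \<bullet> eb = dlt" unfolding dlt_def by (rule inner_Basis) (use ab Pos_Basis in blast)+
    moreover have "ea \<bullet> pU = X (uu S) \<bullet> ea" "ea \<bullet> mU = 0" using uu_components by (simp_all only: inner_commute[of ea])
    ultimately show ?thesis unfolding wv_def inner_diff_left inner_scaleR_left uu_components by simp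
  qed
  finally show ?thesis
    unfolding heat red_poly_Q[OF h wv_wimg] using h by (auto simp: Q_def s_def q0_def q1_def)
qed

lemma theta_Lor_lor_theta:
  assumes h: "h \<in> {0..2}"
  shows "theta_Lor S \<tau> (r *\<^sub>R mu S g) 0 g (red_poly S \<alpha> \<beta> g h) = lor_theta h \<tau> r"
proof -
  have "lor_theta h \<tau> r = (\<Sum>\<^sub>\<infinity>l\<in>lor S. of_real (if h = 0 then q0 (Im \<tau>) (X l) else if h = 1 then q1 (X l) else q2) *
     (gau Pos \<tau> (wv (X l)) * ch (- (r * mm (X l)))))"
    unfolding lor_theta_def VC_0 using bij_X by (subst infsum_reindex) (auto simp: bij_def o_def intro: inj_on_subset)
  also have "\<dots> = theta_Lor S \<tau> (r *\<^sub>R mu S g) 0 g (red_poly S \<alpha> \<beta> g h)"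
    unfolding theta_Lor_def
  proof (rule infsum_cong)
    fix l assume l: "l \<in> lor S"
    have "gau Pos \<tau> (wv (X l)) * ch (- (r * mm (X l))) = ee (\<tau> * of_real (qf S (proj (frm S) (wperp S g) l))
         + cnj \<tau> * of_real (qf S (proj (frm S) (wsp S g) l)) - of_real (frm S l (r *\<^sub>R mu S g)))"
    proof -
      have "ee (z - of_real t) = ee z * ch (- t)" for z t
        by (simp add: ee_def ch_exp mult_exp_exp algebra_simps)
      moreover have "qf S (proj (frm S) (wperp S g) l) = (norm (ppart Pos (wv (X l))))\<^sup>2 / 2"
        "qf S (proj (frm S) (wsp S g) l) = - (norm (npart Pos (wv (X l))))\<^sup>2 / 2"
        using qf_parts(1)[of "proj (frm S) (wperp S g) l"] qf_parts(2)[of "proj (frm S) (wsp S g) l"]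
        by (simp_all only: X_proj_w part_part)
      ultimately show ?thesis by (simp only: gau_ee frm_simps frm_mu[OF l])
    qed
    thus "of_real (if h = 0 then q0 (Im \<tau>) (X l) else if h = 1 then q1 (X l) else q2) * (gau Pos \<tau> (wv (X l)) * ch (- (r * mm (X l))))
      = of_real (heat (wimg S g) (Im \<tau>) (red_poly S \<alpha> \<beta> g h) (coord S (wmap S g (l + 0)))) *
     ee (\<tau> * of_real (qf S (proj (frm S) (wperp S g) (l + 0)))
         + cnj \<tau> * of_real (qf S (proj (frm S) (wsp S g) (l + 0)))
         - of_real (frm S (l + (1/2) *\<^sub>R 0) (r *\<^sub>R mu S g)))"
      by (simp only: add_0_right scaleR_zero_right coord_wmap heat_red_poly[OF h])
  qed
  finally show ?thesis ..
qed

text \<open>The power of \<open>y\<close> drops by one half because of the factor \<open>1 / sqrt (2 y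
  \<rho>)\<close> of the Gaussian integral.\<close>

lemma orbit_term_unf:
  assumes y: "Im \<tau> > 0"
  shows "orbit_term f 0 r \<tau> = unf_factor S (n + 1) f g \<tau> * (\<Sum>h\<in>{0..2}. (of_real r / (2 * \<i> * of_real (Im \<tau>))) ^ h *
        of_real (exp (- (pi * r\<^sup>2 / (2 * Im \<tau> * rho)))) * cnj (lor_theta h \<tau> r))"
proof -
  let ?E = "complex_of_real (exp (- (pi * r\<^sup>2 / (2 * Im \<tau> * rho))))"
  have c: "cnj (\<i> * of_real r / (2 * of_real (Im \<tau>))) = of_real r / (2 * \<i> * of_real (Im \<tau>))"
    using y by (simp add: field_simps)
  have "Im \<tau> ^ (n + 2) = Im \<tau> powr (real (n + 1) + 1 / 2) * sqrt (Im \<tau>)"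
    using y by (simp add: powr_half_sqrt[symmetric] powr_add[symmetric] powr_realpow[symmetric] del: power_Suc)
  hence "Im \<tau> ^ (n + 2) / sqrt (2 * Im \<tau> * rho) = Im \<tau> powr (real (n + 1) + 1 / 2) / (sqrt 2 * sqrt rho)"
    using y rho_pos by (simp add: real_sqrt_mult)
  hence fac: "complex_of_real (Im \<tau> ^ (n + 2)) / of_real (sqrt (2 * Im \<tau> * rho)) = of_real (Im \<tau> powr (real (n + 1) + 1 / 2)) / of_real (sqrt 2 * sqrt rho)"
    by (simp only: of_real_divide[symmetric])
  have "cnj (phi \<tau> 0 r) = ?E / of_real (sqrt (2 * Im \<tau> * rho)) * (\<Sum>h\<in>{0..2}. (of_real r / (2 * \<i> * of_real (Im \<tau>))) ^ h * cnj (lor_theta h \<tau> r))"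
    unfolding phi_0_lor_theta[OF y] complex_cnj_mult cnj_sum complex_cnj_power c complex_cnj_complex_of_real of_real_divide by simp
  hence "orbit_term f 0 r \<tau> = (complex_of_real (Im \<tau> ^ (n + 2)) / of_real (sqrt (2 * Im \<tau> * rho))) * f \<tau> * (\<Sum>h\<in>{0..2}. ?E * ((of_real r / (2 * \<i> * of_real (Im \<tau>))) ^ h * cnj (lor_theta h \<tau> r)))"
    unfolding orbit_term_def sum_distrib_left[symmetric] by simp
  also have "\<dots> = unf_factor S (n + 1) f g \<tau> * (\<Sum>h\<in>{0..2}. (of_real r / (2 * \<i> * of_real (Im \<tau>))) ^ h * ?E * cnj (lor_theta h \<tau> r))"
    unfolding fac unf_factor_def uzperp_sq_rho by (simp add: mult_ac)
  finally show ?thesis .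
qed

lemma KM_unfolding:
  assumes f: "cusp_form (n + 1) f"
  shows "set_integrable hyp_measure modular_domain (KM_integrand S (n + 1) f \<alpha> \<beta> g) \<and>
    set_integrable hyp_measure modular_domain (lor_integrand S (n + 1) f \<alpha> \<beta> g) \<and>
    set_integrable hyp_measure strip_domain (h_ab S (n + 1) f \<alpha> \<beta> g) \<and>
    KM_lift S (n + 1) f \<alpha> \<beta> g =
      (LINT \<tau>:modular_domain|hyp_measure. lor_integrand S (n + 1) f \<alpha> \<beta> g \<tau>) +
      2 * (LINT \<tau>:strip_domain|hyp_measure. h_ab S (n + 1) f \<alpha> \<beta> g \<tau>)"
proof -
  note unf = theta_unfolding[OF f]
  have md: "modular_domain \<subseteq> uhp" and sd: "strip_domain \<subseteq> uhp"
    by (auto simp: modular_domain_def strip_domain_def uhp_def)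
  have e1: "KM_integrand S (n + 1) f \<alpha> \<beta> g \<tau> = of_real (Im \<tau> ^ (n + 2)) * f \<tau> * cnj (theta_sum \<tau> 0 0)" for \<tau>
    by (simp add: KM_integrand_def theta_L_theta_sum)
  have e2: "lor_integrand S (n + 1) f \<alpha> \<beta> g \<tau> = orbit_term f 0 0 \<tau>" if "\<tau> \<in> modular_domain" for \<tau>
    using that theta_Lor_lor_theta[of 0 \<tau> 0] by (simp add: modular_domain_def lor_integrand_def orbit_term_unf sum_0_2)
  have e3: "h_ab S (n + 1) f \<alpha> \<beta> g \<tau> = (\<Sum>\<^sub>\<infinity>r\<in>{1::nat..}. orbit_term f 0 (real r) \<tau>)" if "\<tau> \<in> strip_domain" for \<tau>
  proof -
    have y: "Im \<tau> > 0" using that by (simp add: strip_domain_def)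
    show ?thesis
      unfolding h_ab_def orbit_term_unf[OF y] infsum_cmult_right' uzperp_sq_rho of_real_of_nat_eq
      by (intro arg_cong2[where f = "(*)"] infsum_cong sum.cong refl arg_cong[where f = cnj] theta_Lor_lor_theta)
  qed
  show ?thesis
    using hypH_hyp_measure[OF md unf(1) e1] hypH_hyp_measure[OF md unf(2) e2] hypH_hyp_measure[OF sd unf(3) e3] unf(4)
    unfolding KM_lift_def by simp
qed

end

theorem corollary5p2:
  fixes S :: "('v::real_vector, 'n::finite) lattice_datum"
    and k \<alpha> \<beta> :: nat and f :: "complex \<Rightarrow> complex" and g :: "'v \<Rightarrow> 'v"
  assumes "lattice_setup S"
    and "real k = 1 + real (rk S) / 2"
    and "cusp_form k f"
    and "\<alpha> \<in> {1..rk S}" and "\<beta> \<in> {1..rk S}"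
    and "g \<in> SO_grp S"
  shows "set_integrable hyp_measure modular_domain (KM_integrand S k f \<alpha> \<beta> g) \<and>
    set_integrable hyp_measure modular_domain (lor_integrand S k f \<alpha> \<beta> g) \<and>
    set_integrable hyp_measure strip_domain (h_ab S k f \<alpha> \<beta> g) \<and>
    KM_lift S k f \<alpha> \<beta> g =
      (LINT \<tau>:modular_domain|hyp_measure. lor_integrand S k f \<alpha> \<beta> g \<tau>) +
      2 * (LINT \<tau>:strip_domain|hyp_measure. h_ab S k f \<alpha> \<beta> g \<tau>)"
proof -
  interpret F: lattice_frame S g using assms by unfold_locales
  obtain n where k: "k = n + 1" "rk S = 2 * n"
  proof
    show "k = (k - 1) + 1" "rk S = 2 * (k - 1)" using assms(2) by linarith+
  qed
  obtain M :: "real ^ 'n \<Rightarrow> real ^ 'n" where M: "linear M" "inj M" "M ` zlat = F.X ` lat S" by (rule F.lattice_matrix, rule that)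
  have uni: "unimodular (frm S) (lat S)" and ev: "even_lattice (frm S) (lat S)" and sp: "span (lat S) = UNIV"
    by (insert assms(1)[unfolded lattice_setup_def], (elim conjE, assumption)+)
  interpret lattice_lift S g M n \<alpha> \<beta>
  proof unfold_locales
    show "F.Pos \<subseteq> Basis" "card F.Pos = 2 * n" "DIM(real ^ 'n) = 2 * n + 2"
      using F.Pos_Basis F.card_Pos F.DIM_rk k by simp_all
    show "axis (ix S \<alpha>) 1 \<in> F.Pos" "axis (ix S \<beta>) 1 \<in> F.Pos" using assms by (auto simp: F.Pos_def)
    show "F.X (uu S) \<in> M ` zlat" "F.X (uu' S) \<in> M ` zlat" unfolding M(3) using F.uu_lat by blast+
    show "F.X (uu S) \<bullet> refl_pos F.Pos (F.X (uu S)) = 0" "F.X (uu' S) \<bullet> refl_pos F.Pos (F.X (uu' S)) = 0"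
      "F.X (uu S) \<bullet> refl_pos F.Pos (F.X (uu' S)) = 1"
      by (simp_all flip: F.frm_X)
    show "x \<bullet> refl_pos F.Pos x / 2 \<in> \<int>" if x: "x \<in> M ` zlat" for x
    proof -
      obtain l where l: "x = F.X l" "l \<in> lat S" using x unfolding M(3) by blast
      obtain m :: int where "frm S l l = 2 * of_int m" using ev l(2) unfolding even_lattice_def by blast
      thus ?thesis by (simp add: l(1) flip: F.frm_X)
    qed
    show "(\<forall>k\<in>zlat. M k \<bullet> refl_pos F.Pos \<xi> \<in> \<int>) \<longleftrightarrow> \<xi> \<in> M ` zlat" for \<xi>
    proof -
      obtain w where w: "F.X w = \<xi>" by (rule F.X_surjE)
      have "(\<forall>k\<in>zlat. M k \<bullet> refl_pos F.Pos \<xi> \<in> \<int>) \<longleftrightarrow> (\<forall>x\<in>M ` zlat. x \<bullet> refl_pos F.Pos \<xi> \<in> \<int>)" by blast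
      also have "\<dots> \<longleftrightarrow> (\<forall>l\<in>lat S. frm S w l \<in> \<int>)"
      proof -
        have "frm S w l = F.X l \<bullet> refl_pos F.Pos \<xi>" for l unfolding w[symmetric] using F.frm_sym F.frm_X by metis
        thus ?thesis unfolding M(3) by simp
      qed
      also have "\<dots> \<longleftrightarrow> w \<in> lat S" using uni unfolding unimodular_def sp by blast
      also have "\<dots> \<longleftrightarrow> \<xi> \<in> M ` zlat" unfolding M(3) w[symmetric] by auto
      finally show ?thesis .
    qed
  qed (use M linear_add[OF M(1)] linear_scale[OF M(1)] in auto)
  show ?thesis using KM_unfolding assms(3) unfolding k(1) by blast
qed

end
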